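(* Let $G$ be a minimal $(3,3)$-Ramsey graph with $|V(G)| \geq 27$. Then $\alpha(G) \leq |V(G)| - 9$.
   Context: All graphs are finite, undirected, without loops or multiple edges. $V(G)$ is the vertex set of $G$ and $\alpha(G)$ is its independence number. A graph $G$ is a $(3,3)$-Ramsey graph, written $G \rightarrow (3,3)$, if every coloring of the edges of $G$ with two colors contains a monochromatic triangle. $G$ is a minimal $(3,3)$-Ramsey graph if $G \rightarrow (3,3)$ and no proper subgraph $H$ of $G$ satisfies $H \rightarrow (3,3)$. *)

theory Defs
  imports "HOL-Library.Ramsey"
begin

text \<open>A graph is given by its vertex set \<open>V\<close> and its edge set \<open>E\<close>, whose members are
  two-element subsets of \<open>V\<close>; so there are no loops and no multiple edges.\<close>

definition simple_graph :: "'a set \<Rightarrow> 'a set set \<Rightarrow> bool" where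
  "simple_graph V E \<longleftrightarrow> finite V \<and> E \<subseteq> [V]\<^bsup>2\<^esup>"

definition subgraph :: "'a set \<Rightarrow> 'a set set \<Rightarrow> 'a set \<Rightarrow> 'a set set \<Rightarrow> bool" where
  "subgraph V' E' V E \<longleftrightarrow> simple_graph V' E' \<and> V' \<subseteq> V \<and> E' \<subseteq> E"

definition proper_subgraph :: "'a set \<Rightarrow> 'a set set \<Rightarrow> 'a set \<Rightarrow> 'a set set \<Rightarrow> bool" where
  "proper_subgraph V' E' V E \<longleftrightarrow> subgraph V' E' V E \<and> (V', E') \<noteq> (V, E)"

definition triangle :: "'a set \<Rightarrow> 'a set set \<Rightarrow> 'a set \<Rightarrow> bool" where
  "triangle V E T \<longleftrightarrow> T \<in> [V]\<^bsup>3\<^esup> \<and> clique T E"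

text \<open>A colouring is a function on all sets, but only its values on \<open>E\<close> are ever used.\<close>

definition ramsey_3_3 :: "'a set \<Rightarrow> 'a set set \<Rightarrow> bool" where
  "ramsey_3_3 V E \<longleftrightarrow>
     (\<forall>c :: 'a set \<Rightarrow> bool. \<exists>T. triangle V E T \<and> (\<exists>i. \<forall>e \<in> [T]\<^bsup>2\<^esup>. c e = i))"

definition minimal_ramsey_3_3 :: "'a set \<Rightarrow> 'a set set \<Rightarrow> bool" where
  "minimal_ramsey_3_3 V E \<longleftrightarrow>
     ramsey_3_3 V E \<and> (\<forall>V' E'. proper_subgraph V' E' V E \<longrightarrow> \<not> ramsey_3_3 V' E')"

definition independence_number :: "'a set \<Rightarrow> 'a set set \<Rightarrow> nat" where
  "independence_number V E = Max (card ` {S. S \<subseteq> V \<and> indep S E})"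

end

theory Submission
  imports Defs
begin

text \<open>If an independent set leaves out at most eight vertices, let \<open>A\<close> be an independent set of size
  \<open>|V| - 8\<close>, \<open>U\<close> its complement and \<open>H\<close> the graph induced on the eight vertices of \<open>U\<close>. A colouring
  of \<open>H\<close> without monochromatic triangles extends to a vertex \<open>v\<close> outside \<open>U\<close> iff the neighbourhood
  \<open>N v\<close> can be split into a part without red and a part without blue edges. By minimality, every such
  colouring of \<open>H\<close> leaves some \<open>N v\<close> unsplit, and for each \<open>v\<close> there is one that leaves only \<open>N v\<close>
  unsplit. So the \<open>|V| - 8\<close> neighbourhoods form a \<^emph>\<open>critical family\<close> of distinct subsets of \<open>U\<close>, and it
  remains to see that a critical family on eight vertices has at most 18 members.

  For that, vertices of degree at most two can be isolated, and \<open>H\<close> is not 4-partite; up to isomorphism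
  this leaves 378 graphs without a 6-clique. For each of them, finitely many colourings give sets of
  candidates that the family must hit; a branching over the members of the family, together with the
  fact that each member is the only one to meet the candidates blocked by its private colouring, bounds
  the family.\<close>

definition good_colouring :: "'a set \<Rightarrow> 'a set set \<Rightarrow> ('a set \<Rightarrow> bool) \<Rightarrow> bool" where
  "good_colouring U E c \<longleftrightarrow>
     (\<forall>x\<in>U. \<forall>y\<in>U. \<forall>z\<in>U. {x, y} \<in> E \<longrightarrow> {x, z} \<in> E \<longrightarrow> {y, z} \<in> E \<longrightarrow>
        \<not> (c {x, y} = c {x, z} \<and> c {x, z} = c {y, z}))"

definition splittable :: "'a set set \<Rightarrow> ('a set \<Rightarrow> bool) \<Rightarrow> 'a set \<Rightarrow> bool" where
  "splittable E c N \<longleftrightarrow>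
     (\<exists>X\<subseteq>N. (\<forall>x\<in>X. \<forall>y\<in>X. {x, y} \<in> E \<longrightarrow> \<not> c {x, y}) \<and>
            (\<forall>x\<in>N - X. \<forall>y\<in>N - X. {x, y} \<in> E \<longrightarrow> c {x, y}))"

definition critical_family :: "'a set \<Rightarrow> 'a set set \<Rightarrow> 'a set set \<Rightarrow> bool" where
  "critical_family U E F \<longleftrightarrow> finite U \<and> E \<subseteq> [U]\<^bsup>2\<^esup> \<and> F \<subseteq> Pow U \<and>
     (\<forall>c. good_colouring U E c \<longrightarrow> (\<exists>N\<in>F. \<not> splittable E c N)) \<and>
     (\<forall>N\<in>F. \<exists>c. good_colouring U E c \<and> (\<forall>N'\<in>F - {N}. splittable E c N')) \<and>
     (\<forall>K\<subseteq>U. clique K E \<longrightarrow> card K \<noteq> 6) \<and>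
     (\<forall>N\<in>F. \<forall>K\<subseteq>N. clique K E \<longrightarrow> card K \<noteq> 5)"

lemma nsets2I: "x \<in> V \<Longrightarrow> y \<in> V \<Longrightarrow> x \<noteq> y \<Longrightarrow> {x, y} \<in> [V]\<^bsup>2\<^esup>"
  by (auto simp: nsets_def)

lemma not_ramsey_iff:
  fixes V :: "'a set"
  assumes "simple_graph V E"
  shows "\<not> ramsey_3_3 V E \<longleftrightarrow> (\<exists>c. good_colouring V E c)"
proof
  assume "\<not> ramsey_3_3 V E"
  then have "\<exists>c :: 'a set \<Rightarrow> bool. \<not> (\<exists>T. triangle V E T \<and> (\<exists>i. \<forall>e\<in>[T]\<^bsup>2\<^esup>. c e = i))"
    by (simp only: ramsey_3_3_def not_all)
  then obtain c :: "'a set \<Rightarrow> bool" where "\<not> (\<exists>T. triangle V E T \<and> (\<exists>i. \<forall>e\<in>[T]\<^bsup>2\<^esup>. c e = i))" ..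
  then have c: "\<exists>e\<in>[T]\<^bsup>2\<^esup>. c e \<noteq> i" if "triangle V E T" for T i
    using that by blast
  have "good_colouring V E c"
    unfolding good_colouring_def
  proof (intro ballI impI notI)
    fix x y z assume "x \<in> V" "y \<in> V" "z \<in> V" and e: "{x, y} \<in> E" "{x, z} \<in> E" "{y, z} \<in> E"
      and m: "c {x, y} = c {x, z} \<and> c {x, z} = c {y, z}"
    have ne: "x \<noteq> y" "x \<noteq> z" "y \<noteq> z"
      using assms e by (auto simp: simple_graph_def nsets_def)
    have "triangle V E {x, y, z}"
      using e ne \<open>x \<in> V\<close> \<open>y \<in> V\<close> \<open>z \<in> V\<close>
      by (auto simp: triangle_def nsets_def clique_def insert_commute)
    then obtain e' where e': "e' \<in> [{x, y, z}]\<^bsup>2\<^esup>" "c e' \<noteq> c {x, y}"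
      using c[of "{x, y, z}" "c {x, y}"] by blast
    then have "e' = {x, y} \<or> e' = {x, z} \<or> e' = {y, z}"
      by (auto simp: nsets_def card_2_iff insert_commute doubleton_eq_iff)
    then show False using e' m by auto
  qed
  then show "\<exists>c. good_colouring V E c" by blast
next
  assume "\<exists>c. good_colouring V E c"
  then obtain c where c: "good_colouring V E c" ..
  show "\<not> ramsey_3_3 V E"
  proof
    assume "ramsey_3_3 V E"
    then have "\<exists>T. triangle V E T \<and> (\<exists>i. \<forall>e\<in>[T]\<^bsup>2\<^esup>. c e = i)"
      by (simp only: ramsey_3_3_def)
    then obtain T i where T: "triangle V E T" "\<forall>e\<in>[T]\<^bsup>2\<^esup>. c e = i" by blast
    then obtain x y z where xyz: "T = {x, y, z}" "x \<noteq> y" "x \<noteq> z" "y \<noteq> z"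
      by (auto simp: triangle_def nsets_def card_3_iff)
    have "{x, y} \<in> E" "{x, z} \<in> E" "{y, z} \<in> E" "x \<in> V" "y \<in> V" "z \<in> V"
      using T(1) xyz by (auto simp: triangle_def nsets_def clique_def)
    moreover have "c {x, y} = i" "c {x, z} = i" "c {y, z} = i"
      using T(2) xyz nsets2I[of _ T] by auto
    ultimately show False using c by (auto simp: good_colouring_def)
  qed
qed

text \<open>Among the five other vertices, three are joined to a given vertex in the same colour.\<close>

lemma clique6_ramsey:
  assumes "clique K E" "card K = 6"
  shows "ramsey_3_3 K E"
  unfolding ramsey_3_3_def
proof
  fix c :: "'a set \<Rightarrow> bool"
  have fin: "finite K" using assms(2) by (metis card.infinite zero_neq_numeral)
  obtain v where v: "v \<in> K" using assms(2) by fastforce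
  define A where "A i = {w \<in> K - {v}. c {v, w} = i}" for i
  have "card (A True \<union> A False) = 5"
  proof -
    have "A True \<union> A False = K - {v}" by (auto simp: A_def)
    then show ?thesis using v assms(2) fin by simp
  qed
  then have "card (A True) + card (A False) \<ge> 5" using card_Un_le[of "A True" "A False"] by simp
  then have "card (A True) \<ge> 3 \<or> card (A False) \<ge> 3" by linarith
  then obtain i where "card (A i) \<ge> 3" by blast
  then obtain B where "B \<subseteq> A i" "card B = 3" by (meson obtain_subset_with_card_n)
  then obtain x y z where xyz: "x \<in> A i" "y \<in> A i" "z \<in> A i" "x \<noteq> y" "x \<noteq> z" "y \<noteq> z"
    by (auto simp: card_3_iff)
  have tri: "triangle K E {a, b, d}" if "a \<in> K" "b \<in> K" "d \<in> K" "a \<noteq> b" "a \<noteq> d" "b \<noteq> d" for a b d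
    using that assms(1) by (auto simp: triangle_def nsets_def clique_def)
  have two: "e = {a, b} \<or> e = {a, d} \<or> e = {b, d}" if "e \<in> [{a, b, d}]\<^bsup>2\<^esup>" for e and a b d :: 'a
    using that by (auto simp: nsets_def card_2_iff insert_commute doubleton_eq_iff)
  show "\<exists>T. triangle K E T \<and> (\<exists>i. \<forall>e\<in>[T]\<^bsup>2\<^esup>. c e = i)"
  proof (cases "c {x, y} = i \<or> c {x, z} = i \<or> c {y, z} = i")
    case True
    then obtain a b where ab: "a \<in> A i" "b \<in> A i" "a \<noteq> b" "c {a, b} = i" using xyz by auto
    have "triangle K E {v, a, b}" using ab v by (intro tri) (auto simp: A_def)
    moreover have "\<forall>e\<in>[{v, a, b}]\<^bsup>2\<^esup>. c e = i"
    proof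
      fix e assume "e \<in> [{v, a, b}]\<^bsup>2\<^esup>"
      then have "e = {v, a} \<or> e = {v, b} \<or> e = {a, b}" by (rule two)
      then show "c e = i" using ab by (auto simp: A_def)
    qed
    ultimately show ?thesis by blast
  next
    case False
    have "triangle K E {x, y, z}" using xyz by (intro tri) (auto simp: A_def)
    moreover have "\<forall>e\<in>[{x, y, z}]\<^bsup>2\<^esup>. c e = (\<not> i)"
    proof
      fix e assume "e \<in> [{x, y, z}]\<^bsup>2\<^esup>"
      then have "e = {x, y} \<or> e = {x, z} \<or> e = {y, z}" by (rule two)
      then show "c e = (\<not> i)" using False by auto
    qed
    ultimately show ?thesis by blast
  qed
qed


lemma good_colouring_mono:
  assumes "good_colouring V E c" "U \<subseteq> V" "E' \<subseteq> E"
  shows "good_colouring U E' c"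
  unfolding good_colouring_def
proof (intro ballI impI)
  fix x y z assume "x \<in> U" "y \<in> U" "z \<in> U" "{x, y} \<in> E'" "{x, z} \<in> E'" "{y, z} \<in> E'"
  then have "x \<in> V" "y \<in> V" "z \<in> V" "{x, y} \<in> E" "{x, z} \<in> E" "{y, z} \<in> E" using assms by auto
  then show "\<not> (c {x, y} = c {x, z} \<and> c {x, z} = c {y, z})"
    using assms(1) unfolding good_colouring_def by blast
qed

lemma splittable_mono:
  assumes "splittable E c N" "M \<subseteq> N" "H \<subseteq> E"
  shows "splittable H c M"
proof -
  obtain X where "X \<subseteq> N" "\<forall>x\<in>X. \<forall>y\<in>X. {x, y} \<in> E \<longrightarrow> \<not> c {x, y}"
    "\<forall>x\<in>N - X. \<forall>y\<in>N - X. {x, y} \<in> E \<longrightarrow> c {x, y}"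
    using assms(1) unfolding splittable_def by blast
  then show ?thesis unfolding splittable_def
    using assms(2,3) by (intro exI[of _ "X \<inter> M"] conjI) blast+
qed

definition nbrs :: "'a set set \<Rightarrow> 'a \<Rightarrow> 'a set" where
  "nbrs E v = {u. {v, u} \<in> E}"

lemma simple_graph_edgeD:
  assumes "simple_graph V E" "{x, y} \<in> E"
  shows "x \<in> V" "y \<in> V" "x \<noteq> y"
proof -
  have "{x, y} \<in> [V]\<^bsup>2\<^esup>" using assms unfolding simple_graph_def by blast
  then show "x \<in> V" "y \<in> V" "x \<noteq> y" by auto
qed

lemma nbrs_indep_subset:
  assumes "simple_graph V E" "indep (V - U) E" "v \<in> V - U"
  shows "nbrs E v \<subseteq> U"
proof
  fix u assume "u \<in> nbrs E v"
  then have e: "{v, u} \<in> E" by (simp add: nbrs_def)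
  have "u \<notin> V - U"
    using assms(2,3) e simple_graph_edgeD(3)[OF assms(1) e] by (auto simp: indep_def)
  then show "u \<in> U" using simple_graph_edgeD(2)[OF assms(1) e] by simp
qed

lemma good_colouring_splittable_nbrs:
  assumes "simple_graph V E" "good_colouring V E c" "v \<in> V"
  shows "splittable E c (nbrs E v)"
proof -
  have V: "nbrs E v \<subseteq> V" using simple_graph_edgeD(2)[OF assms(1)] by (auto simp: nbrs_def)
  have *: "\<not> (c {v, x} = c {v, y} \<and> c {v, y} = c {x, y})"
    if "x \<in> nbrs E v" "y \<in> nbrs E v" "{x, y} \<in> E" for x y
    using assms that V unfolding good_colouring_def nbrs_def by blast
  show ?thesis unfolding splittable_def
    by (rule exI[of _ "{x \<in> nbrs E v. c {v, x}}"]) (use * in auto)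
qed

text \<open>Colour the edges at each vertex outside \<open>U\<close> according to a splitting of its
  neighbourhood; these vertices lie in no common triangle, as they are independent.\<close>

lemma good_colouring_extend:
  assumes "simple_graph V E" "U \<subseteq> V" "indep (V - U) E" "good_colouring U {e \<in> E. e \<subseteq> U} c"
    and "\<And>v. v \<in> V - U \<Longrightarrow> splittable {e \<in> E. e \<subseteq> U} c (nbrs E v)"
  shows "\<exists>c. good_colouring V E c"
proof -
  define S where "S v X \<longleftrightarrow> X \<subseteq> nbrs E v \<and>
      (\<forall>x\<in>X. \<forall>y\<in>X. {x, y} \<in> E \<longrightarrow> x \<in> U \<longrightarrow> y \<in> U \<longrightarrow> \<not> c {x, y}) \<and>
      (\<forall>x\<in>nbrs E v - X. \<forall>y\<in>nbrs E v - X. {x, y} \<in> E \<longrightarrow> x \<in> U \<longrightarrow> y \<in> U \<longrightarrow> c {x, y})" for v X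
  have "\<exists>X. S v X" if v: "v \<in> V - U" for v
  proof -
    obtain X where "X \<subseteq> nbrs E v" "\<forall>x\<in>X. \<forall>y\<in>X. {x, y} \<in> {e \<in> E. e \<subseteq> U} \<longrightarrow> \<not> c {x, y}"
      "\<forall>x\<in>nbrs E v - X. \<forall>y\<in>nbrs E v - X. {x, y} \<in> {e \<in> E. e \<subseteq> U} \<longrightarrow> c {x, y}"
      using assms(5)[OF v] unfolding splittable_def by blast
    then have "S v X" by (simp add: S_def)
    then show ?thesis ..
  qed
  then obtain X where X: "\<And>v. v \<in> V - U \<Longrightarrow> S v (X v)" by metis
  have nU: "u \<in> U" if "{v, u} \<in> E" "v \<in> V - U" for u v
    using nbrs_indep_subset[OF assms(1,3) that(2)] that(1) by (auto simp: nbrs_def)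
  define c' where "c' e = (if e \<subseteq> U then c e else \<exists>v\<in>V - U. \<exists>u\<in>X v. e = {v, u})" for e
  have c'1: "c' {x, y} = c {x, y}" if "x \<in> U" "y \<in> U" for x y using that by (simp add: c'_def)
  have c'2: "c' {v, u} \<longleftrightarrow> u \<in> X v" if "v \<in> V - U" "u \<in> U" for u v
    using that X by (auto simp: c'_def doubleton_eq_iff S_def)
  have out: "\<not> (c' {v, x} = c' {v, y} \<and> c' {v, y} = c' {x, y})"
    if v: "v \<in> V - U" and e: "{v, x} \<in> E" "{v, y} \<in> E" "{x, y} \<in> E" for v x y
  proof -
    have U: "x \<in> U" "y \<in> U" using nU e v by auto
    have "x \<in> nbrs E v" "y \<in> nbrs E v" using e by (auto simp: nbrs_def)
    then show ?thesis using X[OF v] e(3) U v by (auto simp: c'1 c'2 S_def)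
  qed
  have "good_colouring V E c'"
    unfolding good_colouring_def
  proof (intro ballI impI)
    fix x y z assume V: "x \<in> V" "y \<in> V" "z \<in> V" and e: "{x, y} \<in> E" "{x, z} \<in> E" "{y, z} \<in> E"
    consider "x \<notin> U" | "y \<notin> U" | "z \<notin> U" | "x \<in> U" "y \<in> U" "z \<in> U" by blast
    then show "\<not> (c' {x, y} = c' {x, z} \<and> c' {x, z} = c' {y, z})"
    proof cases
      case 1
      then show ?thesis using out[of x y z] V e by auto
    next
      case 2
      then show ?thesis using out[of y x z] V e by (auto simp: insert_commute)
    next
      case 3
      then show ?thesis using out[of z x y] V e by (auto simp: insert_commute)
    next
      case 4
      then show ?thesis using assms(4) e by (auto simp: good_colouring_def c'1)
    qed
  qed
  then show ?thesis by blast
qed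

lemma critical_family_of_minimal_ramsey:
  assumes G: "simple_graph V E" and min: "minimal_ramsey_3_3 V E" and ind: "indep (V - U) E"
    and U: "U \<subseteq> V" and card: "6 < card V"
  shows "critical_family U {e \<in> E. e \<subseteq> U} (nbrs E ` (V - U))" "inj_on (nbrs E) (V - U)"
proof -
  define H where "H = {e \<in> E. e \<subseteq> U}"
  define F where "F = nbrs E ` (V - U)"
  have fin: "finite V" and EV: "E \<subseteq> [V]\<^bsup>2\<^esup>" using G by (auto simp: simple_graph_def)
  have nU: "nbrs E v \<subseteq> U" if "v \<in> V - U" for v
    using nbrs_indep_subset[OF G ind that] .
  have R: "ramsey_3_3 V E" using min by (simp add: minimal_ramsey_3_3_def)
  have cover: "\<exists>v\<in>V - U. \<not> splittable H c (nbrs E v)" if "good_colouring U H c" for c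
  proof (rule ccontr)
    assume "\<not> ?thesis"
    then have "\<exists>c. good_colouring V E c"
      using that by (intro good_colouring_extend[OF G U ind, of c]) (auto simp: H_def)
    then show False using R not_ramsey_iff[OF G] by blast
  qed
  have priv: "\<exists>c. good_colouring U H c \<and> (\<forall>w\<in>V - U - {v}. splittable H c (nbrs E w))"
    if v: "v \<in> V - U" for v
  proof -
    define E' where "E' = {e \<in> E. v \<notin> e}"
    have G': "simple_graph (V - {v}) E'"
    proof -
      have "e \<in> [V - {v}]\<^bsup>2\<^esup>" if "e \<in> E'" for e
      proof -
        have "e \<in> [V]\<^bsup>2\<^esup>" "v \<notin> e" using that EV by (auto simp: E'_def)
        then show ?thesis by (auto simp: nsets_def)
      qed
      then show ?thesis using fin by (auto simp: simple_graph_def)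
    qed
    have "proper_subgraph (V - {v}) E' V E"
      using G' v by (auto simp: proper_subgraph_def subgraph_def E'_def)
    then have "\<not> ramsey_3_3 (V - {v}) E'" using min by (simp add: minimal_ramsey_3_3_def)
    then obtain c where c: "good_colouring (V - {v}) E' c" using not_ramsey_iff[OF G'] by blast
    have HE: "H \<subseteq> E'" using v by (auto simp: H_def E'_def)
    have "good_colouring U H c" using good_colouring_mono[OF c _ HE] U v by blast
    moreover have "splittable H c (nbrs E w)" if w: "w \<in> V - U - {v}" for w
    proof -
      have 1: "nbrs E w \<subseteq> nbrs E' w" using nU[of w] w v by (auto simp: nbrs_def E'_def)
      have 2: "splittable E' c (nbrs E' w)"
        using good_colouring_splittable_nbrs[OF G' c] w by blast
      show ?thesis by (rule splittable_mono[OF 2 1 HE])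
    qed
    ultimately show ?thesis by blast
  qed
  show inj: "inj_on (nbrs E) (V - U)"
  proof (rule inj_onI, rule ccontr)
    fix v w assume vw: "v \<in> V - U" "w \<in> V - U" "nbrs E v = nbrs E w" "v \<noteq> w"
    obtain c where c: "good_colouring U H c" "\<forall>w\<in>V - U - {v}. splittable H c (nbrs E w)"
      using priv[OF vw(1)] by blast
    obtain x where "x \<in> V - U" "\<not> splittable H c (nbrs E x)" using cover[OF c(1)] by blast
    then have "\<not> splittable H c (nbrs E v)" using c(2) by (cases "x = v") auto
    then show False using c(2) vw by auto
  qed
  have K6: "card K \<noteq> 6" if "K \<subseteq> V" "clique K E" for K
  proof
    assume c6: "card K = 6"
    define E' where "E' = {e \<in> E. e \<subseteq> K}"
    have "clique K E'" using that(2) by (auto simp: clique_def E'_def)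
    then have "ramsey_3_3 K E'" using clique6_ramsey c6 by blast
    moreover have "proper_subgraph K E' V E"
    proof -
      have "E' \<subseteq> [K]\<^bsup>2\<^esup>" using EV by (auto simp: E'_def nsets_def)
      moreover have "finite K" using that(1) fin finite_subset by blast
      moreover have "K \<noteq> V" using c6 card by auto
      ultimately show ?thesis using that(1)
        by (auto simp: proper_subgraph_def subgraph_def simple_graph_def E'_def)
    qed
    ultimately show False using min by (simp add: minimal_ramsey_3_3_def)
  qed
  show "critical_family U {e \<in> E. e \<subseteq> U} (nbrs E ` (V - U))"
    unfolding critical_family_def H_def[symmetric] F_def[symmetric]
  proof (intro conjI allI ballI impI)
    show "finite U" using fin U finite_subset by blast
    show "H \<subseteq> [U]\<^bsup>2\<^esup>" using EV by (auto simp: H_def nsets_def)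
    show "F \<subseteq> Pow U" using nU by (auto simp: F_def)
    show "\<exists>N\<in>F. \<not> splittable H c N" if "good_colouring U H c" for c
      using cover[OF that] by (auto simp: F_def)
    show "\<exists>c. good_colouring U H c \<and> (\<forall>N'\<in>F - {N}. splittable H c N')" if N: "N \<in> F" for N
    proof -
      obtain v where v: "v \<in> V - U" "N = nbrs E v" using N by (auto simp: F_def)
      obtain c where c: "good_colouring U H c" "\<forall>w\<in>V - U - {v}. splittable H c (nbrs E w)"
        using priv[OF v(1)] by blast
      have "splittable H c N'" if N': "N' \<in> F - {N}" for N'
      proof -
        obtain w where "w \<in> V - U" "N' = nbrs E w" using N' by (auto simp: F_def)
        then show ?thesis using c(2) v N' by auto
      qed
      then show ?thesis using c(1) by blast
    qed
    show "card K \<noteq> 6" if "K \<subseteq> U" "clique K H" for K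
      using K6[of K] that U by (auto simp: clique_def H_def)
    show "card K \<noteq> 5" if N: "N \<in> F" and K: "K \<subseteq> N" "clique K H" for N K
    proof
      assume c5: "card K = 5"
      then have "finite K" by (metis card.infinite zero_neq_numeral)
      obtain v where v: "v \<in> V - U" "N = nbrs E v" using N by (auto simp: F_def)
      have KU: "K \<subseteq> U" using nU v K by blast
      then have "v \<notin> K" using v by blast
      then have "card (insert v K) = 6" using c5 \<open>finite K\<close> by simp
      moreover have "clique (insert v K) E"
        using K v by (auto simp: clique_def H_def nbrs_def insert_commute)
      ultimately show False using K6[of "insert v K"] v KU U by auto
    qed
  qed
qed

fun bits :: "nat \<Rightarrow> bool list" where
  "bits n = (if n = 0 then [] else odd n # bits (n div 2))"

declare bits.simps [simp del]

fun num_bits :: "num \<Rightarrow> bool list" where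
  "num_bits num.One = [True]"
| "num_bits (num.Bit0 k) = False # num_bits k"
| "num_bits (num.Bit1 k) = True # num_bits k"

lemma bits_0: "bits 0 = []"
  by (simp add: bits.simps)

lemma bits_1: "bits 1 = [True]"
  by (subst bits.simps) (simp add: bits_0)

lemma bits_numeral: "bits (numeral k) = num_bits k"
proof (induction k)
  case One
  then show ?case using bits_1 by simp
next
  case (Bit0 k)
  then show ?case by (subst bits.simps) simp
next
  case (Bit1 k)
  then show ?case by (subst bits.simps) simp
qed

definition members :: "bool list \<Rightarrow> nat set" where
  "members m = {i. i < length m \<and> m ! i}"

lemma members_simps [simp]:
  "members [] = {}"
  "members (False # m) = Suc ` members m"
  "members (True # m) = insert 0 (Suc ` members m)"
proof -
  have *: "i \<in> members (b # m) \<longleftrightarrow> (b \<and> i = 0) \<or> i \<in> Suc ` members m" for i b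
    by (cases i) (auto simp: members_def)
  show "members [] = {}" by (simp add: members_def)
  show "members (False # m) = Suc ` members m" using *[of _ False] by blast
  show "members (True # m) = insert 0 (Suc ` members m)" using *[of _ True] by blast
qed

fun pad :: "nat list \<Rightarrow> bool list \<Rightarrow> bool list" where
  "pad [] m = []"
| "pad (u # us) [] = False # pad us []"
| "pad (u # us) (b # m) = b # pad us m"

lemma length_pad [simp]: "length (pad us m) = length us"
  by (induction us m rule: pad.induct) auto

fun sel :: "bool list \<Rightarrow> bool list \<Rightarrow> nat list \<Rightarrow> nat list" where
  "sel (True # a) (True # b) (u # us) = u # sel a b us"
| "sel (True # a) (False # b) (u # us) = sel a b us"
| "sel (False # a) (True # b) (u # us) = sel a b us"
| "sel (False # a) (False # b) (u # us) = sel a b us"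
| "sel [] b us = []"
| "sel (x # a) [] us = []"
| "sel (x # a) (y # b) [] = []"

lemma sel_nth: "x \<in> set (sel a b us) \<Longrightarrow> \<exists>i<length us. x = us ! i \<and> i \<in> members a \<and> i \<in> members b"
  by (induction a b us rule: sel.induct) (auto simp: Ex_less_Suc2)

fun subl :: "bool list \<Rightarrow> bool list \<Rightarrow> bool" where
  "subl [] n = True"
| "subl (True # m) (True # n) = subl m n"
| "subl (True # m) (False # n) = False"
| "subl (False # m) (True # n) = subl m n"
| "subl (False # m) (False # n) = subl m n"
| "subl (True # m) [] = False"
| "subl (False # m) [] = subl m []"

lemma subl_iff: "subl m n \<longleftrightarrow> members m \<subseteq> members n"
  by (induction m n rule: subl.induct) auto

fun hit :: "bool list list \<Rightarrow> bool list \<Rightarrow> bool" where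
  "hit [] n = False"
| "hit (m # D) n = (if subl m n then True else hit D n)"

lemma hit_iff: "hit D n \<longleftrightarrow> (\<exists>m\<in>set D. members m \<subseteq> members n)"
  by (induction D) (auto simp: subl_iff)

text \<open>A graph on \<open>{..<8}\<close> is given by eight numbers: bit \<open>u\<close> of the number with index \<open>v\<close> says whether
  \<open>u < v\<close> and \<open>v\<close> are adjacent.\<close>

fun rows_from :: "nat list \<Rightarrow> nat list \<Rightarrow> bool list list" where
  "rows_from us [] = []"
| "rows_from us (r # g) = pad us (bits r) # rows_from (0 # us) g"

definition triangular :: "bool list list \<Rightarrow> bool" where
  "triangular rs \<longleftrightarrow> (\<forall>v<length rs. length (rs ! v) = v)"

lemma rows_from_length: "length (rows_from us g) = length g"
  "v < length g \<Longrightarrow> length (rows_from us g ! v) = length us + v"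
proof (induction us g arbitrary: v rule: rows_from.induct)
  case (2 us r g)
  case 1 show ?case using 2 by simp
  case 2 then show ?case using "2.IH"(2)[of "v - 1"] by (cases v) auto
qed auto

definition row_edges :: "bool list list \<Rightarrow> nat set set" where
  "row_edges rs = {{u, v} |u v. v < length rs \<and> u \<in> members (rs ! v)}"

lemma row_edges_iff:
  assumes "triangular rs" "u < v" "v < length rs"
  shows "{u, v} \<in> row_edges rs \<longleftrightarrow> u \<in> members (rs ! v)"
proof
  assume "{u, v} \<in> row_edges rs"
  then obtain a b where ab: "{u, v} = {a, b}" "b < length rs" "a \<in> members (rs ! b)"
    by (auto simp: row_edges_def)
  then have "a < b" using assms(1) by (auto simp: members_def triangular_def)
  then show "u \<in> members (rs ! v)" using ab assms(2) by (auto simp: doubleton_eq_iff)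
qed (use assms in \<open>auto simp: row_edges_def\<close>)

datatype trit = Z | R | B

fun okR :: "trit list \<Rightarrow> trit list \<Rightarrow> bool" where
  "okR (R # a) (R # e) = False"
| "okR (R # a) (B # e) = okR a e"
| "okR (R # a) (Z # e) = okR a e"
| "okR (B # a) (R # e) = okR a e"
| "okR (B # a) (B # e) = okR a e"
| "okR (B # a) (Z # e) = okR a e"
| "okR (Z # a) (R # e) = okR a e"
| "okR (Z # a) (B # e) = okR a e"
| "okR (Z # a) (Z # e) = okR a e"
| "okR [] e = True"
| "okR (x # a) [] = True"

fun okB :: "trit list \<Rightarrow> trit list \<Rightarrow> bool" where
  "okB (B # a) (B # e) = False"
| "okB (B # a) (R # e) = okB a e"
| "okB (B # a) (Z # e) = okB a e"
| "okB (R # a) (R # e) = okB a e"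
| "okB (R # a) (B # e) = okB a e"
| "okB (R # a) (Z # e) = okB a e"
| "okB (Z # a) (R # e) = okB a e"
| "okB (Z # a) (B # e) = okB a e"
| "okB (Z # a) (Z # e) = okB a e"
| "okB [] e = True"
| "okB (x # a) [] = True"

definition okc :: "trit \<Rightarrow> trit list \<Rightarrow> trit list \<Rightarrow> bool" where
  "okc k a e \<longleftrightarrow> k = Z \<or> (\<forall>i<length a. i < length e \<longrightarrow> \<not> (a ! i = k \<and> e ! i = k))"

lemma okc_Cons: "okc k (x # a) (y # e) \<longleftrightarrow> k = Z \<or> (\<not> (x = k \<and> y = k) \<and> okc k a e)"
  by (simp add: okc_def All_less_Suc2 imp_conjR all_conj_distrib) blast

lemma okc_trivial [simp]: "okc Z a e" "okc k [] e" "okc k a []"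
  by (simp_all add: okc_def)

lemma okR_iff: "okR a e \<longleftrightarrow> okc R a e"
  by (induction a e rule: okR.induct) (simp_all add: okc_Cons)

lemma okB_iff: "okB a e \<longleftrightarrow> okc B a e"
  by (induction a e rule: okB.induct) (simp_all add: okc_Cons)

text \<open>A split of a set of vertices is a partial assignment of \<open>R\<close> and \<open>B\<close>; in the reversed list
  \<open>a\<close> it is aligned with the entry of the next vertex, which lists its colours to the earlier
  vertices in descending order.\<close>

fun splits :: "trit list list \<Rightarrow> bool list \<Rightarrow> trit list \<Rightarrow> bool" where
  "splits es [] a = True"
| "splits [] (b # n) a = True"
| "splits (e # es) (False # n) a = splits es n (Z # a)"
| "splits (e # es) (True # n) a =
     (if (if okR a e then splits es n (R # a) else False) then True
      else if okB a e then splits es n (B # a) else False)"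

lemma splitsD:
  assumes "splits es n a"
  shows "\<exists>s. length s = length es \<and> (\<forall>i<length es. s ! i \<noteq> Z \<longleftrightarrow> i \<in> members n) \<and>
             (\<forall>i<length es. okc (s ! i) (rev (take i s) @ a) (es ! i))"
  using assms
proof (induction es n a rule: splits.induct)
  case (1 es a)
  then show ?case by (intro exI[of _ "replicate (length es) Z"]) simp
next
  case (3 e es n a)
  then obtain s where "length s = length es" "\<forall>i<length es. s ! i \<noteq> Z \<longleftrightarrow> i \<in> members n"
    "\<forall>i<length es. okc (s ! i) (rev (take i s) @ (Z # a)) (es ! i)" by auto
  then show ?case
    by (intro exI[of _ "Z # s"]) (auto simp: All_less_Suc2)
next
  case (4 e es n a)
  obtain k s where k: "k \<noteq> Z" "okc k a e" and s: "length s = length es"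
    "\<forall>i<length es. s ! i \<noteq> Z \<longleftrightarrow> i \<in> members n"
    "\<forall>i<length es. okc (s ! i) (rev (take i s) @ (k # a)) (es ! i)"
    using 4 by (auto simp: okR_iff okB_iff split: if_splits)
  then show ?case
    by (intro exI[of _ "k # s"]) (auto simp: All_less_Suc2)
qed auto

fun entry :: "bool list \<Rightarrow> bool list \<Rightarrow> trit list \<Rightarrow> trit list \<times> bool list" where
  "entry [] s a = (a, s)"
| "entry (False # r) s a = entry r s (Z # a)"
| "entry (True # r) (True # s) a = entry r s (R # a)"
| "entry (True # r) (False # s) a = entry r s (B # a)"
| "entry (True # r) [] a = entry r [] (B # a)"

fun entries :: "bool list list \<Rightarrow> bool list \<Rightarrow> trit list list" where
  "entries [] s = []"
| "entries (r # rs) s = (case entry r s [] of (e, s') \<Rightarrow> e # entries rs s')"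

lemma entry_shape: "map (\<lambda>t. t \<noteq> Z) (rev (fst (entry r s a))) = map (\<lambda>t. t \<noteq> Z) (rev a) @ r"
  by (induction r s a rule: entry.induct) auto

lemma entries_shape: "map (\<lambda>e. map (\<lambda>t. t \<noteq> Z) (rev e)) (entries rs s) = rs"
proof (induction rs s rule: entries.induct)
  case (2 r rs s)
  then show ?case using entry_shape[of r s "[]"] by (auto split: prod.splits)
qed auto

fun entry_ok :: "trit list \<Rightarrow> trit list list \<Rightarrow> bool" where
  "entry_ok [] p = True"
| "entry_ok (t # e) [] = True"
| "entry_ok (Z # e) (q # p) = entry_ok e p"
| "entry_ok (R # e) (q # p) = (if okR e q then entry_ok e p else False)"
| "entry_ok (B # e) (q # p) = (if okB e q then entry_ok e p else False)"

fun entries_ok :: "trit list list \<Rightarrow> trit list list \<Rightarrow> bool" where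
  "entries_ok [] p = True"
| "entries_ok (e # es) p = (if entry_ok e p then entries_ok es (e # p) else False)"

lemma entry_okD:
  "entry_ok e p \<Longrightarrow> i < length e \<Longrightarrow> i < length p \<Longrightarrow> okc (e ! i) (drop (Suc i) e) (p ! i)"
proof (induction e p arbitrary: i rule: entry_ok.induct)
  case (3 e q p)
  then show ?case by (cases i) auto
next
  case (4 e q p)
  then show ?case by (cases i) (auto simp: okR_iff split: if_splits)
next
  case (5 e q p)
  then show ?case by (cases i) (auto simp: okB_iff split: if_splits)
qed auto

lemma entries_okD:
  "entries_ok es p \<Longrightarrow> v < length es \<Longrightarrow> entry_ok (es ! v) (rev (take v es) @ p)"
proof (induction es p arbitrary: v rule: entries_ok.induct)
  case (2 e es p)
  then show ?case by (cases v) (auto split: if_splits)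
qed auto

definition colour :: "trit list list \<Rightarrow> nat set \<Rightarrow> trit" where
  "colour es e = rev (es ! Max e) ! Min e"

lemma colour_doubleton: "u < v \<Longrightarrow> colour es {u, v} = rev (es ! v) ! u"
  by (simp add: colour_def max_def min_def)

locale coloured_rows =
  fixes rs :: "bool list list" and es :: "trit list list"
  assumes tri: "triangular rs" and shape: "map (\<lambda>e. map (\<lambda>t. t \<noteq> Z) (rev e)) es = rs"
begin

lemma length_es [simp]: "length es = length rs"
  using shape by (metis length_map)

lemma row_eq: "v < length rs \<Longrightarrow> rs ! v = map (\<lambda>t. t \<noteq> Z) (rev (es ! v))"
  using shape by (metis length_es nth_map)

lemma length_entry [simp]: "v < length rs \<Longrightarrow> length (es ! v) = v"
  using row_eq tri unfolding triangular_def by (metis length_map length_rev)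

lemma edge_iff: "u < v \<Longrightarrow> v < length rs \<Longrightarrow> {u, v} \<in> row_edges rs \<longleftrightarrow> colour es {u, v} \<noteq> Z"
  using row_edges_iff[OF tri] row_eq by (simp add: colour_doubleton members_def)

lemma colour_nth: "u < v \<Longrightarrow> v < length rs \<Longrightarrow> colour es {u, v} = es ! v ! (v - 1 - u)"
  by (simp add: colour_doubleton rev_nth)

lemma good:
  assumes "entries_ok es []"
  shows "good_colouring {..<length rs} (row_edges rs) (\<lambda>e. colour es e = R)"
proof -
  have *: "\<not> (colour es {w, u} = colour es {w, v} \<and> colour es {w, v} = colour es {u, v})"
    if "w < u" "u < v" "v < length rs" "{u, v} \<in> row_edges rs" for w u v
  proof
    assume eq: "colour es {w, u} = colour es {w, v} \<and> colour es {w, v} = colour es {u, v}"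
    define k where "k = colour es {u, v}"
    have k: "k \<noteq> Z" using edge_iff that by (simp add: k_def)
    define i where "i = v - 1 - u"
    define j where "j = u - 1 - w"
    have "entry_ok (es ! v) (rev (take v es))"
      using entries_okD[OF assms, of v] that by simp
    then have "okc (es ! v ! i) (drop (Suc i) (es ! v)) (rev (take v es) ! i)"
      using that by (intro entry_okD) (auto simp: i_def)
    moreover have "rev (take v es) ! i = es ! u" using that by (simp add: rev_nth i_def)
    moreover have "es ! v ! i = k" using colour_nth that by (simp add: k_def i_def)
    moreover have "drop (Suc i) (es ! v) ! j = k"
    proof -
      have "drop (Suc i) (es ! v) ! j = es ! v ! (v - 1 - w)"
      proof -
        have "Suc i + j = v - 1 - w" "Suc i \<le> length (es ! v)" using that by (simp_all add: i_def j_def)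
        then show ?thesis by (metis nth_drop)
      qed
      then show ?thesis using colour_nth[of w v] that eq by (simp add: k_def)
    qed
    moreover have "es ! u ! j = k" using colour_nth[of w u] that eq by (simp add: k_def j_def)
    ultimately have "\<not> (j < length (drop (Suc i) (es ! v)) \<and> j < length (es ! u))"
      using k by (auto simp: okc_def)
    then show False using that by (simp add: i_def j_def)
  qed
  have **: "\<not> ((colour es {w, u} = R) = (colour es {w, v} = R) \<and>
      (colour es {w, v} = R) = (colour es {u, v} = R))"
    if "w < u" "u < v" "v < length rs" "{w, u} \<in> row_edges rs" "{w, v} \<in> row_edges rs"
      "{u, v} \<in> row_edges rs" for w u v
  proof -
    have "colour es {w, u} \<noteq> Z" "colour es {w, v} \<noteq> Z" "colour es {u, v} \<noteq> Z"
      using that edge_iff[of w u] edge_iff[of w v] edge_iff[of u v] by auto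
    then show ?thesis using *[OF that(1-3,6)]
      by (cases "colour es {w, u}"; cases "colour es {w, v}"; cases "colour es {u, v}") auto
  qed
  show ?thesis
    unfolding good_colouring_def
  proof (intro ballI impI)
    fix x y z assume V: "x \<in> {..<length rs}" "y \<in> {..<length rs}" "z \<in> {..<length rs}"
      and e: "{x, y} \<in> row_edges rs" "{x, z} \<in> row_edges rs" "{y, z} \<in> row_edges rs"
    have lt: "a \<noteq> b" if "{a, b} \<in> row_edges rs" for a b
      using that tri by (auto simp: row_edges_def members_def triangular_def doubleton_eq_iff)
    have "x \<noteq> y" "x \<noteq> z" "y \<noteq> z" using lt e by auto
    then consider "x < y \<and> y < z" | "x < z \<and> z < y" | "y < x \<and> x < z" | "y < z \<and> z < x"
      | "z < x \<and> x < y" | "z < y \<and> y < x" by linarith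
    then show "\<not> ((colour es {x, y} = R) = (colour es {x, z} = R) \<and>
        (colour es {x, z} = R) = (colour es {y, z} = R))"
      using V e **[of x y z] **[of x z y] **[of y x z] **[of y z x] **[of z x y] **[of z y x]
      by cases (auto simp: insert_commute)
  qed
qed

lemma splittable:
  assumes "splits es n []" "N \<subseteq> members n" "N \<subseteq> {..<length rs}"
  shows "splittable (row_edges rs) (\<lambda>e. colour es e = R) N"
proof -
  obtain s where s: "\<forall>i<length rs. s ! i \<noteq> Z \<longleftrightarrow> i \<in> members n"
    "\<forall>i<length rs. okc (s ! i) (rev (take i s)) (es ! i)" "length s = length rs"
    using splitsD[OF assms(1)] by auto
  have *: "\<not> (s ! u = k \<and> s ! v = k \<and> colour es {u, v} = k)"
    if "u < v" "v < length rs" "k \<noteq> Z" for u v k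
  proof
    assume eq: "s ! u = k \<and> s ! v = k \<and> colour es {u, v} = k"
    have "okc (s ! v) (rev (take v s)) (es ! v)" using s(2) that(2) by simp
    then have "okc k (rev (take v s)) (es ! v)" using eq by simp
    moreover have "rev (take v s) ! (v - 1 - u) = s ! u" using that s(3) by (simp add: rev_nth)
    moreover have "es ! v ! (v - 1 - u) = k" using colour_nth that eq by simp
    ultimately show False using that eq s(3) by (auto simp: okc_def)
  qed
  have **: "\<not> (s ! u = k \<and> s ! v = k \<and> colour es {u, v} = k)"
    if "{u, v} \<in> row_edges rs" "u < length rs" "v < length rs" "k \<noteq> Z" for u v k
  proof -
    have "u \<noteq> v"
      using that(1) tri by (auto simp: row_edges_def members_def triangular_def doubleton_eq_iff)
    then consider "u < v" | "v < u" by linarith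
    then show ?thesis
      using *[of u v k] *[of v u k] that by cases (auto simp: insert_commute)
  qed
  have ne: "colour es {u, v} \<noteq> Z" if "{u, v} \<in> row_edges rs" "u < length rs" "v < length rs" for u v
  proof -
    have "u \<noteq> v"
      using that(1) tri by (auto simp: row_edges_def members_def triangular_def doubleton_eq_iff)
    then show ?thesis using edge_iff[of u v] edge_iff[of v u] that
      by (cases "u < v") (auto simp: insert_commute)
  qed
  show ?thesis unfolding splittable_def
  proof (intro exI[of _ "{u \<in> N. s ! u = R}"] conjI ballI impI)
    fix x y assume "x \<in> {u \<in> N. s ! u = R}" "y \<in> {u \<in> N. s ! u = R}" "{x, y} \<in> row_edges rs"
    then show "colour es {x, y} \<noteq> R" using **[of x y R] assms(3) by auto
  next
    fix x y assume xy: "x \<in> N - {u \<in> N. s ! u = R}" "y \<in> N - {u \<in> N. s ! u = R}"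
      "{x, y} \<in> row_edges rs"
    then have lt: "x < length rs" "y < length rs" using assms(3) by auto
    have "s ! x = B" "s ! y = B"
      using xy s(1) assms(2) lt by (cases "s ! x"; cases "s ! y"; auto)+
    then have "colour es {x, y} \<noteq> B" using **[of x y B] xy(3) lt by auto
    then show "colour es {x, y} = R" using ne[OF xy(3) lt] trit.exhaust by blast
  qed auto
qed

end

fun has_nil :: "bool list list \<Rightarrow> bool" where
  "has_nil [] = False"
| "has_nil ([] # L) = True"
| "has_nil ((b # m) # L) = has_nil L"

lemma has_nil_iff: "has_nil L \<longleftrightarrow> [] \<in> set L"
  by (induction L rule: has_nil.induct) auto

fun tails :: "bool list list \<Rightarrow> bool list list" where
  "tails [] = []"
| "tails ([] # L) = tails L"
| "tails ((b # m) # L) = m # tails L"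

fun tails_avoid :: "bool list list \<Rightarrow> bool list list" where
  "tails_avoid [] = []"
| "tails_avoid ([] # L) = tails_avoid L"
| "tails_avoid ((True # m) # L) = tails_avoid L"
| "tails_avoid ((False # m) # L) = m # tails_avoid L"

definition splits_all :: "trit list list \<Rightarrow> bool list \<Rightarrow> bool" where
  "splits_all es n \<longleftrightarrow> splits es n []"

fun covers :: "trit list list \<Rightarrow> bool list \<Rightarrow> bool list \<Rightarrow> bool list list \<Rightarrow> bool" where
  "covers es p ks [] = splits_all es (p @ ks)"
| "covers es p [] (m # L) = has_nil (m # L)"
| "covers es p (k # ks) (m # L) =
     (if has_nil (m # L) then True
      else if covers es (p @ [True]) ks (tails (m # L))
      then covers es (p @ [False]) ks (tails_avoid (m # L)) else False)"

lemma tails_Cons: "m \<in> set (tails L) \<Longrightarrow> \<exists>b. b # m \<in> set L"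
  by (induction L rule: tails.induct) auto

lemma tails_avoid_Cons: "m \<in> set (tails_avoid L) \<Longrightarrow> False # m \<in> set L"
  by (induction L rule: tails_avoid.induct) auto

lemma members_append: "members (p @ n) = members p \<union> (\<lambda>i. length p + i) ` members n"
proof -
  have "i \<in> members (p @ n) \<longleftrightarrow> i \<in> members p \<or> (\<exists>j\<in>members n. i = length p + j)" for i
  proof (cases "i < length p")
    case False
    then obtain j where "i = length p + j" using le_Suc_ex not_less by blast
    then show ?thesis by (auto simp: members_def)
  qed (auto simp: members_def nth_append)
  then show ?thesis by blast
qed

lemma members_replicate_True [simp]: "members (replicate k True) = {..<k}"
  by (auto simp: members_def)

lemma members_mono_append: "members n \<subseteq> members n' \<Longrightarrow> members (p @ n) \<subseteq> members (p @ n')"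
  by (auto simp: members_append)

lemma members_bounded: "members n \<subseteq> {..<length n}"
  by (auto simp: members_def)

text \<open>The search branches on whether the next vertex belongs to the set; \<open>L\<close> keeps the remainders
  of those sets that may still be contained in it.\<close>

lemma coversD:
  assumes "covers es p ks L" "length n = length ks" "ks = replicate (length ks) True"
  shows "(\<exists>m\<in>set L. members m \<subseteq> members n) \<or>
    (\<exists>w. splits es w [] \<and> members (p @ n) \<subseteq> members w)"
  using assms
proof (induction es p ks L arbitrary: n rule: covers.induct)
  case (1 es p ks)
  have "members n \<subseteq> members ks"
    using members_bounded[of n] 1(2,3) by (metis members_replicate_True)
  then have "members (p @ n) \<subseteq> members (p @ ks)" by (rule members_mono_append)
  then show ?case using 1(1) by (auto simp: splits_all_def)
next
  case (2 es p m L)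
  then have "[] \<in> set (m # L)" unfolding has_nil_iff[symmetric] by simp
  then show ?case by (intro disjI1 bexI[of _ "[]"]) simp_all
next
  case (3 es p k ks m L)
  obtain b n' where n: "n = b # n'" "length n' = length ks" using 3(4) by (cases n) auto
  have ks: "ks = replicate (length ks) True" using 3(5) by simp
  show ?case
  proof (cases "has_nil (m # L)")
    case True
    then have "[] \<in> set (m # L)" unfolding has_nil_iff[symmetric] .
    then show ?thesis by (intro disjI1 bexI[of _ "[]"]) simp_all
  next
    case False
    then have c: "covers es (p @ [True]) ks (tails (m # L))"
      "covers es (p @ [False]) ks (tails_avoid (m # L))"
      using 3(3) by (simp_all split: if_splits)
    show ?thesis
    proof (cases b)
      case True
      consider m' a where "a # m' \<in> set (m # L)" "members m' \<subseteq> members n'"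
        | w where "splits es w []" "members ((p @ [True]) @ n') \<subseteq> members w"
        using "3.IH"(1)[OF False c(1) n(2) ks] tails_Cons by blast
      then show ?thesis
      proof cases
        case 1
        then have "members (a # m') \<subseteq> members n" using n True by (cases a) auto
        then show ?thesis using 1(1) by blast
      next
        case 2
        then show ?thesis using n True by auto
      qed
    next
      case bF: False
      consider m' where "False # m' \<in> set (m # L)" "members m' \<subseteq> members n'"
        | w where "splits es w []" "members ((p @ [False]) @ n') \<subseteq> members w"
        using "3.IH"(2)[OF False c(1) c(2) n(2) ks] tails_avoid_Cons by blast
      then show ?thesis
      proof cases
        case 1
        then have "members (False # m') \<subseteq> members n" using n bF by auto
        then show ?thesis using 1(1) by blast
      next
        case 2
        then show ?thesis using n bF by auto
      qed
    qed
  qed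
qed

fun adjacent_to :: "bool list \<Rightarrow> bool list \<Rightarrow> bool" where
  "adjacent_to q [] = True"
| "adjacent_to [] r = True"
| "adjacent_to (True # q) (False # r) = False"
| "adjacent_to (True # q) (True # r) = adjacent_to q r"
| "adjacent_to (False # q) (x # r) = adjacent_to q r"

fun is_clique :: "bool list list \<Rightarrow> bool list \<Rightarrow> bool list \<Rightarrow> bool" where
  "is_clique rs [] q0 = True"
| "is_clique [] (b # q) q0 = False"
| "is_clique (r # rs) (False # q) q0 = is_clique rs q q0"
| "is_clique (r # rs) (True # q) q0 = (if adjacent_to q0 r then is_clique rs q q0 else False)"

fun count_true :: "bool list \<Rightarrow> nat" where
  "count_true [] = 0"
| "count_true (True # q) = Suc (count_true q)"
| "count_true (False # q) = count_true q"

lemma card_members: "card (members q) = count_true q"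
proof (induction q rule: count_true.induct)
  case (2 q)
  have "finite (members q)" using members_bounded finite_subset by blast
  then show ?case using 2 by (simp add: card_image)
qed (auto simp: card_image)

lemma adjacent_toD: "adjacent_to q r \<Longrightarrow> u \<in> members q \<Longrightarrow> u < length r \<Longrightarrow> u \<in> members r"
proof (induction q r arbitrary: u rule: adjacent_to.induct)
  case (5 q x r)
  then show ?case by (cases x) auto
qed auto

lemma is_cliqueD:
  "is_clique rs q q0 \<Longrightarrow> v \<in> members q \<Longrightarrow> v < length rs \<Longrightarrow> adjacent_to q0 (rs ! v)"
proof (induction rs q q0 arbitrary: v rule: is_clique.induct)
  case (3 r rs q q0)
  then show ?case by (cases v) auto
next
  case (4 r rs q q0)
  then show ?case by (cases v) (auto split: if_splits)
qed auto

lemma is_clique_length: "is_clique rs q q0 \<Longrightarrow> length q \<le> length rs"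
  by (induction rs q q0 rule: is_clique.induct) (auto split: if_splits)

lemma is_clique_clique:
  assumes "triangular rs" "is_clique rs q q"
  shows "clique (members q) (row_edges rs)"
proof -
  have "{u, v} \<in> row_edges rs" if "u \<in> members q" "v \<in> members q" "u < v" for u v
  proof -
    have v: "v < length rs" using that(2) is_clique_length[OF assms(2)] members_bounded[of q] by auto
    have "u \<in> members (rs ! v)"
      using adjacent_toD[OF is_cliqueD[OF assms(2) that(2) v] that(1)] that v assms(1)
      by (simp add: triangular_def)
    then show ?thesis using row_edges_iff[OF assms(1) that(3) v] by simp
  qed
  then show ?thesis unfolding clique_def by (metis insert_commute linorder_neqE_nat)
qed

fun clique5s :: "bool list list \<Rightarrow> bool list list \<Rightarrow> bool" where
  "clique5s rs [] = True"
| "clique5s rs (q # qs) =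
     (if is_clique rs q q then if count_true q = Suc (Suc (Suc (Suc (Suc 0)))) then clique5s rs qs else False else False)"

lemma clique5sD:
  "clique5s rs qs \<Longrightarrow> q \<in> set qs \<Longrightarrow> is_clique rs q q \<and> card (members q) = 5"
  by (induction rs qs rule: clique5s.induct) (auto simp: card_members split: if_splits)


subsection \<open>Colourings as propositional assignments\<close>

fun triangle_clauses :: "(nat \<Rightarrow> nat \<Rightarrow> bool) \<Rightarrow> nat \<Rightarrow> nat \<Rightarrow> nat list \<Rightarrow> bool" where
  "triangle_clauses c v w [] = True"
| "triangle_clauses c v w (u # us) =
     ((c u v \<or> c u w \<or> c v w) \<and> (\<not> c u v \<or> \<not> c u w \<or> \<not> c v w) \<and> triangle_clauses c v w us)"

fun row_clauses :: "(nat \<Rightarrow> nat \<Rightarrow> bool) \<Rightarrow> nat \<Rightarrow> bool list \<Rightarrow> bool list \<Rightarrow> bool list list \<Rightarrow> nat list \<Rightarrow> bool" where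
  "row_clauses c w r (False # q) (x # rs) (v # vs) = row_clauses c w r q rs vs"
| "row_clauses c w r (True # q) (x # rs) (v # vs) =
     (triangle_clauses c v w (sel x r [0, 1, 2, 3, 4, 5, 6, 7]) \<and> row_clauses c w r q rs vs)"
| "row_clauses c w r [] rs vs = True"
| "row_clauses c w r q [] vs = True"
| "row_clauses c w r q rs [] = True"

fun good_clauses :: "(nat \<Rightarrow> nat \<Rightarrow> bool) \<Rightarrow> bool list list \<Rightarrow> bool list list \<Rightarrow> nat list \<Rightarrow> bool" where
  "good_clauses c rs (r # ts) (w # ws) =
     (row_clauses c w r r rs [0, 1, 2, 3, 4, 5, 6, 7] \<and> good_clauses c rs ts ws)"
| "good_clauses c rs [] ws = True"
| "good_clauses c rs ts [] = True"

fun edge_clauses :: "(nat \<Rightarrow> nat \<Rightarrow> bool) \<Rightarrow> bool \<Rightarrow> (nat \<Rightarrow> bool) \<Rightarrow> nat \<Rightarrow> nat list \<Rightarrow> bool" where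
  "edge_clauses c p x v [] = True"
| "edge_clauses c p x v (u # us) =
     ((\<not> p \<or> \<not> c u v \<or> \<not> x u \<or> \<not> x v) \<and> (\<not> p \<or> c u v \<or> x u \<or> x v) \<and> edge_clauses c p x v us)"

fun split_clauses :: "(nat \<Rightarrow> nat \<Rightarrow> bool) \<Rightarrow> bool \<Rightarrow> (nat \<Rightarrow> bool) \<Rightarrow> bool list \<Rightarrow> bool list \<Rightarrow> bool list list \<Rightarrow> nat list \<Rightarrow> bool" where
  "split_clauses c p x m (False # q) (r # rs) (v # vs) = split_clauses c p x m q rs vs"
| "split_clauses c p x m (True # q) (r # rs) (v # vs) =
     (edge_clauses c p x v (sel r m [0, 1, 2, 3, 4, 5, 6, 7]) \<and> split_clauses c p x m q rs vs)"
| "split_clauses c p x m [] rs vs = True"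
| "split_clauses c p x m q [] vs = True"
| "split_clauses c p x m q rs [] = True"

fun all_split_clauses :: "(nat \<Rightarrow> nat \<Rightarrow> bool) \<Rightarrow> (nat \<Rightarrow> bool) \<Rightarrow> (nat \<Rightarrow> nat \<Rightarrow> bool) \<Rightarrow> bool list list \<Rightarrow> bool list list \<Rightarrow> nat \<Rightarrow> bool" where
  "all_split_clauses c p x rs [] k = True"
| "all_split_clauses c p x rs (m # ms) k =
     (split_clauses c (p k) (x k) m m rs [0, 1, 2, 3, 4, 5, 6, 7] \<and> all_split_clauses c p x rs ms (k + 1))"

fun some_of :: "(nat \<Rightarrow> bool) \<Rightarrow> nat list \<Rightarrow> bool" where
  "some_of p [] = False"
| "some_of p (k # ks) = (p k \<or> some_of p ks)"

fun some_of_each :: "(nat \<Rightarrow> bool) \<Rightarrow> nat list list \<Rightarrow> bool" where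
  "some_of_each p [] = True"
| "some_of_each p (ks # kss) = (some_of p ks \<and> some_of_each p kss)"

lemma sel_upt8D:
  assumes "u \<in> set (sel a b [0, 1, 2, 3, 4, 5, 6, 7])"
  shows "u \<in> members a" "u \<in> members b" "u < 8"
proof -
  have e: "[0, 1, 2, 3, 4, 5, 6, 7] = [0..<8]" by (simp add: upt_rec)
  obtain i where "i < 8" "u = [0..<8] ! i" "i \<in> members a" "i \<in> members b"
    using sel_nth[OF assms[unfolded e]] by auto
  then show "u \<in> members a" "u \<in> members b" "u < 8" by simp_all
qed

lemma triangle_clausesI:
  "(\<And>u. u \<in> set us \<Longrightarrow> \<not> (c u v = c u w \<and> c u w = c v w)) \<Longrightarrow> triangle_clauses c v w us"
  by (induction us) auto

lemma row_clausesI: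
  assumes "\<And>i u. i < length q \<Longrightarrow> i < length rs \<Longrightarrow> i < length vs \<Longrightarrow> q ! i \<Longrightarrow> u \<in> members (rs ! i) \<Longrightarrow>
    u \<in> members r \<Longrightarrow> \<not> (c u (vs ! i) = c u w \<and> c u w = c (vs ! i) w)"
  shows "row_clauses c w r q rs vs"
  using assms
proof (induction c w r q rs vs rule: row_clauses.induct)
  case (1 c w r q x rs v vs)
  show ?case using "1.IH" 1(2)[of "Suc i" for i] by simp
next
  case (2 c w r q x rs v vs)
  have "triangle_clauses c v w (sel x r [0, 1, 2, 3, 4, 5, 6, 7])"
  proof (intro triangle_clausesI)
    fix u assume "u \<in> set (sel x r [0, 1, 2, 3, 4, 5, 6, 7])"
    then have "u \<in> members x" "u \<in> members r" using sel_upt8D by blast+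
    then show "\<not> (c u v = c u w \<and> c u w = c v w)" using 2(2)[of 0 u] by simp
  qed
  moreover have "row_clauses c w r q rs vs" using "2.IH" 2(2)[of "Suc i" for i] by simp
  ultimately show ?case by simp
qed auto

lemma good_clausesI:
  assumes "\<And>i. i < length ts \<Longrightarrow> i < length ws \<Longrightarrow>
    row_clauses c (ws ! i) (ts ! i) (ts ! i) rs [0, 1, 2, 3, 4, 5, 6, 7]"
  shows "good_clauses c rs ts ws"
  using assms
proof (induction c rs ts ws rule: good_clauses.induct)
  case (1 c rs r ts w ws)
  show ?case using "1.IH" 1(2)[of 0] 1(2)[of "Suc i" for i] by simp
qed auto

lemma edge_clausesI:
  "(\<And>u. u \<in> set us \<Longrightarrow> p \<Longrightarrow> (c u v \<longrightarrow> \<not> (x u \<and> x v)) \<and> (\<not> c u v \<longrightarrow> x u \<or> x v)) \<Longrightarrow>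
   edge_clauses c p x v us"
  by (induction us) auto

lemma split_clausesI:
  assumes "\<And>i u. i < length q \<Longrightarrow> i < length rs \<Longrightarrow> i < length vs \<Longrightarrow> q ! i \<Longrightarrow> u \<in> members (rs ! i) \<Longrightarrow>
    u \<in> members m \<Longrightarrow> p \<Longrightarrow>
    (c u (vs ! i) \<longrightarrow> \<not> (x u \<and> x (vs ! i))) \<and> (\<not> c u (vs ! i) \<longrightarrow> x u \<or> x (vs ! i))"
  shows "split_clauses c p x m q rs vs"
  using assms
proof (induction c p x m q rs vs rule: split_clauses.induct)
  case (1 c p x m q r rs v vs)
  show ?case using "1.IH" 1(2)[of "Suc i" for i] by simp
next
  case (2 c p x m q r rs v vs)
  have "edge_clauses c p x v (sel r m [0, 1, 2, 3, 4, 5, 6, 7])"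
  proof (intro edge_clausesI)
    fix u assume u: "u \<in> set (sel r m [0, 1, 2, 3, 4, 5, 6, 7])" and p
    have "u \<in> members r" "u \<in> members m" using sel_upt8D[OF u] by blast+
    then show "(c u v \<longrightarrow> \<not> (x u \<and> x v)) \<and> (\<not> c u v \<longrightarrow> x u \<or> x v)"
      using 2(2)[of 0 u] \<open>p\<close> by simp
  qed
  moreover have "split_clauses c p x m q rs vs" using "2.IH" 2(2)[of "Suc i" for i] by simp
  ultimately show ?case by simp
qed auto

lemma all_split_clausesI:
  assumes "\<And>i. i < length ms \<Longrightarrow>
    split_clauses c (p (k + i)) (x (k + i)) (ms ! i) (ms ! i) rs [0, 1, 2, 3, 4, 5, 6, 7]"
  shows "all_split_clauses c p x rs ms k"
  using assms
proof (induction ms arbitrary: k)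
  case (Cons m ms)
  have "all_split_clauses c p x rs ms (k + 1)"
    using Cons.prems[of "Suc i" for i] by (intro Cons.IH) simp
  then show ?case using Cons.prems[of 0] by simp
qed simp

lemma some_of_iff: "some_of p ks \<longleftrightarrow> (\<exists>k\<in>set ks. p k)"
  by (induction ks) auto

lemma some_of_each_iff: "some_of_each p kss \<longleftrightarrow> (\<forall>ks\<in>set kss. \<exists>k\<in>set ks. p k)"
  by (induction kss) (auto simp: some_of_iff)

definition separates :: "nat set set \<Rightarrow> (nat set \<Rightarrow> bool) \<Rightarrow> nat set \<Rightarrow> nat set \<Rightarrow> bool" where
  "separates E c N X \<longleftrightarrow> (\<forall>u\<in>N. \<forall>v\<in>N. {u, v} \<in> E \<longrightarrow>
     (c {u, v} \<longrightarrow> \<not> (u \<in> X \<and> v \<in> X)) \<and> (\<not> c {u, v} \<longrightarrow> u \<in> X \<or> v \<in> X))"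

lemma splittable_separates:
  assumes "splittable E c N"
  shows "\<exists>X. separates E c N X"
proof -
  obtain X where X: "X \<subseteq> N" "\<forall>x\<in>X. \<forall>y\<in>X. {x, y} \<in> E \<longrightarrow> \<not> c {x, y}"
    "\<forall>x\<in>N - X. \<forall>y\<in>N - X. {x, y} \<in> E \<longrightarrow> c {x, y}"
    using assms unfolding splittable_def by blast
  have "separates E c N X"
    unfolding separates_def
  proof (intro ballI impI conjI)
    fix u v assume "u \<in> N" "v \<in> N" "{u, v} \<in> E" "\<not> c {u, v}"
    then show "u \<in> X \<or> v \<in> X" using X(3) by blast
  qed (use X(2) in blast)
  then show ?thesis by (rule exI)
qed

text \<open>The variable \<open>p k\<close> says that the \<open>k\<close>-th set is splittable, and \<open>x k\<close> is a splitting of it.\<close>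

lemma all_blocked_if_unsatisfiable:
  assumes unsat: "\<And>c p x. good_clauses c rs rs [0, 1, 2, 3, 4, 5, 6, 7] \<Longrightarrow>
      all_split_clauses c p x rs ms 0 \<Longrightarrow> some_of_each p kss \<Longrightarrow> False"
    and tri: "triangular rs" and len: "length rs = 8"
    and good: "good_colouring {..<8} (row_edges rs) c"
  shows "\<exists>ks\<in>set kss. \<forall>k\<in>set ks. k < length ms \<longrightarrow>
    \<not> splittable (row_edges rs) c (members (ms ! k))"
proof (rule ccontr)
  assume contr: "\<not> ?thesis"
  define p where "p k \<longleftrightarrow> k < length ms \<and> splittable (row_edges rs) c (members (ms ! k))" for k
  define X where "X k = (SOME X. separates (row_edges rs) c (members (ms ! k)) X)" for k
  have X: "separates (row_edges rs) c (members (ms ! k)) (X k)" if "p k" for k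
    using that splittable_separates unfolding p_def X_def by (metis someI_ex)
  let ?vs = "[0, 1, 2, 3, 4, 5, 6, 7] :: nat list"
  have e: "?vs = [0..<8]" by (simp add: upt_rec)
  have nth: "?vs ! i = i" if "i < 8" for i using that unfolding e by simp
  have edge: "{u, v} \<in> row_edges rs" "u < 8" if "v < 8" "u \<in> members (rs ! v)" for u v
  proof -
    have "u < v" using that tri len by (auto simp: members_def triangular_def)
    then show "{u, v} \<in> row_edges rs" "u < 8" using that len row_edges_iff[OF tri, of u v] by auto
  qed
  have 1: "good_clauses (\<lambda>u v. c {u, v}) rs rs ?vs"
  proof (intro good_clausesI row_clausesI)
    fix w v u assume a: "w < length rs" "v < length (rs ! w)" "v < length rs" "rs ! w ! v"
      "u \<in> members (rs ! v)" "u \<in> members (rs ! w)"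
    have lt: "w < 8" "v < 8" using a len by auto
    have "v \<in> members (rs ! w)" using a by (simp add: members_def)
    then have "{v, w} \<in> row_edges rs" "{u, v} \<in> row_edges rs" "{u, w} \<in> row_edges rs" "u < 8"
      using edge lt a by auto
    then show "\<not> (c {u, ?vs ! v} = c {u, ?vs ! w} \<and> c {u, ?vs ! w} = c {?vs ! v, ?vs ! w})"
      using good lt unfolding good_colouring_def nth[OF lt(1)] nth[OF lt(2)] by simp
  qed
  have 2: "all_split_clauses (\<lambda>u v. c {u, v}) p (\<lambda>k u. u \<in> X k) rs ms 0"
  proof (intro all_split_clausesI split_clausesI)
    fix k v u assume a: "k < length ms" "v < length (ms ! k)" "v < length rs" "ms ! k ! v"
      "u \<in> members (rs ! v)" "u \<in> members (ms ! k)" "p (0 + k)"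
    have lt: "v < 8" using a len by auto
    have "v \<in> members (ms ! k)" using a by (simp add: members_def)
    then show "(c {u, ?vs ! v} \<longrightarrow> \<not> (u \<in> X (0 + k) \<and> ?vs ! v \<in> X (0 + k))) \<and>
        (\<not> c {u, ?vs ! v} \<longrightarrow> u \<in> X (0 + k) \<or> ?vs ! v \<in> X (0 + k))"
      using X[of k] edge[OF lt a(5)] a unfolding nth[OF lt] separates_def by simp
  qed
  have "some_of_each p kss"
    unfolding some_of_each_iff p_def using contr by blast
  then show False using unsat 1 2 by blast
qed

fun prefix_all :: "bool \<Rightarrow> bool list list \<Rightarrow> bool list list" where
  "prefix_all b [] = []"
| "prefix_all b (n # ns) = (b # n) # prefix_all b ns"

fun supersets :: "bool list \<Rightarrow> bool list list" where
  "supersets [] = []"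
| "supersets (True # n) = prefix_all True (supersets n)"
| "supersets (False # n) = (True # n) # prefix_all False (supersets n)"

fun same :: "bool list \<Rightarrow> bool list \<Rightarrow> bool" where
  "same [] [] = True"
| "same [] (b # n) = False"
| "same (a # m) [] = False"
| "same (True # m) (True # n) = same m n"
| "same (True # m) (False # n) = False"
| "same (False # m) (True # n) = False"
| "same (False # m) (False # n) = same m n"

fun among :: "bool list \<Rightarrow> bool list list \<Rightarrow> bool" where
  "among n [] = False"
| "among n (m # ms) = (if same n m then True else among n ms)"

lemma same_iff: "same m n \<longleftrightarrow> m = n"
  by (induction m n rule: same.induct) auto

lemma among_iff: "among n ms \<longleftrightarrow> n \<in> set ms"
  by (induction ms) (auto simp: same_iff)

lemma prefix_all_map: "prefix_all b ns = map ((#) b) ns"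
  by (induction ns) auto

lemma supersets_eq:
  assumes "members m \<subseteq> members n" "length m = length n"
  shows "m = n \<or> (\<exists>m'\<in>set (supersets m). members m' \<subseteq> members n \<and> length m' = length n)"
  using assms
proof (induction m arbitrary: n)
  case (Cons b m)
  obtain a n' where n: "n = a # n'" "length m = length n'" using Cons.prems(2) by (cases n) auto
  show ?case
  proof (cases "b = a")
    case True
    then have "members m \<subseteq> members n'" using Cons.prems(1) n by (cases a) auto
    then have "m = n' \<or> (\<exists>m'\<in>set (supersets m). members m' \<subseteq> members n' \<and> length m' = length n')"
      using Cons.IH n by blast
    then show ?thesis using True n by (cases a) (auto simp: prefix_all_map)
  next
    case False
    then have "\<not> b" "a" using Cons.prems(1) n by (cases a; cases b; auto)+
    then show ?thesis using n Cons.prems(1) by (auto intro!: bexI[of _ "True # m"])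
  qed
qed auto

lemma hit_mono: "hit D m \<Longrightarrow> members m \<subseteq> members n \<Longrightarrow> hit D n"
  unfolding hit_iff by blast

text \<open>Every superset of \<open>n\<close> contains a member of \<open>D\<close> or of \<open>Q\<close>, or is one of the excluded sets
  \<open>X\<close>; the first list only bounds the recursion depth.\<close>

fun dominated :: "bool list list \<Rightarrow> bool list list \<Rightarrow> bool list list \<Rightarrow> bool list \<Rightarrow> bool list \<Rightarrow> bool"
and all_dominated :: "bool list list \<Rightarrow> bool list list \<Rightarrow> bool list list \<Rightarrow> bool list \<Rightarrow> bool list list \<Rightarrow> bool" where
  "dominated D Q X [] n = (if hit D n then True else hit Q n)"
| "dominated D Q X (d # ds) n =
     (if hit D n then True else if hit Q n then True
      else if among n X then all_dominated D Q X ds (supersets n) else False)"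
| "all_dominated D Q X ds [] = True"
| "all_dominated D Q X ds (n # ns) = (if dominated D Q X ds n then all_dominated D Q X ds ns else False)"

lemma dominatedD:
  shows "dominated D Q X ds m \<Longrightarrow> members m \<subseteq> members n \<Longrightarrow> length m = length n \<Longrightarrow>
      hit D n \<or> hit Q n \<or> n \<in> set X"
    and "all_dominated D Q X ds ms \<Longrightarrow> m \<in> set ms \<Longrightarrow> members m \<subseteq> members n \<Longrightarrow> length m = length n \<Longrightarrow>
      hit D n \<or> hit Q n \<or> n \<in> set X"
proof (induction D Q X ds m and D Q X ds ms arbitrary: n and n m rule: dominated_all_dominated.induct)
  case (1 D Q X m)
  then show ?case using hit_mono by (auto split: if_splits)
next
  case (2 D Q X d ds m)
  show ?case
  proof (cases "hit D m \<or> hit Q m")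
    case True
    then show ?thesis using 2(3) hit_mono by blast
  next
    case False
    then have a: "among m X" "all_dominated D Q X ds (supersets m)"
      using 2(2) by (auto split: if_splits)
    show ?thesis
      using supersets_eq[OF 2(3,4)]
    proof
      assume "m = n"
      then show ?thesis using a by (simp add: among_iff)
    next
      assume "\<exists>m'\<in>set (supersets m). members m' \<subseteq> members n \<and> length m' = length n"
      then obtain m' where "m' \<in> set (supersets m)" "members m' \<subseteq> members n" "length m' = length n"
        by blast
      then show ?thesis using 2(1) False a by blast
    qed
  qed
qed (auto split: if_splits)

text \<open>\<open>Pick k ds t t'\<close> branches on whether the set with bit mask \<open>k\<close> belongs to the family. If it does not,
  then for each \<open>(i, j)\<close> in \<open>ds\<close> the \<open>j\<close>-th list of candidates is dropped and the \<open>i\<close>-th of the remaining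
  ones takes over its role. \<open>Dead i\<close> claims that the \<open>i\<close>-th list can no longer be hit.\<close>

datatype search = Done | Dead nat | Pick nat "(nat \<times> nat) list" search search

fun fits :: "'b list \<Rightarrow> 'c list \<Rightarrow> bool" where
  "fits [] b = True"
| "fits (x # u) [] = False"
| "fits (x # u) (y # b) = fits u b"

lemma fits_iff: "fits u b \<longleftrightarrow> length u \<le> length b"
  by (induction u b rule: fits.induct) auto

fun not_hit :: "bool list \<Rightarrow> bool list list list \<Rightarrow> bool list list list" where
  "not_hit n [] = []"
| "not_hit n (D # U) = (if hit D n then not_hit n U else D # not_hit n U)"

lemma set_not_hit: "set (not_hit n U) = {D \<in> set U. \<not> hit D n}"
  by (induction U) auto

fun fetch :: "'b list \<Rightarrow> nat \<Rightarrow> 'b option" where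
  "fetch [] k = None"
| "fetch (x # u) 0 = Some x"
| "fetch (x # u) (Suc k) = fetch u k"

fun remove_at :: "nat \<Rightarrow> 'b list \<Rightarrow> 'b list" where
  "remove_at k [] = []"
| "remove_at 0 (x # u) = u"
| "remove_at (Suc k) (x # u) = x # remove_at k u"

lemma fetch_numeral:
  "fetch (x # u) 1 = fetch u 0"
  "fetch (x # u) (numeral k) = fetch u (pred_numeral k)"
  by (simp_all add: numeral_eq_Suc)

lemma remove_at_numeral:
  "remove_at 1 (x # u) = x # remove_at 0 u"
  "remove_at (numeral k) (x # u) = x # remove_at (pred_numeral k) u"
  by (simp_all add: numeral_eq_Suc)

lemma fetch_eq: "fetch u k = (if k < length u then Some (u ! k) else None)"
  by (induction u k rule: fetch.induct) auto

lemma set_remove_at: "fetch u k = Some x \<Longrightarrow> set u = insert x (set (remove_at k u))"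
  by (induction u k rule: fetch.induct) auto

fun pad_all :: "bool list list \<Rightarrow> bool list list" where
  "pad_all [] = []"
| "pad_all (m # ms) = pad [0, 1, 2, 3, 4, 5, 6, 7] m # pad_all ms"

abbreviation eight :: "bool list" where
  "eight \<equiv> [True, True, True, True, True, True, True, True]"

fun covered :: "bool list list \<Rightarrow> bool list list \<Rightarrow> bool list list option \<Rightarrow> bool" where
  "covered Q X None = False"
| "covered Q X (Some D) = all_dominated [] Q X eight (pad_all D)"

primrec discard :: "bool list list \<Rightarrow> bool list list \<Rightarrow> (nat \<times> nat) list \<Rightarrow> bool list list list \<Rightarrow>
    bool list list list option" where
  "discard Q X [] U = Some U"
| "discard Q X (d # ds) U = (case fetch U (snd d) of None \<Rightarrow> None | Some D \<Rightarrow>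
     (case fetch (remove_at (snd d) U) (fst d) of None \<Rightarrow> None | Some D' \<Rightarrow>
       (if all_dominated D Q X eight (pad_all D') then discard Q X ds (remove_at (snd d) U) else None)))"

definition discard_second :: "bool list list \<Rightarrow> bool list list \<Rightarrow> (nat \<times> nat) list \<Rightarrow> bool list list \<Rightarrow>
    bool list list option \<Rightarrow> bool list list list \<Rightarrow> bool list list list option" where
  "discard_second Q X ds D d U = (case d of None \<Rightarrow> None | Some D' \<Rightarrow>
     (if all_dominated D Q X eight (pad_all D') then discard Q X ds U else None))"

definition discard_first :: "bool list list \<Rightarrow> bool list list \<Rightarrow> (nat \<times> nat) list \<Rightarrow> bool list list option \<Rightarrow>
    nat \<Rightarrow> bool list list list \<Rightarrow> bool list list list option" where
  "discard_first Q X ds d i U =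
     (case d of None \<Rightarrow> None | Some D \<Rightarrow> discard_second Q X ds D (fetch U i) U)"

lemma discard_eqs:
  "discard Q X [] U = Some U"
  "discard Q X ((i, j) # ds) U = discard_first Q X ds (fetch U j) i (remove_at j U)"
  "discard_first Q X ds None i U = None"
  "discard_first Q X ds (Some D) i U = discard_second Q X ds D (fetch U i) U"
  "discard_second Q X ds D None U = None"
  "discard_second Q X ds D (Some D') U =
     (if all_dominated D Q X eight (pad_all D') then discard Q X ds U else None)"
  by (simp_all add: discard_first_def discard_second_def cong: option.case_cong if_cong)

primrec bounded :: "bool list list \<Rightarrow> search \<Rightarrow> bool list \<Rightarrow> bool list list \<Rightarrow> bool list list list \<Rightarrow> bool" where
  "bounded Q Done b X U = fits U b"
| "bounded Q (Dead i) b X U = covered Q X (fetch U i)"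
| "bounded Q (Pick k ds t t') b X U =
     (let n = pad [0, 1, 2, 3, 4, 5, 6, 7] (bits k) in
      case b of [] \<Rightarrow> False
      | y # b' \<Rightarrow> (if bounded Q t b' X (not_hit n U)
          then case discard Q (n # X) ds U of None \<Rightarrow> False | Some U' \<Rightarrow> bounded Q t' (y # b') (n # X) U'
          else False))"

definition bounded_out :: "bool list list \<Rightarrow> search \<Rightarrow> bool list \<Rightarrow> bool list list \<Rightarrow>
    bool list list list option \<Rightarrow> bool" where
  "bounded_out Q t b X u = (case u of None \<Rightarrow> False | Some U \<Rightarrow> bounded Q t b X U)"

definition bounded_in :: "bool list list \<Rightarrow> search \<Rightarrow> search \<Rightarrow> (nat \<times> nat) list \<Rightarrow> bool list \<Rightarrow>
    bool list \<Rightarrow> bool list list \<Rightarrow> bool list list list \<Rightarrow> bool" where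
  "bounded_in Q t t' ds n b X U = (case b of [] \<Rightarrow> False
      | y # b' \<Rightarrow> (if bounded Q t b' X (not_hit n U)
          then bounded_out Q t' (y # b') (n # X) (discard Q (n # X) ds U) else False))"

lemma bounded_eqs:
  "bounded Q Done b X U = fits U b"
  "bounded Q (Dead i) b X U = covered Q X (fetch U i)"
  "bounded Q (Pick k ds t t') b X U =
     bounded_in Q t t' ds (pad [0, 1, 2, 3, 4, 5, 6, 7] (bits k)) b X U"
  "bounded_in Q t t' ds n [] X U = False"
  "bounded_in Q t t' ds n (y # b) X U =
     (if bounded Q t b X (not_hit n U)
      then bounded_out Q t' (y # b) (n # X) (discard Q (n # X) ds U) else False)"
  "bounded_out Q t b X None = False"
  "bounded_out Q t b X (Some U) = bounded Q t b X U"
  by (simp_all add: bounded_in_def bounded_out_def Let_def cong: list.case_cong)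

definition code :: "nat set \<Rightarrow> bool list" where
  "code N = map (\<lambda>i. i \<in> N) [0..<8]"

lemma length_code [simp]: "length (code N) = 8"
  by (simp add: code_def)

lemma members_code [simp]: "N \<subseteq> {..<8} \<Longrightarrow> members (code N) = N"
  by (auto simp: code_def members_def)

lemma code_members: "length n = 8 \<Longrightarrow> code (members n) = n"
  by (rule nth_equalityI) (auto simp: code_def members_def)

lemma members_pad: "members (pad us m) \<subseteq> members m"
  by (induction us m rule: pad.induct) (simp_all, case_tac b, auto)

lemma all_dominated_pad:
  assumes "all_dominated D Q X ds (pad_all D')" "hit D' n" "length n = 8"
  shows "hit D n \<or> hit Q n \<or> n \<in> set X"
proof -
  obtain m where m: "m \<in> set D'" "members m \<subseteq> members n" using assms(2) by (auto simp: hit_iff)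
  have "pad [0, 1, 2, 3, 4, 5, 6, 7] m \<in> set (pad_all D')" using m(1) by (induction D') auto
  moreover have "members (pad [0, 1, 2, 3, 4, 5, 6, 7] m) \<subseteq> members n"
    using m(2) members_pad by blast
  ultimately show ?thesis by (rule dominatedD(2)[OF assms(1)]) (simp add: assms(3))
qed

definition transversal :: "nat set set \<Rightarrow> nat set set \<Rightarrow> bool list list \<Rightarrow> bool list list \<Rightarrow> bool list list list \<Rightarrow> bool"
where
  "transversal F P Q X U \<longleftrightarrow> finite F \<and> F \<subseteq> Pow {..<8} \<and> P \<subseteq> F \<and>
     (\<forall>N\<in>F. \<not> hit Q (code N) \<and> code N \<notin> set X) \<and>
     (\<forall>D\<in>set U. \<exists>N\<in>F. hit D (code N)) \<and>
     (\<forall>N\<in>F - P. \<exists>D\<in>set U. \<forall>N'\<in>F. hit D (code N') \<longrightarrow> N' = N)"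

lemma transversal_remove:
  assumes "transversal F P Q X U" "fetch U j = Some D" "fetch (remove_at j U) i = Some D'"
    "all_dominated D Q X eight (pad_all D')"
  shows "transversal F P Q X (remove_at j U)"
proof -
  have U: "set U = insert D (set (remove_at j U))" using set_remove_at assms(2) by metis
  have D': "D' \<in> set (remove_at j U)" using assms(3) by (auto simp: fetch_eq split: if_splits)
  have "\<exists>D\<in>set (remove_at j U). \<forall>N'\<in>F. hit D (code N') \<longrightarrow> N' = N" if N: "N \<in> F - P" for N
  proof -
    obtain C where C: "C \<in> set U" "\<forall>N'\<in>F. hit C (code N') \<longrightarrow> N' = N"
      using assms(1) N unfolding transversal_def by meson
    show ?thesis
    proof (cases "C \<in> set (remove_at j U)")
      case False
      then have "C = D" using C(1) U by blast
      have "N' = N" if "N' \<in> F" "hit D' (code N')" for N'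
        using all_dominated_pad[OF assms(4) that(2)] assms(1) that(1) C(2) \<open>C = D\<close>
        by (auto simp: transversal_def)
      then show ?thesis using D' by blast
    qed (use C in blast)
  qed
  then show ?thesis using assms(1) U by (auto simp: transversal_def)
qed

lemma transversal_discard:
  assumes "transversal F P Q X U" "discard Q X ds U = Some U'"
  shows "transversal F P Q X U'"
  using assms
proof (induction ds arbitrary: U)
  case (Cons ij ds)
  obtain i j where ij: "ij = (i, j)" by fastforce
  obtain D where D: "fetch U j = Some D" using Cons.prems(2) ij by (cases "fetch U j") auto
  obtain D' where D': "fetch (remove_at j U) i = Some D'"
    using Cons.prems(2) ij D by (cases "fetch (remove_at j U) i") auto
  have "all_dominated D Q X eight (pad_all D')" "discard Q X ds (remove_at j U) = Some U'"
    using Cons.prems(2) ij D D' by (simp_all split: if_splits)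
  then show ?case using Cons.IH transversal_remove[OF Cons.prems(1) D D'] by blast
qed auto

lemma transversal_in:
  assumes "transversal F P Q X U" "length n = 8" "members n \<in> F"
  shows "transversal F (insert (members n) P) Q X (not_hit n U)"
proof -
  have c: "code (members n) = n" using code_members assms(2) .
  have priv: "\<forall>N\<in>F - P. \<exists>D\<in>set U. \<forall>N'\<in>F. hit D (code N') \<longrightarrow> N' = N"
    using assms(1) by (simp add: transversal_def)
  have "\<exists>D\<in>set (not_hit n U). \<forall>N'\<in>F. hit D (code N') \<longrightarrow> N' = N"
    if N: "N \<in> F - insert (members n) P" for N
  proof -
    obtain C where C: "C \<in> set U" "\<forall>N'\<in>F. hit C (code N') \<longrightarrow> N' = N"
      using bspec[OF priv, of N] N by blast
    then have "\<not> hit C n" using assms(3) c N by (metis DiffD2 insertI1)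
    then show ?thesis using C by (auto simp: set_not_hit)
  qed
  then show ?thesis using assms(1,3) by (auto simp: transversal_def set_not_hit)
qed

lemma transversal_out:
  assumes "transversal F P Q X U" "length n = 8" "members n \<notin> F"
  shows "transversal F P Q (n # X) U"
proof -
  have "code N \<noteq> n" if "N \<in> F" for N
    using assms that unfolding transversal_def by (metis PowD members_code subsetD)
  then show ?thesis using assms(1) by (auto simp: transversal_def)
qed

lemma transversal_card:
  assumes "transversal F P Q X U"
  shows "card F \<le> card P + length U"
proof -
  have fin: "finite F" "P \<subseteq> F" using assms by (auto simp: transversal_def)
  have "\<forall>N\<in>F - P. \<exists>D\<in>set U. \<forall>N'\<in>F. hit D (code N') \<longrightarrow> N' = N"
    using assms by (simp add: transversal_def)
  then obtain f where f: "\<And>N. N \<in> F - P \<Longrightarrow> f N \<in> set U"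
    "\<And>N N'. N \<in> F - P \<Longrightarrow> N' \<in> F \<Longrightarrow> hit (f N) (code N') \<Longrightarrow> N' = N" by metis
  have "inj_on f (F - P)"
  proof (rule inj_onI)
    fix N M assume NM: "N \<in> F - P" "M \<in> F - P" "f N = f M"
    obtain K where "K \<in> F" "hit (f N) (code K)"
      using f(1)[OF NM(1)] assms unfolding transversal_def by meson
    then show "N = M" using f(2)[OF NM(1)] f(2)[OF NM(2)] NM(3) by metis
  qed
  then have "card (F - P) \<le> card (set U)" using f(1) by (intro card_inj_on_le[of f]) auto
  also have "\<dots> \<le> length U" by (rule card_length)
  finally show ?thesis using fin by (simp add: card_Diff_subset finite_subset)
qed

lemma bounded_card:
  "bounded Q t b X U \<Longrightarrow> transversal F P Q X U \<Longrightarrow> card F \<le> card P + length b"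
proof (induction t arbitrary: b X U P)
  case Done
  then show ?case using transversal_card[OF Done(2)] by (simp add: fits_iff)
next
  case (Dead i)
  then obtain D where D: "fetch U i = Some D" "all_dominated [] Q X eight (pad_all D)"
    by (cases "fetch U i") auto
  then have "D \<in> set U" by (auto simp: fetch_eq split: if_splits)
  then obtain N where N: "N \<in> F" "hit D (code N)" using Dead(2) unfolding transversal_def by meson
  then show ?case using all_dominated_pad[OF D(2) N(2)] Dead(2) by (auto simp: transversal_def)
next
  case (Pick k ds t t')
  define n where "n = pad [0, 1, 2, 3, 4, 5, 6, 7] (bits k)"
  have n8: "length n = 8" by (simp add: n_def)
  obtain y b' where b: "b = y # b'"
    using Pick.prems(1) by (cases b) (simp_all only: bounded_eqs)
  have t: "bounded Q t b' X (not_hit n U)"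
    using Pick.prems(1) by (simp only: bounded_eqs b n_def split: if_splits)
  then have "bounded_out Q t' (y # b') (n # X) (discard Q (n # X) ds U)"
    using Pick.prems(1) by (simp only: bounded_eqs b n_def if_True)
  then obtain U' where U': "discard Q (n # X) ds U = Some U'" "bounded Q t' (y # b') (n # X) U'"
    by (cases "discard Q (n # X) ds U") (simp_all only: bounded_eqs)
  have fin: "finite P" using Pick.prems(2) by (auto simp: transversal_def intro: finite_subset)
  show ?case
  proof (cases "members n \<in> F")
    case True
    have "card F \<le> card (insert (members n) P) + length b'"
      using Pick.IH(1)[OF t transversal_in[OF Pick.prems(2) n8 True]] .
    also have "\<dots> \<le> card P + length b" using fin by (simp add: card_insert_if b)
    finally show ?thesis .
  next
    case False
    show ?thesis
      using Pick.IH(2)[OF U'(2)] transversal_discard[OF transversal_out[OF Pick.prems(2) n8 False] U'(1)]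
      by (simp add: b)
  qed
qed

definition solved :: "bool list list \<Rightarrow> bool" where
  "solved rs \<longleftrightarrow> (\<forall>F. critical_family {..<8} (row_edges rs) F \<longrightarrow> card F \<le> 18)"

fun bits_all :: "nat list \<Rightarrow> bool list list" where
  "bits_all [] = []"
| "bits_all (k # ks) = bits k # bits_all ks"

fun add_some :: "'b option \<Rightarrow> 'b list \<Rightarrow> 'b list" where
  "add_some None u = u"
| "add_some (Some x) u = x # u"

fun select :: "'b list \<Rightarrow> nat list \<Rightarrow> 'b list" where
  "select u [] = []"
| "select u (k # ks) = add_some (fetch u k) (select u ks)"

fun select_all :: "'b list \<Rightarrow> nat list list \<Rightarrow> 'b list list" where
  "select_all u [] = []"
| "select_all u (ks # kss) = select u ks # select_all u kss"

lemma set_select: "set (select u ks) = {u ! k |k. k \<in> set ks \<and> k < length u}"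
  by (induction ks) (auto simp: fetch_eq)

lemma select_all_map: "select_all u kss = map (select u) kss"
  by (induction kss) auto

fun family_ok :: "bool list list \<Rightarrow> trit list list \<Rightarrow> bool list list \<Rightarrow> bool" where
  "family_ok Q es D = (if entries_ok es [] then covers es [] eight (Q @ D) else False)"

fun families_ok :: "bool list list \<Rightarrow> bool list list \<Rightarrow> nat list \<Rightarrow> bool list list list \<Rightarrow> bool" where
  "families_ok rs Q (d # ds) (D # U) =
     (if family_ok Q (entries rs (bits d)) D then families_ok rs Q ds U else False)"
| "families_ok rs Q [] [] = True"
| "families_ok rs Q (d # ds) [] = False"
| "families_ok rs Q [] (D # U) = False"

definition certified :: "bool list list \<Rightarrow> bool list list \<Rightarrow> nat list \<Rightarrow> bool list list list \<Rightarrow> search \<Rightarrow> bool" where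
  "certified rs Q ds U t \<longleftrightarrow>
     (if clique5s rs Q then if families_ok rs Q ds U
      then bounded Q t [True, True, True, True, True, True, True, True, True,
             True, True, True, True, True, True, True, True, True] [] U
      else False else False)"

lemma families_okD:
  "families_ok rs Q ds U \<Longrightarrow> D \<in> set U \<Longrightarrow> \<exists>d. family_ok Q (entries rs d) D"
  by (induction rs Q ds U rule: families_ok.induct) (auto simp del: family_ok.simps split: if_splits)

lemma family_hit:
  assumes "triangular rs" "length rs = 8" "critical_family {..<8} (row_edges rs) F"
    and Q: "\<forall>N\<in>F. \<not> hit Q (code N)" and "family_ok Q (entries rs d) D"
  shows "\<exists>N\<in>F. hit D (code N)"
proof -
  interpret coloured_rows rs "entries rs d"
    using assms(1) entries_shape by unfold_locales
  let ?c = "\<lambda>e. colour (entries rs d) e = R"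
  have ok: "entries_ok (entries rs d) []" "covers (entries rs d) [] eight (Q @ D)"
    using assms(5) by (auto split: if_splits)
  obtain N where N: "N \<in> F" "\<not> splittable (row_edges rs) ?c N"
    using good[OF ok(1)] assms(2,3) unfolding critical_family_def by auto
  have N8: "N \<subseteq> {..<8}" using N(1) assms(3) by (auto simp: critical_family_def)
  have "(\<exists>m\<in>set (Q @ D). members m \<subseteq> members (code N)) \<or>
      (\<exists>w. splits (entries rs d) w [] \<and> members ([] @ code N) \<subseteq> members w)"
    by (rule coversD[OF ok(2)]) (simp_all add: numeral_eq_Suc)
  moreover have "\<not> (splits (entries rs d) w [] \<and> members ([] @ code N) \<subseteq> members w)" for w
    using splittable[of w N] N(2) N8 assms(2) by auto
  ultimately have "hit (Q @ D) (code N)" by (auto simp: hit_iff)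
  then have "hit D (code N)" using Q N(1) by (auto simp: hit_iff)
  then show ?thesis using N(1) by blast
qed

lemma triangular_rows: "triangular (rows_from [] g)"
  by (simp add: triangular_def rows_from_length)

lemma solvedI:
  assumes len: "length g = 8"
    and cert: "certified (rows_from [] g) (bits_all qs) ds (select_all (bits_all ms) kss) t"
    and unsat: "\<And>c p x. good_clauses c (rows_from [] g) (rows_from [] g) [0, 1, 2, 3, 4, 5, 6, 7] \<Longrightarrow>
      all_split_clauses c p x (rows_from [] g) (bits_all ms) 0 \<Longrightarrow> some_of_each p kss \<Longrightarrow> False"
  shows "solved (rows_from [] g)"
  unfolding solved_def
proof (intro allI impI)
  fix F assume F: "critical_family {..<8} (row_edges (rows_from [] g)) F"
  define rs where "rs = rows_from [] g"
  define Q where "Q = bits_all qs"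
  define U where "U = select_all (bits_all ms) kss"
  have tri: "triangular rs" and l8: "length rs = 8"
    using triangular_rows rows_from_length(1) len by (simp_all add: rs_def)
  have c: "clique5s rs Q" "families_ok rs Q ds U"
    "bounded Q t [True, True, True, True, True, True, True, True, True,
             True, True, True, True, True, True, True, True, True] [] U"
    using cert by (auto simp: certified_def rs_def Q_def U_def split: if_splits)
  have F8: "N \<subseteq> {..<8}" if "N \<in> F" for N using F that by (auto simp: critical_family_def)
  have Q: "\<not> hit Q (code N)" if N: "N \<in> F" for N
  proof
    assume "hit Q (code N)"
    then obtain q where q: "q \<in> set Q" "members q \<subseteq> N" using F8[OF N] by (auto simp: hit_iff)
    then have "clique (members q) (row_edges rs)" "card (members q) = 5"
      using clique5sD[OF c(1) q(1)] is_clique_clique[OF tri] by auto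
    then show False using F N q(2) unfolding critical_family_def rs_def by blast
  qed
  have hit: "\<exists>N\<in>F. hit D (code N)" if D: "D \<in> set U" for D
  proof -
    obtain d where "family_ok Q (entries rs d) D" using families_okD[OF c(2) D] by blast
    then show ?thesis using family_hit[OF tri l8 _ _ ] F Q unfolding rs_def by blast
  qed
  have priv: "\<exists>D\<in>set U. \<forall>N'\<in>F. hit D (code N') \<longrightarrow> N' = N" if N: "N \<in> F" for N
  proof -
    obtain c where c: "good_colouring {..<8} (row_edges rs) c"
      "\<forall>N'\<in>F - {N}. splittable (row_edges rs) c N'"
      using F N unfolding critical_family_def rs_def by meson
    have "\<exists>ks\<in>set kss. \<forall>k\<in>set ks. k < length (bits_all ms) \<longrightarrow>
        \<not> splittable (row_edges rs) c (members (bits_all ms ! k))"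
    proof (rule all_blocked_if_unsatisfiable[OF _ tri l8 c(1)])
      show False if "good_clauses c rs rs [0, 1, 2, 3, 4, 5, 6, 7]"
        "all_split_clauses c p x rs (bits_all ms) 0" "some_of_each p kss" for c p x
        using unsat that unfolding rs_def by blast
    qed
    then obtain ks where ks: "ks \<in> set kss"
      "\<forall>k\<in>set ks. k < length (bits_all ms) \<longrightarrow> \<not> splittable (row_edges rs) c (members (bits_all ms ! k))"
      by blast
    have "N' = N" if N': "N' \<in> F" "hit (select (bits_all ms) ks) (code N')" for N'
    proof (rule ccontr)
      assume "N' \<noteq> N"
      then have s: "splittable (row_edges rs) c N'" using c(2) N'(1) by blast
      obtain k where "k \<in> set ks" "k < length (bits_all ms)" "members (bits_all ms ! k) \<subseteq> N'"
        using N' F8 by (auto simp: hit_iff set_select)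
      then show False using ks(2) splittable_mono[OF s _ order_refl] by blast
    qed
    moreover have "select (bits_all ms) ks \<in> set U" using ks(1) by (simp add: U_def select_all_map)
    ultimately show ?thesis by blast
  qed
  have "transversal F {} Q [] U"
    unfolding transversal_def
  proof (intro conjI ballI)
    show "finite F" using F8 by (intro finite_subset[of F "Pow {..<8}"]) auto
  qed (use F8 Q hit priv in auto)
  then show "card F \<le> 18" using bounded_card[OF c(3), of F "{}"] by simp
qed


subsection \<open>Critical families on the individual graphs\<close>

fun decode :: "nat list \<Rightarrow> nat list list" where
  "decode [] = []"
| "decode (k # ks) = sel (bits k) (bits k) [0,1,2,3,4,5,6,7,8,9,10,11,12,13,14,15,16,17,18,19,20,21,22,23,24,25,26,27,28,29,30,31,32,33,34] # decode ks"

text \<open>All arguments but \<open>g\<close> are only the data for the introduction rule below.\<close>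

definition certificate :: "nat list \<Rightarrow> nat list \<Rightarrow> nat list \<Rightarrow> nat list \<Rightarrow> nat list \<Rightarrow> search \<Rightarrow> bool" where
  "certificate g qs ds ms ks t \<longleftrightarrow> length g = 8 \<and> solved (rows_from [] g)"

lemma certificateI:
  assumes "length g = 8"
    and "certified (rows_from [] g) (bits_all qs) ds (select_all (bits_all ms) (decode ks)) t"
    and "\<And>c p x. good_clauses c (rows_from [] g) (rows_from [] g) [0, 1, 2, 3, 4, 5, 6, 7] \<Longrightarrow>
      all_split_clauses c p x (rows_from [] g) (bits_all ms) 0 \<Longrightarrow> some_of_each p (decode ks) \<Longrightarrow> False"
  shows "certificate g qs ds ms ks t"
  unfolding certificate_def using assms(1) by (intro conjI solvedI[OF assms])

lemmas search_run = bits_0 bits_1 bits_numeral num_bits.simps pad.simps sel.simps subl.simps hit.simps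
  rows_from.simps okR.simps okB.simps splits.simps entry.simps entries.simps entry_ok.simps
  entries_ok.simps has_nil.simps tails.simps tails_avoid.simps covers.simps adjacent_to.simps
  is_clique.simps count_true.simps clique5s.simps triangle_clauses.simps row_clauses.simps
  good_clauses.simps edge_clauses.simps split_clauses.simps all_split_clauses.simps some_of.simps
  some_of_each.simps prefix_all.simps supersets.simps same.simps among.simps dominated.simps
  all_dominated.simps fits.simps not_hit.simps fetch.simps(1,2) remove_at.simps(1,2) fetch_numeral
  remove_at_numeral pad_all.simps covered.simps discard_eqs bounded_eqs
  decode.simps bits_all.simps add_some.simps select.simps select_all.simps family_ok.simps families_ok.simps
  certified_def splits_all_def append.simps if_True if_False prod.case
  pred_numeral_simps BitM.simps Num.inc.simps add_0 one_add_one numeral_plus_one add_One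
  list.size simp_thms nat.inject nat.distinct

text \<open>Used as congruence rules, these keep the simplifier out of arguments that are already values.\<close>

lemma search_cong:
  "splits es n a = splits es n a"
  "okR a e = okR a e"
  "okB a e = okB a e"
  "entry_ok e es = entry_ok e es"
  "entries_ok es es' = entries_ok es es'"
  "subl m n = subl m n"
  "hit D n = hit D n"
  "has_nil L = has_nil L"
  "tails L = tails L"
  "tails_avoid L = tails_avoid L"
  "dominated D Q X b n = dominated D Q X b n"
  "not_hit n U = not_hit n U"
  "discard Q X ijs U = discard Q X ijs U"
  "families_ok rs Q ds V = families_ok rs Q ds V"
  "among n X = among n X"
  "same m n = same m n"
  "supersets n = supersets n"
  "fits xs ys = fits xs ys"
  "adjacent_to m n = adjacent_to m n"
  "is_clique rs m n = is_clique rs m n"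
  "num_bits k = num_bits k"
  by (rule refl)+

lemma search_cong':
  "n = n' \<Longrightarrow> splits_all es n = splits_all es n'"
  "p = p' \<Longrightarrow> L = L' \<Longrightarrow> covers es p ks L = covers es p' ks L'"
  "ns = ns' \<Longrightarrow> all_dominated D Q X b ns = all_dominated D Q X b ns'"
  "U = U' \<Longrightarrow> bounded Q t b X U = bounded Q t b X U'"
  "n = n' \<Longrightarrow> bounded_in Q t t2 ijs n b X U = bounded_in Q t t2 ijs n' b X U"
  "u = u' \<Longrightarrow> bounded_out Q t b X u = bounded_out Q t b X u'"
  "dj = dj' \<Longrightarrow> U = U' \<Longrightarrow> discard_first Q X ijs dj i U = discard_first Q X ijs dj' i U'"
  "di = di' \<Longrightarrow> discard_second Q X ijs D di U = discard_second Q X ijs D di' U"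
  "di = di' \<Longrightarrow> covered Q X di = covered Q X di'"
  "k = k' \<Longrightarrow> fetch xs k = fetch xs k'"
  "k = k' \<Longrightarrow> remove_at k ys = remove_at k' ys"
  "es = es' \<Longrightarrow> family_ok Q es D = family_ok Q es' D"
  by simp_all

lemma certificates_clique_1:
  "certificate [0,1,3,7,15,0,0,0] [31] [787] [] [0] (Dead 0)"
  "certificate [0,1,3,7,15,0,0,28] [31] [1811,2835] [157,158] [2,1] Done"
  "certificate [0,1,3,7,15,0,0,30] [31,158] [3859] [] [0] (Dead 0)"
  "certificate [0,1,3,7,15,0,24,88] [31] [10003,18195,6931,19219,21267,25363,9997,18189,6925,19213,21261,25357,7593,
11689,13737,26025,14761,22953,17171] [91,93,94,155,157,158,216,217,218,220] [10,514,17,257,528,264,12,516,33,129,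
544,136,288,144,260,20,130,34,64] (Pick 91 [] Done (Pick 123 [(3,18)] Done Done))"
  "certificate [0,1,3,7,15,0,24,84] [31] [29347] [] [0] (Dead 0)"
  "certificate [0,1,3,7,15,0,24,92] [31] [11027,41747,11021,41741,11689,19881] [91,157,158,217,218,220] [3,34,5,36,
20,10] Done"
  "certificate [0,1,3,7,15,0,24,70] [31] [29459] [] [0] (Dead 0)"
  "certificate [0,1,3,7,15,0,24,86] [31] [21267,53861] [151,158] [1,2] Done"
  "certificate [0,1,3,7,15,0,24,94] [31,158] [86797,23977] [218,220] [2,1] Done"
  "certificate [0,1,3,7,15,0,24,71] [31] [8979,17171] [143,151] [2,1] Done"
  "certificate [0,1,3,7,15,0,24,87] [31,151] [41747] [] [0] (Dead 0)"
  "certificate [0,1,3,7,15,0,28,28] [31] [10003,19219,18195,11027] [93,94,157,158,220] [10,5,22,25] Done"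
  "certificate [0,1,3,7,15,0,28,92] [31,220] [83731,76563] [93,94,157,158] [6,9] Done"
  "certificate [0,1,3,7,15,0,28,26] [31] [10003,34579,11027,35603] [93,94,155,158] [10,6,9,5] Done"
  "certificate [0,1,3,7,15,0,28,90] [31] [35603,100115,76563,75539] [93,94,155,158,216,218,220] [5,38,73,26] Done"
  "certificate [0,1,3,7,15,0,28,30] [31,158] [26387,27411] [93,94,220] [2,5] Done"
  "certificate [0,1,3,7,15,0,28,94] [31,158,220] [158483] [93] [1] Done"
  "certificate [0,1,3,7,15,0,28,19] [31] [42771,50963,43795,51987] [93,94,151,155] [10,6,9,5] Done"
  "certificate [0,1,3,7,15,0,28,83] [31] [108307,116499,109331,117523] [93,94,151,155] [10,6,9,5] Done"
  "certificate [0,1,3,7,15,0,28,91] [31,155] [206611,76563] [93,94,217,218] [10,5] Done"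
  "certificate [0,1,3,7,15,0,30,30] [31,94,158] [53011] [] [0] (Dead 0)"
  "certificate [0,1,3,7,15,0,30,93] [31,94,157,220] [347923] [] [0] (Dead 0)"
  "certificate [0,1,3,7,15,16,48,112] [31] [20243,14099,38675,15123,23315,29459,20131,13987,38563,15011,23203,29347,
20069,13925,38501,14949,23141,29285] [115,117,118,121,122,124,179,181,182,185,186,188,211,213,214,217,218,220]
[1,64,131072,4096,2048,32,2,128,65536,8192,1024,16,4,256,32768,16384,512,8] Done"
  "certificate [0,1,3,7,15,16,48,104] [31] [5907] [] [0] (Dead 0)"
  "certificate [0,1,3,7,15,16,48,120] [31] [36627,71443,39699,36515,71331,39587,36453,71269,39525,22291,23315,22179,
23203,22117,23141,21267,21155,21093] [115,117,118,121,122,124,155,157,158,179,181,182,185,186,188,211,213,214,217,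
218,220,240] [1,1048576,16384,2,524288,8192,4,262144,4096,576,32832,1152,65664,2304,131328,2097248,2097296,2097416]
Done"
  "certificate [0,1,3,7,15,16,48,108] [31] [63251] [] [0] (Dead 0)"
  "certificate [0,1,3,7,15,16,48,124] [31] [145171,153363,80659,88851,38563,39587,38501,39525,38313,39337,38257,39281,
77587,85779,208547,37539,208485,37477] [115,117,118,121,122,157,158,181,182,185,186,188,213,214,217,218,220,240]
[65600,65568,2112,2080,160,4128,320,8256,544,16416,1088,32832,65,33,131138,131120,131108,131144] Done"
  "certificate [0,1,3,7,15,16,48,110] [31] [96019,120595] [143,158] [2,1] Done"
  "certificate [0,1,3,7,15,16,48,126] [31,158] [292627,419603,162579,420627,292515,419491,162467,420515,309005,435981,
178957,437005,79461,80485,435625,436649,79217,80241,421651,421539,78437] [115,117,121,182,186,188,214,218,220,240,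
242,244,248] [264,4352,96,4128,136,4224,80,4112,272,2304,160,2080,1032,1088,2112,2056,1040,1152,513,514,516] (Pick
182 [] Done (Pick 183 [(12,20),(12,19),(12,18)] Done Done))"
  "certificate [0,1,3,7,15,16,48,111] [31,143] [235283] [] [0] (Dead 0)"
  "certificate [0,1,3,7,15,16,40,120] [31] [7955] [] [0] (Dead 0)"
  "certificate [0,1,3,7,15,16,40,100] [31] [7955] [] [0] (Dead 0)"
  "certificate [0,1,3,7,15,16,40,116] [31] [7955] [] [0] (Dead 0)"
  "certificate [0,1,3,7,15,16,40,124] [31] [147219,87827] [157,158] [2,1] Done"
  "certificate [0,1,3,7,15,16,40,102] [31] [126739] [] [0] (Dead 0)"
  "certificate [0,1,3,7,15,16,40,118] [31] [96019,178963] [151,158] [2,1] Done"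
  "certificate [0,1,3,7,15,16,40,126] [31,158] [177933] [] [0] (Dead 0)"
  "certificate [0,1,3,7,15,16,40,103] [31] [89875,106259] [143,151] [2,1] Done"
  "certificate [0,1,3,7,15,16,40,119] [31,151] [350995] [] [0] (Dead 0)"
  "certificate [0,1,3,7,15,16,56,56] [31] [10003] [] [0] (Dead 0)"
  by (rule certificateI, simp, simp only: search_run cong: search_cong search_cong' if_weak_cong,
      (simp (no_asm_use) only: search_run; sat))+

lemma certificates_clique_2:
  "certificate [0,1,3,7,15,16,56,120] [31] [143123,214803,143011,214691,143117,214797,142949,214629,47529,119209,47473,
119153,44819,87827,44707,87715,44813,87821,44645,87653,174505,217513,174449,217457,141075,109331,94995,109325,94989,
167337,153001,43795,86803,43683,86691,43789,86797,43621,86629,175529,218537,175473,218481] [91,93,94,115,117,118,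
121,122,124,155,157,158,179,181,182,185,186,188,216,217,218,220,240,248] [2097154,2098176,1048577,1049088,2097156,
2099200,524289,524800,525312,524290,1050624,1048580,4610,1033,9217,530,4612,2057,18433,548,1060,18434,2066,9220,
262144,8454914,8520833,8422148,8521793,8422532,8456258,4195074,4326401,4195457,4260354,4195076,4327425,4196417,
4227588,4228100,4196418,4261890,4195460] (Pick 219 [] Done (Pick 221 [] Done (Pick 222 [] Done (Pick 251 [] Done
(Pick 253 [] Done (Pick 254 [] Done (Pick 217 [(8,42),(9,41),(9,40),(8,39),(7,38),(6,37),(6,36),(7,35),(7,34),(6,
33),(6,32),(7,31),(9,30),(8,29),(6,28),(7,27),(6,26),(7,25)] (Pick 218 [(7,37),(6,36),(6,35),(7,34),(3,33),(2,32),
(2,31),(3,30),(3,29),(2,28),(2,27),(3,26),(6,25),(7,24),(2,23),(3,22),(2,21),(3,20)] (Pick 220 [(1,33),(0,32),(0,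
31),(1,30),(2,29),(3,28),(3,27),(2,26),(0,25),(1,24),(1,23),(0,22),(0,21),(1,20),(3,19),(2,18),(1,17),(0,16)] (Pick
243 [] Done (Pick 245 [] Done (Pick 246 [] Done (Pick 247 [] Done (Pick 248 [] Done (Pick 249 [] Done (Pick 250
[] Done (Pick 252 [] Done (Pick 123 [] (Pick 155 [(11,15),(13,14)] Done Done) (Pick 91 [(20,29),(24,27),(2,11),
(6,9)] (Pick 155 [(13,18),(15,16)] Done (Pick 187 [(1,6),(3,4)] Done (Pick 93 [(10,12)] Done (Pick 125 [(0,2)]
Done Done)))) (Pick 155 [(19,25),(23,24)] (Pick 115 [(2,5),(0,4)] (Pick 121 [(7,13)] Done Done) Done) (Pick 187
[(3,9),(7,8)] Done (Pick 125 [] Done (Pick 93 [(14,18),(0,4)] (Pick 124 [(7,15),(7,9)] (Pick 121 [(7,11)] Done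
Done) Done) (Pick 186 [(12,18),(16,17),(15,14),(11,10)] (Pick 124 [(8,16),(11,13),(8,10)] (Pick 157 [(10,12)] Done
(Pick 122 [(9,13)] Done Done)) Done) (Pick 124 [(9,15)] Done Done)))))))))))))))) Done) (Pick 250 [(7,19),(6,18),
(6,17)] Done Done)) (Pick 249 [(8,23),(9,22),(9,21),(8,20),(7,19),(6,18),(6,17)] (Pick 91 [] Done (Pick 123 [(10,
19),(14,17),(2,7)] Done Done)) Done))))))))"
  "certificate [0,1,3,7,15,16,56,52] [31] [10003] [] [0] (Dead 0)"
  "certificate [0,1,3,7,15,16,56,116] [31] [181923,123555,181861,123493,143123,71443,42771,214803,214691,119459,143117,
214797,214629,119397,141075,198419,201491,172819,201485,172813,70419,41747] [91,93,94,115,121,122,124,151,157,158,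
179,181,182,188,213,214,217,218,220,240,244,248] [2048,32,4096,16,262146,9,1152,262656,131584,16386,262148,262400,
65792,32772,2359296,1310720,3284993,3162304,3219457,3178688,532481,524480] (Pick 123 [] Done (Pick 125 [] Done
(Pick 93 [(9,17),(4,15),(4,14),(4,11)] (Pick 91 [] Done (Pick 121 [(3,19),(3,18),(3,17)] (Pick 122 [(1,18),(1,16),
(1,14)] (Pick 126 [] Done (Pick 94 [(9,15),(6,11),(6,10)] (Pick 157 [(7,12)] (Pick 158 [(5,8)] Done Done) (Pick
158 [(5,10)] Done Done)) Done)) Done) Done)) Done)))"
  "certificate [0,1,3,7,15,16,56,44] [31] [124691] [] [0] (Dead 0)"
  "certificate [0,1,3,7,15,16,56,108] [31] [124691] [] [0] (Dead 0)"
  "certificate [0,1,3,7,15,16,56,60] [31] [157459,173843] [157,158] [2,1] Done"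
  "certificate [0,1,3,7,15,16,56,124] [31] [80297,80241,290579,290573,169747,304915,444179,427795,77475,329379,169741,
304909,427789,77413,329317,176915,176909,168723,76451,168717,76389] [91,93,94,115,121,122,156,157,158,181,182,188,
217,218,220,240,244,248] [4224,8448,16642,16516,137,147584,64,82048,641,17024,265,147712,82176,1281,17664,133281,
133393,34945,32929,35073,33041] (Pick 91 [] Done (Pick 123 [] Done (Pick 157 [] Done (Pick 189 [(7,12),(5,11)]
Done (Pick 188 [(14,18)] Done Done)))))"
  "certificate [0,1,3,7,15,16,56,38] [31] [124691] [] [0] (Dead 0)"
  "certificate [0,1,3,7,15,16,56,102] [31] [124691] [] [0] (Dead 0)"
  "certificate [0,1,3,7,15,16,56,54] [31] [190227,83731,86803,100003,103075,99941,234085,238181,90899,107171] [91,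
93,94,121,122,124,151,158,179,181,182,242,244,248] [128,320,65,576,66,1088,68,72,12384,10320] Done"
  "certificate [0,1,3,7,15,16,56,118] [31] [444179,444067,75533,345701,362085,448881,217701,234085,221797,238181,355091,
94995,353043,369315,336653,187761,90899,107171] [91,93,94,121,122,124,151,158,179,181,182,211,213,214,218,220,240,
242,244,248] [32896,16512,320,1152,1088,576,8324,8260,136,72,266338,133201,790624,657488,794720,663632,65632,65616]
Done"
  "certificate [0,1,3,7,15,16,56,46] [31] [190227,239379] [143,158] [2,1] Done"
  "certificate [0,1,3,7,15,16,56,110] [31] [239379,222989] [143,158] [1,2] Done"
  "certificate [0,1,3,7,15,16,56,62] [31,158] [321299] [] [0] (Dead 0)"
  "certificate [0,1,3,7,15,16,56,126] [31,158] [870157,673381,358825,162161,839443,839331,616205,416113,680549,351657,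
837395] [91,93,121,182,186,188,216,218,220,242,244,248] [1280,264,136,640,2306,2177,2320,2208,2308,2180,64] Done"
  "certificate [0,1,3,7,15,16,56,39] [31] [173843,206611] [143,151] [2,1] Done"
  "certificate [0,1,3,7,15,16,56,103] [31] [173843,206611] [143,151] [2,1] Done"
  "certificate [0,1,3,7,15,16,56,55] [31,151] [165651,168723,198307,201379,198245,201317,172819,205475,205413] [91,
93,94,121,122,124,179,181,182,241,242,244,248] [64,1,128,2,256,4,6176,5136,4616] Done"
  by (rule certificateI, simp, simp only: search_run cong: search_cong search_cong' if_weak_cong,
      (simp (no_asm_use) only: search_run; sat))+

lemma certificates_clique_3:
  "certificate [0,1,3,7,15,16,56,119] [31,151] [173843,689939,206499,722595,157453,673549,206437,722533,358825,874921,
375153,891249,699155,176915,682765,160525,871849,349609,697107,729763,680717,729701,351657,367985,172819,205475,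
205413] [91,93,94,121,122,124,179,181,182,211,213,214,240,241,242,244,248] [16448,1088,32896,640,8256,2112,33024,
768,1280,16640,2176,8320,33826,16913,34852,8713,18452,9226,99360,82448,100384,74248,74760,83984,4128,4112,4104]
(Pick 123 [] Done (Pick 125 [] Done (Pick 126 [] Done (Pick 243 [] Done (Pick 245 [] Done (Pick 246 [] Done (Pick
249 [] Done (Pick 241 [(10,3),(2,1)] (Pick 94 [(13,17)] Done Done) (Pick 251 [(8,8),(7,1)] Done (Pick 121 [(21,
21),(20,20),(16,15),(16,14),(12,8)] (Pick 94 [(11,15)] Done Done) Done))))))))))"
  "certificate [0,1,3,7,15,16,56,111] [31,143] [468755] [] [0] (Dead 0)"
  "certificate [0,1,3,7,15,16,44,44] [31] [130835] [] [0] (Dead 0)"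
  "certificate [0,1,3,7,15,16,44,108] [31] [98067,114451,126739,128787,166675,152339,110243,143011,95907,145059,214691,
231075,110181,142949,95845,144997,214629,231013,130835] [79,93,94,143,157,158,204,205,206,220] [288,144,260,130,
20,34,12,516,33,129,544,136,10,514,17,257,528,264,64] (Pick 79 [] Done (Pick 111 [(9,18)] Done Done))"
  "certificate [0,1,3,7,15,16,44,60] [31] [163603,179987] [157,158] [2,1] Done"
  "certificate [0,1,3,7,15,16,44,124] [31] [163603,179987,161443,161381,338595,338533,411299,475811,411237,427433,
427377] [79,93,94,156,157,158,205,206,220,244,248] [160,80,33,17,276,290,1312,8,1296,800,784] Done"
  "certificate [0,1,3,7,15,16,44,42] [31] [16147] [] [0] (Dead 0)"
  "certificate [0,1,3,7,15,16,44,106] [31] [16147] [] [0] (Dead 0)"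
  "certificate [0,1,3,7,15,16,44,58] [31] [163603,80659] [155,158] [2,1] Done"
  "certificate [0,1,3,7,15,16,44,122] [31] [163603,342803] [155,158] [2,1] Done"
  "certificate [0,1,3,7,15,16,44,46] [31] [196371,245523] [143,158] [2,1] Done"
  "certificate [0,1,3,7,15,16,44,110] [31] [196371,316179,444067,476835,208485,328293] [93,143,158,205,206,220] [20,
5,36,10,3,18] Done"
  "certificate [0,1,3,7,15,16,44,62] [31,158] [327443] [] [0] (Dead 0)"
  "certificate [0,1,3,7,15,16,44,126] [31,158] [327443,682597,837283,869801] [93,206,220,244,248] [2,5,20,12] Done"
  "certificate [0,1,3,7,15,16,44,35] [31] [16147] [] [0] (Dead 0)"
  "certificate [0,1,3,7,15,16,44,99] [31] [16147] [] [0] (Dead 0)"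
  "certificate [0,1,3,7,15,16,44,51] [31] [228115,244499] [151,155] [2,1] Done"
  "certificate [0,1,3,7,15,16,44,115] [31] [359187,375571] [151,155] [2,1] Done"
  "certificate [0,1,3,7,15,16,44,43] [31] [163603,212755] [143,155] [2,1] Done"
  "certificate [0,1,3,7,15,16,44,107] [31] [294675,239267] [143,155] [2,1] Done"
  "certificate [0,1,3,7,15,16,44,59] [31,155] [162579] [] [0] (Dead 0)"
  "certificate [0,1,3,7,15,16,44,123] [31,155] [686867] [] [0] (Dead 0)"
  "certificate [0,1,3,7,15,16,44,47] [31,143] [474899] [] [0] (Dead 0)"
  "certificate [0,1,3,7,15,16,44,111] [31,143] [688803,672357] [205,206] [1,2] Done"
  "certificate [0,1,3,7,15,16,60,60] [31] [315155,349971,347923,317203] [93,94,157,158,220] [10,5,22,25] Done"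
  "certificate [0,1,3,7,15,16,60,124] [31,220] [610067,855827,579347,825107] [93,94,157,158,244,248] [38,22,25,41]
Done"
  "certificate [0,1,3,7,15,16,60,58] [31] [315155,317203,347811,380517] [93,94,155,158] [10,9,6,5] Done"
  "certificate [0,1,3,7,15,16,60,122] [31] [888589,467313,153363,337571,707341,642661,414483,823059,152339,336547]
[93,94,117,124,155,158,179,186,216,217,218,220,240,248] [2081,1042,81,21,8729,8849,8345,290,4121,4241] Done"
  "certificate [0,1,3,7,15,16,60,46] [31] [380691,481043,314981,139877] [93,94,143,158] [10,5,9,6] Done"
  "certificate [0,1,3,7,15,16,60,110] [31] [413285,478995,893603,565861] [93,94,143,158,204,206,220] [5,38,73,26]
Done"
  "certificate [0,1,3,7,15,16,60,62] [31,158] [642835,644883] [93,94,220] [2,5] Done"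
  "certificate [0,1,3,7,15,16,60,126] [31,158,220] [1677075,1740557] [93,244,248] [5,3] Done"
  "certificate [0,1,3,7,15,16,60,51] [31] [315043,347749,316841,349553] [93,94,151,155] [10,9,6,5] Done"
  "certificate [0,1,3,7,15,16,60,115] [31] [691987,724755,694035,726803,445203,477971,447251,480019,577187,151203,
822947,304803,609893,151141,824745,304553] [93,94,117,118,121,122,124,151,155,179,181,182,185,186,213,214,217,218,
241,242,244,248] [770,642,769,641,322,194,321,193,2232578,1082498,655626,327941,2171137,1067137,557218,278673]
Done"
  "certificate [0,1,3,7,15,16,60,43] [31] [315155,478883,172707,205475] [93,94,143,155] [10,6,9,5] Done"
  "certificate [0,1,3,7,15,16,60,107] [31] [446115,478883,696995,729763] [93,94,143,155] [10,6,9,5] Done"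
  "certificate [0,1,3,7,15,16,60,59] [31,155] [708259,740965] [93,94] [2,1] Done"
  "certificate [0,1,3,7,15,16,60,123] [31,155] [1347347,1380109,1362707,1232547,1740451,698019,1395469,1265253] [93,
94,117,118,124,179,185,186,217,218,241,242,248] [546,289,4626,4674,2570,1285,4369,4481] Done"
  "certificate [0,1,3,7,15,16,60,111] [31,143] [937747,939795] [93,94,205,206] [10,5] Done"
  "certificate [0,1,3,7,15,16,46,46] [31] [384787,489235,483091,390931] [79,94,143,158,206] [10,5,22,25] Done"
  "certificate [0,1,3,7,15,16,46,110] [31,206] [483091,390931] [79,94,143,158] [6,9] Done"
  "certificate [0,1,3,7,15,16,46,62] [31,158] [646931,653075] [79,94,206] [2,5] Done"
  "certificate [0,1,3,7,15,16,46,126] [31,158,206] [653075] [79] [1] Done"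
  "certificate [0,1,3,7,15,16,46,45] [31] [489235,450323,483091,456467] [79,94,143,157] [5,10,6,9] Done"
  "certificate [0,1,3,7,15,16,46,109] [31] [695059,483091,456467,489235] [79,94,143,157,204,205,206] [10,70,41,21]
Done"
  "certificate [0,1,3,7,15,16,46,61] [31,157] [718611,642661] [79,94] [1,2] Done"
  "certificate [0,1,3,7,15,16,46,125] [31,157] [718611,1366691] [79,94,205,220] [5,10] Done"
  "certificate [0,1,3,7,15,16,46,47] [31,143] [947987,941843] [79,94,206] [1,6] Done"
  "certificate [0,1,3,7,15,16,46,111] [31,143,206] [941843] [94] [1] Done"
  "certificate [0,1,3,7,15,16,62,62] [31,94,158] [1285907] [] [0] (Dead 0)"
  "certificate [0,1,3,7,15,16,62,61] [31,94,157] [1416979] [220] [1] Done"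
  "certificate [0,1,3,7,15,16,62,125] [31,94,157,220] [2465555,3481363,2726563,2338573] [118,122,181,185,244,248]
[40,17,34,20] Done"
  "certificate [0,1,3,7,15,16,62,111] [31,94,143,206] [1875731] [] [0] (Dead 0)"
  "certificate [0,1,3,7,15,16,47,47] [31,79,143] [1894163] [] [0] (Dead 0)"
  by (rule certificateI, simp, simp only: search_run cong: search_cong search_cong' if_weak_cong,
      (simp (no_asm_use) only: search_run; sat))+

lemma certificates_clique_4:
  "certificate [0,1,3,7,15,24,24,120] [31] [38675,27411,213779,230163,38669,27405,213773,230157,32169,48553,234921,
223657,202515,207635,202509,207629,54697,59817,165651,150291,103187,90899,165645,150285,103181,90893,171433,159145,
112041,96681,206611,203539,206605,203533,58793,55721,198419,199443,201491,205587,198413,199437,201485,205581,56745,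
60841,62889,63913,197395] [59,61,62,91,93,94,155,157,158,184,185,186,188,216,217,218,220,248] [82,137,69760,34880,
100,265,69888,17472,35072,17536,164,274,69650,34825,69668,17417,34852,17426,163906,196737,133200,135304,147524,
196865,132192,135432,132256,133392,147588,164098,167946,198673,151564,197665,149524,164898,12290,10241,66064,33288,
12292,9217,66080,16904,33312,16912,10244,9218,8704] (Pick 187 [] Done (Pick 155 [(3,48),(7,47),(3,46),(7,45),(3,
44),(7,43),(7,41),(22,40),(3,39),(3,37),(18,36),(18,35),(20,34),(22,32),(18,30),(18,29),(22,28),(0,17),(3,16),(7,
15),(3,13),(7,9),(3,8)] (Pick 157 [(1,40),(5,39),(5,37),(5,35),(1,34),(5,33),(1,32),(1,30),(1,28),(14,25),(15,24),
(5,13),(0,11),(1,10),(1,8),(1,3)] (Pick 158 [(1,32),(2,30),(2,28),(1,26),(1,24),(2,23),(1,22),(2,21),(1,20),(10,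
15),(11,14),(2,8),(1,6),(0,5),(1,4)] (Pick 185 [(22,12)] Done (Pick 186 [(20,15)] Done (Pick 59 [(3,17),(1,14),
(3,8),(1,6)] (Pick 61 [(3,13),(0,8)] Done (Pick 62 [(2,11)] Done Done)) (Pick 123 [(10,18),(12,17),(10,16),(7,13)]
Done Done)))) (Pick 59 [(4,15),(0,7)] Done Done)) (Pick 158 [(3,24),(3,23),(3,22),(3,21),(11,18),(12,17),(3,8),
(2,7)] (Pick 59 [(4,15),(0,7)] Done Done) Done)) (Pick 219 [(18,25),(14,24),(18,23),(14,22),(14,21),(18,20)] Done
(Pick 59 [(5,19),(1,15)] Done Done))))"
  "certificate [0,1,3,7,15,24,24,116] [31] [246435] [] [0] (Dead 0)"
  "certificate [0,1,3,7,15,24,24,124] [31] [43795,426771,43789,426765,48553,81321,297747,172819,297741,172813,335273,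
306601,210345,178601] [59,61,62,91,93,94,157,158,185,186,188,217,218,220,248] [73,9280,137,9344,4736,2368,24641,
17480,24705,17544,24928,25232,19524,21634] Done"
  "certificate [0,1,3,7,15,24,24,102] [31] [246547] [] [0] (Dead 0)"
  "certificate [0,1,3,7,15,24,24,118] [31] [82707,475749] [151,158] [1,2] Done"
  "certificate [0,1,3,7,15,24,24,126] [31,158] [869133,97705,609037,353037,617897,358825] [59,61,91,93,186,188,218,
220,248] [160,80,401,356,408,354] Done"
  "certificate [0,1,3,7,15,24,24,103] [31] [33555,66323] [143,151] [2,1] Done"
  "certificate [0,1,3,7,15,24,24,119] [31,151] [164627] [] [0] (Dead 0)"
  "certificate [0,1,3,7,15,24,56,120] [31,248] [403219,345875,400147,314131,217875,189203,403213,345869,400141,314125,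
217869,189197,335273,306601,210345,124329,178601,121257] [59,61,62,91,93,94,121,122,124,155,157,158,185,186,188,
217,218,220] [81930,66306,139281,132225,8976,17544,49164,33540,135201,133185,4896,18504,5280,10320,33924,40980,
67650,69666] Done"
  "certificate [0,1,3,7,15,24,56,84] [31] [10003,25363,247459,248483,9997,25357,247397,248421,11689,13737,26025,14761,
11633,25969,152339,152333,72467,108195,72461,108133,123555,90787,246435,123493,90725,170771,170765,42659,42597,
138003,86803,137997,86797] [59,61,62,91,93,94,120,121,122,124,151,157,158,213,214,220,244,248] [10,264,257,514,
12,136,129,516,144,260,20,130,288,34,33296,33312,1041,8209,1057,16417,74256,10768,64,82464,21024,167953,165921,
53265,43041,229393,198160,229409,198176] (Pick 93 [(14,15)] (Pick 122 [(2,20),(2,18)] (Pick 62 [(5,12)] Done Done)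
(Pick 250 [(2,18),(2,14),(2,13)] Done Done)) (Pick 221 [(29,31),(8,21),(8,11),(9,7),(6,6),(5,5)] (Pick 62 [(7,16)]
Done Done) (Pick 125 [(23,25),(12,22)] Done (Pick 253 [(11,13),(6,6),(5,4)] Done (Pick 220 [(8,15),(8,14)] Done
(Pick 61 [(7,15)] Done Done))))))"
  by (rule certificateI, simp, simp only: search_run cong: search_cong search_cong' if_weak_cong,
      (simp (no_asm_use) only: search_run; sat))+

lemma certificates_clique_5:
  "certificate [0,1,3,7,15,24,56,116] [31] [247459,381603,247397,381541,142761,276905,142705,276849,239267,367267,
239205,367205,157097,285097,157041,285041,117411,84643,123555,90787,246435,117349,84581,123493,90725,435987,432915,
435981,432909,91561,88489,91505,88433,403219,345875,400147,217875,403213,345869,400141,217869,314019,189091,313957,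
189029,141075,83731,269075,86803,141069,83725,269069,86797,222633,350633,222577,350577] [59,61,62,91,93,94,120,
121,122,124,151,157,158,181,182,185,186,188,213,214,217,218,220,240,244,248] [257,264,129,136,144,130,288,260,262161,
8202,524321,16396,16404,524322,8226,262164,16785922,10754,17039888,264720,64,16794116,20996,17302048,528928,35786762,
37818385,34736140,37783585,34801684,39880738,35819554,38866964,52559882,50595330,54591505,50341392,51511308,50857476,
54558753,50349600,35803650,38343184,34744836,38046240,8519690,8390146,12582929,8390160,8519692,8390148,12582945,
8390176,9570324,12617762,10620962,12652564] (Pick 125 [] Done (Pick 61 [(45,49),(17,43),(16,36)] (Pick 93 [(33,
37),(13,32)] (Pick 122 [(0,23),(1,21),(0,17),(1,15),(0,14),(1,13)] (Pick 62 [(4,13)] Done (Pick 157 [(9,12),(8,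
10)] (Pick 94 [(6,9)] Done Done) (Pick 182 [(4,14),(4,10)] Done Done))) (Pick 123 [(4,18),(5,17),(4,16)] Done Done))
(Pick 221 [(33,36),(33,35),(10,16),(10,15),(4,14),(3,3),(2,2)] (Pick 182 [(9,16),(9,13)] Done Done) (Pick 253 [(7,
7)] Done (Pick 62 [(7,23)] (Pick 213 [(6,18),(6,15),(6,13)] (Pick 94 [(6,13)] Done Done) Done) (Pick 190 [(8,10),
(8,9),(3,3),(2,1),(1,0)] Done (Pick 186 [(13,20),(13,17)] (Pick 157 [(9,13),(8,11)] Done (Pick 94 [(6,11)] Done
Done)) (Pick 187 [(11,21),(11,18),(10,9)] Done (Pick 158 [(8,12),(8,9),(6,6)] Done Done)))))))) (Pick 189 [(44,
49),(44,47),(44,46),(13,24),(13,23),(5,20),(4,4),(3,3),(2,2)] (Pick 93 [(24,27)] (Pick 182 [(9,15),(9,13)] Done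
Done) (Pick 221 [(25,27),(25,26),(10,15),(10,14),(4,13),(3,3),(2,2)] (Pick 62 [(9,14)] Done Done) (Pick 94 [(12,
18),(11,16)] (Pick 158 [(9,11)] Done Done) (Pick 222 [(3,4),(2,1),(1,0)] Done Done)))) (Pick 253 [(9,7)] Done (Pick
93 [(38,39),(15,35),(14,27)] (Pick 94 [(7,21)] (Pick 181 [(6,18),(6,15),(6,13)] (Pick 62 [(6,13)] Done Done) Done)
(Pick 222 [(8,10),(8,9),(3,4),(2,1),(1,0)] Done (Pick 218 [(13,20),(13,15)] (Pick 157 [(9,12),(8,11)] Done (Pick
62 [(6,11)] Done Done)) (Pick 219 [(11,21),(11,18),(10,10)] Done (Pick 158 [(8,12),(8,9),(6,6)] Done Done)))))
(Pick 221 [(8,17),(8,16),(7,7)] (Pick 62 [(11,17),(10,16)] Done (Pick 181 [(9,17),(9,15)] Done Done)) (Pick 126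
[] Done (Pick 122 [(0,33),(1,31),(0,27),(1,25),(0,24),(1,23),(0,18),(1,17),(0,16),(1,15)] (Pick 157 [(14,23),(13,
21),(9,9),(7,7)] (Pick 158 [(10,14),(9,13)] (Pick 181 [(7,16),(5,14),(7,12)] (Pick 62 [(2,11)] Done Done) Done)
(Pick 62 [(3,17),(3,16)] (Pick 181 [(5,15),(4,11)] (Pick 94 [(2,10)] Done Done) (Pick 94 [(3,12)] Done Done)) (Pick
190 [(6,8)] Done (Pick 94 [(4,15),(4,13)] (Pick 181 [(5,13)] Done Done) (Pick 186 [(9,16),(9,13)] (Pick 181 [(7,
13)] Done Done) (Pick 181 [(7,14)] Done Done)))))) (Pick 190 [] Done (Pick 62 [(3,21),(3,20),(6,8)] (Pick 158 [(8,
13),(7,12)] (Pick 181 [(5,13)] Done Done) (Pick 94 [(3,14)] Done (Pick 185 [(9,16),(8,8)] Done (Pick 181 [(5,14)]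
Done Done)))) (Pick 254 [(5,1)] Done (Pick 220 [(12,13)] (Pick 94 [(3,12)] Done Done) (Pick 217 [(21,23),(9,18),
(9,14),(8,7)] (Pick 94 [(3,14),(3,13)] Done (Pick 158 [(8,12),(7,11)] Done (Pick 181 [(6,12)] Done Done))) (Pick
219 [(12,20),(12,15),(11,7)] Done (Pick 94 [(3,13)] Done Done)))))))) (Pick 123 [(4,27),(3,26),(3,25),(4,24),(3,
20),(4,19),(4,18),(3,17),(3,16),(4,15)] (Pick 62 [(0,14),(0,13)] Done (Pick 94 [(1,13),(1,12)] Done Done)) Done)))))))))"
  "certificate [0,1,3,7,15,24,56,28] [31] [75539,83731,72467,86803,75533,83725,72461,86797,73129,142761,79273,145833,
51987,58131,51981,58125,50963,54035,50957,54029,91561,157097,88489,154025,42771,39699,42765,39693,84755,90899,84749,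
90893,138665,77225,144809,80297,49939,82707] [59,61,62,91,93,94,120,121,122,124,157,158,188,220,248] [1034,1538,
1041,1552,2060,2564,2081,2592,2336,1168,2308,1154,2305,2312,1153,1160,6658,10768,5636,9760,10260,5140,6178,9250,
6154,10257,5132,9249,17665,17672,18561,18568,25888,26768,21764,22658,2112,1088] (Pick 123 [] Done (Pick 125 []
Done (Pick 61 [(1,37),(23,32),(0,29),(23,27),(0,26),(1,19),(1,18),(0,15),(11,14),(10,9),(1,3)] (Pick 93 [(1,29),
(17,27),(0,21),(0,20),(17,19),(1,15),(1,14),(7,12),(0,11)] (Pick 62 [(1,20),(0,7),(5,6),(4,4),(1,3)] (Pick 94 [(1,
14)] Done Done) (Pick 121 [(5,11)] Done Done)) (Pick 62 [(3,20),(3,11),(2,10),(8,9)] Done Done)) (Pick 62 [(4,26),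
(4,13),(4,12),(3,11),(8,10),(7,7),(4,6)] (Pick 94 [(4,20),(4,10),(4,9),(5,8)] Done Done) (Pick 93 [(9,18),(2,14)]
Done Done)))))"
  "certificate [0,1,3,7,15,24,56,92] [31] [75539,75533,345875,316179,320275,345869,316173,320269,79273,353705,145833,
416169,90899,90893,400809,339369,301843,346899,301837,346893,304915,304909,144809,80297,344851,344845,81321,146857,
204201,208297,314131,314125,313107,313101] [59,61,62,91,93,94,120,121,122,124,156,157,158,188,216,217,218,220,248]
[2058,4108,133634,135696,69896,135684,133664,34952,69892,135188,34946,133154,264456,266376,395552,397456,397329,
395521,395297,397441,339978,305164,305412,340098,133184,135232,69696,34880,66848,33936,20737,18561,29186,27140]
(Pick 91 [(7,31),(4,30),(7,29),(4,28),(7,27),(4,26),(13,23),(12,22),(0,10),(1,8)] (Pick 124 [(0,7),(1,5)] Done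
(Pick 125 [(3,18),(3,10),(3,6)] Done (Pick 61 [(0,20),(5,18),(5,16),(5,15)] (Pick 62 [(1,14)] Done Done) Done)))
(Pick 219 [(11,21),(10,20),(11,17),(10,15),(11,13),(10,12)] Done Done))"
  by (rule certificateI, simp, simp only: search_run cong: search_cong search_cong' if_weak_cong,
      (simp (no_asm_use) only: search_run; sat))+

lemma certificates_clique_6:
  "certificate [0,1,3,7,15,24,56,124] [31,248] [609043,353043,609037,353037,829203,826131,829197,826125,662953,601513,
406953,342441,222633,219561] [59,61,62,91,93,94,121,122,156,157,158,185,186,188,217,218,220] [66177,8840,66625,
9288,41994,70673,25100,68129,68256,70736,25220,42050,20756,35106] Done"
  "certificate [0,1,3,7,15,24,56,70] [31] [239379,247571,236307,248595,250643,254739,9997,18189,6925,19213,21261,25357,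
236969,241065,243113,255401,244137,252329,246547] [59,61,62,91,93,94,120,121,122,124] [10,514,17,257,528,264,12,
516,33,129,544,136,288,144,260,20,130,34,64] (Pick 59 [] Done (Pick 187 [(3,18)] Done Done))"
  "certificate [0,1,3,7,15,24,56,102] [31] [501523,247571,498451,248595,381715,385811,18189,19213,21261,25357,499113,
503209,505257,506281,272141,137997,140901,268901,255401,383401,386417,252273,246547,468749,206605,465677,334605,
468581,337509,465509,203365,353705,91561,219561,88489,222577,91505,350577,88433] [59,61,62,91,93,94,120,121,122,
124,143,151,231,235,237,238,243,245,246] [10,514,17,257,528,264,516,129,544,136,288,144,260,130,32780,32801,262177,
262156,262164,262178,32802,32788,64,5132,66572,5153,66593,6177,10273,6156,10252,18452,6164,18466,6178,132130,5154,
132116,5140] (Pick 123 [] Done (Pick 125 [] Done (Pick 126 [] Done (Pick 251 [] Done (Pick 253 [] Done (Pick 254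
[] Done (Pick 238 [(21,38),(21,37),(20,36),(20,35),(20,34),(20,33),(21,32),(21,31),(14,30),(14,29),(15,28),(15,
27),(15,26),(15,25),(14,24),(14,23)] (Pick 246 [(16,34),(16,33),(17,32),(17,31),(17,30),(17,29),(16,28),(16,27),
(15,26),(15,25),(14,24),(14,23),(14,22),(14,21),(15,20),(15,19)] (Pick 231 [(29,29),(27,27),(25,25),(23,23),(21,
22),(19,20),(17,18),(15,16)] (Pick 239 [] (Pick 59 [] Done (Pick 187 [(3,14)] Done Done)) (Pick 247 [] (Pick 59
[] Done (Pick 187 [(3,14)] Done Done)) (Pick 62 [] (Pick 59 [] Done (Pick 187 [(3,12),(6,11),(2,10)] Done Done))
(Pick 190 [(6,14),(11,10),(6,8),(9,5),(4,4),(7,3),(2,1)] (Pick 59 [] Done (Pick 187 [(3,12),(6,11),(2,10)] Done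
Done)) (Pick 59 [] Done (Pick 187 [(1,15)] Done Done)))))) (Pick 239 [] Done (Pick 247 [] Done (Pick 62 [] (Pick
59 [] Done (Pick 187 [(13,16),(14,15)] Done Done)) (Pick 190 [(6,14),(11,10),(6,8),(9,5),(4,4),(7,3),(2,1)] (Pick
59 [] Done (Pick 187 [(13,16),(14,15)] Done Done)) Done))))) (Pick 59 [] Done (Pick 187 [(3,18),(14,17)] Done Done)))
(Pick 239 [(19,19),(19,18),(14,17),(15,16)] (Pick 59 [] Done (Pick 187 [(3,18),(14,17)] Done Done)) (Pick 59 []
Done (Pick 187 [(3,18)] Done Done))))))))))"
  "certificate [0,1,3,7,15,24,56,22] [31] [50957,54029,173669,170597,40361,46505,58793,55721,173843,116499,170771,
117523,183059,119571,123667,189203,215715,221859,141069,137997,150285,156429,181861,215653,184933,221797,73129,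
44457,77225,79273,91561,47529,80297,88489,108307,105235,115475,213605] [59,61,62,91,93,94,120,121,122,124,151,158,
186,188,218,220] [2564,2592,2081,2060,2336,2308,2068,2082,1034,10754,1041,6401,1281,35344,18696,1288,1538,1552,
1036,1057,1153,1160,2177,1540,2184,1568,1312,2192,1168,1284,1044,2178,1154,1058,26634,38929,2112,1088] (Pick 62
[(0,36),(3,14),(0,13),(5,11),(0,9),(4,4),(0,1)] (Pick 94 [(0,28),(2,10),(0,9),(1,7),(0,5)] (Pick 121 [] Done (Pick
249 [(12,19),(13,18),(9,2),(9,0)] Done (Pick 59 [] Done (Pick 187 [(2,17),(10,16)] Done Done)))) (Pick 222 [(15,
24),(14,9),(13,8),(13,7),(6,6)] Done (Pick 126 [(1,19),(3,18),(3,15)] Done Done))) (Pick 190 [(17,30),(22,20),(17,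
19),(16,11),(15,10),(9,9),(17,8)] Done (Pick 126 [(4,23),(2,22),(4,15),(2,14)] Done (Pick 94 [(5,17),(1,12)] Done
Done))))"
  "certificate [0,1,3,7,15,24,56,86] [31] [432741,445029,308649,320937,170771,183059,381715,385811,203427,215715,137997,
150285,316173,444005,465509,477797,447077,479845,44457,77225,341417,353705,309673,342441,175473,386417,378643,378531,
173669,317865,447251,189203,414477,335273,442981,370451,367379,379667,379555,189029,156261,475749,368041,302505,
185107,217763,152333,372081,108307,108195,301837,189809] [59,61,62,91,93,94,120,121,122,124,150,151,158,186,188,
211,213,214,218,220,242,244,248] [4108,4612,4356,4116,2065,2305,528912,266504,2058,2562,2081,2177,528928,4225,2060,
2564,4232,2184,4240,2192,2308,2068,4226,2178,266528,2082,545282,274689,135201,135202,2165264,1083656,2230816,1181984,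
4160,4476938,4730897,4731137,4477442,1184288,1568,2112,1312,2232608,6294032,5245192,6294048,5245216,413706,667665,
6828065,5525538] (Pick 126 [] Done (Pick 222 [] Done (Pick 158 [(3,21),(2,20),(1,15),(0,14)] (Pick 94 [(21,20),
(19,19),(12,3),(2,1)] (Pick 59 [] Done (Pick 187 [(1,16)] Done Done)) (Pick 254 [(10,10),(2,3)] Done Done)) (Pick
123 [] Done (Pick 125 [] Done (Pick 251 [] Done (Pick 253 [] Done (Pick 254 [] Done (Pick 190 [(30,37),(18,19),
(16,17),(14,15),(12,11)] (Pick 94 [(17,16),(15,15)] Done Done) (Pick 94 [(20,40),(21,39),(37,36),(35,35),(16,19),
(11,18),(16,9),(15,8),(13,7),(7,6),(5,5),(4,4)] (Pick 62 [(3,26),(0,25),(0,24),(1,23),(1,22),(2,21),(3,20),(0,19),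
(1,18),(0,17)] (Pick 121 [(7,20),(8,19),(9,18),(6,17),(6,16),(7,15)] (Pick 122 [(3,16),(11,11),(3,10)] Done Done)
(Pick 91 [(3,11)] Done Done)) Done) (Pick 62 [(2,28),(1,27),(2,26),(2,25),(1,24),(1,23),(1,22),(2,21),(3,20),(0,
19),(1,18),(2,17),(1,16)] (Pick 122 [(6,26),(17,25),(6,18),(16,16),(6,15)] (Pick 121 [(5,18),(2,17),(5,13)] Done
Done) (Pick 214 [(13,21),(12,20),(12,11),(10,10)] Done (Pick 121 [(2,13)] Done Done))) Done)))))))))))"
  by (rule certificateI, simp, simp only: search_run cong: search_cong search_cong' if_weak_cong,
      (simp (no_asm_use) only: search_run; sat))+

lemma certificates_clique_7:
  "certificate [0,1,3,7,15,24,56,118] [31] [444005,476773,709221,741989,306601,339369,571817,604585,435813,468581,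
694885,727653,320937,353705,580009,612777,435987,444179,695059,183059,709395,189203,411405,676621,859561,865705,
442981,894739,891667,182885,150117,189029,156261,475749,892329,826793,898473,832937,706323,447251,738979,479907,
673549,414477,634225,375153,641811,385811,641699,385699,182035,185107,214691,217763,149261,152333,896369,899441,
829197,826125,189809,186737,304909,563981,451953,711025] [59,61,62,91,93,94,120,121,122,124,150,151,158,179,181,
182,185,186,188,211,213,214,217,218,220,240,242,244,248] [4225,2177,4232,2184,4240,2192,4226,2178,2101281,2099233,
36876,34828,36884,34836,2101282,2099234,542730,134236674,1058833,67119361,135268880,67635464,134253060,136317472,
69208352,67143940,4160,277090314,285347857,67146244,1540,69210656,1568,2112,1312,136319264,1284,134254852,403704322,
402672144,336070913,335554824,404752900,402688544,335579424,337643780,285380865,279187720,277123586,287445520,33556994,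
33557008,33556737,33556744,33556996,33557024,33556768,33556740,415502348,419631137,344264738,356651028,42209292,
50466849,42209314,50466836] (Pick 126 [] Done (Pick 246 [] Done (Pick 247 [] Done (Pick 251 [] Done (Pick 253 []
Done (Pick 254 [] Done (Pick 183 [] (Pick 121 [(0,8),(1,7)] Done (Pick 123 [(2,18),(3,17)] Done Done)) (Pick 215
[] (Pick 182 [(5,20),(4,17),(5,16),(4,13)] Done Done) (Pick 151 [(32,26),(14,14),(12,12),(10,10),(8,8),(6,6),(4,
4),(2,2),(0,0)] (Pick 123 [] Done (Pick 121 [(2,26),(3,25),(2,22),(3,21),(2,18),(3,17),(0,10),(1,9)] (Pick 182
[(2,21),(1,18),(2,17),(1,14)] (Pick 59 [(3,15)] Done Done) (Pick 62 [(2,13),(1,11)] Done Done)) (Pick 125 [(0,18),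
(1,17)] Done Done))) (Pick 250 [] Done (Pick 252 [] Done (Pick 249 [] (Pick 62 [(19,18),(15,17)] Done (Pick 182
[(18,17),(14,16)] Done (Pick 190 [(12,12)] Done Done))) (Pick 123 [] (Pick 182 [(0,23),(0,21),(4,18),(4,12)] (Pick
61 [(1,6)] Done Done) (Pick 62 [(0,14),(4,12),(7,9)] Done Done)) (Pick 122 [(48,56),(47,55),(43,54),(44,53),(46,
46),(46,45),(24,23),(16,22),(24,21),(17,20)] (Pick 121 [(2,37),(3,36),(2,33),(3,32),(2,27),(3,26),(2,25),(3,24),
(2,21),(3,20),(0,15),(1,14),(2,11),(0,10),(3,9),(1,8),(3,7),(2,6)] (Pick 124 [(23,33),(22,32)] (Pick 59 [(7,15)]
Done Done) (Pick 125 [(25,31),(24,30)] Done (Pick 244 [(6,6),(4,4)] (Pick 59 [(7,15)] Done Done) (Pick 245 [(7,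
13),(7,12),(6,11),(6,10),(6,3),(4,2),(3,1),(3,0)] Done (Pick 62 [(8,11),(2,10),(2,9)] Done (Pick 59 [(5,16)] Done
Done)))))) (Pick 125 [(0,19),(1,18),(0,17)] Done Done)) (Pick 125 [] (Pick 182 [(14,21),(1,20),(5,19),(5,13)] Done
(Pick 59 [(2,11)] Done Done)) (Pick 121 [(2,46),(3,45),(0,44),(1,43),(1,40),(0,39),(2,38),(3,37),(2,36),(3,35),
(1,34),(0,33),(1,28),(0,27),(2,26),(3,25),(0,19),(1,18),(1,13),(2,12),(0,11),(0,10),(3,9),(1,8),(3,7),(2,6),(1,
5),(0,4)] (Pick 248 [] (Pick 124 [(10,17),(11,15)] Done Done) (Pick 190 [] (Pick 242 [(4,4),(5,2)] Done (Pick 59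
[(3,11)] Done Done)) (Pick 182 [(2,41),(26,40),(28,39),(1,38),(13,37),(26,36),(13,27),(10,24),(25,15),(23,12),(21,
11)] (Pick 242 [(4,4),(5,2)] (Pick 61 [(7,15),(7,13)] Done Done) (Pick 243 [(15,15),(7,10),(6,6),(5,1),(4,0)] Done
(Pick 62 [(18,18),(17,17),(16,16),(15,15),(14,14),(11,13),(11,12),(10,4)] (Pick 59 [(6,12),(1,10)] (Pick 61 [(4,
8)] Done Done) (Pick 187 [(13,15),(13,14),(12,12)] Done Done)) Done))) (Pick 62 [(1,30),(11,29),(2,28),(10,27),
(2,26),(1,24),(11,22),(10,21),(1,20),(11,19),(2,18),(10,17),(15,14),(13,13)] (Pick 124 [(14,10),(17,8)] (Pick 59
[(4,10)] Done Done) (Pick 242 [(4,4),(5,2)] Done (Pick 243 [(11,11),(10,6),(9,1),(8,0)] Done (Pick 59 [(9,12)]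
Done Done)))) Done)))) (Pick 62 [(7,15)] Done Done)))))))))))))))))"
  "certificate [0,1,3,7,15,24,56,30] [31,158] [182029,185101,171433,177577,116499,117523,119571,123667,173837,170765,
189865,186793,108307,105235,183053,189197,175529,178601,115475] [59,61,62,91,93,94,120,121,122,124,186,188,218,
220,248] [516,544,288,260,2562,1281,8720,4360,4108,1057,8212,2082,6154,9233,17537,20616,24720,18562,64] (Pick 62
[(0,18)] Done Done)"
  "certificate [0,1,3,7,15,24,56,94] [31,158] [643859,647955,173837,706317,177577,714153,189197,699817,632595,629523,
707341,178601,705293,179625,640787,641811] [59,61,62,91,93,120,121,122,124,186,188,216,218,220,248] [8464,4232,
4108,8452,4228,8212,20552,24656,21514,25105,25153,21570,8224,4128,3330,2689] Done"
  "certificate [0,1,3,7,15,24,56,126] [31,158,248] [1681171,1678099,1231629,713485,1224105,702889] [59,61,91,93,121,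
186,188,218,220] [198,297,305,212,312,210] Done"
  by (rule certificateI, simp, simp only: search_run cong: search_cong search_cong' if_weak_cong,
      (simp (no_asm_use) only: search_run; sat))+

lemma certificates_clique_8:
  "certificate [0,1,3,7,15,24,56,7] [31] [75539,141075,149267,72467,138003,84755,152339,90899,83619,150179,86691,156323,
42765,141069,149261,39693,137997,51981,152333,58125,50789,150117,53861,156261,171433,208297,177577,189865,222633,
211369,186793,219561,204145,175473,210289,178545,82707,148243,49933,148237,179625,212393,213779] [59,61,62,91,93,
94,120,121,122,124,135,143,151,235,237,238,243,245,246] [4106,2058,2562,4113,2065,4353,2576,4360,2305,4610,2312,
4624,4108,2060,2564,4129,2081,4225,2592,4232,2177,4612,2184,4640,4384,2192,4356,4116,2068,2178,4130,2082,4240,2336,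
4226,2308,266304,34880,135232,18496,69696,10304,1088] (Pick 123 [] Done (Pick 125 [] Done (Pick 126 [] Done (Pick
251 [] Done (Pick 253 [] Done (Pick 254 [] Done (Pick 143 [] (Pick 121 [] Done (Pick 249 [(16,15),(14,14),(7,7),
(7,6)] Done Done)) (Pick 151 [] (Pick 121 [] Done (Pick 249 [(14,15),(12,13),(9,8),(9,6)] Done Done)) (Pick 175
[] (Pick 121 [] Done (Pick 249 [(16,15),(14,14),(7,7),(7,6)] Done Done)) (Pick 183 [] (Pick 121 [] Done (Pick 249
[(14,15),(12,13),(9,8),(9,6)] Done Done)) (Pick 207 [] (Pick 121 [] Done (Pick 249 [(16,15),(14,14),(7,7),(7,6)]
Done Done)) (Pick 239 [(29,34),(25,32),(30,30),(27,27),(30,26),(28,24),(18,23),(14,21),(20,19),(18,17),(15,15),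
(12,12),(6,11),(2,9),(8,7),(6,5),(3,3),(0,0)] (Pick 121 [] Done (Pick 249 [(16,15),(14,14),(7,7),(7,6)] Done Done))
(Pick 121 [] Done (Pick 249 [(14,15),(12,13),(9,8),(9,6),(8,5),(6,4),(7,3)] Done Done))))))))))))))"
  "certificate [0,1,3,7,15,24,56,71] [31] [75539,141075,149267,72467,138003,84755,414483,353043,83619,150179,348835,
418467,42765,141069,149261,39693,137997,51981,414477,320269,50789,150117,316005,418405,171433,208297,439721,452009,
484777,473513,448937,481705,204145,175473,472433,440689,82707,148243,49933,148237,441769,474537,475923] [59,61,
62,91,93,94,120,121,122,124,135,143,151,235,237,238,243,245,246] [4106,2058,2562,4113,2065,4353,2576,4360,2305,
4610,2312,4624,4108,2060,2564,4129,2081,4225,2592,4232,2177,4612,2184,4640,4384,2192,4356,4116,2068,2178,4130,2082,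
4240,2336,4226,2308,266304,34880,135232,18496,69696,10304,1088] (Pick 123 [] Done (Pick 125 [] Done (Pick 126 []
Done (Pick 251 [] Done (Pick 253 [] Done (Pick 254 [] Done (Pick 143 [] (Pick 121 [] Done (Pick 249 [(16,15),(14,
14),(7,7),(7,6)] Done Done)) (Pick 151 [] (Pick 121 [] Done (Pick 249 [(14,15),(12,13),(9,8),(9,6)] Done Done))
(Pick 175 [] (Pick 121 [] Done (Pick 249 [(16,15),(14,14),(7,7),(7,6)] Done Done)) (Pick 183 [] (Pick 121 [] Done
(Pick 249 [(14,15),(12,13),(9,8),(9,6)] Done Done)) (Pick 207 [] (Pick 121 [] Done (Pick 249 [(16,15),(14,14),(7,
7),(7,6)] Done Done)) (Pick 239 [(29,34),(25,32),(30,30),(27,27),(30,26),(28,24),(18,23),(14,21),(20,19),(18,17),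
(15,15),(12,12),(6,11),(2,9),(8,7),(6,5),(3,3),(0,0)] (Pick 121 [] Done (Pick 249 [(16,15),(14,14),(7,7),(7,6)]
Done Done)) (Pick 121 [] Done (Pick 249 [(14,15),(12,13),(9,8),(9,6),(8,5),(6,4),(7,3)] Done Done))))))))))))))"
  by (rule certificateI, simp, simp only: search_run cong: search_cong search_cong' if_weak_cong,
      (simp (no_asm_use) only: search_run; sat))+

lemma certificates_clique_9:
  "certificate [0,1,3,7,15,24,56,103] [31] [411411,346899,676627,615187,345763,412323,610979,680611,411405,314125,
676621,582413,312933,412261,578149,680549,433577,470441,701865,735657,466289,437617,734577,702833,337683,599827,
403219,665363,334611,596755,400147,662291,337571,665251,596643,400035,304909,567053,403213,665357,301837,563981,
400141,662285,304741,665189,563813,399973,452009,714153,484777,746921,448937,711081,481705,743849,451953,746865,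
711025,481649,82707,148243,49933,148237,966057,998825,993043,989971,960269,957197,157097,154025,475923] [59,61,
62,91,93,94,120,121,122,124,135,143,151,235,237,238,243,245,246] [2562,4353,2576,4360,2305,4610,2312,4624,2564,
4225,2592,4232,2177,4612,2184,4640,4384,2192,4356,2178,4240,2336,4226,2308,200714,20490,67594,26634,20497,200721,
26641,67601,133137,12305,133130,12298,331788,36876,67596,43020,36897,331809,43041,67617,264225,12321,264204,12300,
397332,20500,264212,51220,20514,397346,51234,264226,133154,36898,133140,36884,266304,34880,135232,18496,69696,10304,
1034,1041,1036,1057,1044,1058,1088] (Pick 239 [] (Pick 243 [(19,19),(18,18)] Done (Pick 59 [] Done (Pick 187 [(0,
18),(4,11)] Done Done))) (Pick 247 [] (Pick 235 [(19,19),(18,18)] Done (Pick 59 [] Done (Pick 187 [(2,18),(2,11)]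
Done Done))) (Pick 123 [] (Pick 237 [(12,21),(9,20),(9,19),(12,17),(12,13)] (Pick 245 [(12,17),(14,16)] Done Done)
Done) (Pick 125 [] (Pick 235 [(17,21),(19,20),(16,13),(15,12),(16,9)] (Pick 243 [(13,17),(10,16)] Done Done) Done)
(Pick 126 [] (Pick 235 [(17,21),(19,20),(16,13),(15,12),(16,9)] (Pick 243 [(13,17),(10,16)] Done Done) Done) (Pick
251 [] (Pick 237 [(12,21),(9,20),(9,19),(12,17),(12,13)] (Pick 245 [(12,17),(14,16)] Done Done) Done) (Pick 253
[] (Pick 235 [(17,21),(19,20),(16,13),(15,12),(16,9)] (Pick 243 [(13,17),(10,16)] Done Done) Done) (Pick 254 []
(Pick 235 [(17,21),(19,20),(16,13),(15,12),(16,9)] (Pick 243 [(13,17),(10,16)] Done Done) Done) (Pick 143 [] (Pick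
151 [] Done (Pick 183 [] Done (Pick 215 [] Done (Pick 235 [(21,21),(20,20),(20,19),(19,18),(15,15),(14,14),(14,
13),(13,12)] (Pick 237 [(21,25),(22,24),(22,23),(20,20),(14,15),(12,12)] (Pick 238 [(19,19),(19,18),(16,17),(14,
14)] (Pick 243 [(19,19),(18,18)] (Pick 245 [(14,14)] (Pick 59 [] Done (Pick 187 [(0,12)] Done Done)) (Pick 61 []
Done (Pick 189 [(2,14),(10,10)] Done Done))) (Pick 121 [] (Pick 59 [] Done (Pick 187 [(11,13)] Done Done)) (Pick
249 [(11,17),(10,16),(4,15),(5,14),(4,13)] (Pick 59 [] Done (Pick 187 [(11,13)] Done Done)) Done))) (Pick 121 []
Done (Pick 249 [(10,17),(11,16),(4,15),(5,14),(4,13),(5,12)] Done Done))) (Pick 121 [] (Pick 238 [(12,13)] Done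
Done) (Pick 249 [(11,19),(10,18),(4,17),(4,16),(5,15),(5,14),(4,13)] (Pick 238 [(12,13)] Done Done) Done))) (Pick
121 [] (Pick 237 [(13,17),(14,16)] (Pick 238 [(13,13)] Done Done) Done) (Pick 249 [(10,21),(11,20),(11,19),(11,
18),(10,17),(10,16),(5,15),(4,14)] (Pick 237 [(13,17),(14,16)] (Pick 238 [(13,13)] Done Done) Done) Done))))))
(Pick 151 [] (Pick 175 [] Done (Pick 207 [] Done (Pick 243 [(18,23),(21,22),(20,20),(18,19),(12,17),(15,16),(14,
14),(12,13)] (Pick 245 [(23,23),(22,22),(22,21),(21,20),(13,13),(13,12)] (Pick 246 [(20,20),(18,19),(15,15),(15,
14)] (Pick 235 [(19,19),(18,18)] (Pick 237 [(14,14)] (Pick 59 [] Done (Pick 187 [(2,12)] Done Done)) (Pick 61 []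
Done (Pick 189 [(0,14),(8,8)] Done Done))) (Pick 121 [] (Pick 59 [] Done (Pick 187 [(11,13)] Done Done)) (Pick
249 [(9,17),(8,16),(6,15),(7,14),(6,13)] (Pick 59 [] Done (Pick 187 [(11,13)] Done Done)) Done))) (Pick 121 []
Done (Pick 249 [(9,17),(8,16),(7,15),(6,14),(6,13),(7,12)] Done Done))) (Pick 121 [] (Pick 246 [(11,11)] Done Done)
(Pick 249 [(8,19),(9,18),(7,17),(6,16),(6,15),(7,14),(7,13)] (Pick 246 [(11,11)] Done Done) Done))) (Pick 121 []
(Pick 245 [(15,15),(14,14)] (Pick 246 [(14,14)] Done Done) Done) (Pick 249 [(8,21),(9,20),(9,19),(9,18),(8,17),
(8,16),(6,15),(7,14)] (Pick 245 [(15,15),(14,14)] (Pick 246 [(14,14)] Done Done) Done) Done))))) (Pick 175 [] (Pick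
183 [] Done (Pick 215 [] Done (Pick 235 [(21,21),(20,20),(20,19),(19,18),(15,15),(14,14),(14,13),(13,12)] (Pick
237 [(21,25),(22,24),(22,23),(20,20),(14,15),(12,12)] (Pick 238 [(19,19),(19,18),(16,17),(14,14)] (Pick 243 [(19,
19),(18,18)] (Pick 245 [(14,14)] (Pick 59 [] Done (Pick 187 [(0,12)] Done Done)) (Pick 61 [] Done (Pick 189 [(2,
14),(10,10)] Done Done))) (Pick 121 [] (Pick 59 [] Done (Pick 187 [(11,13)] Done Done)) (Pick 249 [(11,17),(10,
16),(4,15),(5,14),(4,13)] (Pick 59 [] Done (Pick 187 [(11,13)] Done Done)) Done))) (Pick 121 [] Done (Pick 249
[(10,17),(11,16),(4,15),(5,14),(4,13),(5,12)] Done Done))) (Pick 121 [] (Pick 238 [(12,13)] Done Done) (Pick 249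
[(11,19),(10,18),(4,17),(4,16),(5,15),(5,14),(4,13)] (Pick 238 [(12,13)] Done Done) Done))) (Pick 121 [] (Pick
237 [(13,17),(14,16)] (Pick 238 [(13,13)] Done Done) Done) (Pick 249 [(10,21),(11,20),(11,19),(11,18),(10,17),(10,
16),(5,15),(4,14)] (Pick 237 [(13,17),(14,16)] (Pick 238 [(13,13)] Done Done) Done) Done))))) (Pick 207 [(54,53),
(49,48),(42,41),(37,36),(30,29),(25,24),(19,22),(17,20),(20,18),(18,16),(10,15),(8,13),(12,11),(10,9),(2,7),(0,
5),(4,3),(2,1)] (Pick 183 [] Done (Pick 215 [] Done (Pick 235 [(21,21),(20,20),(20,19),(19,18),(15,15),(14,14),
(14,13),(13,12)] (Pick 237 [(21,25),(22,24),(22,23),(20,20),(14,15),(12,12)] (Pick 238 [(19,19),(19,18),(16,17),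
(14,14)] (Pick 243 [(19,19),(18,18)] (Pick 245 [(14,14)] (Pick 59 [] Done (Pick 187 [(0,12)] Done Done)) (Pick
61 [] Done (Pick 189 [(2,14),(10,10)] Done Done))) (Pick 121 [] (Pick 59 [] Done (Pick 187 [(11,13)] Done Done))
(Pick 249 [(11,17),(10,16),(4,15),(5,14),(4,13)] (Pick 59 [] Done (Pick 187 [(11,13)] Done Done)) Done))) (Pick
121 [] Done (Pick 249 [(10,17),(11,16),(4,15),(5,14),(4,13),(5,12)] Done Done))) (Pick 121 [] (Pick 238 [(12,13)]
Done Done) (Pick 249 [(11,19),(10,18),(4,17),(4,16),(5,15),(5,14),(4,13)] (Pick 238 [(12,13)] Done Done) Done)))
(Pick 121 [] (Pick 237 [(13,17),(14,16)] (Pick 238 [(13,13)] Done Done) Done) (Pick 249 [(10,21),(11,20),(11,19),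
(11,18),(10,17),(10,16),(5,15),(4,14)] (Pick 237 [(13,17),(14,16)] (Pick 238 [(13,13)] Done Done) Done) Done)))))
(Pick 243 [(46,54),(27,51),(23,50),(17,49),(13,48),(45,44),(44,42),(23,31),(23,30),(27,29),(27,28),(26,26),(25,
25),(23,24),(22,22),(13,21),(13,20),(17,19),(17,18),(16,16),(15,15),(13,14),(12,12)] (Pick 245 [(40,49),(34,48),
(36,47),(16,44),(18,43),(39,38),(36,37),(34,35),(33,33),(32,32),(31,31),(31,30),(30,29),(29,28),(18,19),(16,17),
(15,15),(14,14),(14,13),(13,12)] (Pick 246 [(34,44),(31,43),(27,42),(22,41),(24,40),(27,33),(31,32),(30,30),(29,
29),(27,28),(26,26),(24,25),(22,23),(21,21),(20,20),(20,19),(19,18)] (Pick 235 [(32,39),(22,36),(23,35),(16,34),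
(17,33),(31,31),(30,30),(20,20),(18,18),(14,14),(12,12)] (Pick 237 [(23,30),(18,29),(16,28),(13,25),(12,24),(22,
22),(16,21),(18,20)] (Pick 183 [] (Pick 59 [] Done (Pick 187 [(2,12)] Done Done)) (Pick 215 [] (Pick 59 [] Done
(Pick 187 [(2,12)] Done Done)) (Pick 238 [(16,23),(14,22),(15,21),(13,20),(12,19)] (Pick 135 [] (Pick 59 [] Done
(Pick 187 [(2,11)] Done Done)) (Pick 167 [] (Pick 59 [] Done (Pick 187 [(2,11)] Done Done)) (Pick 199 [] (Pick
59 [] Done (Pick 187 [(2,11)] Done Done)) (Pick 231 [] (Pick 59 [] Done (Pick 187 [(2,11)] Done Done)) (Pick 121
[] (Pick 62 [] Done (Pick 190 [(11,9),(8,8),(6,6)] Done Done)) (Pick 249 [(9,17),(8,16),(6,15),(7,14),(6,13),(7,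
12),(6,3)] (Pick 62 [] Done (Pick 190 [(11,9),(8,8),(6,6)] Done Done)) Done)))))) (Pick 121 [] (Pick 59 [] Done
(Pick 187 [(9,10),(2,7)] Done Done)) (Pick 249 [(6,18),(7,17),(8,15),(9,14),(6,13),(7,12)] (Pick 59 [] Done (Pick
187 [(9,10),(2,7)] Done Done)) Done))))) (Pick 238 [(15,22),(14,21),(18,18),(16,16)] (Pick 183 [] (Pick 59 [] Done
(Pick 187 [(2,12)] Done Done)) (Pick 215 [] (Pick 59 [] Done (Pick 187 [(2,12)] Done Done)) (Pick 121 [] (Pick
59 [] Done (Pick 187 [(9,10),(2,7)] Done Done)) (Pick 249 [(6,18),(7,17),(9,15),(8,14),(6,13),(7,12)] (Pick 59
[] Done (Pick 187 [(9,10),(2,7)] Done Done)) Done)))) (Pick 121 [] (Pick 59 [] Done (Pick 187 [(2,7)] Done Done))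
(Pick 249 [(9,17),(8,16),(6,15),(7,14),(6,13)] (Pick 59 [] Done (Pick 187 [(2,7)] Done Done)) Done)))) (Pick 237
[(22,28),(20,27),(20,25),(22,24),(12,15),(13,14)] (Pick 238 [(18,22),(19,21),(14,17),(15,16)] (Pick 183 [] (Pick
59 [] Done (Pick 187 [(2,12)] Done Done)) (Pick 215 [] (Pick 59 [] Done (Pick 187 [(2,12)] Done Done)) (Pick 121
[] (Pick 59 [] Done (Pick 187 [(10,13),(8,12)] Done Done)) (Pick 249 [(9,18),(8,17),(7,15),(6,14),(7,13),(6,12)]
(Pick 59 [] Done (Pick 187 [(10,13),(8,12)] Done Done)) Done)))) (Pick 121 [] (Pick 59 [] Done (Pick 187 [(8,13)]
Done Done)) (Pick 249 [(8,17),(9,16),(6,15),(7,14),(7,13)] (Pick 59 [] Done (Pick 187 [(8,13)] Done Done)) Done)))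
(Pick 238 [(20,20),(18,18),(14,17),(15,16)] (Pick 121 [] (Pick 59 [] Done (Pick 187 [(10,13)] Done Done)) (Pick
249 [(9,17),(8,16),(7,15),(6,14),(6,13)] (Pick 59 [] Done (Pick 187 [(10,13)] Done Done)) Done)) (Pick 121 [] Done
(Pick 249 [(9,17),(8,16),(6,15),(7,14)] Done Done))))) (Pick 235 [(16,27),(17,26),(24,24),(23,23),(22,22),(14,14),
(12,12)] (Pick 237 [(13,22),(12,21),(19,19),(18,18)] (Pick 121 [] (Pick 59 [] Done (Pick 187 [(8,11)] Done Done))
(Pick 249 [(6,19),(7,18),(9,15),(8,14),(7,13),(6,12)] (Pick 59 [] Done (Pick 187 [(8,11)] Done Done)) Done)) (Pick
121 [] Done (Pick 249 [(9,17),(8,16),(7,15),(6,14)] Done Done))) (Pick 59 [] (Pick 61 [] Done (Pick 189 [(0,15)]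
Done Done)) (Pick 187 [(2,20),(16,19),(2,11),(2,10),(6,9)] (Pick 61 [] Done (Pick 189 [(0,15)] Done Done)) Done))))
(Pick 235 [(19,29),(21,28),(26,26),(25,25),(24,24),(16,16),(14,14)] (Pick 238 [(15,24),(14,23),(20,22),(20,21)]
(Pick 121 [] (Pick 246 [(10,15),(11,14)] (Pick 59 [] Done (Pick 187 [(8,11)] Done Done)) Done) (Pick 249 [(6,21),
(7,20),(8,17),(9,16),(7,15),(6,14),(7,13)] (Pick 246 [(10,15),(11,14)] (Pick 59 [] Done (Pick 187 [(8,11)] Done
Done)) Done) Done)) (Pick 59 [] (Pick 61 [] Done (Pick 189 [(0,15)] Done Done)) (Pick 187 [(2,20),(12,19),(2,11),
(2,10),(6,9)] (Pick 61 [] Done (Pick 189 [(0,15)] Done Done)) Done))) (Pick 238 [(14,19),(14,18),(15,17),(15,16)]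
(Pick 59 [] (Pick 61 [] Done (Pick 189 [(0,15)] Done Done)) (Pick 187 [(2,20),(12,19),(2,11),(2,10),(6,9)] (Pick
61 [] Done (Pick 189 [(0,15)] Done Done)) Done)) (Pick 59 [] Done (Pick 187 [(2,18),(12,17)] Done Done))))) (Pick
237 [(19,31),(16,30),(27,29),(27,28),(26,26),(16,25),(19,23)] (Pick 245 [(18,26),(20,25),(20,21),(18,19),(17,17),
(17,16)] (Pick 238 [(18,24),(19,23),(20,22),(20,21)] (Pick 121 [] (Pick 246 [(13,15),(12,14)] (Pick 59 [] Done
(Pick 187 [(11,13)] Done Done)) Done) (Pick 249 [(9,21),(8,20),(9,17),(8,16),(6,15),(7,14),(6,13)] (Pick 246 [(13,
15),(12,14)] (Pick 59 [] Done (Pick 187 [(11,13)] Done Done)) Done) Done)) (Pick 61 [] (Pick 59 [] Done (Pick 187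
[(1,15)] Done Done)) (Pick 189 [(0,20),(12,14),(8,8),(7,7),(6,6)] (Pick 59 [] Done (Pick 187 [(1,15)] Done Done))
Done))) (Pick 121 [] Done (Pick 249 [(8,17),(9,16),(6,15),(7,14)] Done Done))) (Pick 238 [(18,23),(20,22),(20,21),
(19,19),(17,17),(16,16)] (Pick 245 [(19,19),(18,18),(18,17),(17,16)] (Pick 61 [] (Pick 59 [] Done (Pick 187 [(1,
15)] Done Done)) (Pick 189 [(0,20),(12,14),(8,8),(7,7),(6,6)] (Pick 59 [] Done (Pick 187 [(1,15)] Done Done)) Done))
(Pick 59 [] Done (Pick 187 [(2,18),(13,17)] Done Done))) (Pick 59 [] Done (Pick 187 [(2,18)] Done Done)))))))))))))))))"
  by (rule certificateI, simp, simp only: search_run cong: search_cong search_cong' if_weak_cong,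
      (simp (no_asm_use) only: search_run; sat))+

lemma certificates_clique_10:
  "certificate [0,1,3,7,15,24,56,119] [31,151] [861971,870163,1383187,346899,1397523,353043,829197,837389,1350413,
314125,1364749,320269,1744297,699817,1750441,714153,1227177,1235369,1394451,873235,1459875,938659,1361677,840461,
1459813,938597,1224105,702889,1256817,735601,345875,348947,869139,1393427,411299,414371,934563,1458851,313101,316173,
836365,1360653,411237,414309,934501,1458789,703913,1228201,1748393,1751465,736625,1260913,1781105,1784177,344851]
[59,61,62,91,93,94,120,121,122,124,179,181,182,211,213,214,240,241,242,244,248] [10250,526850,17425,263425,541200,
270600,12300,528900,33825,132225,557600,139400,295200,147600,266500,20500,133250,34850,1589762,1575440,1319169,
1312008,1606148,1577504,1187969,1180808,1181840,1196162,1315104,1343748,66050,66064,526400,540736,65793,65800,263232,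
270400,66052,66080,528448,557120,65665,65672,132160,139328,147520,133184,65680,65666,294976,266304,65824,65796,
65600] (Pick 123 [] Done (Pick 125 [] Done (Pick 126 [] Done (Pick 243 [] Done (Pick 245 [] Done (Pick 246 [] Done
(Pick 249 [] Done (Pick 250 [] Done (Pick 251 [] Done (Pick 252 [] Done (Pick 253 [] Done (Pick 254 [] Done (Pick
248 [] (Pick 59 [] Done (Pick 61 [] Done (Pick 62 [] Done (Pick 91 [] Done (Pick 93 [] Done (Pick 94 [] Done (Pick
121 [] Done (Pick 241 [(16,17)] Done Done)))))))) (Pick 121 [(42,35),(40,34),(45,31),(45,30)] (Pick 122 [(27,27),
(27,26)] (Pick 181 [(1,14),(1,10)] Done Done) (Pick 242 [(19,19),(19,18),(10,13),(11,12),(9,9),(3,8),(8,7),(5,6),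
(2,2),(3,0)] Done (Pick 59 [(1,9)] Done Done))) (Pick 241 [(40,33),(38,32),(39,31),(39,30),(24,21),(22,20),(23,
19),(23,18),(16,17),(13,15),(8,8),(9,6),(8,5),(9,4),(4,3),(3,2),(8,1),(3,0)] (Pick 242 [(27,27),(27,26)] (Pick
61 [(1,14),(1,11)] Done Done) (Pick 122 [(19,19),(19,18),(10,13),(11,12),(9,9),(3,8),(8,7),(5,6),(2,2),(3,0)] Done
(Pick 59 [(1,14)] Done Done))) (Pick 122 [(29,17),(29,16)] (Pick 59 [(1,9)] Done Done) (Pick 242 [(25,17),(25,16),
(13,9),(13,8),(3,2),(4,0)] (Pick 59 [(1,14)] Done Done) (Pick 120 [] (Pick 59 [(0,7)] Done Done) (Pick 124 [(23,
23),(22,22),(21,19),(20,18),(19,13),(18,12),(15,11)] (Pick 59 [(0,7)] Done Done) Done)))))))))))))))))))"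
  "certificate [0,1,3,7,15,24,20,108] [31] [246547] [] [0] (Dead 0)"
  "certificate [0,1,3,7,15,24,20,124] [31] [411411,430867,443155,79523,411405,430861,79461,73129,73073,162467,209571,
162405,209509,306601,331177,306545,331121,157459,301843,157453,301837,160419,160357,298409,298353] [59,61,62,87,
93,94,156,157,158,184,185,186,188,212,213,214,220,244,248] [69890,69792,64,16513,69764,69904,33025,1160,2312,37122,
151680,20612,168192,67856,328832,66720,329984,135434,327841,135308,327953,33536,17024,10496,9344] (Pick 157 []
Done (Pick 158 [] Done (Pick 187 [] Done (Pick 188 [] Done (Pick 189 [(10,23),(5,20),(5,13)] Done (Pick 190 [(10,
21),(1,17),(1,14)] Done (Pick 61 [(0,5)] Done Done)))))))"
  "certificate [0,1,3,7,15,24,20,114] [31] [246547] [] [0] (Dead 0)"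
  "certificate [0,1,3,7,15,24,20,106] [31] [258723] [] [0] (Dead 0)"
  "certificate [0,1,3,7,15,24,20,122] [31] [67347,197395,213773,85361,476529,443149,225893,221797] [61,94,155,158,
185,186,188,214,220,244] [5,36,20,40,9,328,712,202] Done"
  "certificate [0,1,3,7,15,24,20,110] [31] [361235,443155,475917,422501,413041] [143,158,186,188,214,220] [1,6,18,
10,34] Done"
  "certificate [0,1,3,7,15,24,20,126] [31,158] [837395,873229,325283,326307,422501,613801,617897,675185,324259,609705]
[59,61,87,93,184,186,188,212,214,220,244,248] [578,584,289,322,1344,292,552,2592,272,160] Done"
  "certificate [0,1,3,7,15,24,20,99] [31] [787] [] [0] (Dead 0)"
  "certificate [0,1,3,7,15,24,20,115] [31] [475923,492307] [151,155] [2,1] Done"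
  "certificate [0,1,3,7,15,24,20,107] [31] [66323,488099] [143,155] [1,2] Done"
  "certificate [0,1,3,7,15,24,20,123] [31,155] [410387,426765] [185,186] [2,1] Done"
  "certificate [0,1,3,7,15,24,20,111] [31,143] [197395] [] [0] (Dead 0)"
  "certificate [0,1,3,7,15,24,52,108] [31] [494355,500499,357027,246547,377619,115475,160419,406179,144035,282025,
396713,265641,182035,348947,154275,434851,182029,348941,154213,434789,288169,461225,288113,461169] [59,61,62,87,
93,94,124,143,157,158,188,220,236,244,248] [1,8,128,16448,8256,4160,17408,5120,9216,10240,6144,18432,1602,2400,
1122,3600,1348,2640,1108,3360,2132,3586,2146,3332] (Pick 124 [] Done (Pick 125 [(16,23),(13,19)] Done (Pick 126
[(12,20),(16,15),(3,11),(5,10)] Done Done)))"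
  "certificate [0,1,3,7,15,24,52,28] [31] [62115,160419] [157,158] [2,1] Done"
  "certificate [0,1,3,7,15,24,52,92] [31] [41747,62115,160419,41741,413097,413041] [87,157,158,213,214,220] [5,20,
10,3,34,36] Done"
  "certificate [0,1,3,7,15,24,52,124] [31] [161443,161381,155049,154993,406179,406117,658857,658801,321299,613139,
434851,321293,613133,434789,723369,723313,324259,324197,609705,609649,304915,596755,641811,385811,304909,596749,
641805,385805,625427,369427,830115,830053,862633,862577] [59,61,62,87,93,94,117,118,121,122,156,157,158,184,185,
186,188,212,213,214,220,240,244,248] [264193,528385,18440,36872,4524032,4788224,9455616,9474048,4264010,9439777,
263184,4262028,9441553,525344,17410,33796,536576,272384,167936,149504,2166794,3147809,12584449,12584008,2164748,
3149841,12584193,12584072,2098177,2098184,3215442,3213476,3215634,3213860] (Pick 157 [] Done (Pick 158 [] Done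
(Pick 187 [] Done (Pick 185 [(6,33),(6,32),(6,31),(6,30),(2,29),(6,28),(2,27),(6,26),(2,24),(2,23),(6,22),(6,21),
(6,9)] (Pick 186 [(5,27),(5,26),(5,25),(5,24),(2,23),(5,22),(2,21),(5,20),(5,19),(2,17),(5,16)] (Pick 59 [(5,23),
(8,22)] Done (Pick 123 [(11,21),(15,20),(18,19)] Done (Pick 251 [(1,9),(0,6),(1,3)] Done Done))) Done) (Pick 186
[(7,20),(3,19),(7,11)] Done Done)))))"
  by (rule certificateI, simp, simp only: search_run cong: search_cong search_cong' if_weak_cong,
      (simp (no_asm_use) only: search_run; sat))+

lemma certificates_clique_11:
  "certificate [0,1,3,7,15,24,52,114] [31] [247571,363283,381715,238355,161443,277155,94883,438947,247565,381709,94821,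
438885,381541,238181,286121,429481,85361,362865,246547,377619,160419,406179,127589,242277] [59,61,62,87,93,94,117,
121,124,151,155,158,179,185,186,211,213,214,242,244,248] [258,4097,288,32776,16385,66,66048,18432,260,272,131584,
9216,144,131104,131080,133120,17408,16388,1048832,524544,1064960,278528,393216,655360] (Pick 125 [] Done (Pick
126 [] Done (Pick 124 [(19,23),(18,20)] (Pick 59 [] Done (Pick 123 [(2,15)] Done Done)) (Pick 62 [(17,20),(16,16),
(15,7),(14,4)] (Pick 94 [(12,19),(12,14),(12,13)] (Pick 119 [] Done (Pick 87 [(11,17),(11,12)] (Pick 59 [] Done
(Pick 123 [(2,14)] Done Done)) Done)) Done) Done))))"
  "certificate [0,1,3,7,15,24,52,42] [31] [258723] [] [0] (Dead 0)"
  "certificate [0,1,3,7,15,24,52,106] [31] [389795] [] [0] (Dead 0)"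
  "certificate [0,1,3,7,15,24,52,26] [31] [62115,94883] [155,158] [2,1] Done"
  "certificate [0,1,3,7,15,24,52,90] [31] [324259,357027] [155,158] [2,1] Done"
  "certificate [0,1,3,7,15,24,52,58] [31] [357027,389733,455269,118185,379305,141075,80547,153363,72355,149267] [61,
87,94,117,118,124,155,158,185,186,188,244,248] [576,320,1152,640,129,67,73,4197,117,6241] Done"
  "certificate [0,1,3,7,15,24,52,122] [31] [897637,325283,723313,604835,357027,897699,864931,887209,183665,691569,
443761,402195,438885,434789,646569,642473,677651,371113,435569,673555,447077,149267,826019,895401,451953] [59,61,
62,87,93,94,117,118,121,124,154,155,158,185,186,188,211,213,214,218,220,240,242,244,248] [10240,20481,18436,2114,
16795648,1024,4212736,266242,4214784,16797696,4162,83976,8687616,299040,282632,8671232,17304098,18354450,17306402,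
25692674,17994000,2099714,17339042,3150098,2626082] (Pick 61 [] Done (Pick 125 [(7,13),(7,12)] Done (Pick 189 [(7,
13)] Done (Pick 253 [(7,12)] Done (Pick 94 [(12,15)] Done (Pick 93 [] Done (Pick 119 [] Done (Pick 117 [(10,19),
(10,18)] (Pick 121 [] Done (Pick 123 [(12,17)] Done Done)) Done))))))))"
  "certificate [0,1,3,7,15,24,52,14] [31] [127651,193187] [143,158] [2,1] Done"
  "certificate [0,1,3,7,15,24,52,78] [31] [455331,324197] [143,158] [1,2] Done"
  "certificate [0,1,3,7,15,24,52,110] [31] [717475,887571,959245,378643,893715,893603,953101,709389,324197,832101,
307813,952745,576881,822641,560497,318053,583025,377619,705293] [59,61,62,87,93,94,124,143,158,186,188,214,220,
236,244,248] [128,769,2312,1346,776,5392,2305,4432,34048,9472,17664,5378,20736,12544,37120,1364,4450,33600,18752]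
(Pick 61 [(3,15)] Done Done)"
  "certificate [0,1,3,7,15,24,52,30] [31,158] [127651] [] [0] (Dead 0)"
  "certificate [0,1,3,7,15,24,52,94] [31,158] [127651,839025] [214,220] [1,2] Done"
  "certificate [0,1,3,7,15,24,52,126] [31,158] [652963,832101,1236393,1346929,651939,1232297,1682083,1747369] [59,
61,87,93,117,121,184,186,188,212,214,220,240,244,248] [1153,9472,1156,18560,1088,640,6426,6442] Done"
  "certificate [0,1,3,7,15,24,52,67] [31] [29347] [] [0] (Dead 0)"
  "certificate [0,1,3,7,15,24,52,99] [31] [29347] [] [0] (Dead 0)"
  "certificate [0,1,3,7,15,24,52,19] [31] [62115,160419] [151,155] [2,1] Done"
  "certificate [0,1,3,7,15,24,52,83] [31] [324259,461587,160419,160357,205587,475923] [59,87,124,151,155,211,213,214]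
[16,9,72,136,42,12] Done"
  "certificate [0,1,3,7,15,24,52,115] [31] [160419,160357,150953,150897,690963,723731,434963,467731,444179,476947,
709395,742163,444173,476941,709389,742157,443155,738067,705299,475923] [59,61,62,87,93,94,124,151,155,179,185,186,
211,213,214,244,248] [8320,16512,1280,2304,769,641,4360,4232,322,194,352,224,196,324,208,336,65856,32960,33088,
65728] (Pick 124 [] Done (Pick 125 [] Done (Pick 126 [] Done (Pick 151 [] Done (Pick 183 [(6,6)] Done (Pick 215
[(16,17)] Done Done))))))"
  "certificate [0,1,3,7,15,24,52,11] [31] [193187,225955] [143,155] [2,1] Done"
  "certificate [0,1,3,7,15,24,52,75] [31] [455331,488099] [143,155] [2,1] Done"
  "certificate [0,1,3,7,15,24,52,43] [31] [455331,488099] [143,155] [2,1] Done"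
  "certificate [0,1,3,7,15,24,52,107] [31] [717475,750243] [143,155] [2,1] Done"
  "certificate [0,1,3,7,15,24,52,91] [31,155] [717475] [] [0] (Dead 0)"
  "certificate [0,1,3,7,15,24,52,123] [31,155] [1749667,1782373,828179,717475,860941,750181,412073,1444265,412017,
1444209,836371,869133,413097] [61,62,87,124,184,185,186,211,217,218,241,242,248] [2112,1056,196,4416,164,4640,4129,
161,4162,194,4168,4136,16] Done"
  "certificate [0,1,3,7,15,24,52,111] [31,143] [1405603] [] [0] (Dead 0)"
  "certificate [0,1,3,7,15,24,28,60] [31] [76563,336659,76557,336653,77225,150953,332563,332557,72467,72461,142761,
85417] [59,93,94,157,158,185,186,188,220,248] [11,138,21,148,84,42,396,402,269,275,812,850] Done"
  "certificate [0,1,3,7,15,24,28,124] [31,220] [856851,856845,667049,609705,596755,596749] [59,93,94,157,158,185,186,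
188,248] [140,146,300,338,269,275] Done"
  "certificate [0,1,3,7,15,24,28,58] [31] [141075,369421,109993,398099,430861,304915,365325,371113,379305,136979,402195,
169741,105229,434957,118185,305939,303891] [59,61,62,93,94,124,155,158,184,185,186,188,218,220,248] [74,2192,1168,
1104,584,2186,10376,178,8330,114,17480,1132,9353,21072,25736,17545,392] Done"
  "certificate [0,1,3,7,15,24,28,122] [31] [141075,922387,889613,955149,903593,402195,434957,642473,661267,126377,
826131,825107,824083] [59,61,92,93,94,124,155,158,184,185,186,188,216,217,218,220,248] [74,17488,34952,8776,32906,
66632,82512,99464,82034,17540,5265,6322,4496] Done"
  "certificate [0,1,3,7,15,24,28,38] [31] [234259,238355] [93,94] [2,1] Done"
  "certificate [0,1,3,7,15,24,28,102] [31] [500499,503209] [93,94] [1,2] Done"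
  "certificate [0,1,3,7,15,24,28,54] [31] [442981,172819,140045,314793] [93,94,151,158] [10,5,6,9] Done"
  "certificate [0,1,3,7,15,24,28,118] [31] [135949,168723,954981,830889] [93,94,151,158,212,214,220] [5,38,73,26]
Done"
  "certificate [0,1,3,7,15,24,28,62] [31,158] [697101,175529,693005,170765,183721] [59,93,94,186,188,220,248] [20,
12,50,43,106] Done"
  "certificate [0,1,3,7,15,24,28,126] [31,158,220] [1741581,1232297] [93,186,188,248] [5,11] Done"
  by (rule certificateI, simp, simp only: search_run cong: search_cong search_cong' if_weak_cong,
      (simp (no_asm_use) only: search_run; sat))+

lemma certificates_clique_12:
  "certificate [0,1,3,7,15,24,28,35] [31] [4883,8979] [93,94] [2,1] Done"
  "certificate [0,1,3,7,15,24,28,99] [31] [4883,8979] [93,94] [2,1] Done"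
  "certificate [0,1,3,7,15,24,28,51] [31] [430867,463635,434963,467731] [93,94,151,155] [10,6,9,5] Done"
  "certificate [0,1,3,7,15,24,28,115] [31] [955155,987923,959251,992019] [93,94,151,155] [10,6,9,5] Done"
  "certificate [0,1,3,7,15,24,28,59] [31,155] [824083,856845,300819,828179,333581,860941] [61,62,93,94,124,185,186,
217,218,248] [72,36,57,708,86,808] Done"
  "certificate [0,1,3,7,15,24,28,123] [31,155] [1872659,1905421,828179,860941] [93,94,185,186,217,218,248] [42,21,
89,102] Done"
  "certificate [0,1,3,7,15,24,28,39] [31] [74515,82595,41741,49765] [93,94,143,151] [9,5,10,6] Done"
  "certificate [0,1,3,7,15,24,28,103] [31] [961961,994729,970153,1002921] [93,94,143,151] [10,6,9,5] Done"
  "certificate [0,1,3,7,15,24,28,119] [31,151] [332563,1385235] [93,94,213,214] [10,5] Done"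
  "certificate [0,1,3,7,15,24,60,60] [31] [142099,142093,697107,697101,142761,282025,170771,600851,170765,600845,273833,
150953,693011,631571,693005,631565] [59,93,94,120,121,122,124,157,158,184,185,186,188,220,248] [131,261,4290,4420,
2340,1170,24741,26883,24851,25733,25764,26898,12428,9026,12554,8900] Done"
  "certificate [0,1,3,7,15,24,60,58] [31] [207629,762637,208297,764329,300819,600851,828179,893709,216489,824083,631571,
889613,413097,628493,629517,758541,404905,419241,420265] [59,61,62,92,93,94,120,121,122,124,154,155,158,184,185,
186,188,218,220,248] [36897,70176,37152,4642,526882,561169,559632,674336,823440,34912,12816,18512,10384,67092,17553,
331856,141600,35084,18570] (Pick 59 [(5,8)] Done Done)"
  "certificate [0,1,3,7,15,24,60,122] [31,248] [828179,1349395,1649427,893709,1265065,1649421,747945] [59,61,92,93,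
94,121,124,154,155,158,185,186,218,220] [2376,4434,10761,5456,10792,9361,4646] Done"
  "certificate [0,1,3,7,15,24,60,70] [31] [469779,500499,470441,478633,502185,273165,280165,303885,311909,434957,442981]
[59,61,93,94,121,122,124,143,151,199,206,214,236,244] [5,68,40,20,74,2057,1033,10312,5192,1736,2888] Done"
  "certificate [0,1,3,7,15,24,60,38] [31] [469779,500499,11021,41741,470441,478633] [59,93,94,121,122,124] [3,34,5,
36,20,10] Done"
  "certificate [0,1,3,7,15,24,60,102] [31] [994067,994729,1002921,38669,762643,770723,45837,535309,542309,497427,498339,
862989,404237,566029,869989,411237,574053,502185,764329,797453,804453,697101,705125] [59,61,62,92,93,94,121,122,
124,143,151,158,199,206,214,230,235,236,243,244] [17,160,80,276,524560,131344,8,278561,73761,8482,16674,18465,8737,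
540960,10273,17441,139552,131362,524578,49185,40993,570144,185632] (Pick 206 [(16,22)] Done (Pick 207 [(19,19),
(9,17)] Done (Pick 214 [(13,19)] Done (Pick 215 [(10,17)] Done Done))))"
  "certificate [0,1,3,7,15,24,60,22] [31] [107277,345701,77225,338707,238355,443043,104205,273165,142761,85417,150953,
442981,174505,303885,207635] [59,61,62,93,94,121,122,124,151,158,186,214,220,244] [656,529,592,265,4744,392,652,
273,336,552,296,2448,402,8592,5641] Done"
  "certificate [0,1,3,7,15,24,60,86] [31] [762643,150953,862995,797453,863601,893715,432803,828173,432741,667049,300813,
731923,732585,277261,631565,601513,157097,307981,214691,673443,600845] [59,61,62,92,93,94,121,122,124,150,151,158,
186,212,213,214,220,242,244,248] [67856,1104,17425,33825,67664,279824,34082,296224,17684,165024,263444,595985,672,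
1033,10528,10400,1164,787464,14353,590353,538657] (Pick 213 [(5,17),(5,10)] Done (Pick 93 [(0,13)] Done Done))"
  "certificate [0,1,3,7,15,24,60,54] [31] [869989,901733,601513,411299,443043,667049,609705,675241,762643,628493,273165,
935525,967269,698793,303885,731923,770723,640425,207635] [59,61,62,93,94,121,122,124,151,158,179,182,186,188,214,
220,244,248] [529,656,592,265,392,336,552,296,41608,8844,1297,16657,16784,402,65936,168457,168584,68236,39433]
(Pick 62 [(8,8)] Done Done)"
  "certificate [0,1,3,7,15,24,60,118] [31] [675241,935525,1387283,1418003,1352461,1715625,1133993,1780499,825101,1781161,
1141161,381541,316005,1650089,1157545,774819,874085,890469,300813,832269,1664425,770723,307981,1415781,367205,1419633,
1649421,1125133] [59,61,62,92,93,94,121,122,124,150,151,158,179,182,185,186,212,213,214,220,240,242,244,248] [1104,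
263201,136209,4326672,4457760,2360480,8915024,8947729,4203796,672,2122,2361352,520,67744,67874,8685576,4458505,
67665,1049876,12592136,4204684,8489232,1049608,1583380,2173204,1607956,8505377,1148961] (Pick 213 [(3,22),(3,19),
(3,18),(3,8)] (Pick 214 [(2,16),(2,14)] Done Done) (Pick 151 [(3,20)] Done (Pick 183 [(1,22),(1,21),(3,18),(0,16),
(1,15)] Done Done)))"
  "certificate [0,1,3,7,15,24,60,30] [31,158] [369421,339369,238355,338701,207635,347561] [59,93,94,121,122,124,186,
220,248] [36,20,162,69,195,394] Done"
  "certificate [0,1,3,7,15,24,60,94] [31,158,220] [1286931,1396137,1256211] [59,93,121,124,186,248] [10,38,51] Done"
  "certificate [0,1,3,7,15,24,60,62] [31,158] [338701,1417997,339369,1256211,347561,1286931,1413901] [59,93,94,120,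
121,122,124,184,186,188,220,248] [261,580,292,3331,3346,1218,1546] Done"
  "certificate [0,1,3,7,15,24,60,126] [31,158,220,248] [3353363,2444713] [59,93,121,186] [11,14] Done"
  "certificate [0,1,3,7,15,24,60,67] [31] [11027,41747,11021,41741,11689,19881] [59,93,94,121,122,124] [3,34,5,36,
20,10] Done"
  "certificate [0,1,3,7,15,24,60,35] [31] [11027,41747,11021,41741,11689,19881] [59,93,94,121,122,124] [3,34,5,36,
20,10] Done"
  "certificate [0,1,3,7,15,24,60,99] [31] [41747,41741,273833,282025,273171,535315,280227,542371,273165,535309,280165,
542309,862995,600851,928525,666381,404243,411299,338701,345701] [59,93,94,121,122,124,143,151,155,207,215,235,237,
238,243,245,246] [34,36,20,10,6147,17411,49155,2563,10245,17413,81925,2565,2307,16643,2309,16645,4227,32835,8325,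
65605] (Pick 207 [(11,14),(7,12)] Done Done)"
  by (rule certificateI, simp, simp only: search_run cong: search_cong search_cong' if_weak_cong,
      (simp (no_asm_use) only: search_run; sat))+

lemma certificates_clique_13:
  "certificate [0,1,3,7,15,24,60,19] [31] [338707,404237,404243,369427,434963,338701,369421,434957,77225,273833,282025,
142705] [59,93,94,121,122,124,151,155,217,218] [131,133,67,162,98,69,100,164,84,660,394,74] Done"
  "certificate [0,1,3,7,15,24,60,83] [31] [862995,928525,928531,893715,959251,862989,893709,959245,273833,282025,601513,
85417] [59,93,94,121,122,124,151,155,213,214,217,218,241,242] [131,133,67,162,98,69,100,164,2196,1162,8788,4426]
Done"
  "certificate [0,1,3,7,15,24,60,51] [31] [893715,959251,893709,959245,601513,666993,338707,404243,628387,280227,338701,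
404237,693861,280165,282025,281969,273833,273777,607907,673381] [59,93,94,121,122,124,151,155,179,185,186,213,214,
217,218,241,242,248] [162,98,100,164,84,74,387,323,1173,2115,325,389,651,4165,8842,17556,148116,140426,205955,180869]
(Pick 59 [(8,15),(12,14)] Done Done)"
  "certificate [0,1,3,7,15,24,60,115] [31] [890643,956179,1387283,1452819,311971,890637,956173,1387277,1452813,311909,
893715,1483539,1417997,959245,1422099,1487635,1418003,959251,893709,1483533,1650089,609705,1322409,1322353,1656483,
1721957,607907,673381] [59,61,62,92,93,94,121,122,124,151,155,179,185,186,211,213,214,217,218,220,240,241,242,244,
248] [1314,802,3089,2577,33552,788,1300,2593,3105,66336,16778512,8389392,8389408,16778528,1032,520,8389904,16778000,
16778016,8389920,4260512,2130512,17061024,16933968,21636113,19665953,1188881,1315873] (Pick 93 [] Done (Pick 221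
[(16,19),(17,18),(10,13),(11,12)] Done (Pick 59 [] Done (Pick 94 [] Done (Pick 123 [] Done (Pick 124 [] Done (Pick
125 [(10,23),(10,21),(10,18)] Done (Pick 126 [(10,20),(10,19),(10,18)] Done Done))))))))"
  "certificate [0,1,3,7,15,24,60,91] [31,155] [600851,666381,798121,806313,631571,697101] [59,93,94,121,122,124,217,
218,248] [67,133,148,74,354,420] Done"
  "certificate [0,1,3,7,15,24,60,59] [31,155] [628499,1680147,694029,1745677,1676051,1741581,798121,806313,812457,
813481] [61,62,92,93,94,120,121,122,124,184,185,186,217,218,248] [17681,22792,18698,25872,2096,1064,8848,4680,2182,
1093] Done"
  "certificate [0,1,3,7,15,24,60,123] [31,155,248] [1680147,1745677] [93,94,124,185,186,217,218] [53,78] Done"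
  "certificate [0,1,3,7,15,24,60,7] [31] [142099,149155,76557,83557,339369,413097,404849,347505,172819,180899,107277,
115301,303891,311971,303885,311909,378281,443817,371113,436649,307987,316067] [59,61,62,92,93,94,121,122,124,143,
151,205,206,213,214,237,238,245,246] [1041,529,1057,545,1184,592,1104,672,263440,66320,132384,33568,2832,9488,4896,
17696,1300,788,1314,802,520,1032] (Pick 237 [(11,20),(11,19),(11,14)] (Pick 245 [(10,19),(10,16),(10,13)] (Pick
238 [(9,16),(9,13)] (Pick 246 [(8,15)] Done Done) Done) Done) (Pick 245 [(10,18)] Done Done))"
  "certificate [0,1,3,7,15,24,60,71] [31] [339369,413097,404849,347505,666387,273171,600845,273165,902569,968105,895401,
960937,697107,303891,631565,303885,701203,307987,828179,836259,635661,307981,828173,836197] [59,61,62,92,93,94,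
121,122,124,143,151,199,205,206,213,214,236,244] [1184,592,1104,672,17425,4625,33825,8737,1300,788,1314,802,148752,
70416,165152,74528,33800,8712,6928,19728,17416,4616,11040,36128] (Pick 93 [] Done (Pick 94 [] Done (Pick 123 []
Done (Pick 124 [] Done (Pick 125 [] Done (Pick 126 [] Done (Pick 143 [] Done (Pick 151 [] Done (Pick 175 [] Done
(Pick 183 [] Done (Pick 207 [] Done (Pick 239 [(10,10),(8,8),(1,2),(1,0)] Done (Pick 59 [] Done (Pick 92 [] Done
(Pick 187 [] Done (Pick 251 [(4,19),(5,18)] Done Done))))))))))))))))"
  "certificate [0,1,3,7,15,24,60,39] [31] [142099,149155,76557,83557,863657,937385,929137,871793,172819,180899,107277,
115301,303891,311971,303885,311909,902569,968105,895401,960937,307987,316067] [59,61,62,92,93,94,121,122,124,143,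
151,205,206,213,214,237,238,245,246] [1041,529,1057,545,1184,592,1104,672,263440,66320,132384,33568,2832,9488,4896,
17696,1300,788,1314,802,520,1032] (Pick 237 [(11,20),(11,19),(11,14)] (Pick 245 [(10,19),(10,16),(10,13)] (Pick
238 [(9,16),(9,13)] (Pick 246 [(8,15)] Done Done) Done) Done) (Pick 245 [(10,18)] Done Done))"
  by (rule certificateI, simp, simp only: search_run cong: search_cong search_cong' if_weak_cong,
      (simp (no_asm_use) only: search_run; sat))+

lemma certificates_clique_14:
  "certificate [0,1,3,7,15,24,60,103] [31] [863657,937385,929137,871793,1190675,797459,1125133,797453,694035,825107,
1221395,303891,628493,825101,1155853,303885,902569,1492393,1419689,960937,1714963,1225491,307987,1722019,1649421,
1159949,307981,1656421,1426857,968105,895401,1485225,1321747,1328803,1321741,1328741,1977107,1352467,1984163,1360547,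
1911565,1352461,1918565,1360485] [59,61,62,92,93,94,121,122,124,135,143,151,199,205,206,213,214,229,230,235,236,
243,244] [2208,1104,2128,1184,2131985,533521,2164769,541729,67874,17698,4229392,1058064,35092,9492,4262176,1066272,
4196628,1049876,4196642,1049890,165905,67592,17416,140305,329761,34824,9224,279585,1050900,4195604,1050914,4195618,
2110481,563217,2118689,596001,8721,4338960,33297,1218832,16929,4478240,66081,1382688] (Pick 125 [] Done (Pick 126
[] Done (Pick 207 [] Done (Pick 215 [] Done (Pick 239 [] Done (Pick 247 [] Done (Pick 253 [] Done (Pick 254 []
Done (Pick 93 [] (Pick 206 [(5,9)] Done (Pick 238 [(15,17),(5,12)] Done Done)) (Pick 94 [] (Pick 205 [(5,9)] Done
(Pick 237 [(15,17),(7,12)] Done Done)) (Pick 124 [] (Pick 235 [(15,19),(7,18),(13,17)] Done Done) (Pick 143 []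
(Pick 213 [(5,8)] Done (Pick 221 [(5,8),(5,7)] Done Done)) (Pick 175 [(19,30),(17,28),(28,18),(26,16),(1,2),(1,
0)] (Pick 213 [(5,8)] Done (Pick 221 [(5,8),(5,7)] Done Done)) (Pick 221 [] Done (Pick 205 [(9,37),(9,33),(18,16),
(9,15),(9,14),(9,13)] (Pick 206 [(10,29),(17,16),(6,12)] (Pick 213 [(5,7)] Done (Pick 245 [(17,19),(15,16),(11,
10),(2,3)] Done (Pick 229 [(15,16)] Done Done))) (Pick 238 [(24,26),(4,21),(6,18),(14,15),(13,13),(5,5)] (Pick
213 [(5,7)] Done Done) (Pick 222 [(9,18),(17,17),(4,15),(9,10)] Done Done))) (Pick 237 [(26,31),(26,29),(26,28),
(3,25),(22,24),(3,23),(11,20),(17,17),(16,14),(15,13),(10,10),(3,5)] (Pick 243 [(3,23),(18,21),(2,20),(3,19),(2,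
17),(3,12)] (Pick 235 [(16,20),(2,18),(15,17),(2,12)] (Pick 206 [(10,9)] Done (Pick 238 [(14,16),(3,12)] Done Done))
(Pick 199 [(14,10)] Done Done)) (Pick 199 [(15,13)] Done Done)) (Pick 243 [(16,17),(4,12)] Done Done)))))))))))))))))"
  "certificate [0,1,3,7,15,24,60,119] [31,151] [2763539,2794259,2697997,2728717,3485097,1396137] [59,93,94,121,122,
124,179,213,214,241,242,244] [195,2210,325,2340,1300,650] Done"
  "certificate [0,1,3,7,15,24,6,126] [31,158] [869133,934501,97705,163185,317203,321299,318227,322323,325395,326419,
316179,320275,871181,877325,935525,942693,93609,96681,159089,161137,324371] [59,61,79,87,184,186,188,198,206,214,
234,236,242,244] [8768,2368,1312,4640,586,326,553,293,194,161,536,276,529,196,273,200,168,274,164,530,144] (Pick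
59 [] Done (Pick 123 [(9,20),(12,19),(7,18)] Done Done))"
  "certificate [0,1,3,7,15,24,6,117] [31] [340755,488099] [151,157] [1,2] Done"
  "certificate [0,1,3,7,15,24,6,125] [31,157] [881427,687529] [185,188] [2,1] Done"
  "certificate [0,1,3,7,15,24,38,30] [31,158] [127763] [] [0] (Dead 0)"
  "certificate [0,1,3,7,15,24,38,94] [31,158] [688909,819813] [206,214] [2,1] Done"
  "certificate [0,1,3,7,15,24,38,126] [31,158] [1737485,1868389,196009,327025,644883,648979,645907,650003,653075,654099,
627475,631571,652051] [59,61,79,87,184,186,188,198,206,214,234,236,242,244] [8768,2368,1312,4640,586,326,553,293,
194,161,536,276,144] Done"
  "certificate [0,1,3,7,15,24,38,21] [31] [62227,160531] [151,157] [2,1] Done"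
  "certificate [0,1,3,7,15,24,38,85] [31] [324371,422675] [151,157] [2,1] Done"
  "certificate [0,1,3,7,15,24,38,117] [31] [684819,717475] [151,157] [1,2] Done"
  "certificate [0,1,3,7,15,24,38,93] [31,157] [717587] [] [0] (Dead 0)"
  "certificate [0,1,3,7,15,24,38,125] [31,157] [1375657,640781,1749779,1880739] [62,185,188,236,244] [2,5,20,12] Done"
  "certificate [0,1,3,7,15,24,22,54] [31] [185107,447077,176915,451173] [87,94,151,158,214] [5,10,22,25] Done"
  "certificate [0,1,3,7,15,24,22,118] [31,214] [176915,189029] [87,94,151,158] [6,9] Done"
  "certificate [0,1,3,7,15,24,22,46] [31] [430861,209683,217875,443149,381715,385699] [87,94,143,158,186,188,214]
[10,6,5,73,25,41] Done"
  "certificate [0,1,3,7,15,24,22,110] [31] [742163,209683,967437,373523,373411] [87,94,143,158,186,188,198,206,214]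
[5,134,265,90,106] Done"
  "certificate [0,1,3,7,15,24,22,62] [31,158] [693005,171433,844389,175529] [87,94,186,188,214] [10,6,25,21] Done"
  "certificate [0,1,3,7,15,24,22,126] [31,158,214] [645907,649891,1753869,1224105] [59,61,87,186,188,242,244] [13,
22,84,44] Done"
  "certificate [0,1,3,7,15,24,22,53] [31] [152339,438947,471715,451235] [87,94,151,157] [5,10,6,9] Done"
  "certificate [0,1,3,7,15,24,22,117] [31] [963235,144147,189091,484003] [87,94,151,157,212,213,214] [10,70,41,21]
Done"
  "certificate [0,1,3,7,15,24,22,45] [31] [471827,156323,302505,447251,320163,377613] [87,94,143,157,185,188,213]
[6,5,10,73,41,25] Done"
  "certificate [0,1,3,7,15,24,22,109] [31] [668323,680611,963347,971539,832163,844451,901901,889613] [87,94,143,157,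
185,188,213,220,250] [6,5,138,73,42,41,25,282] Done"
  "certificate [0,1,3,7,15,24,22,61] [31,157] [701203,844451,628493,302505,321187,306601] [59,62,87,94,185,188,213,
220] [168,36,42,24,21,84] Done"
  "certificate [0,1,3,7,15,24,22,125] [31,157] [1749779,306601,1236337,1757971,649829] [62,87,94,185,188,213,220,244]
[84,42,76,178,51] Done"
  "certificate [0,1,3,7,15,24,22,39] [31] [86803,144147,37645,148237] [87,94,143,151] [9,6,10,5] Done"
  "certificate [0,1,3,7,15,24,22,103] [31] [135949,78611,676627,574221] [87,94,143,151,198,199,214] [6,74,37,25] Done"
  "certificate [0,1,3,7,15,24,22,55] [31,151] [348947,340755] [87,94,214] [1,6] Done"
  "certificate [0,1,3,7,15,24,22,119] [31,151,214] [340755] [94] [1] Done"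
  "certificate [0,1,3,7,15,24,22,111] [31,143] [406291,1463059] [87,94,199,206] [10,5] Done"
  "certificate [0,1,3,7,15,24,54,54] [31] [348947,905829,971365,909925] [87,94,151,158,214] [5,10,22,25] Done"
  "certificate [0,1,3,7,15,24,54,118] [31,214] [447077,938597,385637,877157] [87,94,151,158,242,244] [38,22,25,41]
Done"
  by (rule certificateI, simp, simp only: search_run cong: search_cong search_cong' if_weak_cong,
      (simp (no_asm_use) only: search_run; sat))+

lemma certificates_clique_15:
  "certificate [0,1,3,7,15,24,54,46] [31] [414483,889613,869133,643685,316005,368041,613745,439059,742163,373411,746147]
[87,94,122,124,143,158,186,188,206,214] [17,42,545,162,274,98,38,26,97,22,161] Done"
  "certificate [0,1,3,7,15,24,54,110] [31] [1463059,1917709,1364581,767763,768787,766739,766627] [59,61,87,94,122,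
124,143,158,186,188,198,206,214,248] [68,4228,2120,1706,1433,9640,9880] Done"
  "certificate [0,1,3,7,15,24,54,30] [31,158] [643685,217875] [87,94,214] [2,5] Done"
  "certificate [0,1,3,7,15,24,54,62] [31,158] [1692261,368041,1696357,372137] [87,94,186,188,214] [10,6,25,21] Done"
  "certificate [0,1,3,7,15,24,54,126] [31,158,214] [3490573,2469289] [87,186,188,242,244] [21,11] Done"
  "certificate [0,1,3,7,15,24,54,53] [31] [283411,877219,447077,897699,774757,635667,890281,644465] [61,62,87,94,118,
122,124,151,157,181,185,188,244] [132,260,136,296,1288,2376,6426,4937] Done"
  "certificate [0,1,3,7,15,24,54,117] [31] [1777065,1162609,1421987,1790565,942755,1391267,1268325,1414569,1660273,
1424035,1792613,375459,744037] [61,62,87,94,118,121,122,124,151,157,181,185,186,188,212,213,214,220,240,241,242,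
244] [65800,33284,584,2568,16644,2098841,2106906,2241050,2229929,263817,270874,542345,1073690] Done"
  "certificate [0,1,3,7,15,24,54,45] [31] [287395,630185,873235,381541,963347,307875,615075,738061] [87,94,122,124,
143,157,185,188,206,213] [17,34,545,274,26,22,161,97] Done"
  "certificate [0,1,3,7,15,24,54,109] [31] [1335971,1921811,1430117,1422099,1356451,1786637,1790565,637603,759565,
1154473,1645993,1121705,615075,430861,1160867,1663651,1479437,635555,758541,1358499,1787661,647843,955149] [59,
61,62,87,94,115,122,124,143,157,171,185,188,206,213,220,233,236,242,244,248] [264,16904,8464,33424,336,2568,37392,
4754,4756,557584,164368,1081872,528904,131472,2641,135688,524688,1053264,1051280,1048978,1053196,1315368,1115536]
(Pick 220 [(3,18),(6,17),(3,8),(3,7)] (Pick 61 [(5,6)] Done Done) (Pick 87 [] Done (Pick 94 [] Done (Pick 222 [(6,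
16)] Done Done))))"
  "certificate [0,1,3,7,15,24,54,93] [31,157] [1397523,1299045] [87,94,213,220] [5,10] Done"
  "certificate [0,1,3,7,15,24,54,61] [31,157] [1663651,597417,1422099,616099,1283853,601513,1684131,1676713] [59,62,
87,94,118,122,124,185,188,213,220,244,248] [260,136,1352,133,330,644,5416,2330] Done"
  "certificate [0,1,3,7,15,24,54,125] [31,157] [2473329,3494675,2694569,1300069,1684131,3365477,1268325,3496305] [59,
62,87,94,118,122,185,188,212,213,220,240,242,244,248] [580,8836,17480,329,16808,3226,4506,3242] Done"
  "certificate [0,1,3,7,15,24,54,7] [31] [152339,279309,119397,316005,103181,417137,72461,447857] [59,61,87,94,122,
124,143,151,214,243,245] [132,68,72,392,1192,664,153,170] Done"
  "certificate [0,1,3,7,15,24,54,71] [31] [807699,643685,283237,299789,875889,300813,269069,906609,874865,283405,606989,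
365325,810353] [59,61,62,86,87,94,122,124,135,143,151,198,199,206,214,235,237] [4624,8736,17440,66208,33376,676,
609,674,612,520,3088,416,352] Done"
  "certificate [0,1,3,7,15,24,54,39] [31] [152339,279309,119397,316005,103181,941425,596749,972145] [59,61,87,94,122,
124,143,151,214,243,245] [132,68,72,392,1192,664,153,170] Done"
  "certificate [0,1,3,7,15,24,54,103] [31] [1331987,1167973,299789,1924465,176915,307875,825101,793357,1168141,316005,
1908137,1430897,1399153,1131277,1364581,316173,807693,1416561,1908081,841485,808717,889613,1334641] [59,61,62,86,
87,94,122,124,135,143,151,187,189,198,199,206,214,235,237,242,244,248] [16912,33312,262816,131680,66720,66656,676,
609,1032,1115168,590880,674,612,9232,9248,1311240,526856,1053192,655880,1049100,524812,2097568,2097504] (Pick 235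
[(3,22),(18,20),(17,16),(3,12),(3,7)] (Pick 237 [(2,19),(14,17),(14,16),(2,10)] (Pick 62 [] Done (Pick 190 [(10,
18),(4,17),(14,14)] Done Done)) Done) Done)"
  "certificate [0,1,3,7,15,24,54,55] [31,151] [676627,840293] [87,94,214] [1,6] Done"
  "certificate [0,1,3,7,15,24,54,119] [31,151,214] [840293,3481001] [94,242,244] [5,3] Done"
  "certificate [0,1,3,7,15,24,54,111] [31,143] [2904851,2740837] [87,94,199,206] [5,10] Done"
  "certificate [0,1,3,7,15,24,30,62] [31,94,158] [1397517,351657] [186,188] [2,1] Done"
  "certificate [0,1,3,7,15,24,30,125] [31,94,157,220] [3486483,2710953] [185,188,248] [2,5] Done"
  "certificate [0,1,3,7,15,24,30,103] [31,94] [144147,275219] [143,151,206,214] [10,5] Done"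
  "certificate [0,1,3,7,15,24,30,119] [31,94,151,214] [668435] [] [0] (Dead 0)"
  "certificate [0,1,3,7,15,24,62,62] [31,94,158] [2839309,679337] [122,124,186,188] [10,5] Done"
  "certificate [0,1,3,7,15,24,62,61] [31,94,157] [1203625,2831123,2577165] [120,122,124,184,185,188,220,248] [210,
97,76] Done"
  "certificate [0,1,3,7,15,24,62,125] [31,94,157,220,248] [5397929] [122,185] [3] Done"
  "certificate [0,1,3,7,15,24,62,7] [31,94] [217869,234085,810409,826737,154381,611085,169573,627301,679337,874921,
695665,890225,865043] [59,61,120,122,124,135,143,151,206,214,235,237,243,245] [8336,2128,1096,4232,137,336,73,656,
648,82,328,146,36] Done"
  "certificate [0,1,3,7,15,24,62,71] [31,94] [341779,603923,342803,604947,1266445,611085,1727913,810409,340755,602899,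
1659661,1675877,679337,695665] [59,61,120,122,124,143,151,198,206,214,234,236,242,244] [594,306,585,297,8784,2352,
4680,1320,580,292,176,208,200,168] Done"
  "certificate [0,1,3,7,15,24,62,39] [31,94] [217869,234085,1858985,1875313,154381,611085,169573,627301,1727913,1923497,
1744241,1938801,1913619] [59,61,120,122,124,135,143,151,206,214,235,237,243,245] [8336,2128,1096,4232,137,336,73,
656,648,82,328,146,36] Done"
  "certificate [0,1,3,7,15,24,62,103] [31,94] [1390355,1652499,1391379,1653523,2315021,611085,3825065,1858985,340755,
602899,2708237,2724453,1727913,1744241] [59,61,120,122,124,143,151,198,206,214,234,236,242,244] [594,306,585,297,
8784,2352,4680,1320,580,292,8368,2256,1224,4264] Done"
  "certificate [0,1,3,7,15,24,62,119] [31,94,151,214] [5460749,6970793] [122,124,242,244] [10,5] Done"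
  "certificate [0,1,3,7,15,24,7,39] [31] [74515,148243,140051,82707] [79,87,143,151,199] [10,5,22,25] Done"
  "certificate [0,1,3,7,15,24,7,55] [31,151] [336659,344851] [79,87,199] [2,5] Done"
  by (rule certificateI, simp, simp only: search_run cong: search_cong search_cong' if_weak_cong,
      (simp (no_asm_use) only: search_run; sat))+

lemma certificates_clique_16:
  "certificate [0,1,3,7,15,24,39,39] [31] [140051,279315,271123,148243] [79,87,143,151,199] [10,5,22,25] Done"
  "certificate [0,1,3,7,15,24,39,103] [31,199] [1319699,1196819] [79,87,143,151] [6,9] Done"
  "certificate [0,1,3,7,15,24,39,55] [31,151] [664339,672531] [79,87,199] [2,5] Done"
  "certificate [0,1,3,7,15,24,39,119] [31,151,199] [2769683] [79] [1] Done"
  "certificate [0,1,3,7,15,24,55,55] [31,87,151] [1352467] [] [0] (Dead 0)"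
  "certificate [0,1,3,7,15,24,55,111] [31,87,143,199] [5808915] [] [0] (Dead 0)"
  "certificate [0,1,3,7,15,28,28,28] [31] [75539,150291,141075,83731,149267,76563,142099,84755] [61,62,93,94,124,157,
158,188,220] [74,37,426,342,182,217,313,453] Done"
  "certificate [0,1,3,7,15,28,28,92] [31,220] [665363,608019,666387,609043] [61,62,93,94,124,157,158,188] [170,86,
57,197] Done"
  "certificate [0,1,3,7,15,28,28,124] [31,188,220] [1713939,1657619] [61,62,93,94,157,158] [26,37] Done"
  "certificate [0,1,3,7,15,28,28,26] [31] [75539,272147,84755,281363,83731,76563,280339,273171] [61,62,93,94,124,155,
158] [74,42,69,37,86,89,54,57] Done"
  "certificate [0,1,3,7,15,28,28,90] [31] [281363,796435,609043,608019,280339,345869,599827,600851] [61,62,93,94,124,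
155,158,216,218,220] [37,298,581,598,54,313,202,217] Done"
  "certificate [0,1,3,7,15,28,28,122] [31] [281363,1845011,1657619,804627,1321747,1656595,1649427,1648403] [61,62,
93,94,124,155,158,184,186,188,216,218,220,248] [37,2346,4677,8502,10297,4310,1625,1226] Done"
  "certificate [0,1,3,7,15,28,28,30] [31,158] [206611,214803,207635,215827] [61,62,93,94,124,188,220] [10,86,57,101]
Done"
  "certificate [0,1,3,7,15,28,28,94] [31,158,220] [1263379,1264403] [61,62,93,124,188] [14,21] Done"
  "certificate [0,1,3,7,15,28,28,126] [31,158,188,220] [3361555] [61,93] [3] Done"
  "certificate [0,1,3,7,15,28,28,19] [31] [337683,403219,346899,412435,345875,411411,338707,404243] [61,62,93,94,124,
151,155] [74,42,69,37,86,54,89,57] Done"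
  "certificate [0,1,3,7,15,28,28,83] [31] [861971,927507,871187,936723,870163,935699,862995,928531] [61,62,93,94,124,
151,155] [74,42,69,37,86,54,89,57] Done"
  "certificate [0,1,3,7,15,28,28,115] [31] [1910547,1976083,1919763,1985299,1918739,1984275,1911571,1977107] [61,62,
93,94,124,151,155] [74,42,69,37,86,54,89,57] Done"
  "certificate [0,1,3,7,15,28,28,123] [31,155] [3745555,609043,1656595,2698003] [61,62,93,94,124,185,186,217,218,248]
[330,165,726,825] Done"
  "certificate [0,1,3,7,15,28,60,90] [31,124] [1263379,608019,1649427,1256211,1263373] [61,62,93,94,154,155,158,216,
218,220,248] [582,1062,1321,201,537] Done"
  "certificate [0,1,3,7,15,28,60,94] [31,124,158,220] [2574099] [62,93] [3] Done"
  "certificate [0,1,3,7,15,28,60,115] [31,124] [1787667,2967315,2829075,1911571,2836243,1918739,1780499,2960147] [61,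
62,93,94,151,155,244,248] [166,86,169,89,102,150,105,153] Done"
  "certificate [0,1,3,7,15,28,60,123] [31,124,155,248] [3360531,5450515] [61,62,93,94,185,186,217,218] [102,153] Done"
  "certificate [0,1,3,7,15,28,26,22] [31] [206611,231187,207635,363283,91917,289549,356965,438885,362259,338707,108301,
305933,353893,435813] [61,62,91,94,122,124,151,158,182,188,214,218] [138,2182,649,69,169,1098,150,330,326,1097,
2181,86,645,105] Done"
  "certificate [0,1,3,7,15,28,26,86] [31] [755475,813837,943717,338707,108301,362259,305933,946789,373349,370277,371057]
[61,62,91,94,122,124,151,158,182,188,210,211,214,218,244,248] [8326,4170,69,4169,8325,2374,2134,342,1162,18089,
34473] Done"
  "certificate [0,1,3,7,15,28,26,118] [31] [337683,304909,1468005,362259,862995,878181,1337101,1471077,1861221,250281,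
354061,288525,1823089,1692017,1320717,1300849,1672979,1716899,633613,894565,641449,895345,374373,1657257] [60,61,
62,90,91,94,122,124,150,151,158,180,181,182,188,210,211,214,218,242,244,248] [139812,66066,4626,74260,135714,279570,
1180322,533076,16658,262418,262562,33442,2644,16724,1180170,533009,2375956,2375970,2362452,1098914,789588,2147490,
42017,134156] (Pick 62 [(0,17),(0,10)] Done (Pick 94 [(0,15),(0,12)] Done (Pick 126 [(0,9),(0,8)] Done Done)))"
  "certificate [0,1,3,7,15,28,26,30] [31,158] [206611,231187,207635,232211] [61,62,91,94,188,218] [10,38,25,53] Done"
  "certificate [0,1,3,7,15,28,26,126] [31,158,188,218] [3377939] [61,91,248] [7] Done"
  "certificate [0,1,3,7,15,28,26,25] [31] [362259,207635,304909,92941,420265,381353,231187,338707,288525,109325,379305,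
422313] [61,62,91,94,122,124,155,157,185,188,217,218] [70,137,69,138,74,133,1670,2377,2153,1174,662,361] Done"
  "certificate [0,1,3,7,15,28,26,89] [31] [861971,731923,232211,617229,879017,881065,231187,288525,862995,633613,624403,
796429,444841,446889,448937] [60,61,62,90,91,94,122,124,153,155,157,185,188,216,217,218,220,248] [33316,66594,17426,
66596,5156,1186,21524,33442,166434,148564,33044,16906,8788,10770,8721] Done"
  "certificate [0,1,3,7,15,28,26,121] [31] [289549,1927593,755475,1387283,1681165,1845005,383401,446889,1664781,444841,
1674003] [60,61,62,90,91,94,122,124,153,155,157,184,185,186,188,216,217,218,220,248] [131620,17444,607252,660002,
68626,70154,70673,37394,265378,41556,672018] Done"
  "certificate [0,1,3,7,15,28,26,21] [31] [75539,76563,403107,348835,411299,182641,100115,273171,345763,406179,174449,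
119153] [61,62,91,94,122,124,151,157,181,188,214,217] [138,137,74,133,70,69,2182,1097,646,329,105,150] Done"
  "certificate [0,1,3,7,15,28,26,85] [31] [927395,864931,873123,635249,935587,706929,100115,273171,870051,930467,698737,
643441] [61,62,91,94,122,124,151,157,181,188,214,217] [74,137,133,138,70,69,2182,1097,646,329,105,150] Done"
  "certificate [0,1,3,7,15,28,26,53] [31] [176497,599827,296723,870051,411299,406179,414371,184689,362259,186737,600851,
641393] [60,61,62,91,94,122,149,151,157,180,181,182,188,211] [148,4372,8332,4364,2188,1170,1162,172,76,137,786,
778] Done"
  "certificate [0,1,3,7,15,28,26,117] [31] [1225073,1910435,296723,1918627,1459875,1454755,1462947,1233265,1235313,
1649427,1681777,1689969] [60,61,62,91,94,122,124,151,157,180,181,182,188,211,220] [148,4372,8332,4364,2188,1170,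
1162,172,137,17170,850,778] Done"
  by (rule certificateI, simp, simp only: search_run cong: search_cong search_cong' if_weak_cong,
      (simp (no_asm_use) only: search_run; sat))+

lemma certificates_clique_17:
  "certificate [0,1,3,7,15,28,26,93] [31,157] [1387283,363283,1386259,362259] [61,62,91,94,188,217,220] [73,37,90,
54] Done"
  "certificate [0,1,3,7,15,28,26,125] [31,157,188] [3483411,1410835] [62,91,94,217,220,248] [21,43] Done"
  "certificate [0,1,3,7,15,28,26,7] [31] [92941,111205,296723,142099,166675,297747,280227,144035,152227,283299,109325,
94821,422313,436593,298771,174867,284323,160419,370445,427795,404243,411299,406179] [60,61,62,90,91,94,122,124,
135,143,151,173,174,181,182,203,206,211,214] [1060,548,4628,263202,132114,2578,17428,66082,33298,9234,1108,596,
674,1186,529,1034,1041,522,274,131348,2338,33044,8482] (Pick 61 [] Done (Pick 62 [] Done (Pick 190 [(0,22),(0,20),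
(1,17),(0,15),(0,13)] Done Done)))"
  "certificate [0,1,3,7,15,28,26,71] [31] [617229,635493,142099,166675,144035,152227,632589,829197,633613,619109,165651,
821011,616205,812813,894733,952083,935587,878349] [61,62,91,94,122,124,135,143,151,173,174,181,182,203,206,211,
214] [266,138,65801,33029,16521,8325,2309,645,278,150,37126,9350,2345,681,69,32838,8262,105] Done"
  "certificate [0,1,3,7,15,28,26,103] [31] [1665805,1338125,1927593,944553,1156877,1353485,1954217,2019753,165651,
1345299,666387,273171,1140493,1337101,1682189,1354509,1952169,2017705,1929641,946601,1476371,928531,1459875,930467]
[61,62,91,94,122,124,135,143,151,173,174,181,182,203,206,211,214] [4362,1162,65802,16522,2309,645,33029,8325,37126,
9350,67849,17033,2345,681,4374,1174,33046,8342,65833,16553,33862,66121,12358,18505] (Pick 61 [] Done (Pick 62 []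
Done (Pick 190 [(3,23),(2,21),(3,19),(2,18),(3,11),(2,10)] Done Done)))"
  "certificate [0,1,3,7,15,28,26,119] [31,151] [665363,689939,1714963,1739539] [61,62,91,94,181,182,211,214] [170,
102,153,85] Done"
  "certificate [0,1,3,7,15,28,58,118] [31] [1739539,632589,2975333,3574547,2713357,2912869,1287955,2438819,1780493,
734821,3299753,1227121,1779475,730899,2959011,1288973,1223437,1812069,763493,3328425,1747313] [60,61,62,90,91,94,
120,121,122,124,150,151,158,180,181,182,188,210,211,214,218,240,242,244,248] [280594,264338,18578,17895442,8915490,
4229396,16843788,17826849,8390156,4231177,8917001,4195617,534628,2656356,165988,1060948,3158292,2298402,143906,
143636,200802] (Pick 61 [(3,15),(4,12)] Done (Pick 91 [(3,18)] Done Done))"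
  "certificate [0,1,3,7,15,28,58,30] [31,158] [493331,469779,428819,468755] [61,62,91,94,120,122,124,188,218] [294,
201,389,26] Done"
  "certificate [0,1,3,7,15,28,58,121] [31,248] [1541907,2829075,3312403,2697997,2783657] [60,61,62,90,91,94,122,124,
153,155,157,185,188,217,218] [13396,19106,20754,8844,3169] Done"
  "certificate [0,1,3,7,15,28,58,53] [31] [807587,315761,1257235,1787555,894565,560915,1255187,1256211,677539,309617,
861859,1231217,601875,1216275,599827,1215251] [60,61,62,91,94,120,121,122,124,151,157,180,181,182,188,211,214,217,
244,248] [4618,652,1041,17548,4882,33289,17460,3346,5129,657,8756,3146,852497,918537,328244,658442] Done"
  "certificate [0,1,3,7,15,28,58,117] [31] [2904739,2412913,1787555,864931,1779363,1288561,734883,603811,2774691,2959011,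
1227121,2406769,1218929,3328369,2836131,3451249,2699027,3313427,2696979,3312403,2844323,3582321,601875,1216275,
599827,1215251] [60,61,62,90,91,94,120,121,122,124,149,151,157,180,181,182,188,213,214,217,218,240,241,242,244,
248] [18450,2324,33624340,16796194,69732,12834,4214817,1057,16797713,34916,8392993,33556769,4105,12434,8401172,
4212834,50726945,51908625,17172580,35139602,12300,1122,2361377,2625553,2361444,2633746] (Pick 122 [(2,23),(2,17)]
Done (Pick 121 [(13,23),(13,18)] Done (Pick 123 [(11,20),(11,16)] Done (Pick 182 [(9,19),(9,16)] Done Done))))"
  "certificate [0,1,3,7,15,28,58,93] [31,157] [690963,2829075,755475,2828051] [61,62,91,94,120,122,124,188,217,220,
248] [261,585,1446,666] Done"
  "certificate [0,1,3,7,15,28,58,125] [31,157,188,248] [2852627] [62,91,122,217] [15] Done"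
  "certificate [0,1,3,7,15,28,58,7] [31] [297747,559891,283299,545443,174861,160357,881065,895345,560915,305939,546467,
291491,763661,337683,599827,861971] [60,61,62,90,91,94,120,121,122,124,135,143,151,173,174,181,182,203,206,211,
214] [528402,10258,133138,36882,4372,2324,2594,4642,2065,4106,4113,2058,1170,1118308,280676,1124] Done"
  "certificate [0,1,3,7,15,28,58,71] [31] [297747,283299,174861,160357,338707,340643,1271565,1664781,1287949,1681165,
305939,291491,1795853,1812237,337683,599827,861971,861859] [61,62,90,91,94,120,121,122,124,135,143,151,173,174,
181,182,203,206,211,214] [264201,66569,2186,1162,526609,132369,18705,5393,18505,5193,526341,132101,785,585,559154,
140338,524850,131634] Done"
  by (rule certificateI, simp, simp only: search_run cong: search_cong search_cong' if_weak_cong,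
      (simp (no_asm_use) only: search_run; sat))+

lemma certificates_clique_18:
  "certificate [0,1,3,7,15,28,58,103] [31] [1346323,2657043,2320141,2713357,2336525,2729741,3852713,3983785,3854761,
3985833,1223437,2665229,2847145,1929641,1388307,601875,370451,2729747,3320589,3306085,881065,895345,3967763,3953315,
337683,599827,1347347,2658067,1354515,2665235,1288973,2730765,1256205,600845,3832233,1866153,3830185,1864105,1224461,
2666253,2838953,1921449,864019,894739,865955,878243,2395923,1616659,2381475,1602211,3321613,2273037,1682189,1649421,
3307109,2258533,1667685,1651301,1735081,1733033,2970025,872873,1751409,1747313,2984305,887153,2920211,1878803,2905763,
1864355,861971,861859] [60,61,62,90,91,94,120,121,122,124,135,143,151,167,173,174,181,182,199,203,206,211,214,227,
229,230,234,236,242,244] [2166802,542738,70178,18978,69778,18578,2101524,526612,2101394,526482,268570900,67143956,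
541069858,135268898,4329505,1083425,4329484,1083404,100798740,302024980,571476514,171971106,2114578,590866,4329572,
1083492,539103249,134776849,272699402,68175882,537006164,134252628,537006604,134253068,272634145,68159777,272633954,
68159586,805376273,201345297,807408138,201853450,37782561,37782540,34735137,34735116,170266641,303065098,571246609,
104935434,637604113,218173713,570468436,570468876,436226321,822102289,167915604,167916044,105124129,105123938,814221834,
638061066,303302945,303302754,211816970,438309386,136348689,272647178,537527313,68224010,37782628,34735204] (Pick
123 [] Done (Pick 125 [] Done (Pick 126 [] Done (Pick 251 [] Done (Pick 253 [] Done (Pick 254 [] Done (Pick 239
[] (Pick 181 [(0,17)] Done Done) (Pick 247 [] (Pick 173 [(0,17)] Done Done) (Pick 61 [] (Pick 206 [(9,20),(5,17),
(5,14),(5,13)] (Pick 182 [(7,17),(4,12)] Done Done) (Pick 174 [(9,17)] Done Done)) (Pick 91 [] (Pick 174 [(9,21),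
(5,18),(5,15),(5,11)] (Pick 182 [(4,13),(4,8)] Done Done) (Pick 182 [(8,17)] Done Done)) (Pick 189 [] (Pick 206
[(9,20),(5,17),(5,14),(5,13)] (Pick 182 [(7,17),(4,12)] Done Done) (Pick 174 [(9,17)] Done Done)) (Pick 219 []
(Pick 174 [(9,21),(5,18),(5,15),(5,11)] (Pick 182 [(4,13),(4,8)] Done Done) (Pick 182 [(8,17)] Done Done)) (Pick
122 [] (Pick 60 [] Done (Pick 62 [] Done (Pick 94 [] Done (Pick 124 [] Done (Pick 143 [] Done (Pick 151 [] Done
(Pick 175 [] Done (Pick 183 [] Done (Pick 188 [] Done (Pick 190 [] Done (Pick 174 [(11,19),(11,12),(10,9)] (Pick
181 [(14,18),(0,15),(2,8)] Done Done) (Pick 181 [(13,20),(0,14),(2,8)] (Pick 173 [(9,15)] Done Done) (Pick 173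
[(11,17)] Done Done))))))))))))) (Pick 250 [(7,68),(6,66),(7,48),(6,46),(7,27),(6,26)] (Pick 60 [] Done (Pick 62
[] Done (Pick 94 [] Done (Pick 124 [] Done (Pick 143 [] Done (Pick 151 [] Done (Pick 175 [] Done (Pick 183 [] Done
(Pick 188 [] Done (Pick 190 [] Done (Pick 174 [(11,19),(11,12),(10,9)] (Pick 181 [(14,18),(0,15),(2,8)] Done Done)
(Pick 181 [(13,20),(0,14),(2,8)] (Pick 173 [(9,15)] Done Done) (Pick 173 [(11,17)] Done Done))))))))))))) (Pick
94 [] (Pick 62 [] Done (Pick 190 [(5,13),(4,12),(5,7),(4,6),(4,1),(2,0)] Done (Pick 173 [(1,9)] Done Done))) (Pick
222 [(3,51),(3,50),(2,47),(2,46),(3,37),(2,36)] (Pick 62 [] Done (Pick 190 [(5,13),(4,12),(5,7),(4,6),(4,1),(2,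
0)] Done (Pick 173 [(1,9)] Done Done))) (Pick 175 [] (Pick 211 [(4,16),(3,15),(0,12),(3,5)] Done (Pick 181 [(0,
13)] Done Done)) (Pick 183 [] (Pick 203 [(4,16),(3,15),(0,12),(3,5)] Done (Pick 173 [(0,13)] Done Done)) (Pick
207 [] (Pick 214 [(10,22),(8,20),(10,19),(6,17),(6,14),(6,13)] Done Done) (Pick 215 [] (Pick 206 [(10,22),(8,20),
(10,19),(6,17),(6,14),(6,13)] Done Done) (Pick 124 [] (Pick 62 [] Done (Pick 190 [(5,15),(4,14),(5,7),(4,6),(4,
1),(2,0)] Done (Pick 174 [(5,17)] Done Done))) (Pick 252 [(2,57),(3,56),(2,43),(3,42),(3,27),(2,26),(2,23),(3,22),
(3,5),(2,4),(2,1),(0,0)] (Pick 62 [] Done (Pick 190 [(5,15),(4,14),(5,7),(4,6),(4,1),(2,0)] Done (Pick 174 [(5,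
17)] Done Done))) (Pick 238 [] Done (Pick 246 [] Done (Pick 62 [] (Pick 203 [(3,9)] Done Done) (Pick 190 [(2,45),
(2,44),(3,41),(3,40),(3,29),(2,28),(3,5),(2,4)] (Pick 203 [(3,9)] Done Done) (Pick 143 [] Done (Pick 174 [(17,39),
(13,37),(9,36),(5,35),(5,34),(21,33),(19,32),(11,29),(9,28),(5,25),(5,23),(5,12)] (Pick 214 [(12,27),(8,22),(11,
21),(8,20),(7,19),(5,14),(5,13)] (Pick 206 [(5,15),(5,14)] Done (Pick 60 [] Done (Pick 188 [(12,16)] Done Done)))
(Pick 182 [(9,18),(7,17),(4,15),(4,13)] Done Done)) (Pick 206 [(16,27),(11,26),(13,25),(11,24),(9,23),(16,22),(9,
21),(7,20),(11,19),(7,18)] (Pick 182 [(11,22),(8,19),(7,18),(4,17),(4,16)] (Pick 60 [] Done (Pick 188 [(12,16)]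
Done Done)) (Pick 151 [(14,17)] Done Done)) Done)))))))))))))))))))))))))))))"
  "certificate [0,1,3,7,15,28,58,119] [31,151] [3443475,1410835,3484435,1388307,3483411,1386259,1664675,5842595] [60,
61,62,90,91,94,120,122,124,180,181,182,210,211,214,240,242,244] [9234,75924,148770,51233,16996,51300,51212,6244]
Done"
  "certificate [0,1,3,7,15,28,30,30] [31,94,158] [419603,420627] [61,62,124,188] [2,13] Done"
  "certificate [0,1,3,7,15,28,30,93] [31,94,157,220] [2778899,2779923] [61,62,124,188] [10,5] Done"
  "certificate [0,1,3,7,15,28,30,125] [31,94,157,188,220] [6973203] [62] [1] Done"
  "certificate [0,1,3,7,15,28,30,83] [31,94] [1730323,812819,1731347,813843] [61,62,124,151,155,214,218] [82,42,85,
45] Done"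
  "certificate [0,1,3,7,15,28,30,115] [31,94] [3827475,1861395,3828499,1862419] [61,62,124,151,155,214,218] [82,42,
85,45] Done"
  "certificate [0,1,3,7,15,28,30,123] [31,94,155,218] [7497491,5401363] [61,62,124,185,186,248] [18,45] Done"
  "certificate [0,1,3,7,15,28,62,61] [31,94,124,157,188] [] [] [] Done"
  "certificate [0,1,3,7,15,28,62,115] [31,94,124] [5663507,3828499,3566355,3581709] [61,151,155,210,214,218,244,248]
[165,83,77,139] Done"
  by (rule certificateI, simp, simp only: search_run cong: search_cong search_cong' if_weak_cong,
      (simp (no_asm_use) only: search_run; sat))+

lemma certificates_clique_19:
  "certificate [0,1,3,7,15,28,62,123] [31,94,124,155,218,248] [10906387] [61,185] [3] Done"
  "certificate [0,1,3,7,15,28,19,111] [31,143] [2926355,2934547,2927379,2935571] [61,62,87,91,173,174,199,203] [170,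
102,153,85] Done"
  "certificate [0,1,3,7,15,28,51,111] [31,143] [5875475,5883667,5876499,5884691] [61,62,87,91,173,174,199,203] [170,
102,153,85] Done"
  "certificate [0,1,3,7,15,28,59,59] [31,91,155] [6760211,2435859] [61,62,121,122,185,186] [42,21] Done"
  "certificate [0,1,3,7,15,28,59,119] [31,91,151,211] [2828051,6892307] [61,62,121,122,181,182,241,242] [170,85] Done"
  "certificate [0,1,3,7,15,30,30,30] [31,62,94,158] [839443] [] [0] (Dead 0)"
  "certificate [0,1,3,7,15,30,30,125] [31,62,94,157,188,220] [13946643] [] [0] (Dead 0)"
  "certificate [0,1,3,7,15,30,61,123] [31,62,93,124,155,186,217,248] [13455123] [] [0] (Dead 0)"
  by (rule certificateI, simp, simp only: search_run cong: search_cong search_cong' if_weak_cong,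
      (simp (no_asm_use) only: search_run; sat))+

lemma certificates_free_1:
  "certificate [0,0,2,2,14,6,42,126] [] [22695,39079,43175,28839,57511,57659,57563,29387,43827,29637] [150,154,158,
166,182,202,218,226,230,234] [8,32,1,2,128,784,832,580,276,84] Done"
  "certificate [0,0,2,3,15,7,42,126] [] [181663,312735,345503,230815,460191,235183,340623,211087,237211,350533] [150,
154,158,166,182,202,218,226,230,234] [8,32,1,2,128,580,784,832,84,276] Done"
  "certificate [0,0,3,2,15,7,42,126] [] [181663,312735,345503,230815,460191,350671,211087,208075,185503,345551,340487,
173155,287077,62993] [55,150,154,158,166,181,182,186,202,218,226,230,234,242] [16,256,2,4,1024,2120,6656,4616,6336,
8776,6240,616,585,6209] Done"
  "certificate [0,0,3,3,15,7,42,126] [] [363327,625471,691007,461631,920383,422175,371007,465719,470095,701327,680975,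
375207,346307,632429,125989,574153,356807,690827,886947,62413] [31,55,150,154,157,158,166,174,181,182,186,202,206,
218,226,230,234,242] [64,2048,4,8,16384,106496,99840,73888,73776,33328,99072,33313,8992,73761,98818,8738,37664,
139824,139809,37410] (Pick 31 [] Done (Pick 95 [(11,19)] Done (Pick 55 [] Done (Pick 119 [(15,18)] Done Done))))"
  "certificate [0,0,3,1,15,5,42,127] [] [52895] [] [0] (Dead 0)"
  "certificate [0,0,3,1,7,9,42,127] [] [26463] [] [0] (Dead 0)"
  "certificate [0,0,3,1,7,13,42,127] [] [52831] [] [0] (Dead 0)"
  "certificate [0,0,3,1,15,13,42,127] [] [105631] [] [0] (Dead 0)"
  "certificate [0,0,3,1,13,14,42,127] [] [198479,200335,137079,138935,385349,387205,312143,137143,463175,61069,212101]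
[151,167,181,182,185,199,203,214,217,218,226,230,233,234,248] [16384,8,4,16,2,4096,8512,1024,2177,2081,8960] Done"
  "certificate [0,0,3,1,15,14,42,127] [] [396959,400671,400743,397015,397159,624287,97635,918175,926359,423943,624347,
926419,96099,119453,639645,120989,95217,919399,479243,405203,551925] [149,151,155,157,167,173,182,185,203,205,211,
214,217,218,226,229,230,233,234,236,248] [1048576,64,128,1,16384,274688,131624,231424,67590,339968,274440,67594,
393256,589842,5138,327698,131114,495616,65594,136202,337922] (Pick 151 [] Done (Pick 157 [] Done (Pick 159 [] Done
(Pick 167 [] Done (Pick 175 [(15,20)] Done (Pick 173 [(16,19)] Done (Pick 237 [(17,11)] Done Done)))))))"
  "certificate [0,0,3,1,12,15,42,127] [] [198271,200255,198495,198559,342431,200351,463195,312171,341469,202587,239757,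
409949,174221,409941] [157,158,165,166,167,169,173,182,188,220,226,227,230,232,233,234,248] [8192,8,4,1024,53248,
32,4176,49216,36880,18512,16465,82384,16850,82768] Done"
  "certificate [0,0,3,1,6,15,42,127] [] [198255,200239,198479,198551,200343,459671,202571,463187,60533,276887,312171,
463179,48019,60525,239765,463951,239651,275933,59753,232079,410383,378983,377699,409949,377707,113555] [150,151,
157,165,166,167,169,171,173,174,181,182,186,188,214,218,226,227,229,230,232,233,234,236,242] [1048576,16,8,65536,
64,7077888,2228512,526624,4720672,6832128,6324480,540960,6291716,4718626,2097442,4735136,524582,4767776,8913186,
6295296,23071488,6822912,23072000,18884896,6292737,23068929] (Pick 167 [] Done (Pick 231 [(14,25),(14,24)] Done
(Pick 230 [(7,22),(7,20),(7,19)] Done (Pick 175 [(8,19)] Done (Pick 238 [(7,19)] Done (Pick 151 [] Done (Pick 159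
[(13,17)] Done Done)))))))"
  "certificate [0,0,3,1,14,15,42,127] [] [396527,400495,396975,397111,400695,919351,405163,926387,121077,624363,926379,
96051,121069,927919,626895,479299,551869,950957,119529,757959,819901,755395,227075,684839,348445,684855,348437,
820783,290355,755403,227091] [150,151,155,157,158,165,166,167,169,171,173,174,181,182,185,186,188,214,218,220,226,
227,229,230,232,233,234,236,242,248] [16777216,64,32,1048576,256,113246208,35652736,8397952,75505792,100926464,
8520832,100664328,75497602,75629184,109445120,8389770,75890816,33555594,142607490,109113344,838935680,369161216,
906048512,109096976,302064784,109084673,33621121,906570752,100727812,100717569,906036225] (Pick 167 [] Done (Pick
175 [(8,25),(8,23),(8,19)] Done (Pick 231 [(19,27),(19,24),(19,21)] Done (Pick 230 [(7,24),(7,23),(7,20)] Done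
(Pick 238 [(7,21),(7,20),(7,19)] Done (Pick 151 [] Done (Pick 159 [(12,16)] Done Done)))))))"
  "certificate [0,0,3,1,13,15,42,127] [] [396495,400463,396983,397111,400695,626895,479307,96051,121037,919759,415823,
479509,950949,365583,415863,757959,252101,684823,682917] [149,151,153,157,165,166,167,169,171,173,181,182,185,186,
214,217,218,226,229,230,232,233,234,244,248] [1048576,32,16,131072,128,6848512,524872,6291976,4718658,7094272,4784448,
2097738,2130504,7083008,4724032,6831104,29889600,6828033,13108292] (Pick 171 [(14,18)] Done Done)"
  "certificate [0,0,3,1,15,15,42,127] [] [792991,800927,794215,801383,192099,242077,1839519,1838695,958603,959013,
1253791,793887,793943,793959,1838623,1515911,1836319,1836391,956431,1858071,956455,1906887,1906823,1858055,817687,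
866503,866439,817671,731291,586341,923935,826471] [149,150,151,153,155,157,158,165,166,167,169,171,173,174,181,
182,185,186,211,214,217,218,220,226,227,229,230,232,233,234,236,242,248] [134217728,256,8388608,1024,805310496,
603980292,906493952,907018240,67113508,268440100,876085248,4295032960,129,2147516544,906084352,872660992,336134272,
336625792,262284,1140883604,4194466,285278432,285212808,1140850818,286556308,1145635040,1145569416,286523522,604143752,
805503106,538978504,538978450] (Pick 230 [(5,31),(5,29)] Done (Pick 238 [(17,27),(17,24),(8,20)] Done (Pick 233
[(4,26),(4,25)] Done (Pick 235 [(16,24),(16,23),(9,18)] Done (Pick 229 [(14,15)] Done (Pick 245 [(6,10)] Done (Pick
151 [] Done (Pick 215 [(9,18),(9,17)] Done Done))))))))"
  by (rule certificateI, simp, simp only: search_run cong: search_cong search_cong' if_weak_cong,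
      (simp (no_asm_use) only: search_run; sat))+

lemma certificates_free_2:
  "certificate [0,0,3,1,15,15,58,111] [] [530847,555151,531799,532071,555559,1466783,1173023,1445339,380507,876683,
1615115,487837,1160989,1705301,868949,1577375,610463,1610015,643103,1466767,1173007,1576551,805479,1707111,936039,
876763,1615195,792987,858267,564507,629787,1445331,380499,479645,1152797,1713525,877173,662869,923989,597589,858709,
484825,1517017,386905,1419097,1585567,618655,1618207,651295,1584743,813671,1715303,944231,793051,858331,564571,
629851,662901,924021,597621,858741,476625,1508817,378705,1410897] [31,55,61,87,91,93,94,118,121,122,151,157,165,
166,167,169,171,173,174,214,217,218,226,227,229,230,232,233,234,236] [67108864,8192,4096,4194304,32768,437780480,
436208000,404883456,402784772,34228224,33702020,304104448,302006786,135414784,134365442,455606272,302072448,304693248,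
452985472,437256320,436732160,456130560,403047168,406192128,452985600,33704064,34226180,404097024,143804416,142754052,
403046660,404881412,402786816,302007808,304103426,135413762,134366464,571098112,302597120,302071938,570572930,570575872,
142756864,142753798,570572806,453509696,304169152,302596672,455082176,454033936,405143824,404095504,455082256,403048736,
142756128,143802404,404095012,571097098,302596106,302072968,570573960,570573829,142754821,142755843,570574851]
(Pick 175 [] Done (Pick 191 [] Done (Pick 231 [] Done (Pick 235 [] Done (Pick 237 [] Done (Pick 238 [] Done (Pick
239 [] Done (Pick 247 [] Done (Pick 251 [] Done (Pick 253 [] Done (Pick 254 [] Done (Pick 255 [] Done (Pick 127
[] (Pick 151 [] Done (Pick 159 [(8,11)] Done (Pick 157 [(6,12)] Done (Pick 215 [(9,13)] Done Done)))) (Pick 223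
[] (Pick 55 [] Done (Pick 63 [(8,10)] Done (Pick 61 [(6,11)] Done (Pick 119 [(9,12)] Done Done)))) (Pick 167 []
(Pick 123 [] Done (Pick 125 [] Done (Pick 121 [(16,26),(12,23),(14,21),(4,20),(10,19),(4,9),(4,8),(7,7),(6,3)]
(Pick 122 [(7,15)] Done (Pick 126 [(5,17),(5,12)] Done Done)) (Pick 61 [] Done (Pick 63 [(12,17)] Done Done)))))
(Pick 173 [] (Pick 119 [] Done (Pick 118 [(10,23),(8,21),(10,19),(4,14)] (Pick 95 [] Done (Pick 122 [] Done (Pick
126 [(10,17)] Done (Pick 123 [(5,17),(11,13)] Done Done)))) (Pick 126 [(17,21),(4,20),(11,13),(4,12),(10,3)] Done
(Pick 55 [] Done (Pick 63 [(14,17)] Done Done))))) (Pick 183 [] (Pick 123 [] Done (Pick 125 [] Done (Pick 121 [(16,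
26),(12,23),(14,21),(4,20),(10,19),(4,9),(4,8),(7,7),(6,3)] (Pick 122 [(7,15)] Done (Pick 126 [(5,17),(5,12)] Done
Done)) (Pick 61 [] Done (Pick 63 [(12,17)] Done Done))))) (Pick 189 [] (Pick 119 [] Done (Pick 118 [(10,23),(8,
21),(10,19),(4,14)] (Pick 95 [] Done (Pick 122 [] Done (Pick 126 [(10,17)] Done (Pick 123 [(5,17),(11,13)] Done
Done)))) (Pick 126 [(17,21),(4,20),(11,13),(4,12),(10,3)] Done (Pick 55 [] Done (Pick 63 [(14,17)] Done Done)))))
(Pick 230 [] (Pick 63 [] Done (Pick 61 [(11,22),(12,21),(12,19),(4,7)] (Pick 95 [] Done (Pick 121 [] Done (Pick
125 [(6,15)] Done (Pick 123 [(5,17),(12,13)] Done Done)))) (Pick 125 [(17,22),(4,18),(4,13),(11,7),(10,3)] Done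
(Pick 55 [] Done (Pick 119 [(14,17)] Done Done))))) (Pick 233 [] (Pick 63 [] Done (Pick 55 [(16,24),(15,23),(12,
19),(6,7)] (Pick 95 [] Done (Pick 118 [] Done (Pick 119 [(6,15)] Done (Pick 126 [(4,17),(8,13)] Done Done)))) (Pick
119 [(17,21),(6,18),(6,10),(9,7),(8,5)] Done (Pick 61 [] Done (Pick 125 [(14,17)] Done Done))))) (Pick 234 [] (Pick
63 [] Done (Pick 119 [] Done (Pick 55 [(17,24),(18,23),(14,22),(11,20),(6,19),(6,12),(6,10),(9,9),(8,5)] (Pick
61 [(9,14)] Done (Pick 125 [(4,15),(7,11)] Done Done)) (Pick 31 [] Done (Pick 95 [(15,12)] Done Done))))) (Pick
246 [] (Pick 63 [] Done (Pick 61 [(11,22),(12,21),(12,19),(4,7)] (Pick 95 [] Done (Pick 121 [] Done (Pick 125 [(6,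
15)] Done (Pick 123 [(5,17),(12,13)] Done Done)))) (Pick 125 [(17,22),(4,18),(4,13),(11,7),(10,3)] Done (Pick 55
[] Done (Pick 119 [(14,17)] Done Done))))) (Pick 249 [] (Pick 63 [] Done (Pick 55 [(16,24),(15,23),(12,19),(6,7)]
(Pick 95 [] Done (Pick 118 [] Done (Pick 119 [(6,15)] Done (Pick 126 [(4,17),(8,13)] Done Done)))) (Pick 119 [(17,
21),(6,18),(6,10),(9,7),(8,5)] Done (Pick 61 [] Done (Pick 125 [(14,17)] Done Done))))) (Pick 250 [] (Pick 63 []
Done (Pick 119 [] Done (Pick 55 [(17,24),(18,23),(14,22),(11,20),(6,19),(6,12),(6,10),(9,9),(8,5)] (Pick 61 [(9,
14)] Done (Pick 125 [(4,15),(7,11)] Done Done)) (Pick 31 [] Done (Pick 95 [(15,12)] Done Done))))) (Pick 63 []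
(Pick 159 [] (Pick 123 [] Done (Pick 122 [(10,20),(8,18)] (Pick 95 [] Done (Pick 118 [] Done (Pick 119 [] Done
(Pick 126 [(6,16),(6,15)] Done Done)))) (Pick 126 [(16,22),(14,20)] Done (Pick 214 [] Done (Pick 215 [(5,15),(5,
13)] Done (Pick 222 [(5,18),(5,17),(12,14)] Done Done)))))) (Pick 151 [(25,33),(25,31),(25,16),(9,13),(9,11),(9,
5)] (Pick 157 [(20,29),(22,27),(7,17),(7,15),(16,13),(7,5)] (Pick 123 [] Done (Pick 126 [] Done (Pick 122 [(16,
24),(14,22),(10,20),(8,18)] (Pick 95 [] Done (Pick 118 [] Done (Pick 119 [(6,16),(6,15),(9,12)] Done Done))) (Pick
219 [] Done (Pick 222 [] Done (Pick 218 [(15,20),(13,19),(9,18),(7,17)] (Pick 95 [] Done (Pick 118 [] Done (Pick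
119 [(9,16),(8,15),(7,14)] Done Done))) (Pick 118 [] Done (Pick 119 [(6,16),(11,15)] Done Done)))))))) (Pick 221
[(6,24),(6,23),(6,22),(7,21),(6,20),(7,19),(17,14),(16,13),(7,12),(11,11),(6,10)] (Pick 95 [] Done (Pick 118 []
Done (Pick 119 [(7,15),(9,13),(5,12),(5,11)] Done Done))) Done)) (Pick 215 [(22,34),(22,33),(8,32),(9,31),(8,30),
(9,29),(8,28),(8,27),(20,20),(9,19),(9,18),(17,16),(8,15),(15,14),(8,13),(9,12),(12,11),(11,10),(7,6),(10,5)] (Pick
157 [(15,22),(17,20),(6,12),(6,10),(11,9)] (Pick 95 [] Done (Pick 118 [] Done (Pick 119 [(8,17),(7,15),(5,12),(5,
10)] Done Done))) (Pick 221 [(6,18),(6,17),(6,16),(6,15),(13,10)] Done Done)) Done))) (Pick 55 [(40,60),(39,59),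
(34,48),(34,46),(34,19),(12,18),(12,16),(13,6)] (Pick 61 [(27,46),(28,45),(29,44),(28,42),(8,22),(8,20),(21,18),
(9,6)] (Pick 159 [] (Pick 123 [] Done (Pick 126 [] Done (Pick 122 [(16,24),(14,22),(10,20),(8,18)] (Pick 95 []
Done (Pick 118 [] Done (Pick 119 [(6,16),(6,15),(9,12)] Done Done))) (Pick 219 [] Done (Pick 222 [] Done (Pick
218 [(15,20),(13,19),(9,18),(7,17)] (Pick 95 [] Done (Pick 118 [] Done (Pick 119 [(9,16),(8,15),(7,14)] Done Done)))
(Pick 118 [] Done (Pick 119 [(6,16),(11,15)] Done Done)))))))) (Pick 151 [(25,33),(25,31),(25,16),(9,13),(9,11),
(9,5)] (Pick 157 [(20,29),(22,27),(7,17),(7,15),(16,13),(7,5)] (Pick 123 [] Done (Pick 126 [] Done (Pick 122 [(16,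
24),(14,22),(10,20),(8,18)] (Pick 218 [] Done (Pick 219 [] Done (Pick 222 [] Done (Pick 229 [] Done (Pick 245 [(15,
15),(13,13),(11,12),(7,10)] Done Done))))) (Pick 219 [] Done (Pick 222 [] Done (Pick 218 [(15,20),(13,19),(9,18),
(7,17)] (Pick 229 [] Done (Pick 245 [(15,16),(13,14),(11,11),(10,10)] Done Done)) (Pick 118 [] Done (Pick 119 [(6,
16),(11,15),(6,14)] Done Done)))))))) (Pick 221 [(6,24),(6,23),(6,22),(7,21),(6,20),(7,19),(17,14),(16,13),(7,12),
(11,11),(6,10),(9,9)] (Pick 95 [] Done (Pick 121 [] Done (Pick 125 [(10,15),(10,13),(5,9),(5,7)] Done (Pick 123
[(5,12)] Done Done)))) Done)) (Pick 215 [(22,34),(22,33),(8,32),(9,31),(8,30),(9,29),(8,28),(8,27),(20,20),(9,19),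
(9,18),(17,16),(8,15),(15,14),(8,13),(9,12),(12,11),(11,10),(7,6),(10,5)] (Pick 157 [(15,22),(17,20),(6,12),(6,
10),(11,9)] (Pick 95 [] Done (Pick 118 [] Done (Pick 119 [(8,17),(7,15),(5,12),(5,10)] Done (Pick 126 [(5,14)]
Done Done)))) (Pick 221 [(6,18),(6,17),(6,16),(6,15),(13,10),(12,9)] Done Done)) (Pick 87 [] Done (Pick 95 [] Done
(Pick 118 [] Done (Pick 119 [] Done (Pick 126 [(8,14)] Done Done)))))))) (Pick 125 [(9,42),(9,41),(7,38),(7,37),
(9,36),(7,35),(9,34),(7,33),(20,30),(20,29),(7,27),(7,26),(9,19),(23,18),(22,17),(9,16),(7,15),(14,14),(7,13),(12,
12),(16,10),(10,8),(14,6),(8,5)] (Pick 159 [] (Pick 95 [] Done (Pick 118 [] Done (Pick 119 [(10,18),(9,17),(7,15),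
(9,13)] Done Done))) (Pick 157 [(18,31),(20,30),(6,16),(6,15),(14,14),(6,5)] (Pick 151 [(15,20),(15,18),(6,10),
(6,8),(6,5)] (Pick 95 [] Done (Pick 122 [] Done (Pick 123 [(9,16),(7,14)] Done (Pick 126 [] Done (Pick 91 [(15,
12),(13,11)] (Pick 94 [(13,8),(11,6)] (Pick 118 [] Done (Pick 119 [(10,12)] Done Done)) Done) (Pick 94 [(11,8)]
Done Done)))))) (Pick 215 [(6,18),(6,17),(5,16),(5,15),(5,11),(5,10)] Done Done)) (Pick 221 [(13,27),(13,26),(5,
25),(6,24),(5,23),(6,22),(6,19),(6,18),(16,17),(12,12),(5,11),(10,10)] (Pick 151 [(10,15),(10,13),(5,8),(5,6)]
Done Done) Done))) (Pick 151 [] Done (Pick 215 [(7,10),(7,9)] Done (Pick 159 [(7,16),(7,15)] Done Done))))) (Pick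
119 [(39,54),(40,53),(31,50),(31,49),(13,48),(13,47),(13,46),(11,45),(13,44),(11,43),(11,42),(11,41),(13,32),(11,
29),(11,28),(27,27),(13,26),(13,25),(25,24),(24,23),(11,20),(21,19),(11,18),(19,17),(13,16),(17,15),(16,14),(16,
12),(14,10),(9,7),(12,6),(12,5)] (Pick 61 [(21,38),(22,37),(23,36),(22,34),(7,17),(7,15),(15,13)] (Pick 159 []
(Pick 95 [] Done (Pick 121 [] Done (Pick 125 [(10,17),(12,15),(8,14),(8,13)] Done Done))) (Pick 151 [(20,27),(20,
26),(20,12),(8,11),(8,10),(8,5)] (Pick 157 [(15,22),(17,20),(6,13),(6,11),(6,5)] (Pick 95 [] Done (Pick 122 []
Done (Pick 126 [(12,18),(10,16)] Done (Pick 123 [] Done (Pick 91 [(15,11),(13,9)] (Pick 94 [(13,7),(11,6)] (Pick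
121 [] Done (Pick 125 [(10,11)] Done Done)) Done) (Pick 94 [(11,7)] Done Done)))))) (Pick 221 [(5,18),(5,17),(6,
16),(6,15),(13,11),(12,10)] Done Done)) (Pick 215 [(17,27),(17,26),(7,25),(8,24),(7,23),(8,22),(15,15),(8,14),(8,
13),(12,12),(7,11),(10,10)] (Pick 157 [(10,15),(12,13),(5,8),(5,6)] Done Done) Done))) (Pick 125 [(7,31),(7,30),
(7,29),(7,28),(15,25),(15,24),(7,22),(7,21),(19,14),(18,13),(12,12),(11,11),(15,9),(9,8),(13,6),(7,5)] (Pick 159
[] Done (Pick 151 [(17,23),(17,22),(8,11),(8,10),(8,5)] (Pick 157 [(12,18),(14,17),(6,11),(6,10)] Done Done) (Pick
215 [(8,20),(8,19),(13,13),(8,12),(8,11)] Done Done))) (Pick 95 [] Done (Pick 31 [(18,15),(16,14)] (Pick 93 [(15,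
9),(15,8)] (Pick 121 [] Done (Pick 123 [(10,15)] Done Done)) Done) (Pick 93 [(13,9)] Done Done))))) (Pick 159 []
Done (Pick 215 [] Done (Pick 151 [(17,24),(18,23),(14,22),(13,21)] (Pick 125 [] Done (Pick 61 [(16,20),(15,19),
(10,18),(10,17)] (Pick 31 [] Done (Pick 87 [] Done (Pick 95 [] Done (Pick 118 [] Done (Pick 126 [(8,16)] Done Done)))))
Done)) (Pick 61 [] Done (Pick 125 [(18,18),(18,17),(6,16)] Done Done))))))))))))))))))))))))))))))))"
  by (rule certificateI, simp, simp only: search_run cong: search_cong search_cong' if_weak_cong,
      (simp (no_asm_use) only: search_run; sat))+

lemma certificates_free_3:
  "certificate [0,0,3,1,15,15,58,127] [] [1579423,2515359,1603727,1580375,1580647,1604135,2493915,1925259,487837,3802453,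
1595551,1580319,1587599,1604111,1906703,3807247,1579479,1580631,3708951,1972247,1580391,1596007,1603751,1588775,
3708967,1906727,1677383,3807303,1906823,3807367,3709191,1972487,3709447,1907207,1678343,3808263,1685511,1980423,
1693703,1988615,1580575,1595935,1588495,1588751,1595607,1595991,1579495,1595623,1587623,1588519,3676319,1841439,
3676559,1652879,1661071,1734671,1612119,1711191,1841559,1613079,3676775,1645671,3677735,1849895,1858087,1636391,
1711431,1646151,1734791,1636871,1841695,3676703,1646095,3677711,1653775,1719311,1628247,1726551,1628695,1858071,
1644775,3676391,1841575,3676583,1620263,1849639,1661127,1726663,1621255,1719559] [149,150,151,153,155,157,158,165,
166,167,169,171,173,174,181,182,185,210,211,213,214,216,217,218,220,226,227,229,230,232,233,234,236,242,248] [538968064,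
3503292416,258,129,33685504,1032,3233812512,269488676,2425356804,1077940772,8592032000,2162816,9126805506,17410,
262284,4457473,536936449,33587201,131348,41943058,163968,17180001280,16648,17213423624,17826049,16777378,545259592,
2098272,67110401,1140850824,33556994,2147617024,4563402882,4294971649,2149590016,536883208,541720576,37224448,1243611136,
939655168,35766272,8592081920,25769869442,17213505538,25769869569,25769837569,537116672,17180082432,9126854664,
25769836680,1279918336,2155882696,1246494722,604113428,35916308,4715447297,604244492,4345311266,2155881553,69469716,
4701291520,2155882642,957874184,4330631264,553791584,1279525121,4311880032,2155874641,4581752968,1145831554,4336971848,
4702520320,2149927188,944586754,19327559828,21526294529,27045134604,30484202530,9733177492,9135239249,612452882,
1278820608,2164450400,1259913224,9198406145,10739558624,17221880401,21760245984,25841894914,30083125512] (Pick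
191 [] Done (Pick 223 [] Done (Pick 239 [] Done (Pick 247 [] Done (Pick 251 [] Done (Pick 253 [] Done (Pick 254
[] Done (Pick 255 [] Done (Pick 183 [] (Pick 217 [(4,18)] Done (Pick 218 [(1,16)] Done Done)) (Pick 189 [] (Pick
214 [(4,18)] Done (Pick 215 [(1,13)] Done Done)) (Pick 246 [] (Pick 157 [(4,18)] Done (Pick 159 [(3,13)] Done Done))
(Pick 249 [] (Pick 151 [(3,17)] Done (Pick 159 [(4,12)] Done Done)) (Pick 250 [] (Pick 151 [(3,17)] Done (Pick
157 [(4,17)] Done Done)) (Pick 159 [] (Pick 234 [(1,20),(1,19),(1,18),(1,17)] Done Done) (Pick 175 [] (Pick 218
[(1,20),(1,19),(1,18),(1,17)] Done Done) (Pick 215 [] (Pick 233 [(2,20),(2,19),(2,18),(2,17)] Done Done) (Pick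
219 [] (Pick 167 [(2,20),(2,19),(2,18),(2,17)] Done Done) (Pick 221 [] (Pick 230 [(2,20),(2,19),(2,18),(2,17)]
Done Done) (Pick 222 [] (Pick 173 [(2,20),(2,19),(2,18),(2,17)] Done Done) (Pick 231 [] (Pick 217 [(2,20),(2,19),
(2,18),(2,17)] Done Done) (Pick 235 [] (Pick 151 [(2,20),(2,19),(2,18),(2,17)] Done Done) (Pick 237 [] (Pick 214
[(2,20),(2,19),(2,18),(2,17)] Done Done) (Pick 238 [] (Pick 157 [(2,20),(2,19),(2,18),(2,17)] Done Done) (Pick
151 [(7,89),(7,87),(7,68),(7,66),(8,31),(9,29)] (Pick 248 [(10,39),(8,38),(8,36),(10,35)] Done (Pick 233 [(4,36),
(4,31),(4,28),(1,18)] (Pick 181 [(4,17)] Done (Pick 182 [(3,16)] Done Done)) (Pick 217 [(4,29),(1,19),(1,14),(1,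
2)] Done (Pick 234 [(1,29),(1,28),(1,26),(1,24),(1,23),(1,20),(3,11)] (Pick 216 [(2,16),(1,13)] Done Done) (Pick
218 [(1,23),(1,22),(1,21),(3,20),(3,13),(3,11),(2,2)] Done Done))))) (Pick 167 [(7,73),(7,71),(7,55),(7,53),(8,
37),(8,35),(9,33),(9,27),(8,19),(9,15),(8,6),(7,5),(5,4),(4,1)] (Pick 248 [(12,42),(11,41),(11,36),(12,35)] Done
(Pick 217 [(4,38),(4,34),(4,30),(1,20)] (Pick 181 [(2,16)] Done (Pick 182 [(4,15)] Done Done)) (Pick 233 [(4,31),
(1,18),(1,10),(1,2)] Done (Pick 218 [(1,29),(1,28),(1,27),(1,25),(1,23),(1,19),(3,14)] (Pick 232 [(4,16),(1,13)]
Done Done) (Pick 234 [(1,23),(1,22),(1,21),(3,18),(3,12),(3,6),(2,2)] Done Done))))) (Pick 157 [(5,69),(5,60),(3,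
55),(5,53),(3,46),(5,45),(5,29),(5,25),(3,23)] (Pick 214 [(2,30),(2,24),(2,15),(2,14)] Done (Pick 230 [(2,30),(2,
28),(2,24),(2,21),(2,17),(2,13),(2,12),(1,0)] (Pick 181 [(3,18)] Done (Pick 182 [(4,15)] Done (Pick 185 [(1,15)]
Done Done))) (Pick 218 [(1,21),(1,16),(1,13),(1,9),(1,4)] Done (Pick 210 [(7,19),(6,17)] Done (Pick 155 [(5,11)]
Done Done))))) (Pick 173 [(5,58),(3,57),(3,55),(5,52),(3,50),(5,46),(3,43),(5,40),(3,37),(3,35),(5,33),(3,32),(3,
28),(5,25),(5,24),(3,22),(5,20),(3,18),(3,13),(3,4),(2,1),(2,0)] (Pick 230 [(2,32),(2,23),(2,18),(2,13)] Done (Pick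
214 [(2,32),(2,26),(2,25),(2,21),(2,14),(2,13),(2,11),(1,0)] (Pick 153 [(4,15)] Done (Pick 185 [(2,16),(5,11)]
Done Done)) (Pick 218 [(1,24),(1,23),(1,20),(1,18),(1,17),(1,16),(1,14),(1,11)] (Pick 149 [(3,17),(2,15)] Done
(Pick 171 [(7,8)] Done Done)) Done))) (Pick 214 [(1,38),(1,32),(1,31),(1,30),(1,28),(1,25),(1,19),(1,17),(1,16),
(1,13),(1,12),(1,9),(1,3)] (Pick 217 [(1,22),(1,17),(1,13),(1,9),(1,5)] Done (Pick 153 [(7,19),(6,17)] Done (Pick
155 [(6,10)] Done Done))) (Pick 217 [(2,24),(2,23),(2,22),(2,20),(2,18),(2,17),(2,14),(2,13)] (Pick 150 [(3,19),
(2,17)] Done (Pick 158 [(2,11)] Done Done)) Done)))))))))))))))))))))))))))))"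
  by (rule certificateI, simp, simp only: search_run cong: search_cong search_cong' if_weak_cong,
      (simp (no_asm_use) only: search_run; sat))+

lemma certificates_free_4:
  "certificate [0,0,3,3,13,7,58,127] [] [1250719,923039,1257887,833695,829679,1108591,830063,1110639,923055,931375,
1250711,834711,736407,826519,736279,1774615,1108583,327207,933415,929319,327175,1370631,842759,994311,838663,986119,
923035,1770579,955539,955411,1774611,838723,830061,961061,1362693,986373,1370629,961029,1769817,1360713,955921,
961041,955543,1774743,826391,728087,822503,920999,1370663,961063,323079,929287,850951,998407,1253851,734299,931355,
1368651,845899,1250707,923027,960659,1773853,834077,1102701,326413,988429,1108581,830053,955941,845903,988431,960663,
822375,955943,920967,1245659,726107,1368683,931347,1773981,1098605,322317,834069,953511,996379,322123,928915,726301,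
850445,826917] [143,149,151,153,155,157,158,165,166,167,171,173,174,181,182,185,202,203,206,213,214,216,217,218,
220,226,227,229,230,233,234,241,242,244,248] [541130752,8388680,1891631104,1350567424,1342187008,269549568,1073743104,
1355808768,12591200,1086324832,1614942208,33555968,8858370176,18320721408,8992628736,2151849984,278134800,2151677954,
2097248,4320133216,2152226816,8858656768,18795200512,4707057664,1612709888,42991616,8390768,2160074784,67111457,
161,2147491848,1623195680,1073747460,16777765,9932120576,1351614976,8589943040,515,2151686688,8858378784,268444193,
4203041,67240457,2218918016,18253644928,25803399168,1149249040,1098920032,8875409410,17039649,6444572672,4303372354,
709361664,406323200,19063113760,10083115040,1082155120,27112005664,2017591328,1610618888,71776,272894497,6455075328,
1082177024,4577034756,2227708416,282853888,9437460,67092,272761381,2013265928,14156032,268698121,1082131600,4325665,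
1082134594,574621728,8640274464,27111981058,90208,6455033984,271581700,2216698368,108032,83960353,1485832210,2185388064,
4307552608,8860770816,1623724160,18522048012] (Pick 191 [] Done (Pick 223 [] Done (Pick 239 [] Done (Pick 247 []
Done (Pick 251 [] Done (Pick 253 [] Done (Pick 254 [] Done (Pick 255 [] Done (Pick 183 [] (Pick 157 [] Done (Pick
159 [] Done (Pick 189 [(14,12),(13,2),(12,0)] Done (Pick 155 [] Done (Pick 187 [(11,18),(4,1)] Done (Pick 153 []
Done (Pick 185 [(16,15),(15,12)] Done Done))))))) (Pick 189 [] (Pick 167 [] Done (Pick 175 [(14,13),(13,5),(12,
3)] Done (Pick 151 [] Done (Pick 159 [(19,14)] Done (Pick 215 [(10,3)] Done (Pick 214 [(10,2),(9,1)] Done Done))))))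
(Pick 219 [] (Pick 157 [] Done (Pick 159 [] Done (Pick 221 [(13,12),(12,11),(11,3)] Done (Pick 143 [] Done (Pick
207 [(7,13),(11,11),(10,0)] Done (Pick 149 [] Done (Pick 151 [] Done (Pick 215 [(8,13)] Done Done)))))))) (Pick
221 [] (Pick 167 [] Done (Pick 175 [(13,17),(13,11),(12,2)] Done (Pick 155 [] Done (Pick 159 [] Done (Pick 171
[] Done (Pick 187 [(0,12),(1,11)] Done (Pick 151 [] Done (Pick 215 [(16,18),(10,14)] Done Done)))))))) (Pick 231
[] (Pick 157 [] Done (Pick 159 [(13,17),(14,11),(13,0)] Done (Pick 155 [] Done (Pick 187 [(16,20),(10,18)] Done
(Pick 153 [(11,4)] Done (Pick 185 [(10,10)] Done Done)))))) (Pick 238 [] (Pick 157 [] Done (Pick 159 [(8,23),(8,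
22),(8,21),(8,20),(8,18),(14,17)] Done (Pick 143 [] Done (Pick 207 [(14,14)] Done Done)))) (Pick 250 [] (Pick 143
[] Done (Pick 207 [(13,13),(13,12)] Done (Pick 157 [] Done (Pick 159 [(6,15),(11,10),(6,0)] Done (Pick 149 [] Done
(Pick 151 [(2,3)] Done (Pick 215 [(15,17)] Done Done))))))) (Pick 159 [] (Pick 175 [] Done (Pick 167 [(19,24),(19,
18),(18,6),(17,4)] (Pick 181 [] Done (Pick 182 [] Done (Pick 185 [] Done (Pick 187 [] Done (Pick 244 [(5,16)] Done
Done))))) (Pick 181 [] Done (Pick 245 [(3,6),(3,4),(2,2)] Done (Pick 217 [] Done (Pick 218 [] Done (Pick 222 [(1,
19)] Done (Pick 235 [] Done (Pick 234 [(13,28),(14,24),(14,23),(14,19),(13,15),(13,11),(11,9),(10,6),(9,4)] (Pick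
227 [(14,8)] Done Done) (Pick 227 [(17,13),(14,6)] (Pick 165 [] Done (Pick 171 [] Done (Pick 187 [(2,9)] Done Done)))
(Pick 243 [(4,11)] Done (Pick 241 [(13,17)] Done Done)))))))))))) (Pick 157 [(31,89),(39,88),(27,82),(27,80),(27,
65),(27,62),(27,50),(38,43),(38,36),(37,34),(30,24),(35,12),(28,2),(27,0)] (Pick 175 [] (Pick 181 [] Done (Pick
182 [] Done (Pick 185 [] Done (Pick 187 [] Done (Pick 244 [(4,16)] Done Done))))) (Pick 167 [(21,26),(21,19),(20,
6),(19,4)] (Pick 181 [] Done (Pick 182 [] Done (Pick 185 [] Done (Pick 187 [] Done (Pick 244 [(5,17)] Done (Pick
252 [(5,16)] Done Done)))))) (Pick 222 [] Done (Pick 218 [(1,25),(2,6),(2,4),(2,3)] (Pick 165 [] Done (Pick 173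
[(4,6)] Done Done)) (Pick 245 [] Done (Pick 249 [] Done (Pick 235 [] (Pick 151 [(14,8)] Done Done) (Pick 234 [(15,
36),(16,33),(16,30),(16,28),(16,27),(16,25),(16,22),(15,17),(15,12),(13,10),(13,8),(11,6),(10,4)] (Pick 181 []
Done (Pick 182 [] Done (Pick 190 [(5,20)] Done (Pick 246 [(4,13)] Done (Pick 242 [(9,18),(15,8),(9,2)] Done Done)))))
(Pick 171 [] Done (Pick 187 [(4,22),(2,11),(2,10),(1,1)] Done (Pick 185 [(14,20),(13,18),(12,12),(4,9)] Done Done)))))))))))
(Pick 235 [] (Pick 167 [] Done (Pick 175 [(17,20),(15,13),(14,11),(14,8),(12,7),(11,4),(11,2)] Done (Pick 190 []
Done (Pick 158 [(3,23),(3,16)] (Pick 151 [(16,10)] Done (Pick 215 [(3,9)] Done Done)) (Pick 181 [(1,20),(1,18)]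
Done (Pick 245 [(1,20),(12,19),(1,17),(12,16)] Done Done)))))) (Pick 234 [(7,75),(5,70),(5,61),(30,57),(5,56),(5,
55),(5,45),(7,15),(6,6),(5,0)] (Pick 175 [] Done (Pick 167 [(19,23),(17,15),(16,12),(16,9),(14,8),(13,5),(12,3),
(12,2)] (Pick 149 [] Done (Pick 151 [(5,8)] Done Done)) (Pick 207 [] Done (Pick 143 [(9,27),(10,17),(12,12),(12,
11),(11,1)] (Pick 151 [(14,10)] Done Done) (Pick 206 [(15,23),(17,20),(1,18),(16,14)] (Pick 181 [(9,16),(9,12),
(8,3)] Done Done) (Pick 181 [(10,16),(9,4)] Done (Pick 203 [(14,14)] Done Done))))))) (Pick 245 [] (Pick 167 []
Done (Pick 175 [(15,10),(14,8),(13,3),(12,1)] Done (Pick 187 [] Done (Pick 171 [(4,23),(1,22),(1,14),(0,12)] (Pick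
155 [(3,12)] Done (Pick 143 [] Done (Pick 207 [(4,16)] Done Done))) (Pick 218 [(0,19),(0,16)] Done (Pick 222 [(0,
18),(0,17)] Done Done)))))) (Pick 181 [(1,66),(31,56),(31,54),(31,52),(31,49),(31,39),(32,33),(1,7),(1,3),(0,0)]
(Pick 175 [] Done (Pick 167 [(17,12),(16,11),(15,8),(14,3),(13,1)] (Pick 173 [(16,11)] Done (Pick 153 [] Done (Pick
155 [] Done (Pick 187 [(9,14)] Done Done)))) (Pick 217 [] Done (Pick 249 [(2,20),(2,8),(2,6)] Done (Pick 187 []
Done (Pick 171 [(4,24),(1,23),(4,14),(1,13),(0,11)] (Pick 173 [(17,9)] Done (Pick 237 [(12,15),(11,8)] Done Done))
(Pick 218 [(0,19),(0,15)] (Pick 143 [] Done (Pick 151 [] Done (Pick 215 [(6,11)] Done Done))) (Pick 222 [(0,18),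
(0,17)] Done Done)))))))) (Pick 222 [] (Pick 175 [] Done (Pick 167 [(13,27),(14,26),(14,21),(14,18),(12,10),(11,
6),(10,5),(9,4),(9,3)] (Pick 173 [(13,8)] Done Done) (Pick 143 [(10,15),(10,1)] Done Done))) (Pick 218 [(17,56),
(21,49),(21,46),(21,42),(21,41),(21,37),(21,36),(17,26),(17,20),(19,13),(15,11),(14,9),(13,7),(15,4)] (Pick 230
[] Done (Pick 246 [(0,19),(17,18),(16,14),(15,13),(0,12),(13,10),(12,9),(0,2)] Done (Pick 217 [] Done (Pick 237
[] Done (Pick 229 [(16,22),(19,19),(15,13),(2,12),(15,1)] (Pick 233 [(6,18)] Done (Pick 167 [] Done (Pick 175 [(8,
18),(9,17),(9,14)] Done Done))) (Pick 233 [(15,19),(6,18),(15,7)] Done Done)))))) (Pick 175 [] (Pick 220 [(16,11),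
(12,3)] (Pick 149 [] Done (Pick 151 [] Done (Pick 155 [] Done (Pick 187 [(12,15)] Done Done)))) (Pick 252 [(4,11)]
Done (Pick 244 [(11,17)] Done Done))) (Pick 167 [(18,42),(20,38),(20,37),(20,31),(20,29),(20,27),(20,24),(17,10),
(16,9),(17,8),(14,6),(15,5),(12,2),(11,1)] (Pick 158 [] Done (Pick 190 [(5,21),(2,11),(2,10),(1,1)] Done (Pick
182 [(14,20),(15,18),(5,11),(13,9)] Done Done))) (Pick 187 [] (Pick 174 [(14,13)] Done Done) (Pick 171 [(9,25),
(0,14),(0,13),(0,11)] (Pick 174 [(16,14),(12,1)] (Pick 155 [(14,15)] Done Done) (Pick 155 [(13,16)] Done Done))
(Pick 155 [(14,24),(17,22),(4,18),(16,16),(18,13),(17,7),(11,6)] (Pick 174 [(8,14),(12,3)] Done (Pick 185 [(13,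
1)] Done Done)) Done))))))))))))))))))))))))))))"
  by (rule certificateI, simp, simp only: search_run cong: search_cong search_cong' if_weak_cong,
      (simp (no_asm_use) only: search_run; sat))+

lemma certificates_free_5:
  "certificate [0,0,0,2,12,7,63,127] [] [262655,263423,263039,264767,265279,181725,459205,230905,459601,394071,394471,
183495,207687,330299,459323,185813,459545,459149,234993,426327,458983] [202,203,206,212,213,214,216,217,218,220,
226,227,228,229,230,233,234,236,241,242,244,248] [64,4096,1024,8,1,1073664,66432,1049472,84224,3229696,3235840,
1171456,1394688,1835776,230144,1329664,123136,76544,1059584,1067654,90544] (Pick 217 [(6,14),(7,13)] Done (Pick
233 [(14,18)] Done Done))"
  "certificate [0,0,0,2,13,7,63,127] [] [525311,526079,530559,918409,919201,415375,461809,526719,529535,371625,918299,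
919091,917965,918757,852543,852207,559483,671997,788031,787695,656251,655869] [202,203,206,209,211,212,213,214,
216,217,218,220,225,226,227,228,229,230,233,234,236,241,242,244,248] [256,8192,1,527872,672768,11157504,10489344,
36864,40,10635776,609360,984640,722624,1657920,8587276,2179618,8525892,2146882,26148872,20529184,12590160,6325952]
(Pick 211 [(10,13)] Done (Pick 214 [(11,11)] Done (Pick 209 [(8,13)] Done (Pick 212 [(8,12)] Done Done))))"
  by (rule certificateI, simp, simp only: search_run cong: search_cong search_cong' if_weak_cong,
      (simp (no_asm_use) only: search_run; sat))+

lemmas certificates_clique = certificates_clique_1 certificates_clique_2 certificates_clique_3
  certificates_clique_4 certificates_clique_5 certificates_clique_6 certificates_clique_7
  certificates_clique_8 certificates_clique_9 certificates_clique_10 certificates_clique_11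
  certificates_clique_12 certificates_clique_13 certificates_clique_14 certificates_clique_15
  certificates_clique_16 certificates_clique_17 certificates_clique_18 certificates_clique_19

lemmas certificates_free = certificates_free_1 certificates_free_2 certificates_free_3
  certificates_free_4 certificates_free_5

subsection \<open>Reduction to the individual graphs\<close>

lemma critical_familyD:
  assumes "critical_family U E F"
  shows "finite U" "E \<subseteq> [U]\<^bsup>2\<^esup>" "N \<in> F \<Longrightarrow> N \<subseteq> U" "finite F"
    "good_colouring U E c \<Longrightarrow> \<exists>N\<in>F. \<not> splittable E c N"
    "N \<in> F \<Longrightarrow> \<exists>c. good_colouring U E c \<and> (\<forall>N'\<in>F - {N}. splittable E c N')"
    "K \<subseteq> U \<Longrightarrow> clique K E \<Longrightarrow> card K \<noteq> 6"
    "N \<in> F \<Longrightarrow> K \<subseteq> N \<Longrightarrow> clique K E \<Longrightarrow> card K \<noteq> 5"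
proof -
  show "finite U" "E \<subseteq> [U]\<^bsup>2\<^esup>" "N \<in> F \<Longrightarrow> N \<subseteq> U"
    using assms by (auto simp: critical_family_def)
  show "finite F" using assms unfolding critical_family_def by (metis finite_Pow_iff finite_subset)
  show "good_colouring U E c \<Longrightarrow> \<exists>N\<in>F. \<not> splittable E c N"
    using assms by (simp add: critical_family_def)
  show "N \<in> F \<Longrightarrow> \<exists>c. good_colouring U E c \<and> (\<forall>N'\<in>F - {N}. splittable E c N')"
    using assms by (simp add: critical_family_def)
  show "K \<subseteq> U \<Longrightarrow> clique K E \<Longrightarrow> card K \<noteq> 6"
    using assms by (simp add: critical_family_def)
  show "N \<in> F \<Longrightarrow> K \<subseteq> N \<Longrightarrow> clique K E \<Longrightarrow> card K \<noteq> 5"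
    using assms by (simp add: critical_family_def)
qed

lemma nsets2D: "{x, y} \<in> E \<Longrightarrow> E \<subseteq> [U]\<^bsup>2\<^esup> \<Longrightarrow> x \<in> U \<and> y \<in> U \<and> x \<noteq> y"
  using simple_graph_edgeD[of U E x y] by (auto simp: nsets_def card_2_iff subset_iff doubleton_eq_iff)

lemma image_edge_iff:
  assumes "inj_on f U" "E \<subseteq> [U]\<^bsup>2\<^esup>" "x \<in> U" "y \<in> U"
  shows "{f x, f y} \<in> (`) f ` E \<longleftrightarrow> {x, y} \<in> E"
proof -
  have "f ` {x, y} \<in> (`) f ` E \<longleftrightarrow> {x, y} \<in> E"
    using assms by (intro inj_on_image_mem_iff[OF inj_on_image_Pow[OF assms(1)]]) (auto simp: nsets_def)
  then show ?thesis by simp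
qed

lemma good_colouring_image:
  assumes "inj_on f U" "E \<subseteq> [U]\<^bsup>2\<^esup>"
  shows "good_colouring (f ` U) ((`) f ` E) c \<longleftrightarrow> good_colouring U E (\<lambda>e. c (f ` e))"
  using image_edge_iff[OF assms] by (simp add: good_colouring_def)

lemma splittable_image:
  assumes "inj_on f U" "E \<subseteq> [U]\<^bsup>2\<^esup>" "N \<subseteq> U"
  shows "splittable ((`) f ` E) c (f ` N) \<longleftrightarrow> splittable E (\<lambda>e. c (f ` e)) N"
proof -
  have iff: "{f x, f y} \<in> (`) f ` E \<longleftrightarrow> {x, y} \<in> E" if "x \<in> N" "y \<in> N" for x y
    using image_edge_iff[OF assms(1,2)] that assms(3) by blast
  have diff: "f ` N - f ` X = f ` (N - X)" if "X \<subseteq> N" for X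
    using inj_on_image_set_diff[of f U N X] assms that by auto
  have "(\<forall>x\<in>f ` X. \<forall>y\<in>f ` X. {x, y} \<in> (`) f ` E \<longrightarrow> \<not> c {x, y}) \<and>
        (\<forall>x\<in>f ` N - f ` X. \<forall>y\<in>f ` N - f ` X. {x, y} \<in> (`) f ` E \<longrightarrow> c {x, y}) \<longleftrightarrow>
      (\<forall>x\<in>X. \<forall>y\<in>X. {x, y} \<in> E \<longrightarrow> \<not> c (f ` {x, y})) \<and>
        (\<forall>x\<in>N - X. \<forall>y\<in>N - X. {x, y} \<in> E \<longrightarrow> c (f ` {x, y}))" if X: "X \<subseteq> N" for X
  proof -
    have "x \<in> X \<Longrightarrow> x \<in> N" for x using X by blast
    then show ?thesis unfolding diff[OF X] by (simp add: iff)
  qed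
  note eq = this
  show ?thesis
  proof
    assume "splittable ((`) f ` E) c (f ` N)"
    then obtain X where X: "X \<subseteq> N" "(\<forall>x\<in>f ` X. \<forall>y\<in>f ` X. {x, y} \<in> (`) f ` E \<longrightarrow> \<not> c {x, y}) \<and>
        (\<forall>x\<in>f ` N - f ` X. \<forall>y\<in>f ` N - f ` X. {x, y} \<in> (`) f ` E \<longrightarrow> c {x, y})"
      unfolding splittable_def subset_image_iff by (elim exE conjE) simp
    then show "splittable E (\<lambda>e. c (f ` e)) N"
      unfolding splittable_def by (intro exI[of _ X] conjI[OF X(1)] iffD1[OF eq[OF X(1)] X(2)])
  next
    assume "splittable E (\<lambda>e. c (f ` e)) N"
    then obtain X where X: "X \<subseteq> N" "(\<forall>x\<in>X. \<forall>y\<in>X. {x, y} \<in> E \<longrightarrow> \<not> c (f ` {x, y})) \<and>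
        (\<forall>x\<in>N - X. \<forall>y\<in>N - X. {x, y} \<in> E \<longrightarrow> c (f ` {x, y}))"
      unfolding splittable_def by (elim exE conjE) simp
    then show "splittable ((`) f ` E) c (f ` N)"
      unfolding splittable_def
      by (intro exI[of _ "f ` X"] conjI[OF image_mono[OF X(1)]] iffD2[OF eq[OF X(1)] X(2)])
  qed
qed

lemma good_colouring_cong:
  assumes "\<forall>e\<in>E. c e = d e"
  shows "good_colouring U E c = good_colouring U E d"
  unfolding good_colouring_def using assms by simp

lemma splittable_cong:
  assumes "\<forall>e\<in>E. c e = d e"
  shows "splittable E c N = splittable E d N"
  unfolding splittable_def using assms by simp

lemma clique_image:
  assumes "inj_on f U" "E \<subseteq> [U]\<^bsup>2\<^esup>" "K \<subseteq> U"
  shows "clique (f ` K) ((`) f ` E) \<longleftrightarrow> clique K E"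
proof -
  have "(f x \<noteq> f y \<longrightarrow> {f x, f y} \<in> (`) f ` E) \<longleftrightarrow> (x \<noteq> y \<longrightarrow> {x, y} \<in> E)" if "x \<in> K" "y \<in> K" for x y
    using image_edge_iff[OF assms(1,2)] assms(1,3) that by (metis inj_on_contraD subsetD)
  then show ?thesis by (simp add: clique_def)
qed

lemma critical_family_image:
  assumes F: "critical_family U E F" and f: "inj_on f U"
  shows "critical_family (f ` U) ((`) f ` E) ((`) f ` F)" "card ((`) f ` F) = card F"
proof -
  note FD = critical_familyD[OF F]
  have inj: "inj_on ((`) f) (Pow U)" using inj_on_image_Pow[OF f] .
  have FU: "F \<subseteq> Pow U" using FD(3) by blast
  show "card ((`) f ` F) = card F" using inj FU by (meson card_image inj_on_subset)
  have E: "(`) f ` E \<subseteq> [f ` U]\<^bsup>2\<^esup>"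
  proof
    fix e assume "e \<in> (`) f ` E"
    then obtain d where d: "d \<in> E" "e = f ` d" by blast
    then have "d \<subseteq> U" "finite d" "card d = 2" using FD(2) by (auto simp: nsets_def)
    then show "e \<in> [f ` U]\<^bsup>2\<^esup>"
      using d f by (auto simp: nsets_def card_image[OF inj_on_subset])
  qed
  have cover: "\<exists>N\<in>(`) f ` F. \<not> splittable ((`) f ` E) c N"
    if "good_colouring (f ` U) ((`) f ` E) c" for c
  proof -
    obtain N where "N \<in> F" "\<not> splittable E (\<lambda>e. c (f ` e)) N"
      using FD(5) \<open>good_colouring (f ` U) ((`) f ` E) c\<close> unfolding good_colouring_image[OF f FD(2)]
      by blast
    then show ?thesis using splittable_image[OF f FD(2) FD(3)] by blast
  qed
  have priv: "\<exists>c. good_colouring (f ` U) ((`) f ` E) c \<and>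
      (\<forall>N'\<in>(`) f ` F - {N}. splittable ((`) f ` E) c N')" if N: "N \<in> (`) f ` F" for N
  proof -
    obtain M where M: "M \<in> F" "N = f ` M" using N by blast
    obtain c where c: "good_colouring U E c" "\<forall>N'\<in>F - {M}. splittable E c N'" using FD(6)[OF M(1)] by blast
    define d where "d e = c (inv_into U f ` e)" for e
    have cd: "\<forall>e\<in>E. c e = d (f ` e)"
      using FD(2) f inv_into_image_cancel[OF f] by (auto simp: d_def nsets_def)
    have "good_colouring (f ` U) ((`) f ` E) d"
      unfolding good_colouring_image[OF f FD(2)] using c(1) good_colouring_cong[OF cd] by blast
    moreover have "splittable ((`) f ` E) d N'" if N': "N' \<in> (`) f ` F - {N}" for N'
    proof -
      obtain M' where M': "M' \<in> F" "N' = f ` M'" "M' \<noteq> M" using N' M(2) by blast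
      then have "splittable E (\<lambda>e. d (f ` e)) M'" using c(2) splittable_cong[OF cd] by blast
      then show ?thesis using splittable_image[OF f FD(2) FD(3)] M' by blast
    qed
    ultimately show ?thesis by (intro exI[of _ d] conjI ballI)
  qed
  have sub: "\<exists>K'\<subseteq>M. K = f ` K' \<and> clique K' E \<and> card K' = card K"
    if KM: "K \<subseteq> f ` M" and K: "clique K ((`) f ` E)" and M: "M \<subseteq> U" for K M
  proof -
    obtain K' where K': "K' \<subseteq> M" "K = f ` K'" using KM by (auto simp: subset_image_iff)
    then have "K' \<subseteq> U" using M by blast
    then show ?thesis
      using clique_image[OF f FD(2), of K'] K K' card_image[OF inj_on_subset[OF f]] by metis
  qed
  have c6: "card K \<noteq> 6" if "K \<subseteq> f ` U" "clique K ((`) f ` E)" for K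
    using sub[OF that order_refl] FD(7) by metis
  have c5: "card K \<noteq> 5" if N: "N \<in> (`) f ` F" "K \<subseteq> N" "clique K ((`) f ` E)" for N K
  proof -
    obtain M where M: "M \<in> F" "N = f ` M" using N(1) by blast
    then show ?thesis using sub[of K M] FD(8)[OF M(1)] FD(3)[OF M(1)] N(2,3) by metis
  qed
  show "critical_family (f ` U) ((`) f ` E) ((`) f ` F)"
    unfolding critical_family_def using FD(1,3) E cover priv c5 c6 by auto
qed

text \<open>All edges at \<open>z\<close> get the colour that avoids the only possible triangle through \<open>z\<close>; then
  \<open>z\<close> itself can be put on the side of a splitting on which that colour is allowed.\<close>

lemma critical_family_isolate:
  assumes F: "critical_family U E F" and z: "card (nbrs E z) \<le> 2"
  shows "critical_family U {e \<in> E. z \<notin> e} ((\<lambda>N. N - {z}) ` F)"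
    "card ((\<lambda>N. N - {z}) ` F) = card F"
proof -
  note FD = critical_familyD[OF F]
  define E' where "E' = {e \<in> E. z \<notin> e}"
  have E': "E' \<subseteq> E" by (auto simp: E'_def)
  have "nbrs E z \<subseteq> U" using nsets2D[OF _ FD(2)] by (auto simp: nbrs_def)
  then have fin: "finite (nbrs E z)" using FD(1) finite_subset by blast
  obtain x y where xy: "nbrs E z \<subseteq> {x, y}"
  proof -
    have "card (nbrs E z) = 0 \<or> card (nbrs E z) = 1 \<or> card (nbrs E z) = 2" using z by linarith
    then show ?thesis using fin that by (auto simp: card_1_singleton_iff card_2_iff)
  qed
  define g where "g c e = (if z \<in> e then \<not> c {x, y} else c e)" for c :: "'a set \<Rightarrow> bool" and e
  have opp: "c {a, b} \<noteq> g c {z, a} \<and> g c {z, a} = g c {z, b} \<and> g c {a, b} = c {a, b}"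
    if "{z, a} \<in> E" "{z, b} \<in> E" "{a, b} \<in> E" for a b c
  proof -
    have "a \<in> {x, y}" "b \<in> {x, y}" using that xy by (auto simp: nbrs_def)
    moreover have "a \<noteq> b" "a \<noteq> z" "b \<noteq> z" using that nsets2D[OF _ FD(2)] by metis+
    ultimately have "{a, b} = {x, y}" by auto
    then show ?thesis using \<open>a \<noteq> z\<close> \<open>b \<noteq> z\<close> by (auto simp: g_def)
  qed
  have good: "good_colouring U E (g c)" if c: "good_colouring U E' c" for c
    unfolding good_colouring_def
  proof (intro ballI impI)
    fix a b d assume U: "a \<in> U" "b \<in> U" "d \<in> U" and e: "{a, b} \<in> E" "{a, d} \<in> E" "{b, d} \<in> E"
    consider "a = z" | "b = z" | "d = z" | "z \<notin> {a, b, d}" by blast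
    then show "\<not> (g c {a, b} = g c {a, d} \<and> g c {a, d} = g c {b, d})"
    proof cases
      case 1
      then show ?thesis using opp[of b d c] e by auto
    next
      case 2
      then show ?thesis using opp[of a d c] e by (auto simp: insert_commute)
    next
      case 3
      then show ?thesis using opp[of a b c] e by (auto simp: insert_commute)
    next
      case 4
      then have "g c {a, b} = c {a, b}" "g c {a, d} = c {a, d}" "g c {b, d} = c {b, d}"
        "{a, b} \<in> E'" "{a, d} \<in> E'" "{b, d} \<in> E'" using e by (auto simp: g_def E'_def)
      then show ?thesis using c U unfolding good_colouring_def by metis
    qed
  qed
  have split: "splittable E (g c) N" if s: "splittable E' c (N - {z})" for c N
  proof -
    obtain X where X: "X \<subseteq> N - {z}" "\<forall>x\<in>X. \<forall>y\<in>X. {x, y} \<in> E' \<longrightarrow> \<not> c {x, y}"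
      "\<forall>x\<in>N - {z} - X. \<forall>y\<in>N - {z} - X. {x, y} \<in> E' \<longrightarrow> c {x, y}"
      using s unfolding splittable_def by (elim exE conjE)
    define Y where "Y = (if c {x, y} \<and> z \<in> N then insert z X else X)"
    have eq: "{a, b} \<in> E' \<and> g c {a, b} = c {a, b}" if "{a, b} \<in> E" "a \<noteq> z" "b \<noteq> z" for a b
      using that by (auto simp: E'_def g_def)
    show ?thesis
      unfolding splittable_def
    proof (intro exI[of _ Y] conjI ballI impI)
      show "Y \<subseteq> N" using X(1) by (auto simp: Y_def)
    next
      fix a b assume a: "a \<in> Y" "b \<in> Y" "{a, b} \<in> E"
      show "\<not> g c {a, b}"
      proof (cases "a = z \<or> b = z")
        case True
        then have "c {x, y}" using a X(1) by (auto simp: Y_def split: if_splits)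
        then show ?thesis using True by (auto simp: g_def)
      next
        case False
        then have "a \<in> X" "b \<in> X" using a by (auto simp: Y_def split: if_splits)
        then show ?thesis using X(2) eq a(3) False by blast
      qed
    next
      fix a b assume a: "a \<in> N - Y" "b \<in> N - Y" "{a, b} \<in> E"
      show "g c {a, b}"
      proof (cases "a = z \<or> b = z")
        case True
        then have "\<not> c {x, y}" using a by (auto simp: Y_def split: if_splits)
        then show ?thesis using True by (auto simp: g_def)
      next
        case False
        then have "a \<in> N - {z} - X" "b \<in> N - {z} - X" using a by (auto simp: Y_def split: if_splits)
        then show ?thesis using X(3) eq a(3) False by blast
      qed
    qed
  qed
  have mono: "splittable E c N \<Longrightarrow> splittable E' c (N - {z})" for c N
    using splittable_mono E' by blast
  have gmono: "good_colouring U E c \<Longrightarrow> good_colouring U E' c" for c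
    using good_colouring_mono E' by blast
  have inj: "inj_on (\<lambda>N. N - {z}) F"
  proof (rule inj_onI, rule ccontr)
    fix N M assume NM: "N \<in> F" "M \<in> F" "N - {z} = M - {z}" "N \<noteq> M"
    obtain c where c: "good_colouring U E c" "\<forall>N'\<in>F - {N}. splittable E c N'"
      using FD(6)[OF NM(1)] by blast
    obtain K where K: "K \<in> F" "\<not> splittable E (g c) K" using FD(5)[OF good[OF gmono[OF c(1)]]] by blast
    then have nK: "\<not> splittable E' c (K - {z})" using split by blast
    then have "K = N" using c(2) K(1) mono by blast
    moreover have "splittable E' c (M - {z})" using c(2) NM mono by blast
    ultimately show False using nK NM(3) by simp
  qed
  then show "card ((\<lambda>N. N - {z}) ` F) = card F" by (rule card_image)
  have cover: "\<exists>N\<in>(\<lambda>N. N - {z}) ` F. \<not> splittable E' c N" if "good_colouring U E' c" for c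
    using FD(5)[OF good[OF that]] split by blast
  have priv: "\<exists>c. good_colouring U E' c \<and> (\<forall>N'\<in>(\<lambda>N. N - {z}) ` F - {N}. splittable E' c N')"
    if N: "N \<in> (\<lambda>N. N - {z}) ` F" for N
  proof -
    obtain M where M: "M \<in> F" "N = M - {z}" using N by blast
    obtain c where c: "good_colouring U E c" "\<forall>N'\<in>F - {M}. splittable E c N'"
      using FD(6)[OF M(1)] by blast
    have "splittable E' c N'" if N': "N' \<in> (\<lambda>N. N - {z}) ` F - {N}" for N'
    proof -
      obtain M' where "M' \<in> F" "N' = M' - {z}" "M' \<noteq> M" using N' M(2) by blast
      then show ?thesis using c(2) mono by blast
    qed
    then show ?thesis using gmono[OF c(1)] by blast
  qed
  have cl: "clique K E' \<Longrightarrow> clique K E" for K using E' by (auto simp: clique_def)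
  have c5: "card K \<noteq> 5" if "N \<in> (\<lambda>N. N - {z}) ` F" "K \<subseteq> N" "clique K E'" for N K
    using that FD(8) cl by blast
  have FU: "(\<lambda>N. N - {z}) ` F \<subseteq> Pow U" using FD(3) by blast
  have "critical_family U E' ((\<lambda>N. N - {z}) ` F)"
    unfolding critical_family_def
  proof (intro conjI allI ballI impI)
    show "finite U" "E' \<subseteq> [U]\<^bsup>2\<^esup>" "(\<lambda>N. N - {z}) ` F \<subseteq> Pow U"
      using FD(1,2) E' FU by auto
    show "card K \<noteq> 6" if "K \<subseteq> U" "clique K E'" for K using that FD(7) cl by metis
  qed (use cover priv c5 in metis)+
  then show "critical_family U {e \<in> E. z \<notin> e} ((\<lambda>N. N - {z}) ` F)" by (simp add: E'_def)
qed

definition normal_graph :: "'a set set \<Rightarrow> bool" where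
  "normal_graph E \<longleftrightarrow> (\<forall>v. nbrs E v = {} \<or> 3 \<le> card (nbrs E v))"

lemma critical_family_normalize:
  assumes "critical_family U E F"
  shows "\<exists>E' F'. critical_family U E' F' \<and> card F' = card F \<and> normal_graph E'"
  using assms
proof (induction "card E" arbitrary: E F rule: less_induct)
  case less
  show ?case
  proof (cases "normal_graph E")
    case True
    then show ?thesis using less.prems by blast
  next
    case False
    then obtain z where z: "nbrs E z \<noteq> {}" "card (nbrs E z) < 3"
      unfolding normal_graph_def linorder_not_le[symmetric] by blast
    then have z2: "card (nbrs E z) \<le> 2" by linarith
    note iso = critical_family_isolate[OF less.prems z2]
    obtain w where w: "{z, w} \<in> E" using z(1) by (auto simp: nbrs_def)
    have "finite E"
      using critical_familyD(1,2)[OF less.prems] by (meson finite_imp_finite_nsets finite_subset)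
    then have "card {e \<in> E. z \<notin> e} < card E" using w by (intro psubset_card_mono) auto
    from less.hyps[OF this iso(1)]
    show ?thesis unfolding iso(2) .
  qed
qed

text \<open>On the four classes, colour with a path on three edges; its complement is again such a path,
  so that every set is split by the same partition of the classes into two pairs.\<close>

lemma critical_family_not_four_partite:
  fixes a b :: "'a \<Rightarrow> bool"
  assumes F: "critical_family U E F"
  shows "\<exists>u v. {u, v} \<in> E \<and> a u = a v \<and> b u = b v"
proof (rule ccontr)
  assume neg: "\<not> ?thesis"
  note FD = critical_familyD[OF F]
  define r where "r u v = (if a u = a v then a u else b u = b v)" for u v
  define c where "c e \<longleftrightarrow> (\<exists>u v. e = {u, v} \<and> r u v)" for e
  have r: "r u v = r v u" for u v by (auto simp: r_def)
  have c: "c {u, v} = r u v" for u v using r by (auto simp: c_def doubleton_eq_iff)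
  have ne: "a u \<noteq> a v \<or> b u \<noteq> b v" if "{u, v} \<in> E" for u v using neg that by blast
  have "good_colouring U E c"
    unfolding good_colouring_def
  proof (intro ballI impI)
    fix x y z assume "{x, y} \<in> E" "{x, z} \<in> E" "{y, z} \<in> E"
    from this[THEN ne] show "\<not> (c {x, y} = c {x, z} \<and> c {x, z} = c {y, z})"
      unfolding c r_def by (auto split: if_splits)
  qed
  then obtain N where "\<not> splittable E c N" using FD(5) by blast
  moreover have "splittable E c N" unfolding splittable_def c
    by (rule exI[of _ "{u \<in> N. \<not> a u}"]) (auto simp: r_def split: if_splits)
  ultimately show False by blast
qed

datatype cell = Any | Yes | No

definition meets :: "cell list list \<Rightarrow> nat set set \<Rightarrow> bool" where
  "meets s E \<longleftrightarrow> (\<forall>v<length s. \<forall>u<length (s ! v).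
     (s ! v ! u = Yes \<longrightarrow> {u, v} \<in> E) \<and> (s ! v ! u = No \<longrightarrow> {u, v} \<notin> E))"

definition hard :: "cell list list \<Rightarrow> bool" where
  "hard s \<longleftrightarrow> (\<forall>E F. meets s E \<longrightarrow> normal_graph E \<longrightarrow> critical_family {..<8} E F \<longrightarrow> card F \<le> 18)"

lemma hardI:
  "(\<And>E F. meets s E \<Longrightarrow> normal_graph E \<Longrightarrow> critical_family {..<8} E F \<Longrightarrow> card F \<le> 18) \<Longrightarrow> hard s"
  by (simp add: hard_def)

fun set_at :: "nat \<Rightarrow> 'b \<Rightarrow> 'b list \<Rightarrow> 'b list" where
  "set_at k c [] = []"
| "set_at 0 c (x # xs) = c # xs"
| "set_at (Suc k) c (x # xs) = x # set_at k c xs"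

lemma set_at_numeral:
  "set_at 1 c (x # xs) = x # set_at 0 c xs"
  "set_at (numeral k) c (x # xs) = x # set_at (pred_numeral k) c xs"
  by (simp_all add: numeral_eq_Suc)

lemma set_at_eq: "set_at k c xs = xs[k := c]"
  by (induction k c xs rule: set_at.induct) auto

fun put_row :: "nat \<Rightarrow> nat \<Rightarrow> cell \<Rightarrow> cell list list \<Rightarrow> cell list list" where
  "put_row v u c [] = []"
| "put_row 0 u c (r # s) = set_at u c r # s"
| "put_row (Suc v) u c (r # s) = r # put_row v u c s"

lemma put_row_numeral:
  "put_row 1 u c (r # s) = r # put_row 0 u c s"
  "put_row (numeral k) u c (r # s) = r # put_row (pred_numeral k) u c s"
  by (simp_all add: numeral_eq_Suc)

lemma put_row_eq: "put_row v u c s = s[v := (s ! v)[u := c]]"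
  by (induction v u c s rule: put_row.induct) (auto simp: set_at_eq)

lemma meets_put_row:
  assumes "meets s E" "c = (if {u, v} \<in> E then Yes else No)"
  shows "meets (put_row v u c s) E"
  unfolding meets_def
proof (intro allI impI)
  fix w x assume w: "w < length (put_row v u c s)" "x < length (put_row v u c s ! w)"
  then have l: "w < length s" "x < length (s ! w)"
    by (cases "w = v"; auto simp: put_row_eq)+
  have "put_row v u c s ! w ! x = (if w = v \<and> x = u then c else s ! w ! x)"
    using l by (cases "w = v"; cases "x = u") (simp_all add: put_row_eq)
  then show "(put_row v u c s ! w ! x = Yes \<longrightarrow> {x, w} \<in> E) \<and>
      (put_row v u c s ! w ! x = No \<longrightarrow> {x, w} \<notin> E)"
    using assms l by (auto simp: meets_def)
qed

fun is_no :: "cell \<Rightarrow> bool" where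
  "is_no No = True"
| "is_no Yes = False"
| "is_no Any = False"

fun is_yes :: "cell option \<Rightarrow> bool" where
  "is_yes (Some Yes) = True"
| "is_yes (Some No) = False"
| "is_yes (Some Any) = False"
| "is_yes None = False"

fun is_no' :: "cell option \<Rightarrow> bool" where
  "is_no' (Some No) = True"
| "is_no' (Some Yes) = False"
| "is_no' (Some Any) = False"
| "is_no' None = False"

lemma is_no_iff: "is_no c \<longleftrightarrow> c = No" and is_yes_iff: "is_yes x \<longleftrightarrow> x = Some Yes"
  and is_no'_iff: "is_no' x \<longleftrightarrow> x = Some No"
  by (cases c; simp) (cases x rule: is_yes.cases; simp)+

lemma fetch_Some: "fetch xs k = Some x \<longleftrightarrow> k < length xs \<and> xs ! k = x"
  by (simp add: fetch_eq)

fun partite_row :: "bool \<Rightarrow> bool \<Rightarrow> bool list \<Rightarrow> bool list \<Rightarrow> cell list \<Rightarrow> bool" where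
  "partite_row a b (x # xs) (y # ys) (c # cs) =
     (if a = x then if b = y then if is_no c then partite_row a b xs ys cs else False
      else partite_row a b xs ys cs else partite_row a b xs ys cs)"
| "partite_row a b [] ys cs = True"
| "partite_row a b xs [] cs = True"
| "partite_row a b (x # xs) (y # ys) [] = False"

fun partite_rows :: "bool list \<Rightarrow> bool list \<Rightarrow> bool list \<Rightarrow> bool list \<Rightarrow> cell list list \<Rightarrow> bool" where
  "partite_rows (a # as) (b # bs) xs ys (r # s) =
     (if partite_row a b xs ys r then partite_rows as bs xs ys s else False)"
| "partite_rows [] bs xs ys s = True"
| "partite_rows as [] xs ys s = True"
| "partite_rows (a # as) (b # bs) xs ys [] = False"

lemma partite_rowD:
  "partite_row a b xs ys cs \<Longrightarrow> u < length xs \<Longrightarrow> u < length ys \<Longrightarrow> xs ! u = a \<Longrightarrow> ys ! u = b \<Longrightarrow>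
   u < length cs \<and> cs ! u = No"
proof (induction a b xs ys cs arbitrary: u rule: partite_row.induct)
  case (1 a b x xs y ys c cs)
  then show ?case by (cases u) (auto simp: is_no_iff split: if_splits)
qed auto

lemma partite_rowsD:
  "partite_rows as bs xs ys s \<Longrightarrow> v < length as \<Longrightarrow> v < length bs \<Longrightarrow>
   v < length s \<and> partite_row (as ! v) (bs ! v) xs ys (s ! v)"
proof (induction as bs xs ys s arbitrary: v rule: partite_rows.induct)
  case (1 a as b bs xs ys r s)
  then show ?case by (cases v) (auto split: if_splits)
qed auto

lemma hard_partite:
  assumes "partite_rows xs ys xs ys s" "length xs = 8" "length ys = 8"
  shows "hard s"
proof (rule hardI)
  fix E F assume m: "meets s E" and F: "critical_family {..<8} E F"
  obtain u v where uv: "{u, v} \<in> E" "xs ! u = xs ! v" "ys ! u = ys ! v"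
    using critical_family_not_four_partite[OF F, of "(!) xs" "(!) ys"] by blast
  have "u < 8" "v < 8" using nsets2D[OF uv(1) critical_familyD(2)[OF F]] by auto
  moreover have "v < length s \<and> partite_row (xs ! v) (ys ! v) xs ys (s ! v)"
    using partite_rowsD[OF assms(1)] assms(2,3) \<open>v < 8\<close> by simp
  ultimately have "u < length (s ! v) \<and> s ! v ! u = No" "v < length s"
    using partite_rowD[of "xs ! v" "ys ! v" xs ys "s ! v" u] assms(2,3) uv by auto
  then show "card F \<le> 18" using m uv(1) unfolding meets_def by blast
qed

fun joined_row :: "cell list option \<Rightarrow> nat list \<Rightarrow> bool" where
  "joined_row None us = False"
| "joined_row (Some r) [] = True"
| "joined_row (Some r) (u # us) = (if is_yes (fetch r u) then joined_row (Some r) us else False)"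

fun joined :: "cell list list \<Rightarrow> nat list \<Rightarrow> bool" where
  "joined s [] = True"
| "joined s (v # vs) = (if joined_row (fetch s v) vs then joined s vs else False)"

lemma joined_rowD:
  assumes "joined_row x us" "u \<in> set us"
  shows "\<exists>r. x = Some r \<and> fetch r u = Some Yes"
  using assms by (induction x us rule: joined_row.induct) (auto simp: is_yes_iff split: if_splits)

lemma joinedD:
  assumes "joined s vs" "meets s E" "E \<subseteq> [U]\<^bsup>2\<^esup>"
  shows "clique (set vs) E \<and> distinct vs"
  using assms(1)
proof (induction vs)
  case (Cons v vs)
  have IH: "clique (set vs) E" "distinct vs" and v: "joined_row (fetch s v) vs"
    using Cons by (auto split: if_splits)
  have e: "{u, v} \<in> E" if u: "u \<in> set vs" for u
    using joined_rowD[OF v u] assms(2) by (auto simp: fetch_Some meets_def)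
  have "u \<noteq> v" if "u \<in> set vs" for u
    using nsets2D[OF e[OF that] assms(3)] by simp
  then have "v \<notin> set vs" by blast
  then show ?case using IH e by (auto simp: clique_def insert_commute)
qed (simp add: clique_def)

lemma hard_joined:
  assumes "joined s vs" "length vs = 6"
  shows "hard s"
proof (rule hardI)
  fix E F assume m: "meets s E" and F: "critical_family {..<8} E F"
  note FD = critical_familyD[OF F]
  have c: "clique (set vs) E" "card (set vs) = 6"
    using joinedD[OF assms(1) m FD(2)] assms(2) by (auto simp: distinct_card)
  have "set vs \<subseteq> {..<8}"
  proof
    fix u assume u: "u \<in> set vs"
    have "\<exists>w\<in>set vs. w \<noteq> u"
    proof (rule ccontr)
      assume "\<not> ?thesis"
      then have "set vs \<subseteq> {u}" by blast
      then show False using c(2) card_mono[of "{u}" "set vs"] by simp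
    qed
    then obtain w where "w \<in> set vs" "w \<noteq> u" by blast
    then have "{u, w} \<in> E" using c(1) u unfolding clique_def by metis
    then show "u \<in> {..<8}" using nsets2D[OF _ FD(2)] by blast
  qed
  then show "card F \<le> 18" using FD(7) c by blast
qed

text \<open>The first list bounds the number of cells other than \<open>No\<close>; the last one fixes the length.\<close>

fun few :: "bool list \<Rightarrow> cell list \<Rightarrow> bool list \<Rightarrow> bool" where
  "few b [] [] = True"
| "few b [] (t # ts) = False"
| "few b (c # cs) [] = False"
| "few b (No # cs) (t # ts) = few b cs ts"
| "few (y # b) (Any # cs) (t # ts) = few b cs ts"
| "few (y # b) (Yes # cs) (t # ts) = few b cs ts"
| "few [] (Any # cs) (t # ts) = False"
| "few [] (Yes # cs) (t # ts) = False"

fun some_yes :: "cell list \<Rightarrow> bool" where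
  "some_yes [] = False"
| "some_yes (Yes # cs) = True"
| "some_yes (No # cs) = some_yes cs"
| "some_yes (Any # cs) = some_yes cs"

fun low :: "cell list option \<Rightarrow> bool" where
  "low None = False"
| "low (Some r) = (if some_yes r then few [True, True] r eight else False)"

definition not_no :: "cell list \<Rightarrow> nat set" where
  "not_no cs = {u. u < length cs \<and> cs ! u \<noteq> No}"

lemma finite_not_no [simp]: "finite (not_no cs)"
  by (simp add: not_no_def)

lemma not_no_Cons: "not_no (c # cs) = (if c = No then {} else {0}) \<union> Suc ` not_no cs" (is "?A = ?B")
proof (rule set_eqI)
  fix u show "u \<in> ?A \<longleftrightarrow> u \<in> ?B" by (cases u) (auto simp: not_no_def)
qed

lemma fewD: "few b cs ts \<Longrightarrow> length cs = length ts \<and> card (not_no cs) \<le> length b"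
proof (induction b cs ts rule: few.induct)
  case (4 b cs t ts)
  then show ?case by (simp add: not_no_Cons card_image)
next
  case (5 y b cs t ts)
  then show ?case by (simp add: not_no_Cons card_image)
next
  case (6 y b cs t ts)
  then show ?case by (simp add: not_no_Cons card_image)
qed (auto simp: not_no_def)

lemma some_yesD: "some_yes cs \<Longrightarrow> \<exists>u<length cs. cs ! u = Yes"
  by (induction cs rule: some_yes.induct) auto

lemma hard_low:
  assumes "low (fetch s v)"
  shows "hard s"
proof (rule hardI)
  fix E F assume m: "meets s E" and n: "normal_graph E" and F: "critical_family {..<8} E F"
  obtain r where r: "v < length s" "s ! v = r" "some_yes r" "few [True, True] r eight"
    using assms by (cases "fetch s v") (auto simp: fetch_Some split: if_splits)
  have l: "length r = 8" "card (not_no r) \<le> 2" using fewD[OF r(4)] by auto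
  obtain w where "w < length r" "r ! w = Yes" using some_yesD[OF r(3)] by blast
  then have "{v, w} \<in> E" using m r by (auto simp: meets_def insert_commute)
  then have "nbrs E v \<noteq> {}" by (auto simp: nbrs_def)
  then have "3 \<le> card (nbrs E v)" using n by (auto simp: normal_graph_def)
  moreover have "nbrs E v \<subseteq> not_no r"
  proof
    fix u assume "u \<in> nbrs E v"
    then have e: "{v, u} \<in> E" by (simp add: nbrs_def)
    then have "u < 8" using nsets2D[OF e critical_familyD(2)[OF F]] by simp
    then show "u \<in> not_no r"
      using m r l e by (auto simp: not_no_def meets_def insert_commute)
  qed
  then have "card (nbrs E v) \<le> 2" using l(2) card_mono[of "not_no r" "nbrs E v"] by simp
  ultimately show "card F \<le> 18" by linarith
qed

fun agree_row :: "bool list \<Rightarrow> cell list \<Rightarrow> bool" where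
  "agree_row [] cs = True"
| "agree_row (x # xs) [] = False"
| "agree_row (True # xs) (Yes # cs) = agree_row xs cs"
| "agree_row (False # xs) (No # cs) = agree_row xs cs"
| "agree_row (True # xs) (No # cs) = False"
| "agree_row (True # xs) (Any # cs) = False"
| "agree_row (False # xs) (Yes # cs) = False"
| "agree_row (False # xs) (Any # cs) = False"

fun agree :: "bool list list \<Rightarrow> cell list list \<Rightarrow> bool" where
  "agree [] [] = True"
| "agree [] (r # s) = False"
| "agree (q # qs) [] = False"
| "agree (q # qs) (r # s) = (if agree_row q r then agree qs s else False)"

lemma agree_rowD: "agree_row q r \<Longrightarrow> u < length q \<Longrightarrow> u < length r \<and> r ! u = (if q ! u then Yes else No)"
proof (induction q r arbitrary: u rule: agree_row.induct)
  case (3 xs cs) then show ?case by (cases u) auto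
next
  case (4 xs cs) then show ?case by (cases u) auto
qed auto

lemma agreeD: "agree qs s \<Longrightarrow> v < length qs \<Longrightarrow> v < length s \<and> agree_row (qs ! v) (s ! v)"
proof (induction qs s arbitrary: v rule: agree.induct)
  case (4 q qs r s)
  then show ?case by (cases v) (auto split: if_splits)
qed auto

lemma hard_solved:
  assumes "agree rs s" "triangular rs" "length rs = 8" "solved rs"
  shows "hard s"
proof (rule hardI)
  fix E F assume m: "meets s E" and F: "critical_family {..<8} E F"
  note E2 = critical_familyD(2)[OF F]
  have iff: "{u, v} \<in> E \<longleftrightarrow> {u, v} \<in> row_edges rs" if "u < v" "v < 8" for u v
  proof -
    have v: "v < length s" "agree_row (rs ! v) (s ! v)" "length (rs ! v) = v"
      using agreeD[OF assms(1)] that assms(2,3) by (auto simp: triangular_def)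
    then have "u < length (s ! v)" "s ! v ! u = (if rs ! v ! u then Yes else No)"
      using agree_rowD[OF v(2)] that by auto
    moreover have "(s ! v ! u = Yes \<longrightarrow> {u, v} \<in> E) \<and> (s ! v ! u = No \<longrightarrow> {u, v} \<notin> E)"
      using m v \<open>u < length (s ! v)\<close> unfolding meets_def by blast
    ultimately have "{u, v} \<in> E \<longleftrightarrow> rs ! v ! u" by (cases "rs ! v ! u") simp_all
    then show ?thesis using row_edges_iff[OF assms(2) that(1)] that v assms(3) by (simp add: members_def)
  qed
  have sub: "row_edges rs \<subseteq> [{..<8}]\<^bsup>2\<^esup>"
  proof
    fix e assume "e \<in> row_edges rs"
    then obtain u v where uv: "e = {u, v}" "v < 8" "u \<in> members (rs ! v)"
      using assms(3) by (auto simp: row_edges_def)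
    then have "u < v" using assms(2,3) by (simp add: members_def triangular_def)
    then show "e \<in> [{..<8}]\<^bsup>2\<^esup>" using uv by (auto intro!: nsets2I)
  qed
  have "e \<in> E \<longleftrightarrow> e \<in> row_edges rs" if e: "e \<in> [{..<8}]\<^bsup>2\<^esup>" for e
  proof -
    obtain u v where "e = {u, v}" "u < 8" "v < 8" "u \<noteq> v"
      using e by (auto simp: nsets_def card_2_iff)
    then show ?thesis using iff[of u v] iff[of v u] by (metis insert_commute linorder_neqE_nat)
  qed
  then have "E = row_edges rs" using sub E2 by blast
  then show "card F \<le> 18" using F assms(4) by (simp add: solved_def)
qed

fun row_embeds :: "cell list \<Rightarrow> nat list \<Rightarrow> cell list option \<Rightarrow> bool" where
  "row_embeds cs ps None = False"
| "row_embeds [] ps (Some r) = True"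
| "row_embeds (c # cs) [] (Some r) = False"
| "row_embeds (Any # cs) (p # ps) (Some r) = row_embeds cs ps (Some r)"
| "row_embeds (Yes # cs) (p # ps) (Some r) = (if is_yes (fetch r p) then row_embeds cs ps (Some r) else False)"
| "row_embeds (No # cs) (p # ps) (Some r) = (if is_no' (fetch r p) then row_embeds cs ps (Some r) else False)"

fun embeds :: "cell list list \<Rightarrow> nat list \<Rightarrow> nat list \<Rightarrow> cell list list \<Rightarrow> bool" where
  "embeds [] qs ps s = True"
| "embeds (r # t) [] ps s = False"
| "embeds (r # t) (q # qs) ps s = (if row_embeds r ps (fetch s q) then embeds t qs ps s else False)"

fun all_false :: "bool list \<Rightarrow> bool" where
  "all_false [] = True"
| "all_false (True # b) = False"
| "all_false (False # b) = all_false b"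

fun cross_out :: "nat list \<Rightarrow> bool list \<Rightarrow> bool list" where
  "cross_out [] b = b"
| "cross_out (p # ps) b = cross_out ps (set_at p False b)"

definition permutes8 :: "nat list \<Rightarrow> bool" where
  "permutes8 ps \<longleftrightarrow> (if fits ps eight then all_false (cross_out ps eight) else False)"

lemma all_false_iff: "all_false b \<longleftrightarrow> True \<notin> set b"
  by (induction b rule: all_false.induct) auto

lemma length_cross_out: "length (cross_out ps b) = length b"
  by (induction ps b rule: cross_out.induct) (auto simp: set_at_eq)

lemma cross_out_nth: "i < length b \<Longrightarrow> cross_out ps b ! i \<longleftrightarrow> i \<notin> set ps \<and> b ! i"
proof (induction ps b rule: cross_out.induct)
  case (2 p ps b)
  then show ?case by (cases "i = p") (auto simp: set_at_eq)
qed simp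

lemma permutes8D:
  assumes "permutes8 ps"
  shows "length ps = 8" "bij_betw ((!) ps) {..<8} {..<8}"
proof -
  have l: "length ps \<le> 8" and c: "all_false (cross_out ps eight)"
    using assms by (auto simp: permutes8_def fits_iff split: if_splits)
  have sub: "{..<8} \<subseteq> set ps"
  proof
    fix i :: nat assume i: "i \<in> {..<8}"
    then have l8: "i < length eight" by simp
    then have "cross_out ps eight ! i \<in> set (cross_out ps eight)" by (simp only: length_cross_out nth_mem)
    then have "\<not> cross_out ps eight ! i" using c by (metis all_false_iff)
    moreover have "eight ! i \<in> set eight" using l8 by (rule nth_mem)
    then have "eight ! i" by simp
    ultimately show "i \<in> set ps" using cross_out_nth[OF l8] by blast
  qed
  have "card {..<8::nat} \<le> card (set ps)" using sub by (intro card_mono) auto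
  then have 8: "card (set ps) = 8" "length ps = 8" using l card_length[of ps] by auto
  then have "set ps = {..<8}" using sub by (metis List.finite_set card_lessThan card_subset_eq)
  moreover have "distinct ps" using 8 by (simp add: card_distinct)
  ultimately have "bij_betw ((!) ps) {..<length ps} {..<8}" by (intro bij_betw_nth) simp_all
  then show "length ps = 8" "bij_betw ((!) ps) {..<8} {..<8}" by (simp_all only: 8(2))
qed

lemma row_embedsD:
  assumes "row_embeds cs ps x" "u < length cs"
  shows "u < length ps \<and> (\<exists>r. x = Some r \<and> (cs ! u \<noteq> Any \<longrightarrow> fetch r (ps ! u) = Some (cs ! u)))"
  using assms
proof (induction cs ps x arbitrary: u rule: row_embeds.induct)
  case (4 cs p ps r) then show ?case by (cases u) auto
next
  case (5 cs p ps r) then show ?case by (cases u) (auto simp: is_yes_iff split: if_splits)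
next
  case (6 cs p ps r) then show ?case by (cases u) (auto simp: is_no'_iff split: if_splits)
qed auto

lemma embedsD:
  "embeds t qs ps s \<Longrightarrow> v < length t \<Longrightarrow> v < length qs \<and> row_embeds (t ! v) ps (fetch s (qs ! v))"
proof (induction t qs ps s arbitrary: v rule: embeds.induct)
  case (3 r t q qs ps s)
  then show ?case by (cases v) (auto split: if_splits)
qed auto

lemma hard_embeds:
  assumes "hard t" "embeds t ps ps s" "permutes8 ps"
  shows "hard s"
proof (rule hardI)
  fix E F assume m: "meets s E" and n: "normal_graph E" and F: "critical_family {..<8} E F"
  note FD = critical_familyD[OF F]
  note ps = permutes8D[OF assms(3)]
  define f where "f = inv_into {..<8} ((!) ps)"
  have f: "bij_betw f {..<8} {..<8}" unfolding f_def by (rule bij_betw_inv_into[OF ps(2)])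
  then have inj: "inj_on f {..<8}" and im: "f ` {..<8} = {..<8}" by (auto simp: bij_betw_def)
  have fp: "f (ps ! u) = u" "ps ! u < 8" if "u < 8" for u
    using ps(2) that unfolding f_def by (auto simp: bij_betw_def intro: inv_into_f_f)
  define E' where "E' = (`) f ` E"
  have F': "critical_family {..<8} E' ((`) f ` F)" "card ((`) f ` F) = card F"
    using critical_family_image[OF F inj] unfolding im E'_def by auto
  have iff: "{f x, f y} \<in> E' \<longleftrightarrow> {x, y} \<in> E" if "x < 8" "y < 8" for x y
    using image_edge_iff[OF inj FD(2)] that unfolding E'_def by simp
  have "meets t E'"
    unfolding meets_def
  proof (intro allI impI)
    fix v u assume v: "v < length t" "u < length (t ! v)"
    have r: "v < length ps" "row_embeds (t ! v) ps (fetch s (ps ! v))"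
      using embedsD[OF assms(2) v(1)] by auto
    obtain r where u: "u < length ps" "fetch s (ps ! v) = Some r"
      "t ! v ! u \<noteq> Any \<longrightarrow> fetch r (ps ! u) = Some (t ! v ! u)"
      using row_embedsD[OF r(2) v(2)] by blast
    have "{u, v} \<in> E' \<longleftrightarrow> {ps ! u, ps ! v} \<in> E"
      using iff[of "ps ! u" "ps ! v"] fp u(1) r(1) ps(1) by simp
    then show "(t ! v ! u = Yes \<longrightarrow> {u, v} \<in> E') \<and> (t ! v ! u = No \<longrightarrow> {u, v} \<notin> E')"
      using u m by (auto simp: fetch_Some meets_def)
  qed
  moreover have "normal_graph E'"
    unfolding normal_graph_def
  proof (intro allI)
    fix w show "nbrs E' w = {} \<or> 3 \<le> card (nbrs E' w)"
    proof (cases "w < 8")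
      case False
      then show ?thesis using nsets2D[OF _ critical_familyD(2)[OF F'(1)]] by (auto simp: nbrs_def)
    next
      case True
      then obtain v where v: "v < 8" "w = f v" using im by (metis imageE lessThan_iff)
      have sub: "nbrs E v \<subseteq> {..<8}" using nsets2D[OF _ FD(2)] by (auto simp: nbrs_def)
      have "nbrs E' w = f ` nbrs E v"
      proof (intro equalityI subsetI)
        fix x assume "x \<in> nbrs E' w"
        then have e: "{w, x} \<in> E'" by (simp add: nbrs_def)
        then have "x < 8" using nsets2D[OF e critical_familyD(2)[OF F'(1)]] by simp
        then obtain y where "y < 8" "x = f y" using im by (metis imageE lessThan_iff)
        then show "x \<in> f ` nbrs E v" using e v iff[of v y] by (auto simp: nbrs_def)
      next
        fix x assume "x \<in> f ` nbrs E v"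
        then obtain y where "y \<in> nbrs E v" "x = f y" by blast
        then show "x \<in> nbrs E' w" using v sub iff[of v y] by (auto simp: nbrs_def)
      qed
      moreover have "card (f ` nbrs E v) = card (nbrs E v)"
        using inj sub by (meson card_image inj_on_subset)
      ultimately show ?thesis using n by (auto simp: normal_graph_def)
    qed
  qed
  ultimately show "card F \<le> 18" using assms(1) F' unfolding hard_def by metis
qed

datatype memo = Empty | Node "cell list list option" memo memo

fun lookup :: "bool list \<Rightarrow> memo \<Rightarrow> cell list list option" where
  "lookup b Empty = None"
| "lookup [] (Node x l r) = x"
| "lookup (False # b) (Node x l r) = lookup b l"
| "lookup (True # b) (Node x l r) = lookup b r"

fun insert_at :: "cell list list \<Rightarrow> bool list \<Rightarrow> memo \<Rightarrow> memo" where
  "insert_at s [] Empty = Node (Some s) Empty Empty"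
| "insert_at s (False # b) Empty = Node None (insert_at s b Empty) Empty"
| "insert_at s (True # b) Empty = Node None Empty (insert_at s b Empty)"
| "insert_at s [] (Node x l r) = Node (Some s) l r"
| "insert_at s (False # b) (Node x l r) = Node x (insert_at s b l) r"
| "insert_at s (True # b) (Node x l r) = Node x l (insert_at s b r)"

lemma lookup_Cons: "lookup (c # b) (Node x l r) = lookup b (if c then r else l)"
  by (cases c) auto

lemma lookup_insert_at: "lookup b (insert_at s a m) = Some t \<Longrightarrow> t = s \<or> lookup b m = Some t"
proof (induction s a m arbitrary: b rule: insert_at.induct)
  case (1 s)
  then show ?case by (cases b) (auto simp: lookup_Cons split: if_splits)
next
  case (2 s a)
  then show ?case by (cases b) (auto simp: lookup_Cons split: if_splits)
next
  case (3 s a)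
  then show ?case by (cases b) (auto simp: lookup_Cons split: if_splits)
next
  case (4 s x l r)
  then show ?case by (cases b) (auto simp: lookup_Cons split: if_splits)
next
  case (5 s a x l r)
  then show ?case by (cases b) (auto simp: lookup_Cons split: if_splits)
next
  case (6 s a x l r)
  then show ?case by (cases b) (auto simp: lookup_Cons split: if_splits)
qed

datatype outcome = Failed | Passed memo "nat list list"

text \<open>\<open>By k ps\<close> embeds the state stored under \<open>k\<close> by the permutation \<open>ps\<close>; \<open>Solved\<close> consumes the next graph
  of a list of solved ones; \<open>At u v\<close> branches on the adjacency of \<open>u\<close> and \<open>v\<close>, non-adjacent first.\<close>

datatype refutation = Part nat nat | Clq "nat list" | Low nat | By nat "nat list" | Solved
  | At nat nat refutation refutation | Keep nat refutation

definition ok :: "bool \<Rightarrow> memo \<Rightarrow> nat list list \<Rightarrow> outcome" where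
  "ok b M G = (if b then Passed M G else Failed)"

definition by_memo :: "nat list \<Rightarrow> cell list list \<Rightarrow> memo \<Rightarrow> nat list list \<Rightarrow> cell list list option \<Rightarrow> outcome" where
  "by_memo ps s M G x = (case x of None \<Rightarrow> Failed | Some t \<Rightarrow>
     if permutes8 ps then ok (embeds t ps ps s) M G else Failed)"

fun by_solved :: "cell list list \<Rightarrow> memo \<Rightarrow> nat list list \<Rightarrow> outcome" where
  "by_solved s M [] = Failed"
| "by_solved s M (g # G) = ok (agree (rows_from [] g) s) M G"

definition keep :: "nat \<Rightarrow> cell list list \<Rightarrow> outcome \<Rightarrow> outcome" where
  "keep k s x = (case x of Failed \<Rightarrow> Failed | Passed M G \<Rightarrow> Passed (insert_at s (bits k) M) G)"

primrec check :: "refutation \<Rightarrow> cell list list \<Rightarrow> memo \<Rightarrow> nat list list \<Rightarrow> outcome" where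
  "check (Part x y) s M G = ok (let xs = pad [0, 1, 2, 3, 4, 5, 6, 7] (bits x);
      ys = pad [0, 1, 2, 3, 4, 5, 6, 7] (bits y) in partite_rows xs ys xs ys s) M G"
| "check (Clq vs) s M G = ok (if fits [0, 1, 2, 3, 4, 5::nat] vs then if fits vs [0, 1, 2, 3, 4, 5::nat] then joined s vs
      else False else False) M G"
| "check (Low v) s M G = ok (low (fetch s v)) M G"
| "check (By k ps) s M G = by_memo ps s M G (lookup (bits k) M)"
| "check Solved s M G = by_solved s M G"
| "check (At u v a b) s M G = (case check a (put_row u v No (put_row v u No s)) M G of Failed \<Rightarrow> Failed
     | Passed M' G' \<Rightarrow> check b (put_row u v Yes (put_row v u Yes s)) M' G')"
| "check (Keep k a) s M G = keep k s (check a s M G)"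

definition resume :: "refutation \<Rightarrow> cell list list \<Rightarrow> outcome \<Rightarrow> outcome" where
  "resume b s x = (case x of Failed \<Rightarrow> Failed | Passed M G \<Rightarrow> check b s M G)"

definition check_partite :: "bool list \<Rightarrow> bool list \<Rightarrow> cell list list \<Rightarrow> bool" where
  "check_partite xs ys s = partite_rows xs ys xs ys s"

lemma check_eqs:
  "check (Part x y) s M G = ok (check_partite (pad [0, 1, 2, 3, 4, 5, 6, 7] (bits x))
      (pad [0, 1, 2, 3, 4, 5, 6, 7] (bits y)) s) M G"
  "check (At u v a b) s M G = resume b (put_row u v Yes (put_row v u Yes s))
     (check a (put_row u v No (put_row v u No s)) M G)"
  "resume b s Failed = Failed"
  "resume b s (Passed M G) = check b s M G"
  "by_memo ps s M G None = Failed"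
  "by_memo ps s M G (Some t) = (if permutes8 ps then ok (embeds t ps ps s) M G else Failed)"
  "ok True M G = Passed M G"
  "ok False M G = Failed"
  by (simp_all add: ok_def by_memo_def keep_def resume_def check_partite_def)

lemma ok_iff: "ok b M G = Passed M' G' \<longleftrightarrow> b \<and> M' = M \<and> G' = G"
  by (auto simp: ok_def)

definition sound :: "memo \<Rightarrow> nat list list \<Rightarrow> bool" where
  "sound M G \<longleftrightarrow> (\<forall>k t. lookup k M = Some t \<longrightarrow> hard t) \<and>
     (\<forall>g\<in>set G. length g = 8 \<and> solved (rows_from [] g))"

lemma soundD: "sound M G \<Longrightarrow> lookup k M = Some t \<Longrightarrow> hard t"
  unfolding sound_def by blast

lemma sound_insert_at: "sound M G \<Longrightarrow> hard s \<Longrightarrow> sound (insert_at s k M) G"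
  unfolding sound_def using lookup_insert_at by metis

lemma hard_put:
  assumes "hard (put_row u v No (put_row v u No s))" "hard (put_row u v Yes (put_row v u Yes s))"
  shows "hard s"
proof (rule hardI)
  fix E F assume E: "meets s E" "normal_graph E" "critical_family {..<8} E F"
  define c where "c = (if {u, v} \<in> E then Yes else No)"
  have "meets (put_row u v c (put_row v u c s)) E"
    using E(1) by (intro meets_put_row) (simp_all add: c_def insert_commute)
  moreover have "hard (put_row u v c (put_row v u c s))" using assms by (simp add: c_def)
  ultimately show "card F \<le> 18" using E(2,3) by (simp add: hard_def)
qed

lemma check_sound:
  assumes "check a s M G = Passed M' G'" "sound M G"
  shows "hard s \<and> sound M' G'"
  using assms
proof (induction a arbitrary: s M G M' G')
  case (Part x y)
  define xs ys where "xs = pad [0, 1, 2, 3, 4, 5, 6, 7] (bits x)"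
    and "ys = pad [0, 1, 2, 3, 4, 5, 6, 7] (bits y)"
  have "length xs = 8" "length ys = 8" by (simp_all add: xs_def ys_def)
  moreover have "partite_rows xs ys xs ys s" "M' = M" "G' = G"
    using Part.prems(1) by (simp_all only: check.simps ok_iff Let_def xs_def ys_def)
  ultimately show ?case using hard_partite Part.prems(2) by metis
next
  case (Clq vs)
  have "joined s vs" "length vs = 6" "M' = M" "G' = G"
    using Clq.prems(1) by (simp_all add: ok_iff fits_iff split: if_splits)
  then show ?case using hard_joined Clq.prems(2) by metis
next
  case (Low v)
  have "low (fetch s v)" "M' = M" "G' = G"
    using Low.prems(1) by (simp_all only: check.simps ok_iff)
  then show ?case using hard_low Low.prems(2) by metis
next
  case (By k ps)
  obtain t where t: "lookup (bits k) M = Some t" using By.prems(1)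
    by (cases "lookup (bits k) M") (simp_all only: check_eqs check.simps outcome.distinct option.inject)
  then have "permutes8 ps" "embeds t ps ps s" "M' = M" "G' = G"
    using By.prems(1) by (simp_all add: by_memo_def ok_iff split: if_splits)
  then show ?case using hard_embeds[OF soundD[OF By.prems(2) t]] By.prems(2) by metis
next
  case Solved
  obtain g H where g: "G = g # H" using Solved.prems(1) by (cases G) simp_all
  then have a: "agree (rows_from [] g) s" "M' = M" "G' = H"
    using Solved.prems(1) by (simp_all add: ok_iff)
  have l: "length g = 8" "solved (rows_from [] g)" using Solved.prems(2) g by (simp_all add: sound_def)
  have "hard s" by (rule hard_solved[OF a(1) triangular_rows _ l(2)]) (simp add: rows_from_length(1) l(1))
  moreover have "sound M' G'" using a Solved.prems(2) g by (simp add: sound_def)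
  ultimately show ?case ..
next
  case (At u v a b)
  let ?no = "put_row u v No (put_row v u No s)" and ?yes = "put_row u v Yes (put_row v u Yes s)"
  obtain M1 G1 where 1: "check a ?no M G = Passed M1 G1" "check b ?yes M1 G1 = Passed M' G'"
    using At.prems(1) by (cases "check a ?no M G") simp_all
  have a: "hard ?no" "sound M1 G1" using At.IH(1)[OF 1(1) At.prems(2)] by simp_all
  have b: "hard ?yes" "sound M' G'" using At.IH(2)[OF 1(2) a(2)] by simp_all
  show ?case using hard_put[OF a(1) b(1)] b(2) ..
next
  case (Keep k a)
  obtain M1 where 1: "check a s M G = Passed M1 G'" "M' = insert_at s (bits k) M1"
    using Keep.prems(1) by (cases "check a s M G") (simp_all add: keep_def)
  have "hard s" "sound M1 G'" using Keep.IH[OF 1(1) Keep.prems(2)] by simp_all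
  then show ?case using sound_insert_at unfolding 1(2) by metis
qed

fun passes :: "outcome \<Rightarrow> bool" where
  "passes Failed = False"
| "passes (Passed M G) = True"

lemma hard_if_passes:
  assumes "passes (check a s M G)" "sound M G"
  shows "hard s"
proof (cases "check a s M G")
  case Failed
  then show ?thesis using assms(1) by simp
next
  case (Passed M' G')
  then show ?thesis using check_sound assms(2) by blast
qed

text \<open>Copies of constructors whose arguments are still to be evaluated.\<close>

definition node_left :: "cell list list option \<Rightarrow> memo \<Rightarrow> memo \<Rightarrow> memo" where
  "node_left = Node"

definition node_right :: "cell list list option \<Rightarrow> memo \<Rightarrow> memo \<Rightarrow> memo" where
  "node_right = Node"

definition passed :: "memo \<Rightarrow> nat list list \<Rightarrow> outcome" where
  "passed = Passed"

lemma memo_eqs: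
  "insert_at s [] Empty = Node (Some s) Empty Empty"
  "insert_at s (False # b) Empty = node_left None (insert_at s b Empty) Empty"
  "insert_at s (True # b) Empty = node_right None Empty (insert_at s b Empty)"
  "insert_at s [] (Node x l r) = Node (Some s) l r"
  "insert_at s (False # b) (Node x l r) = node_left x (insert_at s b l) r"
  "insert_at s (True # b) (Node x l r) = node_right x l (insert_at s b r)"
  "node_left x (Node y l l') r = Node x (Node y l l') r"
  "node_right x l (Node y r r') = Node x l (Node y r r')"
  "keep k s Failed = Failed"
  "keep k s (Passed M G) = passed (insert_at s (bits k) M) G"
  "passed (Node x l r) G = Passed (Node x l r) G"
  by (simp_all add: node_left_def node_right_def passed_def keep_def)

definition blank :: "cell list list" where
  "blank = map (\<lambda>v. map (\<lambda>u. if u = v then No else Any) [0..<8]) [0..<8]"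

lemma card_le_18:
  fixes E :: "nat set set"
  assumes "hard blank" "critical_family {..<8} E F"
  shows "card F \<le> 18"
proof -
  obtain E' :: "nat set set" and F' where F': "critical_family {..<8} E' F'" "card F' = card F" "normal_graph E'"
    using critical_family_normalize[OF assms(2)] by (elim exE conjE)
  have "meets blank E'"
    unfolding meets_def blank_def
    using nsets2D[OF _ critical_familyD(2)[OF F'(1)]] nsets2D[of v v for v, OF _ critical_familyD(2)[OF F'(1)]]
    by (auto split: if_splits)
  then have "card F' \<le> 18" using F'(1,3) assms(1) unfolding hard_def by blast
  then show ?thesis by (simp add: F'(2))
qed

lemmas check_run = bits_0 bits_1 bits_numeral num_bits.simps pad.simps rows_from.simps fits.simps
  fetch.simps(1,2) fetch_numeral set_at.simps(1,2) set_at_numeral put_row.simps(1,2) put_row_numeral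
  is_no.simps is_yes.simps is_no'.simps partite_row.simps partite_rows.simps joined_row.simps joined.simps
  few.simps some_yes.simps low.simps agree_row.simps agree.simps row_embeds.simps embeds.simps all_false.simps
  cross_out.simps permutes8_def lookup.simps memo_eqs by_solved.simps check.simps(2,3,4,5,7) check_eqs
  check_partite_def passes.simps if_True if_False pred_numeral_simps BitM.simps simp_thms

lemma check_cong:
  "rows_from us gs = rows_from us gs"
  "fits vs vs' = fits vs vs'"
  "bits k = bits k"
  "partite_row a b xs ys cs = partite_row a b xs ys cs"
  "partite_rows as bs xs ys s = partite_rows as bs xs ys s"
  "joined s vs = joined s vs"
  "few d cs ts = few d cs ts"
  "some_yes cs = some_yes cs"
  "agree_row q cs = agree_row q cs"
  "permutes8 ps = permutes8 ps"
  "embeds t qs ps s = embeds t qs ps s"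
  "Node x l r = Node x l r"
  "Passed M G = Passed M G"
  by (rule refl)+

lemma check_cong':
  "k = k' \<Longrightarrow> fetch zs k = fetch zs k'"
  "k = k' \<Longrightarrow> set_at k z zs = set_at k' z zs"
  "k = k' \<Longrightarrow> s = s' \<Longrightarrow> put_row k v c s = put_row k' v c s'"
  "xs = xs' \<Longrightarrow> ys = ys' \<Longrightarrow> check_partite xs ys s = check_partite xs' ys' s"
  "t = t' \<Longrightarrow> joined_row t vs = joined_row t' vs"
  "rs = rs' \<Longrightarrow> agree rs s = agree rs' s"
  "t = t' \<Longrightarrow> row_embeds cs ps t = row_embeds cs ps t'"
  "b = b' \<Longrightarrow> cross_out ps b = cross_out ps b'"
  "b = b' \<Longrightarrow> lookup b M = lookup b' M"
  "b = b' \<Longrightarrow> insert_at s b M = insert_at s b' M"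
  "l = l' \<Longrightarrow> node_left x l r = node_left x l' r"
  "r = r' \<Longrightarrow> node_right x l r = node_right x l r'"
  "M = M' \<Longrightarrow> passed M G = passed M' G"
  "w = w' \<Longrightarrow> keep k s w = keep k s w'"
  "w = w' \<Longrightarrow> resume a s w = resume a s w'"
  "y = y' \<Longrightarrow> by_memo ps s M G y = by_memo ps s M G y'"
  "q = q' \<Longrightarrow> ok q M G = ok q' M G"
  "s = s' \<Longrightarrow> check a s M G = check a s' M G"
  by simp_all

definition five_clique :: "cell list list" where
  "five_clique =
  [[No, Yes, Yes, Yes, Yes, Any, Any, Any],
   [Yes, No, Yes, Yes, Yes, Any, Any, Any],
   [Yes, Yes, No, Yes, Yes, Any, Any, Any],
   [Yes, Yes, Yes, No, Yes, Any, Any, Any],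
   [Yes, Yes, Yes, Yes, No, Any, Any, Any],
   [Any, Any, Any, Any, Any, No, Any, Any],
   [Any, Any, Any, Any, Any, Any, No, Any],
   [Any, Any, Any, Any, Any, Any, Any, No]]"

lemma blank_eq: "blank =
  [[No, Any, Any, Any, Any, Any, Any, Any],
   [Any, No, Any, Any, Any, Any, Any, Any],
   [Any, Any, No, Any, Any, Any, Any, Any],
   [Any, Any, Any, No, Any, Any, Any, Any],
   [Any, Any, Any, Any, No, Any, Any, Any],
   [Any, Any, Any, Any, Any, No, Any, Any],
   [Any, Any, Any, Any, Any, Any, No, Any],
   [Any, Any, Any, Any, Any, Any, Any, No]]"
  by (simp add: blank_def upt_rec)

definition clique_graphs :: "nat list list" where
  "clique_graphs = [[0,1,3,7,15,0,0,0],[0,1,3,7,15,0,0,28],[0,1,3,7,15,0,0,30],[0,1,3,7,15,0,24,88],[0,1,3,7,15,0,24,84],[0,1,3,7,15,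
0,24,92],[0,1,3,7,15,0,24,70],[0,1,3,7,15,0,24,86],[0,1,3,7,15,0,24,94],[0,1,3,7,15,0,24,71],[0,1,3,7,15,0,24,87],
[0,1,3,7,15,0,28,28],[0,1,3,7,15,0,28,92],[0,1,3,7,15,0,28,26],[0,1,3,7,15,0,28,90],[0,1,3,7,15,0,28,30],[0,1,3,
7,15,0,28,94],[0,1,3,7,15,0,28,19],[0,1,3,7,15,0,28,83],[0,1,3,7,15,0,28,91],[0,1,3,7,15,0,30,30],[0,1,3,7,15,0,
30,93],[0,1,3,7,15,16,48,112],[0,1,3,7,15,16,48,104],[0,1,3,7,15,16,48,120],[0,1,3,7,15,16,48,108],[0,1,3,7,15,
16,48,124],[0,1,3,7,15,16,48,110],[0,1,3,7,15,16,48,126],[0,1,3,7,15,16,48,111],[0,1,3,7,15,16,40,120],[0,1,3,7,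
15,16,40,100],[0,1,3,7,15,16,40,116],[0,1,3,7,15,16,40,124],[0,1,3,7,15,16,40,102],[0,1,3,7,15,16,40,118],[0,1,
3,7,15,16,40,126],[0,1,3,7,15,16,40,103],[0,1,3,7,15,16,40,119],[0,1,3,7,15,16,56,56],[0,1,3,7,15,16,56,120],[0,
1,3,7,15,16,56,52],[0,1,3,7,15,16,56,116],[0,1,3,7,15,16,56,44],[0,1,3,7,15,16,56,108],[0,1,3,7,15,16,56,60],[0,
1,3,7,15,16,56,124],[0,1,3,7,15,16,56,38],[0,1,3,7,15,16,56,102],[0,1,3,7,15,16,56,54],[0,1,3,7,15,16,56,118],[0,
1,3,7,15,16,56,46],[0,1,3,7,15,16,56,110],[0,1,3,7,15,16,56,62],[0,1,3,7,15,16,56,126],[0,1,3,7,15,16,56,39],[0,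
1,3,7,15,16,56,103],[0,1,3,7,15,16,56,55],[0,1,3,7,15,16,56,119],[0,1,3,7,15,16,56,111],[0,1,3,7,15,16,44,44],[0,
1,3,7,15,16,44,108],[0,1,3,7,15,16,44,60],[0,1,3,7,15,16,44,124],[0,1,3,7,15,16,44,42],[0,1,3,7,15,16,44,106],[0,
1,3,7,15,16,44,58],[0,1,3,7,15,16,44,122],[0,1,3,7,15,16,44,46],[0,1,3,7,15,16,44,110],[0,1,3,7,15,16,44,62],[0,
1,3,7,15,16,44,126],[0,1,3,7,15,16,44,35],[0,1,3,7,15,16,44,99],[0,1,3,7,15,16,44,51],[0,1,3,7,15,16,44,115],[0,
1,3,7,15,16,44,43],[0,1,3,7,15,16,44,107],[0,1,3,7,15,16,44,59],[0,1,3,7,15,16,44,123],[0,1,3,7,15,16,44,47],[0,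
1,3,7,15,16,44,111],[0,1,3,7,15,16,60,60],[0,1,3,7,15,16,60,124],[0,1,3,7,15,16,60,58],[0,1,3,7,15,16,60,122],[0,
1,3,7,15,16,60,46],[0,1,3,7,15,16,60,110],[0,1,3,7,15,16,60,62],[0,1,3,7,15,16,60,126],[0,1,3,7,15,16,60,51],[0,
1,3,7,15,16,60,115],[0,1,3,7,15,16,60,43],[0,1,3,7,15,16,60,107],[0,1,3,7,15,16,60,59],[0,1,3,7,15,16,60,123],[0,
1,3,7,15,16,60,111],[0,1,3,7,15,16,46,46],[0,1,3,7,15,16,46,110],[0,1,3,7,15,16,46,62],[0,1,3,7,15,16,46,126],[0,
1,3,7,15,16,46,45],[0,1,3,7,15,16,46,109],[0,1,3,7,15,16,46,61],[0,1,3,7,15,16,46,125],[0,1,3,7,15,16,46,47],[0,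
1,3,7,15,16,46,111],[0,1,3,7,15,16,62,62],[0,1,3,7,15,16,62,61],[0,1,3,7,15,16,62,125],[0,1,3,7,15,16,62,111],[0,
1,3,7,15,16,47,47],[0,1,3,7,15,24,24,120],[0,1,3,7,15,24,24,116],[0,1,3,7,15,24,24,124],[0,1,3,7,15,24,24,102],
[0,1,3,7,15,24,24,118],[0,1,3,7,15,24,24,126],[0,1,3,7,15,24,24,103],[0,1,3,7,15,24,24,119],[0,1,3,7,15,24,56,120],
[0,1,3,7,15,24,56,84],[0,1,3,7,15,24,56,116],[0,1,3,7,15,24,56,28],[0,1,3,7,15,24,56,92],[0,1,3,7,15,24,56,124],
[0,1,3,7,15,24,56,70],[0,1,3,7,15,24,56,102],[0,1,3,7,15,24,56,22],[0,1,3,7,15,24,56,86],[0,1,3,7,15,24,56,118],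
[0,1,3,7,15,24,56,30],[0,1,3,7,15,24,56,94],[0,1,3,7,15,24,56,126],[0,1,3,7,15,24,56,7],[0,1,3,7,15,24,56,71],[0,
1,3,7,15,24,56,103],[0,1,3,7,15,24,56,119],[0,1,3,7,15,24,20,108],[0,1,3,7,15,24,20,124],[0,1,3,7,15,24,20,114],
[0,1,3,7,15,24,20,106],[0,1,3,7,15,24,20,122],[0,1,3,7,15,24,20,110],[0,1,3,7,15,24,20,126],[0,1,3,7,15,24,20,99],
[0,1,3,7,15,24,20,115],[0,1,3,7,15,24,20,107],[0,1,3,7,15,24,20,123],[0,1,3,7,15,24,20,111],[0,1,3,7,15,24,52,108],
[0,1,3,7,15,24,52,28],[0,1,3,7,15,24,52,92],[0,1,3,7,15,24,52,124],[0,1,3,7,15,24,52,114],[0,1,3,7,15,24,52,42],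
[0,1,3,7,15,24,52,106],[0,1,3,7,15,24,52,26],[0,1,3,7,15,24,52,90],[0,1,3,7,15,24,52,58],[0,1,3,7,15,24,52,122],
[0,1,3,7,15,24,52,14],[0,1,3,7,15,24,52,78],[0,1,3,7,15,24,52,110],[0,1,3,7,15,24,52,30],[0,1,3,7,15,24,52,94],
[0,1,3,7,15,24,52,126],[0,1,3,7,15,24,52,67],[0,1,3,7,15,24,52,99],[0,1,3,7,15,24,52,19],[0,1,3,7,15,24,52,83],
[0,1,3,7,15,24,52,115],[0,1,3,7,15,24,52,11],[0,1,3,7,15,24,52,75],[0,1,3,7,15,24,52,43],[0,1,3,7,15,24,52,107],
[0,1,3,7,15,24,52,91],[0,1,3,7,15,24,52,123],[0,1,3,7,15,24,52,111],[0,1,3,7,15,24,28,60],[0,1,3,7,15,24,28,124],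
[0,1,3,7,15,24,28,58],[0,1,3,7,15,24,28,122],[0,1,3,7,15,24,28,38],[0,1,3,7,15,24,28,102],[0,1,3,7,15,24,28,54],
[0,1,3,7,15,24,28,118],[0,1,3,7,15,24,28,62],[0,1,3,7,15,24,28,126],[0,1,3,7,15,24,28,35],[0,1,3,7,15,24,28,99],
[0,1,3,7,15,24,28,51],[0,1,3,7,15,24,28,115],[0,1,3,7,15,24,28,59],[0,1,3,7,15,24,28,123],[0,1,3,7,15,24,28,39],
[0,1,3,7,15,24,28,103],[0,1,3,7,15,24,28,119],[0,1,3,7,15,24,60,60],[0,1,3,7,15,24,60,58],[0,1,3,7,15,24,60,122],
[0,1,3,7,15,24,60,70],[0,1,3,7,15,24,60,38],[0,1,3,7,15,24,60,102],[0,1,3,7,15,24,60,22],[0,1,3,7,15,24,60,86],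
[0,1,3,7,15,24,60,54],[0,1,3,7,15,24,60,118],[0,1,3,7,15,24,60,30],[0,1,3,7,15,24,60,94],[0,1,3,7,15,24,60,62],
[0,1,3,7,15,24,60,126],[0,1,3,7,15,24,60,67],[0,1,3,7,15,24,60,35],[0,1,3,7,15,24,60,99],[0,1,3,7,15,24,60,19],
[0,1,3,7,15,24,60,83],[0,1,3,7,15,24,60,51],[0,1,3,7,15,24,60,115],[0,1,3,7,15,24,60,91],[0,1,3,7,15,24,60,59],
[0,1,3,7,15,24,60,123],[0,1,3,7,15,24,60,7],[0,1,3,7,15,24,60,71],[0,1,3,7,15,24,60,39],[0,1,3,7,15,24,60,103],
[0,1,3,7,15,24,60,119],[0,1,3,7,15,24,6,126],[0,1,3,7,15,24,6,117],[0,1,3,7,15,24,6,125],[0,1,3,7,15,24,38,30],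
[0,1,3,7,15,24,38,94],[0,1,3,7,15,24,38,126],[0,1,3,7,15,24,38,21],[0,1,3,7,15,24,38,85],[0,1,3,7,15,24,38,117],
[0,1,3,7,15,24,38,93],[0,1,3,7,15,24,38,125],[0,1,3,7,15,24,22,54],[0,1,3,7,15,24,22,118],[0,1,3,7,15,24,22,46],
[0,1,3,7,15,24,22,110],[0,1,3,7,15,24,22,62],[0,1,3,7,15,24,22,126],[0,1,3,7,15,24,22,53],[0,1,3,7,15,24,22,117],
[0,1,3,7,15,24,22,45],[0,1,3,7,15,24,22,109],[0,1,3,7,15,24,22,61],[0,1,3,7,15,24,22,125],[0,1,3,7,15,24,22,39],
[0,1,3,7,15,24,22,103],[0,1,3,7,15,24,22,55],[0,1,3,7,15,24,22,119],[0,1,3,7,15,24,22,111],[0,1,3,7,15,24,54,54],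
[0,1,3,7,15,24,54,118],[0,1,3,7,15,24,54,46],[0,1,3,7,15,24,54,110],[0,1,3,7,15,24,54,30],[0,1,3,7,15,24,54,62],
[0,1,3,7,15,24,54,126],[0,1,3,7,15,24,54,53],[0,1,3,7,15,24,54,117],[0,1,3,7,15,24,54,45],[0,1,3,7,15,24,54,109],
[0,1,3,7,15,24,54,93],[0,1,3,7,15,24,54,61],[0,1,3,7,15,24,54,125],[0,1,3,7,15,24,54,7],[0,1,3,7,15,24,54,71],[0,
1,3,7,15,24,54,39],[0,1,3,7,15,24,54,103],[0,1,3,7,15,24,54,55],[0,1,3,7,15,24,54,119],[0,1,3,7,15,24,54,111],[0,
1,3,7,15,24,30,62],[0,1,3,7,15,24,30,125],[0,1,3,7,15,24,30,103],[0,1,3,7,15,24,30,119],[0,1,3,7,15,24,62,62],[0,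
1,3,7,15,24,62,61],[0,1,3,7,15,24,62,125],[0,1,3,7,15,24,62,7],[0,1,3,7,15,24,62,71],[0,1,3,7,15,24,62,39],[0,1,
3,7,15,24,62,103],[0,1,3,7,15,24,62,119],[0,1,3,7,15,24,7,39],[0,1,3,7,15,24,7,55],[0,1,3,7,15,24,39,39],[0,1,3,
7,15,24,39,103],[0,1,3,7,15,24,39,55],[0,1,3,7,15,24,39,119],[0,1,3,7,15,24,55,55],[0,1,3,7,15,24,55,111],[0,1,
3,7,15,28,28,28],[0,1,3,7,15,28,28,92],[0,1,3,7,15,28,28,124],[0,1,3,7,15,28,28,26],[0,1,3,7,15,28,28,90],[0,1,
3,7,15,28,28,122],[0,1,3,7,15,28,28,30],[0,1,3,7,15,28,28,94],[0,1,3,7,15,28,28,126],[0,1,3,7,15,28,28,19],[0,1,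
3,7,15,28,28,83],[0,1,3,7,15,28,28,115],[0,1,3,7,15,28,28,123],[0,1,3,7,15,28,60,90],[0,1,3,7,15,28,60,94],[0,1,
3,7,15,28,60,115],[0,1,3,7,15,28,60,123],[0,1,3,7,15,28,26,22],[0,1,3,7,15,28,26,86],[0,1,3,7,15,28,26,118],[0,
1,3,7,15,28,26,30],[0,1,3,7,15,28,26,126],[0,1,3,7,15,28,26,25],[0,1,3,7,15,28,26,89],[0,1,3,7,15,28,26,121],[0,
1,3,7,15,28,26,21],[0,1,3,7,15,28,26,85],[0,1,3,7,15,28,26,53],[0,1,3,7,15,28,26,117],[0,1,3,7,15,28,26,93],[0,
1,3,7,15,28,26,125],[0,1,3,7,15,28,26,7],[0,1,3,7,15,28,26,71],[0,1,3,7,15,28,26,103],[0,1,3,7,15,28,26,119],[0,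
1,3,7,15,28,58,118],[0,1,3,7,15,28,58,30],[0,1,3,7,15,28,58,121],[0,1,3,7,15,28,58,53],[0,1,3,7,15,28,58,117],[0,
1,3,7,15,28,58,93],[0,1,3,7,15,28,58,125],[0,1,3,7,15,28,58,7],[0,1,3,7,15,28,58,71],[0,1,3,7,15,28,58,103],[0,
1,3,7,15,28,58,119],[0,1,3,7,15,28,30,30],[0,1,3,7,15,28,30,93],[0,1,3,7,15,28,30,125],[0,1,3,7,15,28,30,83],[0,
1,3,7,15,28,30,115],[0,1,3,7,15,28,30,123],[0,1,3,7,15,28,62,61],[0,1,3,7,15,28,62,115],[0,1,3,7,15,28,62,123],
[0,1,3,7,15,28,19,111],[0,1,3,7,15,28,51,111],[0,1,3,7,15,28,59,59],[0,1,3,7,15,28,59,119],[0,1,3,7,15,30,30,30],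
[0,1,3,7,15,30,30,125],[0,1,3,7,15,30,61,123]]"

definition free_graphs :: "nat list list" where
  "free_graphs = [[0,0,2,2,14,6,42,126],[0,0,2,3,15,7,42,126],[0,0,3,2,15,7,42,126],[0,0,3,3,15,7,42,126],[0,0,3,1,15,5,42,127],[0,
0,3,1,7,9,42,127],[0,0,3,1,7,13,42,127],[0,0,3,1,15,13,42,127],[0,0,3,1,13,14,42,127],[0,0,3,1,15,14,42,127],[0,
0,3,1,12,15,42,127],[0,0,3,1,6,15,42,127],[0,0,3,1,14,15,42,127],[0,0,3,1,13,15,42,127],[0,0,3,1,15,15,42,127],
[0,0,3,1,15,15,58,111],[0,0,3,1,15,15,58,127],[0,0,3,3,13,7,58,127],[0,0,0,2,12,7,63,127],[0,0,0,2,13,7,63,127]]"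

lemma sound_Empty: "sound Empty []"
  by (simp add: sound_def)

lemma sound_Cons: "certificate g qs ds ms ks t \<Longrightarrow> sound M G \<Longrightarrow> sound M (g # G)"
  by (simp add: sound_def certificate_def)

lemma sound_clique_graphs: "sound Empty clique_graphs"
  unfolding clique_graphs_def by ((rule sound_Cons, rule certificates_clique)+, rule sound_Empty)

lemma hard_five_clique: "hard five_clique"
proof (rule hard_if_passes[OF _ sound_clique_graphs])
  show "passes (check (At 0 5 (Keep 165 (At 1 5 (Keep 159 (At 2 5 (Keep 112 (At 3 5 (Keep 46 (At 4 5 (Keep 20 (At 0 6 (Keep 19 (At 1 6
(Keep 16 (At 2 6 (Keep 11 (At 3 6 (Keep 5 (At 4 6 (At 5 6 (At 0 7 (Keep 4 (At 1 7 (Keep 3 (At 2 7 (Keep 2 (At 3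
7 (Keep 1 (At 4 7 (At 5 7 (At 6 7 Solved (Low 6)) (Low 5)) (At 5 7 (Low 7) (Low 5)))) (At 4 7 (By 1 [0,1,2,4,3,
5,6,7]) (At 5 7 (At 6 7 (Low 7) (Low 6)) (Low 5))))) (At 3 7 (By 2 [0,1,3,2,4,5,6,7]) (At 4 7 (By 2 [0,1,4,2,3,
5,6,7]) (At 5 7 (At 6 7 Solved (Low 6)) (Low 5)))))) (At 2 7 (By 3 [0,2,1,3,4,5,6,7]) (At 3 7 (By 3 [0,3,1,2,4,
5,6,7]) (At 4 7 (By 3 [0,4,1,2,3,5,6,7]) (At 5 7 (At 6 7 Solved (Low 6)) (Low 5))))))) (At 1 7 (By 4 [1,0,2,3,4,
5,6,7]) (At 2 7 (By 4 [2,0,1,3,4,5,6,7]) (At 3 7 (By 4 [3,0,1,2,4,5,6,7]) (At 4 7 (By 4 [4,0,1,2,3,5,6,7]) (Clq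
[0,1,2,3,4,7])))))) (Low 5)) (At 5 6 (Low 6) (Low 5)))) (At 4 6 (By 5 [0,1,2,4,3,5,6,7]) (At 5 6 (At 0 7 (Keep
9 (At 1 7 (Keep 7 (At 2 7 (At 3 7 (By 5 [0,1,2,3,4,5,7,6]) (At 4 7 (By 5 [0,1,2,4,3,5,7,6]) (At 5 7 (At 6 7 (Low
6) Solved) (Low 5)))) (At 3 7 (Keep 6 (At 4 7 (By 5 [0,1,3,4,2,5,7,6]) (At 5 7 (At 6 7 (Low 6) Solved) (Low 5))))
(At 4 7 (By 6 [0,1,2,4,3,5,6,7]) (At 5 7 (At 6 7 (Low 6) Solved) (Low 5)))))) (At 2 7 (By 7 [0,2,1,3,4,5,6,7])
(At 3 7 (Keep 8 (At 4 7 (At 5 7 (At 6 7 (Low 6) Solved) (Low 5)) (At 5 7 (At 6 7 (Low 6) Solved) (Low 5)))) (At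
4 7 (By 8 [0,1,2,4,3,5,6,7]) (At 5 7 (At 6 7 (Low 6) Solved) (Low 5))))))) (At 1 7 (By 9 [1,0,2,3,4,5,6,7]) (At
2 7 (By 9 [2,0,1,3,4,5,6,7]) (At 3 7 (Keep 10 (At 4 7 (At 5 7 (At 6 7 (Low 6) Solved) (Low 5)) (At 5 7 (At 6 7
(Low 6) Solved) (Low 5)))) (At 4 7 (By 10 [0,1,2,4,3,5,6,7]) (Clq [0,1,2,3,4,7])))))) (Low 5))))) (At 3 6 (By 11
[0,1,3,2,4,5,6,7]) (At 4 6 (By 11 [0,1,4,2,3,5,6,7]) (At 5 6 (At 0 7 (Keep 13 (At 1 7 (At 2 7 (By 11 [0,1,2,3,4,
5,7,6]) (At 3 7 (By 11 [0,1,3,2,4,5,7,6]) (At 4 7 (By 11 [0,1,4,2,3,5,7,6]) (At 5 7 (At 6 7 Solved Solved) (Low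
5))))) (At 2 7 (Keep 12 (At 3 7 (By 11 [0,2,3,1,4,5,7,6]) (At 4 7 (By 11 [0,2,4,1,3,5,7,6]) (At 5 7 (At 6 7 Solved
Solved) (Low 5))))) (At 3 7 (By 12 [0,1,3,2,4,5,6,7]) (At 4 7 (By 12 [0,1,4,2,3,5,6,7]) (At 5 7 (At 6 7 Solved
Solved) (Low 5))))))) (At 1 7 (By 13 [1,0,2,3,4,5,6,7]) (At 2 7 (Keep 15 (At 3 7 (Keep 14 (At 4 7 (By 11 [2,3,4,
0,1,5,7,6]) (At 5 7 (At 6 7 Solved Solved) (Low 5)))) (At 4 7 (By 14 [0,1,2,4,3,5,6,7]) (At 5 7 (At 6 7 (By 11
[0,1,7,3,4,5,6,2]) Solved) (Low 5))))) (At 3 7 (By 15 [0,1,3,2,4,5,6,7]) (At 4 7 (By 15 [0,1,4,2,3,5,6,7]) (Clq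
[0,1,2,3,4,7])))))) (Low 5)))))) (At 2 6 (By 16 [0,2,1,3,4,5,6,7]) (At 3 6 (By 16 [0,3,1,2,4,5,6,7]) (At 4 6 (By
16 [0,4,1,2,3,5,6,7]) (At 5 6 (At 0 7 (Keep 17 (At 1 7 (By 16 [0,1,2,3,4,5,7,6]) (At 2 7 (By 16 [0,2,1,3,4,5,7,
6]) (At 3 7 (By 16 [0,3,1,2,4,5,7,6]) (At 4 7 (By 16 [0,4,1,2,3,5,7,6]) (At 5 7 (At 6 7 Solved (Clq [1,2,3,4,6,
7])) (Low 5))))))) (At 1 7 (Keep 18 (At 2 7 (By 16 [1,2,0,3,4,5,7,6]) (At 3 7 (By 16 [1,3,0,2,4,5,7,6]) (At 4 7
(By 16 [1,4,0,2,3,5,7,6]) (At 5 7 (At 6 7 (By 17 [6,1,2,3,4,5,0,7]) Solved) (Low 5)))))) (At 2 7 (By 18 [0,2,1,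
3,4,5,6,7]) (At 3 7 (By 18 [0,3,1,2,4,5,6,7]) (At 4 7 (By 18 [0,4,1,2,3,5,6,7]) (Clq [0,1,2,3,4,7])))))) (Low 5)))))))
(At 1 6 (By 19 [1,0,2,3,4,5,6,7]) (At 2 6 (By 19 [2,0,1,3,4,5,6,7]) (At 3 6 (By 19 [3,0,1,2,4,5,6,7]) (At 4 6 (By
19 [4,0,1,2,3,5,6,7]) (Clq [0,1,2,3,4,6]))))))) (At 0 6 (Keep 45 (At 1 6 (Keep 41 (At 2 6 (Keep 33 (At 3 6 (Keep
24 (At 4 6 (By 20 [0,1,2,3,4,6,5,7]) (At 5 6 (Low 5) (At 0 7 (Keep 23 (At 1 7 (Keep 22 (At 2 7 (Keep 21 (At 3 7
(At 4 7 (By 20 [0,1,2,3,4,7,5,6]) (At 5 7 (Low 5) (At 6 7 (Low 6) Solved))) (At 4 7 (At 5 7 (Low 5) (At 6 7 (Low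
6) Solved)) (At 5 7 (Low 5) (At 6 7 (Low 6) Solved))))) (At 3 7 (By 21 [0,1,3,2,4,5,6,7]) (At 4 7 (At 5 7 (Low
5) (At 6 7 (Low 6) Solved)) (At 5 7 (Low 5) (At 6 7 (Low 6) Solved)))))) (At 2 7 (By 22 [0,2,1,3,4,5,6,7]) (At
3 7 (By 22 [0,3,1,2,4,5,6,7]) (At 4 7 (At 5 7 (Low 5) (At 6 7 (Low 6) Solved)) (At 5 7 (Low 5) (At 6 7 (Low 6)
Solved))))))) (At 1 7 (By 23 [1,0,2,3,4,5,6,7]) (At 2 7 (By 23 [2,0,1,3,4,5,6,7]) (At 3 7 (By 23 [3,0,1,2,4,5,6,
7]) (At 4 7 (At 5 7 (Low 5) (At 6 7 (Low 6) Solved)) (Clq [0,1,2,3,4,7]))))))))) (At 4 6 (Keep 30 (At 5 6 (Low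
5) (At 0 7 (Keep 28 (At 1 7 (Keep 26 (At 2 7 (At 3 7 (By 24 [0,1,2,3,4,5,7,6]) (At 4 7 (By 24 [0,1,2,4,3,6,7,5])
(At 5 7 (Low 5) (At 6 7 (Low 6) Solved)))) (At 3 7 (Keep 25 (At 4 7 (At 5 7 (Low 5) (At 6 7 (Low 6) Solved)) (At
5 7 (Low 5) (At 6 7 (Low 6) Solved)))) (At 4 7 (By 25 [0,1,2,4,3,6,5,7]) (At 5 7 (Low 5) (At 6 7 (Low 6) Solved))))))
(At 2 7 (By 26 [0,2,1,3,4,5,6,7]) (At 3 7 (Keep 27 (At 4 7 (At 5 7 (Low 5) (At 6 7 (Low 6) Solved)) (At 5 7 (Low
5) (At 6 7 (Low 6) Solved)))) (At 4 7 (By 27 [0,1,2,4,3,6,5,7]) (At 5 7 (Low 5) (At 6 7 (Low 6) Solved))))))) (At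
1 7 (By 28 [1,0,2,3,4,5,6,7]) (At 2 7 (By 28 [2,0,1,3,4,5,6,7]) (At 3 7 (Keep 29 (At 4 7 (At 5 7 (Low 5) (At 6
7 (Low 6) Solved)) (At 5 7 (Low 5) (At 6 7 (Low 6) Solved)))) (At 4 7 (By 29 [0,1,2,4,3,6,5,7]) (Clq [0,1,2,3,4,
7])))))))) (At 5 6 (Low 5) (At 0 7 (Keep 32 (At 1 7 (Keep 31 (At 2 7 (At 3 7 (By 24 [0,1,2,3,4,5,7,6]) (At 4 7
(By 30 [0,1,2,3,4,5,7,6]) (At 5 7 (Low 5) (At 6 7 Solved Solved)))) (At 3 7 (At 4 7 (By 30 [0,1,3,2,4,5,7,6]) (At
5 7 (Low 5) (At 6 7 Solved Solved))) (At 4 7 (At 5 7 (Low 5) (At 6 7 Solved Solved)) (At 5 7 (Low 5) (At 6 7 Solved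
Solved)))))) (At 2 7 (By 31 [0,2,1,3,4,5,6,7]) (At 3 7 (At 4 7 (At 5 7 (Low 5) (At 6 7 Solved Solved)) (At 5 7
(Low 5) (At 6 7 Solved Solved))) (At 4 7 (At 5 7 (Low 5) (At 6 7 Solved Solved)) (At 5 7 (Low 5) (At 6 7 Solved
Solved))))))) (At 1 7 (By 32 [1,0,2,3,4,5,6,7]) (At 2 7 (By 32 [2,0,1,3,4,5,6,7]) (At 3 7 (At 4 7 (At 5 7 (Low
5) (At 6 7 Solved Solved)) (At 5 7 (Low 5) (At 6 7 Solved Solved))) (At 4 7 (At 5 7 (Low 5) (At 6 7 (By 30 [0,1,
2,3,7,5,6,4]) Solved)) (Clq [0,1,2,3,4,7])))))))))) (At 3 6 (By 33 [0,1,3,2,4,5,6,7]) (At 4 6 (Keep 37 (At 5 6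
(Low 5) (At 0 7 (Keep 35 (At 1 7 (At 2 7 (By 33 [0,1,2,3,4,5,7,6]) (At 3 7 (By 33 [0,1,3,2,4,5,7,6]) (At 4 7 (At
5 7 (Low 5) (At 6 7 Solved Solved)) (At 5 7 (Low 5) (At 6 7 Solved Solved))))) (At 2 7 (Keep 34 (At 3 7 (By 33
[0,2,3,1,4,5,7,6]) (At 4 7 (At 5 7 (Low 5) (At 6 7 Solved Solved)) (At 5 7 (Low 5) (At 6 7 Solved Solved))))) (At
3 7 (By 34 [0,1,3,2,4,5,6,7]) (At 4 7 (At 5 7 (Low 5) (At 6 7 Solved Solved)) (At 5 7 (Low 5) (At 6 7 Solved Solved)))))))
(At 1 7 (By 35 [1,0,2,3,4,5,6,7]) (At 2 7 (Keep 36 (At 3 7 (At 4 7 (At 5 7 (Low 5) (At 6 7 Solved Solved)) (At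
5 7 (Low 5) (At 6 7 Solved Solved))) (At 4 7 (At 5 7 (Low 5) (At 6 7 Solved Solved)) (At 5 7 (Low 5) (At 6 7 Solved
Solved))))) (At 3 7 (By 36 [0,1,3,2,4,5,6,7]) (At 4 7 (At 5 7 (Low 5) (At 6 7 Solved Solved)) (Clq [0,1,2,3,4,7]))))))))
(At 5 6 (Low 5) (At 0 7 (Keep 39 (At 1 7 (At 2 7 (By 33 [0,1,2,3,4,5,7,6]) (At 3 7 (By 33 [0,1,3,2,4,5,7,6]) (At
4 7 (By 37 [0,1,2,3,4,5,7,6]) (At 5 7 (Low 5) (At 6 7 Solved Solved))))) (At 2 7 (Keep 38 (At 3 7 (By 33 [0,2,3,
1,4,5,7,6]) (At 4 7 (By 37 [0,2,1,3,4,5,7,6]) (At 5 7 (Low 5) (At 6 7 Solved Solved))))) (At 3 7 (By 38 [0,1,3,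
2,4,5,6,7]) (At 4 7 (At 5 7 (Low 5) (At 6 7 Solved Solved)) (At 5 7 (Low 5) (At 6 7 Solved Solved))))))) (At 1
7 (By 39 [1,0,2,3,4,5,6,7]) (At 2 7 (Keep 40 (At 3 7 (At 4 7 (By 37 [2,3,0,1,4,5,7,6]) (At 5 7 (Low 5) (At 6 7
Solved Solved))) (At 4 7 (At 5 7 (Low 5) (At 6 7 Solved Solved)) (At 5 7 (Low 5) (At 6 7 Solved Solved))))) (At
3 7 (By 40 [0,1,3,2,4,5,6,7]) (At 4 7 (At 5 7 (Low 5) (At 6 7 (By 37 [0,1,2,3,7,5,6,4]) Solved)) (Clq [0,1,2,3,
4,7]))))))))))) (At 2 6 (By 41 [0,2,1,3,4,5,6,7]) (At 3 6 (By 41 [0,3,1,2,4,5,6,7]) (At 4 6 (Keep 43 (At 5 6 (Low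
5) (At 0 7 (At 1 7 (By 41 [0,1,2,3,4,5,7,6]) (At 2 7 (By 41 [0,2,1,3,4,5,7,6]) (At 3 7 (By 41 [0,3,1,2,4,5,7,6])
(At 4 7 (At 5 7 (Low 5) (At 6 7 Solved Solved)) (At 5 7 (Low 5) (At 6 7 Solved Solved)))))) (At 1 7 (Keep 42 (At
2 7 (By 41 [1,2,0,3,4,5,7,6]) (At 3 7 (By 41 [1,3,0,2,4,5,7,6]) (At 4 7 (At 5 7 (Low 5) (At 6 7 Solved Solved))
(At 5 7 (Low 5) (At 6 7 Solved Solved)))))) (At 2 7 (By 42 [0,2,1,3,4,5,6,7]) (At 3 7 (By 42 [0,3,1,2,4,5,6,7])
(At 4 7 (At 5 7 (Low 5) (At 6 7 Solved Solved)) (Clq [0,1,2,3,4,7])))))))) (At 5 6 (Low 5) (At 0 7 (At 1 7 (By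
41 [0,1,2,3,4,5,7,6]) (At 2 7 (By 41 [0,2,1,3,4,5,7,6]) (At 3 7 (By 41 [0,3,1,2,4,5,7,6]) (At 4 7 (By 43 [0,1,2,
3,4,5,7,6]) (At 5 7 (Low 5) (At 6 7 Solved (Clq [1,2,3,4,6,7]))))))) (At 1 7 (Keep 44 (At 2 7 (By 41 [1,2,0,3,4,
5,7,6]) (At 3 7 (By 41 [1,3,0,2,4,5,7,6]) (At 4 7 (By 43 [1,0,2,3,4,5,7,6]) (At 5 7 (Low 5) (At 6 7 Solved Solved))))))
(At 2 7 (By 44 [0,2,1,3,4,5,6,7]) (At 3 7 (By 44 [0,3,1,2,4,5,6,7]) (At 4 7 (At 5 7 (Low 5) (At 6 7 (By 43 [0,1,
2,3,7,5,6,4]) Solved)) (Clq [0,1,2,3,4,7])))))))))))) (At 1 6 (By 45 [1,0,2,3,4,5,6,7]) (At 2 6 (By 45 [2,0,1,3,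
4,5,6,7]) (At 3 6 (By 45 [3,0,1,2,4,5,6,7]) (At 4 6 (At 5 6 (Low 5) (At 0 7 (By 45 [0,1,2,3,4,5,7,6]) (At 1 7 (By
45 [1,0,2,3,4,5,7,6]) (At 2 7 (By 45 [2,0,1,3,4,5,7,6]) (At 3 7 (By 45 [3,0,1,2,4,5,7,6]) (At 4 7 (At 5 7 (Low
5) (At 6 7 Solved (Clq [0,1,2,3,6,7]))) (Clq [0,1,2,3,4,7]))))))) (Clq [0,1,2,3,4,6])))))))) (At 4 5 (By 46 [0,
1,2,4,3,5,6,7]) (At 0 6 (Keep 105 (At 1 6 (Keep 87 (At 2 6 (Keep 64 (At 3 6 (By 46 [0,1,2,3,4,6,5,7]) (At 4 6 (By
46 [0,1,2,4,3,6,5,7]) (At 5 6 (Keep 52 (At 0 7 (Keep 50 (At 1 7 (Keep 48 (At 2 7 (At 3 7 (By 46 [0,1,2,3,4,7,5,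
6]) (At 4 7 (By 46 [0,1,2,4,3,7,5,6]) (At 5 7 (Low 5) (At 6 7 (Low 6) Solved)))) (At 3 7 (Keep 47 (At 4 7 (By 46
[0,1,3,4,2,7,5,6]) (At 5 7 (Low 5) (At 6 7 (Low 6) Solved)))) (At 4 7 (By 47 [0,1,2,4,3,5,6,7]) (At 5 7 (Low 5)
(At 6 7 (Low 6) Solved)))))) (At 2 7 (By 48 [0,2,1,3,4,5,6,7]) (At 3 7 (Keep 49 (At 4 7 (At 5 7 (Low 5) (At 6 7
(Low 6) Solved)) (At 5 7 (Low 5) (At 6 7 (Low 6) Solved)))) (At 4 7 (By 49 [0,1,2,4,3,5,6,7]) (At 5 7 (Low 5) (At
6 7 (Low 6) Solved))))))) (At 1 7 (By 50 [1,0,2,3,4,5,6,7]) (At 2 7 (By 50 [2,0,1,3,4,5,6,7]) (At 3 7 (Keep 51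
(At 4 7 (At 5 7 (Low 5) (At 6 7 (Low 6) Solved)) (At 5 7 (Low 5) (At 6 7 (Low 6) Solved)))) (At 4 7 (By 51 [0,1,
2,4,3,5,6,7]) (Clq [0,1,2,3,4,7]))))))) (At 0 7 (Keep 61 (At 1 7 (Keep 56 (At 2 7 (At 3 7 (By 46 [0,1,2,3,4,7,5,
6]) (At 4 7 (By 46 [0,1,2,4,3,7,5,6]) (At 5 7 (By 52 [0,1,2,3,4,5,7,6]) (At 6 7 (By 52 [0,1,2,3,4,6,7,5]) Solved))))
(At 3 7 (Keep 54 (At 4 7 (By 46 [0,1,3,4,2,7,5,6]) (At 5 7 (Keep 53 (At 6 7 (Low 7) Solved)) (At 6 7 (By 53 [0,
1,2,3,4,6,5,7]) Solved)))) (At 4 7 (By 54 [0,1,2,4,3,5,6,7]) (At 5 7 (Keep 55 (At 6 7 Solved Solved)) (At 6 7 (By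
55 [0,1,2,3,4,6,5,7]) Solved)))))) (At 2 7 (By 56 [0,2,1,3,4,5,6,7]) (At 3 7 (Keep 59 (At 4 7 (At 5 7 (Keep 57
(At 6 7 (Low 7) Solved)) (At 6 7 (By 57 [0,1,2,3,4,6,5,7]) Solved)) (At 5 7 (Keep 58 (At 6 7 Solved Solved)) (At
6 7 (By 58 [0,1,2,3,4,6,5,7]) Solved)))) (At 4 7 (By 59 [0,1,2,4,3,5,6,7]) (At 5 7 (Keep 60 (At 6 7 Solved Solved))
(At 6 7 (By 60 [0,1,2,3,4,6,5,7]) Solved))))))) (At 1 7 (By 61 [1,0,2,3,4,5,6,7]) (At 2 7 (By 61 [2,0,1,3,4,5,6,
7]) (At 3 7 (Keep 63 (At 4 7 (At 5 7 (Keep 62 (At 6 7 Solved Solved)) (At 6 7 (By 62 [0,1,2,3,4,6,5,7]) Solved))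
(At 5 7 (By 46 [0,1,2,7,4,5,3,6]) (At 6 7 (By 46 [0,1,2,7,4,6,3,5]) Solved)))) (At 4 7 (By 63 [0,1,2,4,3,5,6,7])
(Clq [0,1,2,3,4,7])))))))))) (At 3 6 (Keep 77 (At 4 6 (By 46 [0,1,3,4,2,6,5,7]) (At 5 6 (Keep 68 (At 0 7 (Keep
66 (At 1 7 (At 2 7 (By 64 [0,1,2,3,4,5,7,6]) (At 3 7 (By 64 [0,1,3,2,4,6,7,5]) (At 4 7 (At 5 7 (Low 5) (At 6 7
(Low 6) Solved)) (At 5 7 (Low 5) (At 6 7 (Low 6) Solved))))) (At 2 7 (Keep 65 (At 3 7 (At 4 7 (By 46 [0,2,3,4,1,
7,5,6]) (At 5 7 (Low 5) (At 6 7 (Low 6) Solved))) (At 4 7 (At 5 7 (Low 5) (At 6 7 (Low 6) Solved)) (At 5 7 (Low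
5) (At 6 7 (Low 6) Solved))))) (At 3 7 (By 65 [0,1,3,2,4,6,5,7]) (At 4 7 (At 5 7 (Low 5) (At 6 7 (Low 6) Solved))
(At 5 7 (Low 5) (At 6 7 (Low 6) Solved))))))) (At 1 7 (By 66 [1,0,2,3,4,5,6,7]) (At 2 7 (Keep 67 (At 3 7 (At 4
7 (At 5 7 (Low 5) (At 6 7 (Low 6) Solved)) (At 5 7 (Low 5) (At 6 7 (Low 6) Solved))) (At 4 7 (At 5 7 (Low 5) (At
6 7 (Low 6) Solved)) (At 5 7 (Low 5) (At 6 7 (Low 6) Solved))))) (At 3 7 (By 67 [0,1,3,2,4,6,5,7]) (At 4 7 (At
5 7 (Low 5) (At 6 7 (Low 6) Solved)) (Clq [0,1,2,3,4,7]))))))) (At 0 7 (Keep 73 (At 1 7 (At 2 7 (By 64 [0,1,2,3,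
4,5,7,6]) (At 3 7 (By 64 [0,1,3,2,4,6,7,5]) (At 4 7 (At 5 7 (By 68 [0,1,2,4,3,5,7,6]) (At 6 7 (By 68 [0,1,3,4,2,
6,7,5]) Solved)) (At 5 7 (Keep 69 (At 6 7 Solved Solved)) (At 6 7 (By 69 [0,1,3,2,4,6,5,7]) Solved))))) (At 2 7
(Keep 70 (At 3 7 (At 4 7 (By 46 [0,2,3,4,1,7,5,6]) (At 5 7 (By 68 [0,2,1,3,4,5,7,6]) (At 6 7 (By 68 [0,3,1,2,4,
6,7,5]) Solved))) (At 4 7 (At 5 7 (By 68 [0,2,1,4,3,5,7,6]) (At 6 7 Solved Solved)) (At 5 7 (At 6 7 Solved Solved)
(At 6 7 Solved Solved))))) (At 3 7 (By 70 [0,1,3,2,4,6,5,7]) (At 4 7 (At 5 7 (Keep 71 (At 6 7 Solved Solved)) (At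
6 7 (By 71 [0,1,3,2,4,6,5,7]) Solved)) (At 5 7 (Keep 72 (At 6 7 Solved Solved)) (At 6 7 (By 72 [0,1,3,2,4,6,5,7])
Solved))))))) (At 1 7 (By 73 [1,0,2,3,4,5,6,7]) (At 2 7 (Keep 76 (At 3 7 (At 4 7 (At 5 7 (Keep 74 (At 6 7 (Low
7) Solved)) (At 6 7 (By 74 [0,1,3,2,4,6,5,7]) Solved)) (At 5 7 (Keep 75 (At 6 7 Solved Solved)) (At 6 7 (By 75
[0,1,3,2,4,6,5,7]) Solved))) (At 4 7 (At 5 7 (At 6 7 Solved Solved) (At 6 7 Solved Solved)) (At 5 7 (At 6 7 (By
64 [0,1,7,3,4,5,6,2]) Solved) (At 6 7 (By 46 [0,1,3,7,4,6,2,5]) Solved))))) (At 3 7 (By 76 [0,1,3,2,4,6,5,7]) (At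
4 7 (At 5 7 (By 46 [0,1,2,7,3,5,4,6]) (At 6 7 (By 46 [0,1,3,7,2,6,4,5]) Solved)) (Clq [0,1,2,3,4,7]))))))))) (At
4 6 (By 77 [0,1,2,4,3,5,6,7]) (At 5 6 (Keep 82 (At 0 7 (Keep 79 (At 1 7 (At 2 7 (By 64 [0,1,2,3,4,5,7,6]) (At 3
7 (By 77 [0,1,2,3,4,5,7,6]) (At 4 7 (By 77 [0,1,2,4,3,5,7,6]) (At 5 7 (Low 5) (At 6 7 Solved Solved))))) (At 2
7 (At 3 7 (By 77 [0,2,1,3,4,5,7,6]) (At 4 7 (By 77 [0,2,1,4,3,5,7,6]) (At 5 7 (Low 5) (At 6 7 Solved Solved))))
(At 3 7 (Keep 78 (At 4 7 (At 5 7 (Low 5) (At 6 7 Solved Solved)) (At 5 7 (Low 5) (At 6 7 Solved Solved)))) (At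
4 7 (By 78 [0,1,2,4,3,5,6,7]) (At 5 7 (Low 5) (At 6 7 Solved Solved))))))) (At 1 7 (By 79 [1,0,2,3,4,5,6,7]) (At
2 7 (At 3 7 (Keep 80 (At 4 7 (At 5 7 (Low 5) (At 6 7 Solved Solved)) (At 5 7 (Low 5) (At 6 7 Solved Solved))))
(At 4 7 (By 80 [0,1,2,4,3,5,6,7]) (At 5 7 (Low 5) (At 6 7 Solved Solved)))) (At 3 7 (Keep 81 (At 4 7 (At 5 7 (Low
5) (At 6 7 Solved Solved)) (At 5 7 (Low 5) (At 6 7 (By 77 [0,1,2,7,4,5,6,3]) Solved)))) (At 4 7 (By 81 [0,1,2,4,
3,5,6,7]) (Clq [0,1,2,3,4,7]))))))) (At 0 7 (Keep 84 (At 1 7 (At 2 7 (By 64 [0,1,2,3,4,5,7,6]) (At 3 7 (By 77 [0,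
1,2,3,4,5,7,6]) (At 4 7 (By 77 [0,1,2,4,3,5,7,6]) (At 5 7 (By 82 [0,1,2,3,4,5,7,6]) (At 6 7 Solved (By 64 [5,6,
7,3,4,0,1,2])))))) (At 2 7 (At 3 7 (By 77 [0,2,1,3,4,5,7,6]) (At 4 7 (By 77 [0,2,1,4,3,5,7,6]) (At 5 7 (By 82 [0,
2,1,3,4,5,7,6]) (At 6 7 Solved Solved)))) (At 3 7 (Keep 83 (At 4 7 (At 5 7 (At 6 7 (Low 7) Solved) (At 6 7 Solved
Solved)) (At 5 7 (At 6 7 Solved Solved) (At 6 7 Solved Solved)))) (At 4 7 (By 83 [0,1,2,4,3,5,6,7]) (At 5 7 (At
6 7 Solved Solved) (At 6 7 Solved Solved))))))) (At 1 7 (By 84 [1,0,2,3,4,5,6,7]) (At 2 7 (At 3 7 (Keep 85 (At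
4 7 (At 5 7 (At 6 7 (Low 7) Solved) (At 6 7 Solved Solved)) (At 5 7 (At 6 7 Solved Solved) (At 6 7 Solved Solved))))
(At 4 7 (By 85 [0,1,2,4,3,5,6,7]) (At 5 7 (At 6 7 (By 64 [0,1,7,3,4,5,6,2]) Solved) (At 6 7 Solved Solved)))) (At
3 7 (Keep 86 (At 4 7 (At 5 7 (At 6 7 Solved Solved) (At 6 7 Solved Solved)) (At 5 7 (By 46 [0,1,2,7,4,5,3,6]) (At
6 7 (By 77 [0,1,2,7,4,5,6,3]) Solved)))) (At 4 7 (By 86 [0,1,2,4,3,5,6,7]) (Clq [0,1,2,3,4,7]))))))))))) (At 2
6 (By 87 [0,2,1,3,4,5,6,7]) (At 3 6 (Keep 98 (At 4 6 (Keep 94 (At 5 6 (At 0 7 (At 1 7 (By 87 [0,1,2,3,4,5,7,6])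
(At 2 7 (By 87 [0,2,1,3,4,5,7,6]) (At 3 7 (By 87 [0,3,4,1,2,6,7,5]) (At 4 7 (By 87 [0,4,3,1,2,6,7,5]) (At 5 7 (Low
5) (At 6 7 (Low 6) Solved)))))) (At 1 7 (Keep 89 (At 2 7 (By 87 [1,2,0,3,4,5,7,6]) (At 3 7 (Keep 88 (At 4 7 (By
87 [3,4,0,1,2,6,7,5]) (At 5 7 (Low 5) (At 6 7 (Low 6) Solved)))) (At 4 7 (By 88 [0,1,2,4,3,5,6,7]) (At 5 7 (Low
5) (At 6 7 (Low 6) Solved)))))) (At 2 7 (By 89 [0,2,1,3,4,5,6,7]) (At 3 7 (By 89 [0,3,4,1,2,6,5,7]) (At 4 7 (By
89 [0,4,3,1,2,6,5,7]) (Clq [0,1,2,3,4,7])))))) (At 0 7 (At 1 7 (By 87 [0,1,2,3,4,5,7,6]) (At 2 7 (By 87 [0,2,1,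
3,4,5,7,6]) (At 3 7 (By 87 [0,3,4,1,2,6,7,5]) (At 4 7 (By 87 [0,4,3,1,2,6,7,5]) (At 5 7 (Keep 90 (At 6 7 Solved
Solved)) (At 6 7 (By 90 [0,3,4,1,2,6,5,7]) Solved)))))) (At 1 7 (Keep 93 (At 2 7 (By 87 [1,2,0,3,4,5,7,6]) (At
3 7 (Keep 92 (At 4 7 (By 87 [3,4,0,1,2,6,7,5]) (At 5 7 (Keep 91 (At 6 7 Solved Solved)) (At 6 7 (By 91 [0,3,4,1,
2,6,5,7]) Solved)))) (At 4 7 (By 92 [0,1,2,4,3,5,6,7]) (At 5 7 (At 6 7 (By 87 [0,7,2,3,4,5,6,1]) Solved) (At 6
7 (By 46 [0,3,4,7,2,6,1,5]) Solved)))))) (At 2 7 (By 93 [0,2,1,3,4,5,6,7]) (At 3 7 (By 93 [0,3,4,1,2,6,5,7]) (At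
4 7 (By 93 [0,4,3,1,2,6,5,7]) (Clq [0,1,2,3,4,7])))))))) (At 5 6 (Keep 96 (At 0 7 (At 1 7 (By 87 [0,1,2,3,4,5,7,
6]) (At 2 7 (By 87 [0,2,1,3,4,5,7,6]) (At 3 7 (At 4 7 (By 94 [0,1,2,3,4,5,7,6]) (At 5 7 (Low 5) (At 6 7 Solved
Solved))) (At 4 7 (At 5 7 (Low 5) (At 6 7 Solved Solved)) (At 5 7 (Low 5) (At 6 7 Solved Solved)))))) (At 1 7 (Keep
95 (At 2 7 (By 87 [1,2,0,3,4,5,7,6]) (At 3 7 (At 4 7 (By 94 [1,0,2,3,4,5,7,6]) (At 5 7 (Low 5) (At 6 7 Solved Solved)))
(At 4 7 (At 5 7 (Low 5) (At 6 7 Solved Solved)) (At 5 7 (Low 5) (At 6 7 Solved Solved)))))) (At 2 7 (By 95 [0,2,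
1,3,4,5,6,7]) (At 3 7 (At 4 7 (At 5 7 (Low 5) (At 6 7 Solved Solved)) (At 5 7 (Low 5) (At 6 7 Solved Solved)))
(At 4 7 (At 5 7 (Low 5) (At 6 7 (By 94 [0,1,2,3,7,5,6,4]) Solved)) (Clq [0,1,2,3,4,7]))))))) (At 0 7 (At 1 7 (By
87 [0,1,2,3,4,5,7,6]) (At 2 7 (By 87 [0,2,1,3,4,5,7,6]) (At 3 7 (At 4 7 (By 94 [0,1,2,3,4,5,7,6]) (At 5 7 (By 96
[0,1,2,3,4,5,7,6]) (At 6 7 Solved Solved))) (At 4 7 (At 5 7 (By 96 [0,1,2,4,3,5,7,6]) (At 6 7 Solved Solved)) (At
5 7 (At 6 7 Solved (By 96 [7,1,2,6,4,5,0,3])) (At 6 7 Solved Solved)))))) (At 1 7 (Keep 97 (At 2 7 (By 87 [1,2,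
0,3,4,5,7,6]) (At 3 7 (At 4 7 (By 94 [1,0,2,3,4,5,7,6]) (At 5 7 (By 96 [1,0,2,3,4,5,7,6]) (At 6 7 Solved Solved)))
(At 4 7 (At 5 7 (By 96 [1,0,2,4,3,5,7,6]) (At 6 7 Solved Solved)) (At 5 7 (At 6 7 (By 87 [0,7,2,3,4,5,6,1]) Solved)
(At 6 7 Solved Solved)))))) (At 2 7 (By 97 [0,2,1,3,4,5,6,7]) (At 3 7 (At 4 7 (At 5 7 (At 6 7 Solved Solved) (At
6 7 Solved Solved)) (At 5 7 (By 46 [0,1,2,7,4,5,3,6]) (At 6 7 Solved Solved))) (At 4 7 (At 5 7 (By 46 [0,1,2,7,
3,5,4,6]) (At 6 7 (By 94 [0,1,2,3,7,5,6,4]) Solved)) (Clq [0,1,2,3,4,7]))))))))) (At 4 6 (By 98 [0,1,2,4,3,5,6,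
7]) (At 5 6 (Keep 102 (At 0 7 (Keep 99 (At 1 7 (By 87 [0,1,2,3,4,5,7,6]) (At 2 7 (By 87 [0,2,1,3,4,5,7,6]) (At
3 7 (By 98 [0,1,2,3,4,5,7,6]) (At 4 7 (By 98 [0,1,2,4,3,5,7,6]) (At 5 7 (Low 5) (At 6 7 Solved (Clq [1,2,3,4,6,
7])))))))) (At 1 7 (Keep 100 (At 2 7 (By 87 [1,2,0,3,4,5,7,6]) (At 3 7 (By 98 [1,0,2,3,4,5,7,6]) (At 4 7 (By 98
[1,0,2,4,3,5,7,6]) (At 5 7 (Low 5) (At 6 7 (By 99 [6,1,2,3,4,5,0,7]) Solved)))))) (At 2 7 (By 100 [0,2,1,3,4,5,
6,7]) (At 3 7 (Keep 101 (At 4 7 (At 5 7 (Low 5) (At 6 7 (By 99 [6,1,2,3,4,5,0,7]) Solved)) (At 5 7 (Low 5) (At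
6 7 (By 99 [6,1,2,3,4,5,0,7]) Solved)))) (At 4 7 (By 101 [0,1,2,4,3,5,6,7]) (Clq [0,1,2,3,4,7]))))))) (At 0 7 (At
1 7 (By 87 [0,1,2,3,4,5,7,6]) (At 2 7 (By 87 [0,2,1,3,4,5,7,6]) (At 3 7 (By 98 [0,1,2,3,4,5,7,6]) (At 4 7 (By 98
[0,1,2,4,3,5,7,6]) (At 5 7 (By 102 [0,1,2,3,4,5,7,6]) (At 6 7 Solved (Clq [1,2,3,4,6,7]))))))) (At 1 7 (Keep 103
(At 2 7 (By 87 [1,2,0,3,4,5,7,6]) (At 3 7 (By 98 [1,0,2,3,4,5,7,6]) (At 4 7 (By 98 [1,0,2,4,3,5,7,6]) (At 5 7 (By
102 [1,0,2,3,4,5,7,6]) (At 6 7 Solved Solved)))))) (At 2 7 (By 103 [0,2,1,3,4,5,6,7]) (At 3 7 (Keep 104 (At 4 7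
(At 5 7 (At 6 7 Solved Solved) (At 6 7 Solved Solved)) (At 5 7 (By 46 [0,1,2,7,4,5,3,6]) (At 6 7 (By 98 [0,1,2,
7,4,5,6,3]) Solved)))) (At 4 7 (By 104 [0,1,2,4,3,5,6,7]) (Clq [0,1,2,3,4,7])))))))))))) (At 1 6 (By 105 [1,0,2,
3,4,5,6,7]) (At 2 6 (By 105 [2,0,1,3,4,5,6,7]) (At 3 6 (Keep 111 (At 4 6 (Keep 109 (At 5 6 (Keep 107 (At 0 7 (By
105 [0,1,2,3,4,5,7,6]) (At 1 7 (By 105 [1,0,2,3,4,5,7,6]) (At 2 7 (By 105 [2,0,1,3,4,5,7,6]) (At 3 7 (Keep 106
(At 4 7 (At 5 7 (Low 5) (At 6 7 Solved (By 46 [0,1,2,6,7,5,3,4]))) (At 5 7 (Low 5) (At 6 7 Solved (By 46 [0,1,2,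
6,7,5,3,4]))))) (At 4 7 (By 106 [0,1,2,4,3,5,6,7]) (Clq [0,1,2,3,4,7]))))))) (At 0 7 (By 105 [0,1,2,3,4,5,7,6])
(At 1 7 (By 105 [1,0,2,3,4,5,7,6]) (At 2 7 (By 105 [2,0,1,3,4,5,7,6]) (At 3 7 (Keep 108 (At 4 7 (At 5 7 (By 107
[0,1,2,3,4,5,7,6]) (At 6 7 Solved Solved)) (At 5 7 (By 46 [0,1,2,7,4,5,3,6]) (At 6 7 Solved Solved)))) (At 4 7
(By 108 [0,1,2,4,3,5,6,7]) (Clq [0,1,2,3,4,7])))))))) (At 5 6 (By 46 [0,1,2,6,4,5,3,7]) (At 0 7 (By 105 [0,1,2,
3,4,5,7,6]) (At 1 7 (By 105 [1,0,2,3,4,5,7,6]) (At 2 7 (By 105 [2,0,1,3,4,5,7,6]) (At 3 7 (Keep 110 (At 4 7 (By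
109 [0,1,2,3,4,5,7,6]) (At 5 7 (By 46 [0,1,2,7,4,5,3,6]) (At 6 7 Solved (Clq [0,1,2,4,6,7]))))) (At 4 7 (At 5 7
(By 46 [0,1,2,7,3,5,4,6]) (At 6 7 (By 110 [0,1,2,6,4,5,3,7]) Solved)) (Clq [0,1,2,3,4,7]))))))))) (At 4 6 (By 111
[0,1,2,4,3,5,6,7]) (Clq [0,1,2,3,4,6]))))))))) (At 3 5 (By 112 [0,1,3,2,4,5,6,7]) (At 4 5 (By 112 [0,1,4,2,3,5,
6,7]) (At 0 6 (Keep 154 (At 1 6 (Keep 129 (At 2 6 (By 112 [0,1,2,3,4,6,5,7]) (At 3 6 (By 112 [0,1,3,2,4,6,5,7])
(At 4 6 (By 112 [0,1,4,2,3,6,5,7]) (At 5 6 (Keep 121 (At 0 7 (Keep 117 (At 1 7 (At 2 7 (By 112 [0,1,2,3,4,7,5,6])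
(At 3 7 (By 112 [0,1,3,2,4,7,5,6]) (At 4 7 (By 112 [0,1,4,2,3,7,5,6]) (At 5 7 (Keep 113 (At 6 7 Solved Solved))
(At 6 7 (By 113 [0,1,2,3,4,6,5,7]) Solved))))) (At 2 7 (Keep 115 (At 3 7 (By 112 [0,2,3,1,4,7,5,6]) (At 4 7 (By
112 [0,2,4,1,3,7,5,6]) (At 5 7 (Keep 114 (At 6 7 Solved Solved)) (At 6 7 (By 114 [0,1,2,3,4,6,5,7]) Solved)))))
(At 3 7 (By 115 [0,1,3,2,4,5,6,7]) (At 4 7 (By 115 [0,1,4,2,3,5,6,7]) (At 5 7 (Keep 116 (At 6 7 Solved Solved))
(At 6 7 (By 116 [0,1,2,3,4,6,5,7]) Solved))))))) (At 1 7 (By 117 [1,0,2,3,4,5,6,7]) (At 2 7 (Keep 120 (At 3 7 (Keep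
119 (At 4 7 (By 112 [2,3,4,0,1,7,5,6]) (At 5 7 (Keep 118 (At 6 7 Solved Solved)) (At 6 7 (By 118 [0,1,2,3,4,6,5,
7]) Solved)))) (At 4 7 (By 119 [0,1,2,4,3,5,6,7]) (At 5 7 (By 112 [0,1,7,3,4,5,2,6]) (At 6 7 (By 112 [0,1,7,3,4,
6,2,5]) Solved))))) (At 3 7 (By 120 [0,1,3,2,4,5,6,7]) (At 4 7 (By 120 [0,1,4,2,3,5,6,7]) (Clq [0,1,2,3,4,7])))))))
(At 0 7 (Keep 126 (At 1 7 (Keep 122 (At 2 7 (By 112 [0,1,2,3,4,7,5,6]) (At 3 7 (By 112 [0,1,3,2,4,7,5,6]) (At 4
7 (By 112 [0,1,4,2,3,7,5,6]) (At 5 7 (By 121 [0,1,2,3,4,5,7,6]) (At 6 7 (By 121 [0,1,2,3,4,6,7,5]) (Clq [2,3,4,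
5,6,7]))))))) (At 2 7 (Keep 124 (At 3 7 (By 112 [0,2,3,1,4,7,5,6]) (At 4 7 (By 112 [0,2,4,1,3,7,5,6]) (At 5 7 (Keep
123 (At 6 7 (By 122 [5,6,2,3,4,0,1,7]) Solved)) (At 6 7 (By 123 [0,1,2,3,4,6,5,7]) (By 112 [5,6,7,3,4,0,1,2]))))))
(At 3 7 (By 124 [0,1,3,2,4,5,6,7]) (At 4 7 (By 124 [0,1,4,2,3,5,6,7]) (At 5 7 (Keep 125 (At 6 7 (By 122 [5,6,2,
3,4,0,1,7]) Solved)) (At 6 7 (By 125 [0,1,2,3,4,6,5,7]) (Clq [2,3,4,5,6,7])))))))) (At 1 7 (By 126 [1,0,2,3,4,5,
6,7]) (At 2 7 (Keep 128 (At 3 7 (Keep 127 (At 4 7 (By 112 [2,3,4,0,1,7,5,6]) (At 5 7 (By 126 [5,6,2,3,4,0,1,7])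
(At 6 7 (By 126 [6,5,2,3,4,0,1,7]) Solved)))) (At 4 7 (By 127 [0,1,2,4,3,5,6,7]) (At 5 7 (By 126 [5,6,2,3,4,0,1,
7]) (At 6 7 (By 126 [6,5,2,3,4,0,1,7]) Solved))))) (At 3 7 (By 128 [0,1,3,2,4,5,6,7]) (At 4 7 (By 128 [0,1,4,2,
3,5,6,7]) (Clq [0,1,2,3,4,7]))))))))))) (At 2 6 (Keep 145 (At 3 6 (By 112 [0,2,3,1,4,6,5,7]) (At 4 6 (By 112 [0,
2,4,1,3,6,5,7]) (At 5 6 (Keep 138 (At 0 7 (At 1 7 (By 129 [0,1,2,3,4,5,7,6]) (At 2 7 (By 129 [0,2,1,3,4,6,7,5])
(At 3 7 (Keep 131 (At 4 7 (By 112 [0,3,4,1,2,7,5,6]) (At 5 7 (Keep 130 (At 6 7 Solved Solved)) (At 6 7 (By 130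
[0,2,1,3,4,6,5,7]) Solved)))) (At 4 7 (By 131 [0,1,2,4,3,5,6,7]) (At 5 7 (Keep 132 (At 6 7 Solved (By 129 [6,7,
1,3,4,0,5,2]))) (At 6 7 (By 132 [0,2,1,3,4,6,5,7]) Solved)))))) (At 1 7 (Keep 135 (At 2 7 (At 3 7 (By 112 [1,2,
3,0,4,7,5,6]) (At 4 7 (By 112 [1,2,4,0,3,7,5,6]) (At 5 7 (Keep 133 (At 6 7 Solved Solved)) (At 6 7 (By 133 [0,2,
1,3,4,6,5,7]) Solved)))) (At 3 7 (Keep 134 (At 4 7 (By 112 [1,3,4,0,2,7,5,6]) (At 5 7 (At 6 7 Solved Solved) (At
6 7 Solved Solved)))) (At 4 7 (By 134 [0,1,2,4,3,5,6,7]) (At 5 7 (At 6 7 (By 129 [0,7,2,3,4,5,6,1]) Solved) (At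
6 7 (By 129 [5,7,2,3,4,1,6,0]) Solved)))))) (At 2 7 (By 135 [0,2,1,3,4,6,5,7]) (At 3 7 (Keep 137 (At 4 7 (At 5
7 (Keep 136 (At 6 7 Solved Solved)) (At 6 7 (By 136 [0,2,1,3,4,6,5,7]) Solved)) (At 5 7 (By 112 [0,1,7,2,4,5,3,
6]) (At 6 7 (By 112 [0,2,7,1,4,6,3,5]) Solved)))) (At 4 7 (By 137 [0,1,2,4,3,5,6,7]) (Clq [0,1,2,3,4,7])))))))
(At 0 7 (At 1 7 (By 129 [0,1,2,3,4,5,7,6]) (At 2 7 (By 129 [0,2,1,3,4,6,7,5]) (At 3 7 (Keep 139 (At 4 7 (By 112
[0,3,4,1,2,7,5,6]) (At 5 7 (By 138 [0,1,3,2,4,5,7,6]) (At 6 7 (By 138 [0,2,3,1,4,6,7,5]) Solved)))) (At 4 7 (By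
139 [0,1,2,4,3,5,6,7]) (At 5 7 (Keep 140 (At 6 7 Solved (By 138 [7,1,6,3,4,5,0,2]))) (At 6 7 (By 140 [0,2,1,3,4,
6,5,7]) (By 112 [5,6,7,3,4,0,1,2]))))))) (At 1 7 (Keep 142 (At 2 7 (At 3 7 (By 112 [1,2,3,0,4,7,5,6]) (At 4 7 (By
112 [1,2,4,0,3,7,5,6]) (At 5 7 (By 138 [1,0,2,3,4,5,7,6]) (At 6 7 (By 138 [2,0,1,3,4,6,7,5]) Solved)))) (At 3 7
(Keep 141 (At 4 7 (By 112 [1,3,4,0,2,7,5,6]) (At 5 7 (By 138 [1,0,3,2,4,5,7,6]) (At 6 7 Solved Solved)))) (At 4
7 (By 141 [0,1,2,4,3,5,6,7]) (At 5 7 (At 6 7 (By 129 [0,7,2,3,4,5,6,1]) Solved) (At 6 7 (By 112 [0,2,7,3,4,6,1,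
5]) Solved)))))) (At 2 7 (By 142 [0,2,1,3,4,6,5,7]) (At 3 7 (Keep 144 (At 4 7 (At 5 7 (Keep 143 (At 6 7 Solved
Solved)) (At 6 7 (By 143 [0,2,1,3,4,6,5,7]) Solved)) (At 5 7 (By 112 [0,1,7,2,4,5,3,6]) (At 6 7 (By 112 [0,2,7,
1,4,6,3,5]) Solved)))) (At 4 7 (By 144 [0,1,2,4,3,5,6,7]) (Clq [0,1,2,3,4,7])))))))))) (At 3 6 (By 145 [0,1,3,2,
4,5,6,7]) (At 4 6 (By 145 [0,1,4,2,3,5,6,7]) (At 5 6 (Keep 149 (At 0 7 (Keep 146 (At 1 7 (By 129 [0,1,2,3,4,5,7,
6]) (At 2 7 (By 145 [0,1,2,3,4,5,7,6]) (At 3 7 (By 145 [0,1,3,2,4,5,7,6]) (At 4 7 (By 145 [0,1,4,2,3,5,7,6]) (At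
5 7 (At 6 7 Solved (Clq [1,2,3,4,6,7])) (At 6 7 (By 129 [5,7,2,3,4,0,6,1]) (Clq [1,2,3,4,6,7])))))))) (At 1 7 (At
2 7 (By 145 [1,0,2,3,4,5,7,6]) (At 3 7 (By 145 [1,0,3,2,4,5,7,6]) (At 4 7 (By 145 [1,0,4,2,3,5,7,6]) (At 5 7 (At
6 7 (By 146 [6,1,2,3,4,5,0,7]) Solved) (At 6 7 (By 146 [5,7,2,3,4,6,0,1]) Solved))))) (At 2 7 (Keep 148 (At 3 7
(Keep 147 (At 4 7 (By 112 [2,3,4,0,1,7,5,6]) (At 5 7 (At 6 7 (By 146 [6,1,2,3,4,5,0,7]) Solved) (At 6 7 (By 146
[6,1,2,3,4,5,0,7]) Solved)))) (At 4 7 (By 147 [0,1,2,4,3,5,6,7]) (At 5 7 (By 112 [0,1,7,3,4,5,2,6]) (At 6 7 (By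
146 [6,1,2,3,4,5,0,7]) Solved))))) (At 3 7 (By 148 [0,1,3,2,4,5,6,7]) (At 4 7 (By 148 [0,1,4,2,3,5,6,7]) (Clq [0,
1,2,3,4,7]))))))) (At 0 7 (Keep 150 (At 1 7 (By 129 [0,1,2,3,4,5,7,6]) (At 2 7 (By 145 [0,1,2,3,4,5,7,6]) (At 3
7 (By 145 [0,1,3,2,4,5,7,6]) (At 4 7 (By 145 [0,1,4,2,3,5,7,6]) (At 5 7 (By 149 [0,1,2,3,4,5,7,6]) (At 6 7 (By
149 [6,5,2,3,4,0,7,1]) (Clq [1,2,3,4,6,7])))))))) (At 1 7 (Keep 151 (At 2 7 (By 145 [1,0,2,3,4,5,7,6]) (At 3 7
(By 145 [1,0,3,2,4,5,7,6]) (At 4 7 (By 145 [1,0,4,2,3,5,7,6]) (At 5 7 (By 150 [5,6,2,3,4,0,1,7]) (At 6 7 Solved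
(Clq [2,3,4,5,6,7]))))))) (At 2 7 (Keep 153 (At 3 7 (Keep 152 (At 4 7 (By 112 [2,3,4,0,1,7,5,6]) (At 5 7 (By 150
[5,6,2,3,4,0,1,7]) (At 6 7 (By 151 [5,6,2,3,4,0,1,7]) Solved)))) (At 4 7 (By 152 [0,1,2,4,3,5,6,7]) (At 5 7 (By
150 [5,6,2,3,4,0,1,7]) (At 6 7 (By 151 [5,6,2,3,4,0,1,7]) Solved))))) (At 3 7 (By 153 [0,1,3,2,4,5,6,7]) (At 4
7 (By 153 [0,1,4,2,3,5,6,7]) (Clq [0,1,2,3,4,7])))))))))))) (At 1 6 (By 154 [1,0,2,3,4,5,6,7]) (At 2 6 (Keep 158
(At 3 6 (Keep 155 (At 4 6 (By 112 [2,3,4,0,1,6,5,7]) (At 5 6 (At 0 7 (By 154 [0,1,2,3,4,5,7,6]) (At 1 7 (By 154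
[1,0,2,3,4,5,7,6]) (At 2 7 (By 154 [2,3,0,1,4,6,7,5]) (At 3 7 (By 154 [3,2,0,1,4,6,7,5]) (At 4 7 (At 5 7 (By 112
[0,1,7,2,3,5,4,6]) (At 6 7 (By 112 [2,3,7,0,1,6,4,5]) Solved)) (Clq [0,1,2,3,4,7])))))) (At 0 7 (By 154 [0,1,2,
3,4,5,7,6]) (At 1 7 (By 154 [1,0,2,3,4,5,7,6]) (At 2 7 (By 154 [2,3,0,1,4,6,7,5]) (At 3 7 (By 154 [3,2,0,1,4,6,
7,5]) (At 4 7 (At 5 7 (By 112 [0,1,7,2,3,5,4,6]) (At 6 7 (By 112 [2,3,7,0,1,6,4,5]) Solved)) (Clq [0,1,2,3,4,7])))))))))
(At 4 6 (By 155 [0,1,2,4,3,5,6,7]) (At 5 6 (By 112 [0,1,6,3,4,5,2,7]) (At 0 7 (By 154 [0,1,2,3,4,5,7,6]) (At 1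
7 (By 154 [1,0,2,3,4,5,7,6]) (At 2 7 (Keep 156 (At 3 7 (By 155 [0,1,2,3,4,5,7,6]) (At 4 7 (By 155 [0,1,2,4,3,5,
7,6]) (At 5 7 (By 112 [0,1,7,3,4,5,2,6]) (At 6 7 Solved (Clq [0,1,3,4,6,7])))))) (At 3 7 (Keep 157 (At 4 7 (By
155 [0,1,3,4,2,5,7,6]) (At 5 7 (By 112 [0,1,7,2,4,5,3,6]) (At 6 7 (By 156 [0,1,6,3,4,5,2,7]) Solved)))) (At 4 7
(By 157 [0,1,2,4,3,5,6,7]) (Clq [0,1,2,3,4,7])))))))))) (At 3 6 (By 158 [0,1,3,2,4,5,6,7]) (At 4 6 (By 158 [0,1,
4,2,3,5,6,7]) (Clq [0,1,2,3,4,6])))))))))) (At 2 5 (By 159 [0,2,1,3,4,5,6,7]) (At 3 5 (By 159 [0,3,1,2,4,5,6,7])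
(At 4 5 (By 159 [0,4,1,2,3,5,6,7]) (At 0 6 (Keep 162 (At 1 6 (By 159 [0,1,2,3,4,6,5,7]) (At 2 6 (By 159 [0,2,1,
3,4,6,5,7]) (At 3 6 (By 159 [0,3,1,2,4,6,5,7]) (At 4 6 (By 159 [0,4,1,2,3,6,5,7]) (At 5 6 (At 0 7 (Keep 160 (At
1 7 (By 159 [0,1,2,3,4,7,5,6]) (At 2 7 (By 159 [0,2,1,3,4,7,5,6]) (At 3 7 (By 159 [0,3,1,2,4,7,5,6]) (At 4 7 (By
159 [0,4,1,2,3,7,5,6]) (At 5 7 (At 6 7 Solved (Clq [1,2,3,4,6,7])) (Clq [1,2,3,4,5,7]))))))) (At 1 7 (Keep 161
(At 2 7 (By 159 [1,2,0,3,4,7,5,6]) (At 3 7 (By 159 [1,3,0,2,4,7,5,6]) (At 4 7 (By 159 [1,4,0,2,3,7,5,6]) (At 5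
7 (By 160 [5,1,2,3,4,0,6,7]) (At 6 7 (By 160 [6,1,2,3,4,0,5,7]) Solved)))))) (At 2 7 (By 161 [0,2,1,3,4,5,6,7])
(At 3 7 (By 161 [0,3,1,2,4,5,6,7]) (At 4 7 (By 161 [0,4,1,2,3,5,6,7]) (Clq [0,1,2,3,4,7])))))) (Clq [1,2,3,4,5,
6]))))))) (At 1 6 (Keep 164 (At 2 6 (By 159 [1,2,0,3,4,6,5,7]) (At 3 6 (By 159 [1,3,0,2,4,6,5,7]) (At 4 6 (By 159
[1,4,0,2,3,6,5,7]) (At 5 6 (By 162 [5,1,2,3,4,0,6,7]) (At 0 7 (By 162 [0,1,2,3,4,5,7,6]) (At 1 7 (By 162 [1,0,2,
3,4,6,7,5]) (At 2 7 (Keep 163 (At 3 7 (By 159 [2,3,0,1,4,7,5,6]) (At 4 7 (By 159 [2,4,0,1,3,7,5,6]) (At 5 7 (By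
162 [5,1,2,3,4,0,7,6]) (At 6 7 (By 162 [6,0,2,3,4,1,7,5]) Solved))))) (At 3 7 (By 163 [0,1,3,2,4,5,6,7]) (At 4
7 (By 163 [0,1,4,2,3,5,6,7]) (Clq [0,1,2,3,4,7]))))))))))) (At 2 6 (By 164 [0,2,1,3,4,5,6,7]) (At 3 6 (By 164 [0,
3,1,2,4,5,6,7]) (At 4 6 (By 164 [0,4,1,2,3,5,6,7]) (Clq [0,1,2,3,4,6]))))))))))) (At 1 5 (By 165 [1,0,2,3,4,5,6,
7]) (At 2 5 (By 165 [2,0,1,3,4,5,6,7]) (At 3 5 (By 165 [3,0,1,2,4,5,6,7]) (At 4 5 (By 165 [4,0,1,2,3,5,6,7]) (Clq
[0,1,2,3,4,5])))))) five_clique Empty clique_graphs)"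
    unfolding five_clique_def clique_graphs_def
    by (simp only: check_run cong: check_cong check_cong' if_weak_cong)
qed

lemma sound_free_graphs: "sound (Node None Empty (Node (Some five_clique) Empty Empty)) free_graphs"
proof -
  have "sound (Node None Empty (Node (Some five_clique) Empty Empty)) []"
    using sound_insert_at[OF sound_Empty hard_five_clique, of "[True]"] by simp
  then show ?thesis
    unfolding free_graphs_def by - ((rule sound_Cons, rule certificates_free)+)
qed

lemma hard_blank: "hard blank"
proof (rule hard_if_passes[OF _ sound_free_graphs])
  show "passes (check (At 0 1 (Keep 42 (At 2 3 (Keep 41 (At 4 5 (Keep 35 (At 6 7 (Part 204 240) (At 0 6 (Keep 27 (At 0 7 (Keep 10 (At
1 6 (Part 140 176) (At 1 7 (Part 76 112) (At 2 6 (Keep 9 (At 2 7 (Keep 4 (At 3 6 (Part 204 176) (At 3 7 (Part 204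
112) (At 4 6 (Keep 2 (At 4 7 (At 5 6 (Part 140 240) (At 5 7 (Part 76 240) (At 1 3 (Part 58 180) (At 1 5 (Part 178
156) (At 3 5 (Part 212 184) (By 1 [1,3,5,6,7,0,2,4])))))) (At 5 6 (Part 140 240) (At 5 7 (Part 172 240) (At 1 3
(Part 58 180) (At 1 5 (Part 114 92) (At 3 5 (Part 212 120) (By 1 [1,3,5,6,7,0,2,4])))))))) (At 4 7 (By 2 [0,1,2,
3,4,5,7,6]) (At 5 6 (By 2 [0,1,2,3,5,4,6,7]) (At 5 7 (By 2 [0,1,2,3,5,4,7,6]) (At 1 3 (Part 58 180) (At 1 4 (Keep
3 (At 1 5 (Part 178 140) (At 3 5 (Part 58 172) (By 1 [1,3,5,6,7,0,2,4])))) (At 3 4 (By 3 [2,3,0,1,4,5,6,7]) (By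
1 [1,3,4,6,7,0,2,5]))))))))))) (At 3 6 (Part 204 176) (At 3 7 (Part 116 184) (At 4 6 (Keep 7 (At 4 7 (By 4 [0,1,
4,5,2,3,6,7]) (At 5 6 (Part 140 240) (At 5 7 (Part 172 240) (At 1 3 (Part 58 116) (At 1 5 (Part 114 92) (At 3 5
(At 3 4 (Part 196 184) (At 1 4 (Part 58 108) (At 2 5 (Part 172 208) (At 2 4 (Part 212 168) (At 1 2 (Part 86 120)
(At 0 2 (Keep 5 (At 0 3 (At 0 4 (At 0 5 Solved (Low 0)) (Low 0)) (At 0 4 (Low 0) (At 0 5 (Low 0) Solved)))) (At
0 3 (Keep 6 (At 0 4 (Low 0) (At 0 5 (Low 0) Solved))) (At 0 4 (By 5 [0,1,4,5,2,3,6,7]) (At 0 5 (By 6 [0,1,4,5,2,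
3,6,7]) Solved))))))))) (By 1 [1,3,5,6,7,0,2,4])))))))) (At 4 7 (Keep 8 (At 5 6 (Part 108 240) (At 5 7 (Part 76
240) (At 1 3 (Part 58 116) (At 1 5 (Part 178 156) (At 3 5 (Part 212 184) (By 1 [1,3,5,6,7,0,2,4]))))))) (At 5 6
(By 7 [0,1,2,3,5,4,6,7]) (At 5 7 (By 8 [0,1,2,3,5,4,6,7]) (At 1 3 (Part 58 116) (At 1 4 (At 1 5 (Part 178 140)
(At 3 5 (Part 58 108) (By 1 [1,3,5,6,7,0,2,4]))) (At 3 4 (At 3 5 (Part 196 184) (At 1 5 (Part 58 92) (By 1 [1,3,
5,6,7,0,2,4]))) (By 1 [1,3,4,6,7,0,2,5])))))))))))) (At 2 7 (By 9 [0,1,2,3,4,5,7,6]) (At 3 6 (By 9 [0,1,3,2,4,5,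
6,7]) (At 3 7 (By 9 [0,1,3,2,4,5,7,6]) (At 4 6 (By 9 [0,1,4,5,2,3,6,7]) (At 4 7 (By 9 [0,1,4,5,2,3,7,6]) (At 5
6 (By 9 [0,1,5,4,2,3,6,7]) (At 5 7 (By 9 [0,1,5,4,2,3,7,6]) (At 1 2 (By 9 [0,6,2,3,4,5,1,7]) (At 1 4 (By 9 [0,6,
4,5,2,3,1,7]) (At 2 4 (At 1 3 (By 9 [0,6,3,2,4,5,1,7]) (At 3 4 (At 1 5 (Part 162 156) (At 2 5 (At 3 5 (Part 188
192) (By 1 [1,3,5,6,7,0,2,4])) (By 1 [1,2,5,6,7,0,3,4]))) (By 1 [1,3,4,6,7,0,2,5]))) (By 1 [1,2,4,6,7,0,3,5])))))))))))))))
(At 1 6 (Part 140 176) (At 1 7 (Part 178 60) (At 2 6 (Keep 25 (At 2 7 (By 10 [2,3,0,1,4,5,6,7]) (At 3 6 (Part 204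
176) (At 3 7 (Part 116 184) (At 4 6 (Keep 20 (At 4 7 (By 10 [4,5,0,1,2,3,6,7]) (At 5 6 (Part 140 240) (At 5 7 (Part
172 240) (At 1 3 (Keep 19 (At 1 5 (Keep 13 (At 3 5 (Keep 11 (At 0 2 (Part 170 144) (At 0 4 (Part 170 132) (At 2
4 (Part 212 168) (At 1 2 (Part 142 176) (At 1 4 (Part 178 140) (At 0 3 (Part 196 176) (At 3 4 (Part 196 184) (At
0 5 (Part 140 208) (At 2 5 (Part 172 208) Solved)))))))))) (At 0 3 (Part 196 176) (At 0 5 (Part 140 208) (At 0
2 (Part 138 176) (At 1 2 (Part 142 176) (At 0 4 (Part 162 140) (At 1 4 (Part 178 140) (At 2 4 (By 11 [0,6,3,2,5,
4,1,7]) (At 3 4 (Keep 12 (At 2 5 Solved Solved)) (At 2 5 (By 12 [0,1,4,5,2,3,6,7]) Solved))))))))))) (At 3 5 (By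
13 [2,3,0,1,4,5,6,7]) (At 1 2 (Part 142 176) (At 0 3 (Part 196 176) (At 0 2 (Part 138 176) (At 0 5 (Keep 15 (At
0 4 (Part 138 196) (At 2 4 (Part 138 212) (At 1 4 (Keep 14 (At 3 4 (Part 154 196) (At 2 5 (By 13 [3,1,5,0,6,4,2,
7]) Solved))) (At 3 4 (By 13 [1,0,2,6,4,5,3,7]) (At 2 5 (By 14 [5,0,3,1,6,4,2,7]) Solved)))))) (At 2 5 (By 15 [2,
3,0,1,4,5,6,7]) (At 0 4 (Keep 17 (At 1 4 (Keep 16 (At 2 4 (Low 4) (At 3 4 (Low 4) Solved))) (At 2 4 (By 16 [6,0,
3,1,4,5,2,7]) (At 3 4 Solved Solved)))) (At 1 4 (Keep 18 (At 2 4 (By 17 [2,3,0,1,4,5,6,7]) (At 3 4 (By 17 [1,0,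
2,6,4,5,3,7]) Solved))) (At 2 4 (By 17 [2,3,0,1,4,5,6,7]) (At 3 4 (By 18 [2,3,0,1,4,5,6,7]) Solved))))))))))))
(At 1 5 (By 19 [0,1,4,5,2,3,6,7]) (At 3 5 (By 19 [2,3,4,5,0,1,6,7]) (By 1 [1,3,5,6,7,0,2,4])))))))) (At 4 7 (Keep
21 (At 5 6 (Part 108 240) (At 5 7 (Part 76 240) (At 1 5 (Part 178 156) (At 3 5 (Part 212 184) (At 1 3 (At 1 2 (Part
142 176) (At 0 3 (Part 196 176) (At 0 2 (Part 138 176) (At 0 5 (Part 154 212) (At 2 5 (Part 154 180) (At 0 4 (By
20 [1,3,6,2,4,5,0,7]) (At 1 4 (By 20 [0,6,3,2,4,5,1,7]) (At 2 4 (By 20 [3,1,6,0,4,5,2,7]) (At 3 4 (By 20 [1,0,2,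
6,4,5,3,7]) Solved))))))))) (By 1 [1,3,5,6,7,0,2,4]))))))) (At 5 6 (By 20 [0,1,2,3,5,4,6,7]) (At 5 7 (By 21 [0,
1,2,3,5,4,6,7]) (At 1 3 (Keep 23 (At 1 4 (Keep 22 (At 1 5 (Part 178 140) (By 20 [0,6,4,5,3,2,1,7]))) (At 3 4 (By
22 [2,3,0,1,4,5,6,7]) (At 1 2 (Part 142 176) (At 0 3 (Part 196 176) (At 0 2 (Part 138 176) (At 0 4 (By 20 [1,3,
6,2,4,5,0,7]) (At 2 4 (By 20 [3,1,6,0,4,5,2,7]) (At 0 5 (By 20 [1,3,5,4,6,2,0,7]) (At 1 5 (By 22 [0,1,2,3,5,4,6,
7]) (At 2 5 (By 22 [3,2,0,6,5,4,1,7]) (At 3 5 (By 22 [1,3,6,2,5,4,0,7]) Solved)))))))))))) (At 1 4 (Keep 24 (At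
1 5 (Part 178 140) (At 3 5 (At 3 4 (Part 196 184) (At 0 4 (Part 196 168) (At 0 2 (Part 146 168) (At 2 5 (Part 146
172) (At 1 2 (By 20 [0,6,2,3,4,5,1,7]) (At 0 3 (By 23 [0,3,4,5,2,6,1,7]) (At 2 4 (By 23 [0,1,2,4,3,5,6,7]) (At
0 5 (By 23 [0,5,2,3,1,4,6,7]) Solved)))))))) (By 1 [1,3,5,6,7,0,2,4])))) (At 3 4 (By 24 [2,3,0,1,4,5,6,7]) (By
1 [1,3,4,6,7,0,2,5])))))))))))) (At 2 7 (Keep 26 (At 3 6 (Part 180 120) (At 3 7 (Part 204 112) (At 4 6 (By 25 [0,
1,4,5,2,3,6,7]) (At 4 7 (By 25 [2,3,4,5,0,1,7,6]) (At 5 6 (By 25 [0,1,5,4,2,3,6,7]) (At 5 7 (By 25 [2,3,5,4,0,1,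
7,6]) (At 1 3 (Part 58 180) (At 1 4 (By 25 [0,6,4,5,2,3,1,7]) (At 3 4 (By 25 [2,7,4,5,0,1,3,6]) (By 1 [1,3,4,6,
7,0,2,5]))))))))))) (At 3 6 (By 25 [0,1,3,2,4,5,6,7]) (At 3 7 (By 26 [0,1,3,2,4,5,6,7]) (At 4 6 (By 25 [0,1,4,5,
2,3,6,7]) (At 4 7 (By 26 [0,1,4,5,2,3,6,7]) (At 5 6 (By 25 [0,1,5,4,2,3,6,7]) (At 5 7 (By 26 [0,1,5,4,2,3,6,7])
(At 1 2 (By 25 [0,6,2,3,4,5,1,7]) (At 1 4 (By 25 [0,6,4,5,2,3,1,7]) (At 2 4 (At 1 3 (By 25 [0,6,3,2,4,5,1,7]) (At
3 4 (At 1 5 (Part 162 156) (At 2 5 (At 3 5 (Part 188 192) (By 1 [1,3,5,6,7,0,2,4])) (By 1 [1,2,5,6,7,0,3,4])))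
(By 1 [1,3,4,6,7,0,2,5]))) (By 1 [1,2,4,6,7,0,3,5])))))))))))))))) (At 0 7 (By 27 [0,1,2,3,4,5,7,6]) (At 1 6 (By
27 [1,0,2,3,4,5,6,7]) (At 1 7 (By 27 [1,0,2,3,4,5,7,6]) (At 2 6 (By 27 [2,3,0,1,4,5,6,7]) (At 2 7 (By 27 [2,3,0,
1,4,5,7,6]) (At 3 6 (By 27 [3,2,0,1,4,5,6,7]) (At 3 7 (By 27 [3,2,0,1,4,5,7,6]) (At 4 6 (By 27 [4,5,0,1,2,3,6,7])
(At 4 7 (By 27 [4,5,0,1,2,3,7,6]) (At 5 6 (By 27 [5,4,0,1,2,3,6,7]) (At 5 7 (By 27 [5,4,0,1,2,3,7,6]) (At 0 2 (Keep
34 (At 1 2 (Keep 32 (At 0 3 (Keep 30 (At 1 3 (Part 176 192) (At 1 4 (Keep 29 (At 1 5 (Part 178 192) (At 3 5 (At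
3 4 (Part 184 192) (At 0 4 (Keep 28 (At 2 4 (Part 168 192) (At 2 5 (Part 172 192) (At 0 5 (Low 0) Solved)))) (At
0 5 (By 28 [0,3,2,1,5,4,6,7]) (At 2 4 (By 28 [2,0,1,4,3,5,6,7]) (At 2 5 (By 28 [2,0,3,5,1,4,6,7]) Solved))))) (By
1 [1,3,5,6,7,0,2,4])))) (At 3 4 (By 29 [0,3,2,1,4,5,6,7]) (By 1 [1,3,4,6,7,0,2,5]))))) (At 3 4 (Keep 31 (At 3 5
(Part 184 192) (At 0 5 (At 1 5 (By 30 [0,2,1,5,3,4,6,7]) (At 1 3 (By 30 [1,0,2,3,4,5,6,7]) (By 1 [1,3,5,6,7,0,2,
4]))) (By 1 [0,3,5,6,7,1,2,4])))) (At 0 4 (At 1 3 (By 31 [3,1,2,0,4,5,6,7]) (At 1 4 (At 3 5 (By 31 [0,1,2,3,5,4,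
6,7]) (At 0 5 (By 30 [0,1,4,5,2,3,6,7]) (By 1 [0,3,5,6,7,1,2,4]))) (By 1 [1,3,4,6,7,0,2,5]))) (By 1 [0,3,4,6,7,
1,2,5]))))) (At 1 4 (Keep 33 (At 1 5 (By 32 [4,5,1,0,2,3,6,7]) (At 2 5 (At 3 5 (By 32 [2,3,5,4,0,1,6,7]) (At 1
3 (At 0 3 (By 32 [0,1,3,2,4,5,6,7]) (At 0 5 (By 32 [0,2,5,4,1,3,6,7]) (By 1 [0,3,5,6,7,1,2,4]))) (By 1 [1,3,5,6,
7,0,2,4]))) (By 1 [1,2,5,6,7,0,3,4])))) (At 2 4 (At 3 4 (By 32 [2,3,4,5,0,1,6,7]) (At 1 3 (By 33 [0,2,1,3,4,5,6,
7]) (By 1 [1,3,4,6,7,0,2,5]))) (By 1 [1,2,4,6,7,0,3,5]))))) (At 0 4 (By 34 [0,1,4,5,2,3,6,7]) (At 2 4 (By 34 [2,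
3,4,5,0,1,6,7]) (By 1 [0,2,4,6,7,1,3,5])))))))))))))))))) (At 6 7 (By 35 [0,1,2,3,6,7,4,5]) (At 4 6 (By 35 [0,1,
2,3,4,6,5,7]) (At 4 7 (By 35 [0,1,2,3,4,7,5,6]) (At 5 6 (By 35 [0,1,2,3,5,6,4,7]) (At 5 7 (By 35 [0,1,2,3,5,7,4,
6]) (At 0 4 (Keep 40 (At 0 5 (Keep 37 (At 0 6 (Keep 36 (At 0 7 (At 1 4 (By 35 [0,5,1,4,2,3,6,7]) (At 1 5 (By 35
[0,4,1,5,2,3,6,7]) (At 1 6 (By 35 [0,4,1,6,2,3,5,7]) (At 1 7 (By 35 [0,4,1,7,2,3,5,6]) (By 1 [1,4,5,6,7,0,2,3])))))
(At 1 4 (By 35 [0,5,1,4,2,3,6,7]) (At 1 5 (By 35 [0,4,1,5,2,3,6,7]) (At 1 6 (By 35 [0,4,1,6,2,3,5,7]) (At 1 7 (By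
35 [0,4,1,7,2,3,5,6]) (By 1 [1,4,5,6,7,0,2,3]))))))) (At 0 7 (By 36 [0,1,2,3,4,5,7,6]) (At 1 4 (By 35 [0,5,1,4,
2,3,6,7]) (At 1 5 (By 35 [0,4,1,5,2,3,6,7]) (At 1 6 (By 35 [0,4,1,6,2,3,5,7]) (At 1 7 (By 35 [0,4,1,7,2,3,5,6])
(By 1 [1,4,5,6,7,0,2,3])))))))) (At 0 6 (By 37 [0,1,2,3,4,6,5,7]) (At 0 7 (By 37 [0,1,2,3,4,7,5,6]) (At 1 4 (At
1 5 (By 37 [1,0,2,3,4,5,6,7]) (At 1 6 (By 37 [1,0,2,3,4,6,5,7]) (At 1 7 (By 37 [1,0,2,3,4,7,5,6]) (At 2 4 (Keep
38 (At 2 5 (By 37 [2,3,0,1,4,5,6,7]) (At 2 6 (By 37 [2,3,0,1,4,6,5,7]) (At 2 7 (By 37 [2,3,0,1,4,7,5,6]) (At 3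
4 (At 3 5 (By 37 [3,2,0,1,4,5,6,7]) (At 3 6 (By 37 [3,2,0,1,4,6,5,7]) (At 3 7 (By 37 [3,2,0,1,4,7,5,6]) (At 0 2
(At 1 2 (At 0 3 (At 1 3 (Part 160 192) (By 1 [1,3,5,6,7,0,2,4])) (By 1 [0,3,5,6,7,1,2,4])) (By 1 [1,2,5,6,7,0,3,
4])) (By 1 [0,2,5,6,7,1,3,4]))))) (At 3 5 (By 35 [0,1,2,4,3,5,6,7]) (At 3 6 (By 35 [0,1,2,4,3,6,5,7]) (At 3 7 (By
35 [0,1,2,4,3,7,5,6]) (By 1 [3,4,5,6,7,0,1,2]))))))))) (At 2 5 (Keep 39 (At 2 6 (By 37 [2,3,0,1,5,6,4,7]) (At 2
7 (By 37 [2,3,0,1,5,7,4,6]) (At 3 4 (By 38 [0,1,3,2,4,5,6,7]) (At 3 5 (Part 172 192) (At 3 6 (Part 164 200) (At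
3 7 (Part 100 200) (By 1 [3,4,5,6,7,0,1,2])))))))) (At 2 6 (By 39 [0,1,2,3,4,6,5,7]) (At 2 7 (By 39 [0,1,2,3,4,
7,5,6]) (By 1 [2,4,5,6,7,0,1,3])))))))) (At 1 5 (By 35 [0,4,1,5,2,3,6,7]) (At 1 6 (By 35 [0,4,1,6,2,3,5,7]) (At
1 7 (By 35 [0,4,1,7,2,3,5,6]) (By 1 [1,4,5,6,7,0,2,3]))))))))) (At 0 5 (By 40 [0,1,2,3,5,4,6,7]) (At 0 6 (By 40
[0,1,2,3,6,4,5,7]) (At 0 7 (By 40 [0,1,2,3,7,4,5,6]) (By 1 [0,4,5,6,7,1,2,3])))))))))))) (At 4 5 (By 41 [0,1,4,
5,2,3,6,7]) (At 6 7 (By 41 [0,1,6,7,2,3,4,5]) (At 4 6 (By 41 [0,1,4,6,2,3,5,7]) (At 4 7 (By 41 [0,1,4,7,2,3,5,6])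
(At 5 6 (By 41 [0,1,5,6,2,3,4,7]) (At 5 7 (By 41 [0,1,5,7,2,3,4,6]) (At 2 4 (By 41 [0,1,2,4,3,5,6,7]) (At 2 5 (By
41 [0,1,2,5,3,4,6,7]) (At 2 6 (By 41 [0,1,2,6,3,4,5,7]) (At 2 7 (By 41 [0,1,2,7,3,4,5,6]) (By 1 [2,4,5,6,7,0,1,
3]))))))))))))) (At 2 3 (By 42 [2,3,0,1,4,5,6,7]) (At 4 5 (By 42 [4,5,0,1,2,3,6,7]) (At 6 7 (By 42 [6,7,0,1,2,3,
4,5]) (At 4 6 (By 42 [4,6,0,1,2,3,5,7]) (At 4 7 (By 42 [4,7,0,1,2,3,5,6]) (At 5 6 (By 42 [5,6,0,1,2,3,4,7]) (At
5 7 (By 42 [5,7,0,1,2,3,4,6]) (At 2 4 (By 42 [2,4,0,1,3,5,6,7]) (At 2 5 (By 42 [2,5,0,1,3,4,6,7]) (At 2 6 (By 42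
[2,6,0,1,3,4,5,7]) (At 2 7 (By 42 [2,7,0,1,3,4,5,6]) (By 1 [2,4,5,6,7,0,1,3]))))))))))))) blank
    (Node None Empty (Node (Some five_clique) Empty Empty)) free_graphs)"
    unfolding five_clique_def free_graphs_def blank_eq
    by (simp only: check_run cong: check_cong check_cong' if_weak_cong)
qed

theorem corollary7p4:
  fixes V :: "'a set" and E :: "'a set set"
  assumes "simple_graph V E"
    and "minimal_ramsey_3_3 V E"
    and "card V \<ge> 27"
  shows "independence_number V E \<le> card V - 9"
proof (rule ccontr)
  assume large: "\<not> independence_number V E \<le> card V - 9"
  let ?I = "{S. S \<subseteq> V \<and> indep S E}"
  have fin: "finite V" using assms(1) by (simp add: simple_graph_def)
  have "independence_number V E \<in> card ` ?I"
    unfolding independence_number_def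
  proof (intro Max_in)
    show "finite (card ` ?I)" using fin by simp
    have "{} \<in> ?I" by (simp add: indep_def)
    then show "card ` ?I \<noteq> {}" by blast
  qed
  then obtain S where S: "S \<subseteq> V" "indep S E" "card S = independence_number V E" by auto
  then have "card V - 8 \<le> card S" using large by linarith
  then obtain A where A: "A \<subseteq> S" "card A = card V - 8" by (meson obtain_subset_with_card_n)
  define U where "U = V - A"
  have VU: "V - U = A" using A(1) S(1) by (auto simp: U_def)
  have U: "U \<subseteq> V" "card U = 8"
    using A S(1) fin assms(3) finite_subset[of A V] by (auto simp: U_def card_Diff_subset)
  have ind: "indep (V - U) E" using S(2) A(1) unfolding VU indep_def by blast
  have c6: "6 < card V" using assms(3) by linarith
  note F = critical_family_of_minimal_ramsey[OF assms(1,2) ind U(1) c6]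
  obtain f where f: "bij_betw f U {..<8::nat}"
    using ex_bij_betw_finite_nat[of U] finite_subset[OF U(1) fin] U(2) by (auto simp: atLeast0LessThan)
  then have inj: "inj_on f U" and im: "f ` U = {..<8}" by (simp_all add: bij_betw_def)
  have "card (nbrs E ` (V - U)) \<le> 18"
    using card_le_18[OF hard_blank critical_family_image(1)[OF F(1) inj, unfolded im]]
    unfolding critical_family_image(2)[OF F(1) inj] .
  moreover have "card (nbrs E ` (V - U)) = card A"
    using card_image[OF F(2)] by (simp only: VU)
  ultimately show False using A(2) assms(3) by linarith
qed

end
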